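(* Let $\mathcal{E}$ be an additive regular category. Let $\operatorname{hMon}(\mathcal{E})$ be the category whose objects are monomorphisms $\delta_E\colon E^{-1}\hookrightarrow E^0$ in $\mathcal{E}$ and whose morphisms $\delta_E\to\delta_F$ are pairs $(u_{-1}\colon E^{-1}\to F^{-1},\, u_0\colon E^0\to F^0)$ with $u_0\circ\delta_E = \delta_F\circ u_{-1}$ (commutative squares), up to homotopy: a commutative square is identified with zero if there is a morphism $t\colon E^0\to F^{-1}$ in $\mathcal{E}$ such that $u_{-1} = t\circ\delta_E$ and $u_0=\delta_F\circ t$ (so $\operatorname{hMon}(\mathcal{E})$ is the quotient of the category of monomorphisms by the ideal of such squares). (1) The set $S$ of all morphisms which are bicartesian squares (both pullback and pushout squares in $\mathcal{E}$) is a multiplicative system in $\operatorname{hMon}(\mathcal{E})$. (2) The localization $\operatorname{hMon}(\mathcal{E})[S^{-1}]$ is equivalent to the left heart $\mathcal{LH}(\mathcal{E})$.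
   Context: All categories are essentially small and additive, all functors are additive. A multiplicative system means a left and right multiplicative system (left and right calculus of fractions). An additive category is \emph{additive regular} if (Reg1) every morphism $f$ factors as $f = m\circ p$ with $p$ a cokernel and $m$ a monomorphism, and (Reg2) pullbacks of cokernels along arbitrary morphisms exist and are cokernels. Such a category has all kernels. It is endowed with the class of all kernel-cokernel pairs, called \emph{conflations}; the kernel part of a conflation is an \emph{inflation}, the cokernel part a \emph{deflation}. A complex $X^\bullet$ in $\mathcal{E}$ is \emph{acyclic} if for every $n$ the differential $d^{n-1}\colon X^{n-1}\to X^n$ factors as $X^{n-1} \to \ker(d^n) \to X^n$ where the first map is a deflation which is the cokernel of $d^{n-2}$ and the second map is an inflation which is the kernel of $d^n$. $\mathbf{D}(\mathcal{E})$ is the Verdier quotient of the homotopy category $\mathbf{K}(\mathcal{E})$ by the thick closure of the acyclic complexes. For a complex $C^\bullet$, write $d^{n-1} = i^{n-1}\circ p^{n-1}$ with $p^{n-1}\colon C^{n-1}\to\ker(d^n)$ and $i^{n-1}\colon \ker(d^n) \to C^n$ the kernel of $d^n$. Then $\tau^{\leq n}C^\bullet$ is the complex $\cdots\to C^{n-2}\to C^{n-1}\xrightarrow{p^{n-1}}\ker(d^n)\to 0\to\cdots$ with $\ker(d^n)$ in degree $n$, and $\tau^{\geq n+1}C^\bullet$ is the complex $\cdots\to 0\to \ker(d^n)\xrightarrow{i^{n-1}} C^n\to C^{n+1}\to\cdots$ with $C^n$ in degree $n$ and $\ker(d^n)$ in degree $n-1$. The \emph{left $t$-structure} on $\mathbf{D}(\mathcal{E})$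 is given by $\mathbf{D}^{\leq 0}(\mathcal{E}) = \{X^\bullet \mid \tau^{\geq 1}X^\bullet\cong 0\}$ and $\mathbf{D}^{\geq 0}(\mathcal{E}) = \{X^\bullet\mid \tau^{\leq -1}X^\bullet\cong 0\}$ (isomorphisms in $\mathbf{D}(\mathcal{E})$); its heart $\mathbf{D}^{\leq 0}(\mathcal{E})\cap\mathbf{D}^{\geq 0}(\mathcal{E})$ is the \emph{left heart} $\mathcal{LH}(\mathcal{E})$. *)

theory Defs
  imports Complex_Main "HOL-Algebra.Group"
begin

section \<open>Additive categories\<close>

text \<open>
  Hom-sets are indexed by their source and target and need not be disjoint, so composition and
  addition take the objects as arguments: \<open>Cmp C X Y Z g f\<close> is the composite \<open>g \<circ> f\<close> of
  \<open>f : X \<rightarrow> Y\<close> and \<open>g : Y \<rightarrow> Z\<close>. Objects form a set, so every category here is small.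
\<close>

record ('o, 'm) acat =
  Obj :: "'o set"
  Hom :: "'o \<Rightarrow> 'o \<Rightarrow> 'm set"
  Idn :: "'o \<Rightarrow> 'm"
  Cmp :: "'o \<Rightarrow> 'o \<Rightarrow> 'o \<Rightarrow> 'm \<Rightarrow> 'm \<Rightarrow> 'm"
  Add :: "'o \<Rightarrow> 'o \<Rightarrow> 'm \<Rightarrow> 'm \<Rightarrow> 'm"
  Zer :: "'o \<Rightarrow> 'o \<Rightarrow> 'm"

definition hom_group :: "('o, 'm) acat \<Rightarrow> 'o \<Rightarrow> 'o \<Rightarrow> 'm monoid" where
  "hom_group C X Y = \<lparr>carrier = Hom C X Y, mult = Add C X Y, one = Zer C X Y\<rparr>"

definition neg :: "('o, 'm) acat \<Rightarrow> 'o \<Rightarrow> 'o \<Rightarrow> 'm \<Rightarrow> 'm" where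
  "neg C X Y f = inv\<^bsub>hom_group C X Y\<^esub> f"

locale preadditive_category =
  fixes C :: "('o, 'm) acat"
  assumes Idn_in: "X \<in> Obj C \<Longrightarrow> Idn C X \<in> Hom C X X"
    and Cmp_in: "\<lbrakk>X \<in> Obj C; Y \<in> Obj C; Z \<in> Obj C; f \<in> Hom C X Y; g \<in> Hom C Y Z\<rbrakk>
      \<Longrightarrow> Cmp C X Y Z g f \<in> Hom C X Z"
    and Idn_left: "\<lbrakk>X \<in> Obj C; Y \<in> Obj C; f \<in> Hom C X Y\<rbrakk> \<Longrightarrow> Cmp C X Y Y (Idn C Y) f = f"
    and Idn_right: "\<lbrakk>X \<in> Obj C; Y \<in> Obj C; f \<in> Hom C X Y\<rbrakk> \<Longrightarrow> Cmp C X X Y f (Idn C X) = f"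
    and Cmp_assoc: "\<lbrakk>W \<in> Obj C; X \<in> Obj C; Y \<in> Obj C; Z \<in> Obj C;
        f \<in> Hom C W X; g \<in> Hom C X Y; h \<in> Hom C Y Z\<rbrakk>
      \<Longrightarrow> Cmp C W Y Z h (Cmp C W X Y g f) = Cmp C W X Z (Cmp C X Y Z h g) f"
    and hom_comm_group: "\<lbrakk>X \<in> Obj C; Y \<in> Obj C\<rbrakk> \<Longrightarrow> comm_group (hom_group C X Y)"
    and Cmp_Add_left: "\<lbrakk>X \<in> Obj C; Y \<in> Obj C; Z \<in> Obj C;
        f \<in> Hom C X Y; g \<in> Hom C Y Z; h \<in> Hom C Y Z\<rbrakk>
      \<Longrightarrow> Cmp C X Y Z (Add C Y Z g h) f = Add C X Z (Cmp C X Y Z g f) (Cmp C X Y Z h f)"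
    and Cmp_Add_right: "\<lbrakk>X \<in> Obj C; Y \<in> Obj C; Z \<in> Obj C;
        f \<in> Hom C X Y; g \<in> Hom C X Y; h \<in> Hom C Y Z\<rbrakk>
      \<Longrightarrow> Cmp C X Y Z h (Add C X Y f g) = Add C X Z (Cmp C X Y Z h f) (Cmp C X Y Z h g)"

definition zero_obj :: "('o, 'm) acat \<Rightarrow> 'o \<Rightarrow> bool" where
  "zero_obj C Z \<longleftrightarrow> Z \<in> Obj C \<and>
    (\<forall>X\<in>Obj C. (\<exists>!f. f \<in> Hom C X Z) \<and> (\<exists>!f. f \<in> Hom C Z X))"

definition is_biprod ::
  "('o, 'm) acat \<Rightarrow> 'o \<Rightarrow> 'o \<Rightarrow> 'o \<Rightarrow> 'm \<Rightarrow> 'm \<Rightarrow> 'm \<Rightarrow> 'm \<Rightarrow> bool" where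
  "is_biprod C X Y B i j p q \<longleftrightarrow>
    X \<in> Obj C \<and> Y \<in> Obj C \<and> B \<in> Obj C \<and>
    i \<in> Hom C X B \<and> j \<in> Hom C Y B \<and> p \<in> Hom C B X \<and> q \<in> Hom C B Y \<and>
    Cmp C X B X p i = Idn C X \<and> Cmp C Y B Y q j = Idn C Y \<and>
    Cmp C Y B X p j = Zer C Y X \<and> Cmp C X B Y q i = Zer C X Y \<and>
    Add C B B (Cmp C B X B i p) (Cmp C B Y B j q) = Idn C B"

locale additive_category = preadditive_category +
  assumes ex_zero_obj: "\<exists>Z. zero_obj C Z"
    and ex_biprod: "\<lbrakk>X \<in> Obj C; Y \<in> Obj C\<rbrakk> \<Longrightarrow> \<exists>B i j p q. is_biprod C X Y B i j p q"

definition is_iso :: "('o, 'm) acat \<Rightarrow> 'o \<Rightarrow> 'o \<Rightarrow> 'm \<Rightarrow> bool" where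
  "is_iso C X Y f \<longleftrightarrow> f \<in> Hom C X Y \<and>
    (\<exists>g\<in>Hom C Y X. Cmp C X Y X g f = Idn C X \<and> Cmp C Y X Y f g = Idn C Y)"

definition iso_obj :: "('o, 'm) acat \<Rightarrow> 'o \<Rightarrow> 'o \<Rightarrow> bool" where
  "iso_obj C X Y \<longleftrightarrow> X \<in> Obj C \<and> Y \<in> Obj C \<and> (\<exists>f. is_iso C X Y f)"

definition full_subcategory :: "('o, 'm) acat \<Rightarrow> ('o \<Rightarrow> bool) \<Rightarrow> ('o, 'm) acat" where
  "full_subcategory C P = C\<lparr>Obj := {X \<in> Obj C. P X}\<rparr>"


section \<open>Functors and equivalences\<close>

locale additive_functor = dom: additive_category C + cod: additive_category D
  for C :: "('o, 'm) acat" and D :: "('p, 'n) acat" +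
  fixes Fo :: "'o \<Rightarrow> 'p" and Fm :: "'o \<Rightarrow> 'o \<Rightarrow> 'm \<Rightarrow> 'n"
  assumes Fo_in: "X \<in> Obj C \<Longrightarrow> Fo X \<in> Obj D"
    and Fm_in: "\<lbrakk>X \<in> Obj C; Y \<in> Obj C; f \<in> Hom C X Y\<rbrakk> \<Longrightarrow> Fm X Y f \<in> Hom D (Fo X) (Fo Y)"
    and Fm_Idn: "X \<in> Obj C \<Longrightarrow> Fm X X (Idn C X) = Idn D (Fo X)"
    and Fm_Cmp: "\<lbrakk>X \<in> Obj C; Y \<in> Obj C; Z \<in> Obj C; f \<in> Hom C X Y; g \<in> Hom C Y Z\<rbrakk>
      \<Longrightarrow> Fm X Z (Cmp C X Y Z g f) = Cmp D (Fo X) (Fo Y) (Fo Z) (Fm Y Z g) (Fm X Y f)"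
    and Fm_Add: "\<lbrakk>X \<in> Obj C; Y \<in> Obj C; f \<in> Hom C X Y; g \<in> Hom C X Y\<rbrakk>
      \<Longrightarrow> Fm X Y (Add C X Y f g) = Add D (Fo X) (Fo Y) (Fm X Y f) (Fm X Y g)"

definition nat_iso ::
  "('o, 'm) acat \<Rightarrow> ('p, 'n) acat \<Rightarrow> ('o \<Rightarrow> 'p) \<Rightarrow> ('o \<Rightarrow> 'o \<Rightarrow> 'm \<Rightarrow> 'n) \<Rightarrow>
    ('o \<Rightarrow> 'p) \<Rightarrow> ('o \<Rightarrow> 'o \<Rightarrow> 'm \<Rightarrow> 'n) \<Rightarrow> ('o \<Rightarrow> 'n) \<Rightarrow> bool" where
  "nat_iso C D Fo Fm Go Gm \<eta> \<longleftrightarrow>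
    (\<forall>X\<in>Obj C. is_iso D (Fo X) (Go X) (\<eta> X)) \<and>
    (\<forall>X\<in>Obj C. \<forall>Y\<in>Obj C. \<forall>f\<in>Hom C X Y.
      Cmp D (Fo X) (Fo Y) (Go Y) (\<eta> Y) (Fm X Y f) =
      Cmp D (Fo X) (Go X) (Go Y) (Gm X Y f) (\<eta> X))"

definition equivalent_categories :: "('o, 'm) acat \<Rightarrow> ('p, 'n) acat \<Rightarrow> bool" where
  "equivalent_categories C D \<longleftrightarrow>
    (\<exists>Fo Fm Go Gm \<eta> \<epsilon>.
      additive_functor C D Fo Fm \<and> additive_functor D C Go Gm \<and>
      nat_iso C C (\<lambda>X. X) (\<lambda>X Y f. f)
        (\<lambda>X. Go (Fo X)) (\<lambda>X Y f. Gm (Fo X) (Fo Y) (Fm X Y f)) \<eta> \<and>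
      nat_iso D D (\<lambda>X. Fo (Go X)) (\<lambda>X Y f. Fm (Go X) (Go Y) (Gm X Y f))
        (\<lambda>X. X) (\<lambda>X Y f. f) \<epsilon>)"


section \<open>Kernels, cokernels, additive regular categories\<close>

definition is_mono :: "('o, 'm) acat \<Rightarrow> 'o \<Rightarrow> 'o \<Rightarrow> 'm \<Rightarrow> bool" where
  "is_mono C X Y m \<longleftrightarrow> m \<in> Hom C X Y \<and>
    (\<forall>W\<in>Obj C. \<forall>a\<in>Hom C W X. \<forall>b\<in>Hom C W X. Cmp C W X Y m a = Cmp C W X Y m b \<longrightarrow> a = b)"

definition is_kernel :: "('o, 'm) acat \<Rightarrow> 'o \<Rightarrow> 'o \<Rightarrow> 'o \<Rightarrow> 'm \<Rightarrow> 'm \<Rightarrow> bool" where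
  "is_kernel C K X Y k f \<longleftrightarrow>
    K \<in> Obj C \<and> X \<in> Obj C \<and> Y \<in> Obj C \<and> k \<in> Hom C K X \<and> f \<in> Hom C X Y \<and>
    Cmp C K X Y f k = Zer C K Y \<and>
    (\<forall>W\<in>Obj C. \<forall>g\<in>Hom C W X. Cmp C W X Y f g = Zer C W Y \<longrightarrow>
      (\<exists>!h. h \<in> Hom C W K \<and> Cmp C W K X k h = g))"

definition is_cokernel :: "('o, 'm) acat \<Rightarrow> 'o \<Rightarrow> 'o \<Rightarrow> 'o \<Rightarrow> 'm \<Rightarrow> 'm \<Rightarrow> bool" where
  "is_cokernel C X Y Q f q \<longleftrightarrow>
    X \<in> Obj C \<and> Y \<in> Obj C \<and> Q \<in> Obj C \<and> f \<in> Hom C X Y \<and> q \<in> Hom C Y Q \<and>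
    Cmp C X Y Q q f = Zer C X Q \<and>
    (\<forall>W\<in>Obj C. \<forall>g\<in>Hom C Y W. Cmp C X Y W g f = Zer C X W \<longrightarrow>
      (\<exists>!h. h \<in> Hom C Q W \<and> Cmp C Y Q W h q = g))"

definition cokernel_mor :: "('o, 'm) acat \<Rightarrow> 'o \<Rightarrow> 'o \<Rightarrow> 'm \<Rightarrow> bool" where
  "cokernel_mor C Y Q q \<longleftrightarrow> (\<exists>X f. is_cokernel C X Y Q f q)"

text \<open>
  \<open>is_pullback C P X Y Z a b f g\<close> and \<open>is_pushout C P X Y Z a b f g\<close> both refer to the square
  \<open>f \<circ> a = g \<circ> b\<close> with \<open>a : P \<rightarrow> X\<close>, \<open>b : P \<rightarrow> Y\<close>, \<open>f : X \<rightarrow> Z\<close>, \<open>g : Y \<rightarrow> Z\<close>.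
\<close>

definition comm_square ::
  "('o, 'm) acat \<Rightarrow> 'o \<Rightarrow> 'o \<Rightarrow> 'o \<Rightarrow> 'o \<Rightarrow> 'm \<Rightarrow> 'm \<Rightarrow> 'm \<Rightarrow> 'm \<Rightarrow> bool" where
  "comm_square C P X Y Z a b f g \<longleftrightarrow>
    P \<in> Obj C \<and> X \<in> Obj C \<and> Y \<in> Obj C \<and> Z \<in> Obj C \<and>
    a \<in> Hom C P X \<and> b \<in> Hom C P Y \<and> f \<in> Hom C X Z \<and> g \<in> Hom C Y Z \<and>
    Cmp C P X Z f a = Cmp C P Y Z g b"

definition is_pullback ::
  "('o, 'm) acat \<Rightarrow> 'o \<Rightarrow> 'o \<Rightarrow> 'o \<Rightarrow> 'o \<Rightarrow> 'm \<Rightarrow> 'm \<Rightarrow> 'm \<Rightarrow> 'm \<Rightarrow> bool" where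
  "is_pullback C P X Y Z a b f g \<longleftrightarrow> comm_square C P X Y Z a b f g \<and>
    (\<forall>W\<in>Obj C. \<forall>x\<in>Hom C W X. \<forall>y\<in>Hom C W Y. Cmp C W X Z f x = Cmp C W Y Z g y \<longrightarrow>
      (\<exists>!h. h \<in> Hom C W P \<and> Cmp C W P X a h = x \<and> Cmp C W P Y b h = y))"

definition is_pushout ::
  "('o, 'm) acat \<Rightarrow> 'o \<Rightarrow> 'o \<Rightarrow> 'o \<Rightarrow> 'o \<Rightarrow> 'm \<Rightarrow> 'm \<Rightarrow> 'm \<Rightarrow> 'm \<Rightarrow> bool" where
  "is_pushout C P X Y Z a b f g \<longleftrightarrow> comm_square C P X Y Z a b f g \<and>
    (\<forall>W\<in>Obj C. \<forall>x\<in>Hom C X W. \<forall>y\<in>Hom C Y W. Cmp C P X W x a = Cmp C P Y W y b \<longrightarrow>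
      (\<exists>!h. h \<in> Hom C Z W \<and> Cmp C X Z W h f = x \<and> Cmp C Y Z W h g = y))"

locale additive_regular_category = additive_category +
  assumes Reg1: "\<lbrakk>X \<in> Obj C; Y \<in> Obj C; f \<in> Hom C X Y\<rbrakk>
      \<Longrightarrow> \<exists>I\<in>Obj C. \<exists>p m. cokernel_mor C X I p \<and> is_mono C I Y m \<and> f = Cmp C X I Y m p"
    and Reg2_ex: "\<lbrakk>X \<in> Obj C; Y \<in> Obj C; Z \<in> Obj C; cokernel_mor C X Z p; g \<in> Hom C Y Z\<rbrakk>
      \<Longrightarrow> \<exists>P a b. is_pullback C P X Y Z a b p g"
    and Reg2_coker: "\<lbrakk>cokernel_mor C X Z p; is_pullback C P X Y Z a b p g\<rbrakk>
      \<Longrightarrow> cokernel_mor C P Y b"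

definition conflation :: "('o, 'm) acat \<Rightarrow> 'o \<Rightarrow> 'o \<Rightarrow> 'o \<Rightarrow> 'm \<Rightarrow> 'm \<Rightarrow> bool" where
  "conflation C X Y Z i p \<longleftrightarrow> is_kernel C X Y Z i p \<and> is_cokernel C X Y Z i p"

definition inflation :: "('o, 'm) acat \<Rightarrow> 'o \<Rightarrow> 'o \<Rightarrow> 'm \<Rightarrow> bool" where
  "inflation C X Y i \<longleftrightarrow> (\<exists>Z p. conflation C X Y Z i p)"

definition deflation :: "('o, 'm) acat \<Rightarrow> 'o \<Rightarrow> 'o \<Rightarrow> 'm \<Rightarrow> bool" where
  "deflation C Y Z p \<longleftrightarrow> (\<exists>X i. conflation C X Y Z i p)"


section \<open>Quotients by ideals and localizations\<close>

text \<open>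
  The quotient of \<open>C\<close> by an ideal \<open>I\<close> of morphisms: morphisms are the cosets \<open>f + I X Y\<close>.
\<close>

definition coset_mor :: "('o, 'm) acat \<Rightarrow> ('o \<Rightarrow> 'o \<Rightarrow> 'm set) \<Rightarrow> 'o \<Rightarrow> 'o \<Rightarrow> 'm \<Rightarrow> 'm set" where
  "coset_mor C I X Y f = Add C X Y f ` I X Y"

definition quotient_category ::
  "('o, 'm) acat \<Rightarrow> ('o \<Rightarrow> 'o \<Rightarrow> 'm set) \<Rightarrow> ('o, 'm set) acat" where
  "quotient_category C I = \<lparr>
    Obj = Obj C,
    Hom = (\<lambda>X Y. coset_mor C I X Y ` Hom C X Y),
    Idn = (\<lambda>X. coset_mor C I X X (Idn C X)),
    Cmp = (\<lambda>X Y Z G F. \<Union>g\<in>G. \<Union>f\<in>F. coset_mor C I X Z (Cmp C X Y Z g f)),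
    Add = (\<lambda>X Y F G. \<Union>f\<in>F. \<Union>g\<in>G. coset_mor C I X Y (Add C X Y f g)),
    Zer = (\<lambda>X Y. coset_mor C I X Y (Zer C X Y))\<rparr>"

locale multiplicative_system =
  fixes C :: "('o, 'm) acat" and S :: "'o \<Rightarrow> 'o \<Rightarrow> 'm set"
  assumes S_in: "\<lbrakk>X \<in> Obj C; Y \<in> Obj C\<rbrakk> \<Longrightarrow> S X Y \<subseteq> Hom C X Y"
    and S_Idn: "X \<in> Obj C \<Longrightarrow> Idn C X \<in> S X X"
    and S_Cmp: "\<lbrakk>X \<in> Obj C; Y \<in> Obj C; Z \<in> Obj C; s \<in> S X Y; t \<in> S Y Z\<rbrakk>
      \<Longrightarrow> Cmp C X Y Z t s \<in> S X Z"
    and right_ore: "\<lbrakk>X \<in> Obj C; Y \<in> Obj C; Z \<in> Obj C; f \<in> Hom C X Y; s \<in> S Z Y\<rbrakk>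
      \<Longrightarrow> \<exists>W\<in>Obj C. \<exists>t\<in>S W X. \<exists>g\<in>Hom C W Z. Cmp C W X Y f t = Cmp C W Z Y s g"
    and left_ore: "\<lbrakk>X \<in> Obj C; Y \<in> Obj C; Z \<in> Obj C; f \<in> Hom C X Y; s \<in> S X Z\<rbrakk>
      \<Longrightarrow> \<exists>W\<in>Obj C. \<exists>t\<in>S Y W. \<exists>g\<in>Hom C Z W. Cmp C X Y W t f = Cmp C X Z W g s"
    and right_cancel: "\<lbrakk>X \<in> Obj C; Y \<in> Obj C; Z \<in> Obj C; f \<in> Hom C X Y; g \<in> Hom C X Y;
        s \<in> S Y Z; Cmp C X Y Z s f = Cmp C X Y Z s g\<rbrakk>
      \<Longrightarrow> \<exists>W\<in>Obj C. \<exists>t\<in>S W X. Cmp C W X Y f t = Cmp C W X Y g t"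
    and left_cancel: "\<lbrakk>X \<in> Obj C; Y \<in> Obj C; Z \<in> Obj C; f \<in> Hom C X Y; g \<in> Hom C X Y;
        s \<in> S Z X; Cmp C Z X Y f s = Cmp C Z X Y g s\<rbrakk>
      \<Longrightarrow> \<exists>W\<in>Obj C. \<exists>t\<in>S Y W. Cmp C X Y W t f = Cmp C X Y W t g"

text \<open>
  The localization \<open>C[S\<^sup>-\<^sup>1]\<close> by right fractions. A roof \<open>(Z, s, f)\<close> from \<open>X\<close> to \<open>Y\<close> consists of
  \<open>s : Z \<rightarrow> X\<close> in \<open>S\<close> and \<open>f : Z \<rightarrow> Y\<close>, and stands for \<open>f \<circ> s\<^sup>-\<^sup>1\<close>. Composition and addition are
  given as relations on representatives, hence without choosing Ore squares or common
  denominators; they yield a single class when \<open>S\<close> is a multiplicative system.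
\<close>

definition roofs ::
  "('o, 'm) acat \<Rightarrow> ('o \<Rightarrow> 'o \<Rightarrow> 'm set) \<Rightarrow> 'o \<Rightarrow> 'o \<Rightarrow> ('o \<times> 'm \<times> 'm) set" where
  "roofs C S X Y = {(Z, s, f). Z \<in> Obj C \<and> s \<in> S Z X \<and> f \<in> Hom C Z Y}"

definition roof_eq ::
  "('o, 'm) acat \<Rightarrow> ('o \<Rightarrow> 'o \<Rightarrow> 'm set) \<Rightarrow> 'o \<Rightarrow> 'o \<Rightarrow>
    'o \<times> 'm \<times> 'm \<Rightarrow> 'o \<times> 'm \<times> 'm \<Rightarrow> bool" where
  "roof_eq C S X Y = (\<lambda>(Z, s, f) (Z', s', f').
    \<exists>W\<in>Obj C. \<exists>a\<in>Hom C W Z. \<exists>b\<in>Hom C W Z'.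
      Cmp C W Z X s a \<in> S W X \<and>
      Cmp C W Z X s a = Cmp C W Z' X s' b \<and>
      Cmp C W Z Y f a = Cmp C W Z' Y f' b)"

definition fraction ::
  "('o, 'm) acat \<Rightarrow> ('o \<Rightarrow> 'o \<Rightarrow> 'm set) \<Rightarrow> 'o \<Rightarrow> 'o \<Rightarrow>
    'o \<times> 'm \<times> 'm \<Rightarrow> ('o \<times> 'm \<times> 'm) set" where
  "fraction C S X Y r = {r' \<in> roofs C S X Y. roof_eq C S X Y r r'}"

definition localization ::
  "('o, 'm) acat \<Rightarrow> ('o \<Rightarrow> 'o \<Rightarrow> 'm set) \<Rightarrow> ('o, ('o \<times> 'm \<times> 'm) set) acat" where
  "localization C S = \<lparr>
    Obj = Obj C,
    Hom = (\<lambda>X Y. fraction C S X Y ` roofs C S X Y),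
    Idn = (\<lambda>X. fraction C S X X (X, Idn C X, Idn C X)),
    Cmp = (\<lambda>X Y Z B A. \<Union>{fraction C S X Z (W, Cmp C W U X s s', Cmp C W V Z g h)
      | U V W s f t g s' h. (U, s, f) \<in> A \<and> (V, t, g) \<in> B \<and> W \<in> Obj C \<and>
          s' \<in> S W U \<and> h \<in> Hom C W V \<and> Cmp C W U Y f s' = Cmp C W V Y t h}),
    Add = (\<lambda>X Y A B. \<Union>{fraction C S X Y (U, s, Add C U Y f g)
      | U s f g. (U, s, f) \<in> A \<and> (U, s, g) \<in> B}),
    Zer = (\<lambda>X Y. fraction C S X Y (X, Idn C X, Zer C X Y))\<rparr>"


section \<open>Complexes and the homotopy category\<close>

type_synonym ('o, 'm) cpx = "(int \<Rightarrow> 'o) \<times> (int \<Rightarrow> 'm)"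

abbreviation ob :: "('o, 'm) cpx \<Rightarrow> int \<Rightarrow> 'o" where "ob X n \<equiv> fst X n"
abbreviation df :: "('o, 'm) cpx \<Rightarrow> int \<Rightarrow> 'm" where "df X n \<equiv> snd X n"

text \<open>Cohomological grading: \<open>df X n\<close> goes from \<open>ob X n\<close> to \<open>ob X (n + 1)\<close>.\<close>

definition is_complex :: "('o, 'm) acat \<Rightarrow> ('o, 'm) cpx \<Rightarrow> bool" where
  "is_complex E X \<longleftrightarrow> (\<forall>n. ob X n \<in> Obj E \<and> df X n \<in> Hom E (ob X n) (ob X (n + 1)) \<and>
    Cmp E (ob X n) (ob X (n + 1)) (ob X (n + 2)) (df X (n + 1)) (df X n)
      = Zer E (ob X n) (ob X (n + 2)))"

definition chain_maps :: "('o, 'm) acat \<Rightarrow> ('o, 'm) cpx \<Rightarrow> ('o, 'm) cpx \<Rightarrow> (int \<Rightarrow> 'm) set" where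
  "chain_maps E X Y = {f. \<forall>n. f n \<in> Hom E (ob X n) (ob Y n) \<and>
    Cmp E (ob X n) (ob X (n + 1)) (ob Y (n + 1)) (f (n + 1)) (df X n)
      = Cmp E (ob X n) (ob Y n) (ob Y (n + 1)) (df Y n) (f n)}"

definition complexes :: "('o, 'm) acat \<Rightarrow> (('o, 'm) cpx, int \<Rightarrow> 'm) acat" where
  "complexes E = \<lparr>
    Obj = {X. is_complex E X},
    Hom = chain_maps E,
    Idn = (\<lambda>X n. Idn E (ob X n)),
    Cmp = (\<lambda>X Y Z g f n. Cmp E (ob X n) (ob Y n) (ob Z n) (g n) (f n)),
    Add = (\<lambda>X Y f g n. Add E (ob X n) (ob Y n) (f n) (g n)),
    Zer = (\<lambda>X Y n. Zer E (ob X n) (ob Y n))\<rparr>"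

definition null_homotopic ::
  "('o, 'm) acat \<Rightarrow> ('o, 'm) cpx \<Rightarrow> ('o, 'm) cpx \<Rightarrow> (int \<Rightarrow> 'm) set" where
  "null_homotopic E X Y = {f. \<exists>h. \<forall>n. h n \<in> Hom E (ob X n) (ob Y (n - 1)) \<and>
    f n = Add E (ob X n) (ob Y n)
      (Cmp E (ob X n) (ob Y (n - 1)) (ob Y n) (df Y (n - 1)) (h n))
      (Cmp E (ob X n) (ob X (n + 1)) (ob Y n) (h (n + 1)) (df X n))}"

definition homotopy_category :: "('o, 'm) acat \<Rightarrow> (('o, 'm) cpx, (int \<Rightarrow> 'm) set) acat" where
  "homotopy_category E = quotient_category (complexes E) (null_homotopic E)"


section \<open>The derived category\<close>

definition acyclic_complex :: "('o, 'm) acat \<Rightarrow> ('o, 'm) cpx \<Rightarrow> bool" where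
  "acyclic_complex E X \<longleftrightarrow> is_complex E X \<and> (\<forall>n. \<exists>K p i.
    df X (n - 1) = Cmp E (ob X (n - 1)) K (ob X n) i p \<and>
    deflation E (ob X (n - 1)) K p \<and>
    is_cokernel E (ob X (n - 2)) (ob X (n - 1)) K (df X (n - 2)) p \<and>
    inflation E K (ob X n) i \<and>
    is_kernel E K (ob X n) (ob X (n + 1)) i (df X n))"

definition shift :: "('o, 'm) acat \<Rightarrow> ('o, 'm) cpx \<Rightarrow> ('o, 'm) cpx" where
  "shift E X = (\<lambda>n. ob X (n + 1), \<lambda>n. neg E (ob X (n + 1)) (ob X (n + 2)) (df X (n + 1)))"

definition unshift :: "('o, 'm) acat \<Rightarrow> ('o, 'm) cpx \<Rightarrow> ('o, 'm) cpx" where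
  "unshift E X = (\<lambda>n. ob X (n - 1), \<lambda>n. neg E (ob X (n - 1)) (ob X n) (df X (n - 1)))"

text \<open>
  Biproducts are only given up to isomorphism, so the cone of \<open>f : X \<rightarrow> Y\<close> is a relation:
  \<open>T\<close> has \<open>ob X (n + 1) \<oplus> ob Y n\<close> in degree \<open>n\<close>, and its differential is the matrix with
  rows \<open>(- df X (n + 1), 0)\<close> and \<open>(f (n + 1), df Y n)\<close>.
\<close>

definition is_cone ::
  "('o, 'm) acat \<Rightarrow> ('o, 'm) cpx \<Rightarrow> ('o, 'm) cpx \<Rightarrow> (int \<Rightarrow> 'm) \<Rightarrow> ('o, 'm) cpx \<Rightarrow> bool" where
  "is_cone E X Y f T \<longleftrightarrow> is_complex E T \<and> (\<exists>i j p q.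
    (\<forall>n. is_biprod E (ob X (n + 1)) (ob Y n) (ob T n) (i n) (j n) (p n) (q n)) \<and>
    (\<forall>n. Cmp E (ob X (n + 1)) (ob T n) (ob T (n + 1)) (df T n) (i n) =
        Add E (ob X (n + 1)) (ob T (n + 1))
          (Cmp E (ob X (n + 1)) (ob X (n + 2)) (ob T (n + 1)) (i (n + 1))
            (neg E (ob X (n + 1)) (ob X (n + 2)) (df X (n + 1))))
          (Cmp E (ob X (n + 1)) (ob Y (n + 1)) (ob T (n + 1)) (j (n + 1)) (f (n + 1)))) \<and>
    (\<forall>n. Cmp E (ob Y n) (ob T n) (ob T (n + 1)) (df T n) (j n) =
        Cmp E (ob Y n) (ob Y (n + 1)) (ob T (n + 1)) (j (n + 1)) (df Y n)))"

text \<open>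
  The thick closure of a class \<open>P\<close> of complexes in the homotopy category: the smallest class
  containing \<open>P\<close> and closed under shifts, cones and direct summands. Closure under isomorphism
  is the case of a zero complement in the last rule.
\<close>

inductive thick_closure ::
  "('o, 'm) acat \<Rightarrow> (('o, 'm) cpx \<Rightarrow> bool) \<Rightarrow> ('o, 'm) cpx \<Rightarrow> bool"
  for E :: "('o, 'm) acat" and P :: "('o, 'm) cpx \<Rightarrow> bool" where
  base: "P X \<Longrightarrow> thick_closure E P X"
| shift: "thick_closure E P X \<Longrightarrow> thick_closure E P (shift E X)"
| unshift: "thick_closure E P X \<Longrightarrow> thick_closure E P (unshift E X)"
| cone: "\<lbrakk>thick_closure E P X; thick_closure E P Y; f \<in> chain_maps E X Y; is_cone E X Y f T\<rbrakk>
    \<Longrightarrow> thick_closure E P T"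
| summand: "\<lbrakk>thick_closure E P X; is_biprod (homotopy_category E) Y Y' X i j p q\<rbrakk>
    \<Longrightarrow> thick_closure E P Y"

definition cone_in ::
  "('o, 'm) acat \<Rightarrow> (('o, 'm) cpx \<Rightarrow> bool) \<Rightarrow>
    ('o, 'm) cpx \<Rightarrow> ('o, 'm) cpx \<Rightarrow> (int \<Rightarrow> 'm) set set" where
  "cone_in E N X Y = {F \<in> Hom (homotopy_category E) X Y. \<exists>f\<in>F. \<exists>T. is_cone E X Y f T \<and> N T}"

definition verdier_quotient ::
  "('o, 'm) acat \<Rightarrow> (('o, 'm) cpx \<Rightarrow> bool) \<Rightarrow>
    (('o, 'm) cpx, (('o, 'm) cpx \<times> (int \<Rightarrow> 'm) set \<times> (int \<Rightarrow> 'm) set) set) acat" where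
  "verdier_quotient E N = localization (homotopy_category E) (cone_in E N)"

definition derived_category ::
  "('o, 'm) acat \<Rightarrow>
    (('o, 'm) cpx, (('o, 'm) cpx \<times> (int \<Rightarrow> 'm) set \<times> (int \<Rightarrow> 'm) set) set) acat" where
  "derived_category E = verdier_quotient E (thick_closure E (acyclic_complex E))"


section \<open>The left t-structure and its heart\<close>

text \<open>
  Truncations depend on the choice of a kernel and of zero objects, so they are relations as
  well: \<open>trunc_le E n X T\<close> says that \<open>T\<close> is a \<open>\<tau>\<^sup>\<le>\<^sup>n X\<close>. In \<open>trunc_ge_Suc E n X T\<close>, which says that
  \<open>T\<close> is a \<open>\<tau>\<^sup>\<ge>\<^sup>n\<^sup>+\<^sup>1 X\<close>, the kernel of \<open>df X n\<close> sits in degree \<open>n - 1\<close> and \<open>ob X n\<close> in degree \<open>n\<close>.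
  Differentials that are not mentioned start or end at a zero object.
\<close>

definition trunc_le :: "('o, 'm) acat \<Rightarrow> int \<Rightarrow> ('o, 'm) cpx \<Rightarrow> ('o, 'm) cpx \<Rightarrow> bool" where
  "trunc_le E n X T \<longleftrightarrow> is_complex E T \<and>
    (\<exists>i. is_kernel E (ob T n) (ob X n) (ob X (n + 1)) i (df X n) \<and>
      df X (n - 1) = Cmp E (ob X (n - 1)) (ob T n) (ob X n) i (df T (n - 1))) \<and>
    (\<forall>m<n. ob T m = ob X m) \<and> (\<forall>m<n - 1. df T m = df X m) \<and>
    (\<forall>m>n. zero_obj E (ob T m))"

definition trunc_ge_Suc :: "('o, 'm) acat \<Rightarrow> int \<Rightarrow> ('o, 'm) cpx \<Rightarrow> ('o, 'm) cpx \<Rightarrow> bool" where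
  "trunc_ge_Suc E n X T \<longleftrightarrow> is_complex E T \<and>
    is_kernel E (ob T (n - 1)) (ob X n) (ob X (n + 1)) (df T (n - 1)) (df X n) \<and>
    (\<forall>m\<ge>n. ob T m = ob X m \<and> df T m = df X m) \<and>
    (\<forall>m<n - 1. zero_obj E (ob T m))"

definition is_zero_in_derived :: "('o, 'm) acat \<Rightarrow> ('o, 'm) cpx \<Rightarrow> bool" where
  "is_zero_in_derived E X \<longleftrightarrow>
    (\<exists>Z. zero_obj (derived_category E) Z \<and> iso_obj (derived_category E) X Z)"

definition D_le_0 :: "('o, 'm) acat \<Rightarrow> ('o, 'm) cpx \<Rightarrow> bool" where
  "D_le_0 E X \<longleftrightarrow> is_complex E X \<and> (\<exists>T. trunc_ge_Suc E 0 X T \<and> is_zero_in_derived E T)"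

definition D_ge_0 :: "('o, 'm) acat \<Rightarrow> ('o, 'm) cpx \<Rightarrow> bool" where
  "D_ge_0 E X \<longleftrightarrow> is_complex E X \<and> (\<exists>T. trunc_le E (-1) X T \<and> is_zero_in_derived E T)"

definition left_heart ::
  "('o, 'm) acat \<Rightarrow>
    (('o, 'm) cpx, (('o, 'm) cpx \<times> (int \<Rightarrow> 'm) set \<times> (int \<Rightarrow> 'm) set) set) acat" where
  "left_heart E = full_subcategory (derived_category E) (\<lambda>X. D_le_0 E X \<and> D_ge_0 E X)"


section \<open>Monomorphisms up to homotopy\<close>

text \<open>An object \<open>(A, B, d)\<close> is the monomorphism \<open>d : A \<rightarrow> B\<close>, with \<open>A\<close> in degree \<open>-1\<close>.\<close>

type_synonym ('o, 'm) arr = "'o \<times> 'o \<times> 'm"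

definition mono_category :: "('o, 'm) acat \<Rightarrow> (('o, 'm) arr, 'm \<times> 'm) acat" where
  "mono_category E = \<lparr>
    Obj = {(A, B, d). A \<in> Obj E \<and> B \<in> Obj E \<and> is_mono E A B d},
    Hom = (\<lambda>(A, B, d) (A', B', d'). {(u, v). u \<in> Hom E A A' \<and> v \<in> Hom E B B' \<and>
      Cmp E A B B' v d = Cmp E A A' B' d' u}),
    Idn = (\<lambda>(A, B, d). (Idn E A, Idn E B)),
    Cmp = (\<lambda>(A, B, d) (A', B', d') (A'', B'', d'') (u', v') (u, v).
      (Cmp E A A' A'' u' u, Cmp E B B' B'' v' v)),
    Add = (\<lambda>(A, B, d) (A', B', d') (u, v) (u', v'). (Add E A A' u u', Add E B B' v v')),
    Zer = (\<lambda>(A, B, d) (A', B', d'). (Zer E A A', Zer E B B'))\<rparr>"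

definition null_squares ::
  "('o, 'm) acat \<Rightarrow> ('o, 'm) arr \<Rightarrow> ('o, 'm) arr \<Rightarrow> ('m \<times> 'm) set" where
  "null_squares E = (\<lambda>(A, B, d) (A', B', d').
    {(Cmp E A B A' t d, Cmp E B A' B' d' t) | t. t \<in> Hom E B A'})"

definition hMon :: "('o, 'm) acat \<Rightarrow> (('o, 'm) arr, ('m \<times> 'm) set) acat" where
  "hMon E = quotient_category (mono_category E) (null_squares E)"

text \<open>A homotopy class belongs to \<open>bicartesian E\<close> if one of its representatives is bicartesian.\<close>

definition bicartesian ::
  "('o, 'm) acat \<Rightarrow> ('o, 'm) arr \<Rightarrow> ('o, 'm) arr \<Rightarrow> ('m \<times> 'm) set set" where
  "bicartesian E = (\<lambda>(A, B, d) (A', B', d').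
    {F \<in> Hom (hMon E) (A, B, d) (A', B', d'). \<exists>(u, v)\<in>F.
      is_pullback E A A' B B' u d d' v \<and> is_pushout E A A' B B' u d d' v})"

end

theory Submission
  imports Defs
begin

text \<open>
  A morphism of complexes lies in the multiplicative system defining \<open>D(E)\<close> iff it is a
  quasi-isomorphism, where exactness means that cycles become boundaries after pulling back along a
  cokernel. A square of monomorphisms is bicartesian iff it is a quasi-isomorphism between the
  two-term complexes it connects. A monomorphism, viewed as a complex \<open>J x\<close> in degrees \<open>-1\<close> and
  \<open>0\<close>, lies in the left heart; conversely a complex \<open>X\<close> gives the monomorphism
  \<open>H X : im d\<^sup>-\<^sup>1 \<rightarrow> ker d\<^sup>0\<close>. Both \<open>J\<close> and \<open>H\<close> are functors up to homotopy that preserve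
  the distinguished classes of morphisms, and \<open>H J\<close> is naturally isomorphic to the identity. Hence
  calculus of fractions transfers from \<open>K(E)\<close> to \<open>hMon(E)\<close>, and \<open>J\<close>, \<open>H\<close> descend to the
  localizations. A complex in the left heart is exact outside degree \<open>0\<close>, so that both maps
  \<open>X \<leftarrow> \<tau>\<^sup>\<le>\<^sup>0 X \<rightarrow> J (H X)\<close> are quasi-isomorphisms; this is the second half of the equivalence.
\<close>

section \<open>Morphisms as elements of a ring\<close>

text \<open>The obstacle is that \<open>E\<close> has kernels and images but in general no
  cokernels, so a complex has no cohomology objects in \<open>E\<close>. What survives of cohomology
  is the inclusion of boundaries into cycles, a monomorphism taken up to homotopy; hence the form of
  \<open>hMon(E)\<close>. Statements about cohomology become lifting statements for elements, and
  liftings exist only after a cover. This calculus works because every morphism has an image (Reg1),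
  and because covers are stable under pullback (Reg2), compose, and are orthogonal to monomorphisms:
  a local lift through a monomorphism is a global one. Exactness in this sense is inherited by
  homotopy retracts, so the thick closure of the acyclic complexes is the class of exact complexes,
  and vanishing in \<open>D(E)\<close> can be tested degree by degree. The Ore squares for
  bicartesian squares are obtained in \<open>K(E)\<close>, where twisted sums supply the vertices.
  The counit exists only as a fraction; its naturality is proved for chain maps and then extended to
  fractions, which needs the heart to contain the vertex of every roof over its objects.\<close>

text \<open>
  All hom-groups of all preadditive categories are embedded into one ring, so that composition
  and addition become ring operations and no source, target or membership side conditions remain
  in calculations. A generalized element is a choice of a morphism \<open>W \<rightarrow> X\<close> for all categories
  and all pairs of objects; a morphism \<open>f : X \<rightarrow> Y\<close> acts on it by postcomposition.
\<close>

context preadditive_category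
begin

lemma Add_in: "\<lbrakk>X \<in> Obj C; Y \<in> Obj C; f \<in> Hom C X Y; g \<in> Hom C X Y\<rbrakk> \<Longrightarrow> Add C X Y f g \<in> Hom C X Y"
  and Zer_in: "\<lbrakk>X \<in> Obj C; Y \<in> Obj C\<rbrakk> \<Longrightarrow> Zer C X Y \<in> Hom C X Y"
  and neg_in: "\<lbrakk>X \<in> Obj C; Y \<in> Obj C; f \<in> Hom C X Y\<rbrakk> \<Longrightarrow> neg C X Y f \<in> Hom C X Y"
  and Add_assoc: "\<lbrakk>X \<in> Obj C; Y \<in> Obj C; f \<in> Hom C X Y; g \<in> Hom C X Y; h \<in> Hom C X Y\<rbrakk>
    \<Longrightarrow> Add C X Y (Add C X Y f g) h = Add C X Y f (Add C X Y g h)"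
  and Add_commute: "\<lbrakk>X \<in> Obj C; Y \<in> Obj C; f \<in> Hom C X Y; g \<in> Hom C X Y\<rbrakk>
    \<Longrightarrow> Add C X Y f g = Add C X Y g f"
  and Add_Zer: "\<lbrakk>X \<in> Obj C; Y \<in> Obj C; f \<in> Hom C X Y\<rbrakk> \<Longrightarrow> Add C X Y (Zer C X Y) f = f"
  and Add_neg: "\<lbrakk>X \<in> Obj C; Y \<in> Obj C; f \<in> Hom C X Y\<rbrakk> \<Longrightarrow> Add C X Y (neg C X Y f) f = Zer C X Y"
proof -
  assume X: "X \<in> Obj C" and Y: "Y \<in> Obj C"
  interpret G: comm_group "hom_group C X Y" using X Y by (rule hom_comm_group)
  have [simp]: "carrier (hom_group C X Y) = Hom C X Y" "mult (hom_group C X Y) = Add C X Y"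
    "one (hom_group C X Y) = Zer C X Y"
    by (simp_all add: hom_group_def)
  { assume "f \<in> Hom C X Y" "g \<in> Hom C X Y" then show "Add C X Y f g \<in> Hom C X Y"
      using G.m_closed[of f g] by simp }
  show "Zer C X Y \<in> Hom C X Y" using G.one_closed by simp
  { assume "f \<in> Hom C X Y" then show "neg C X Y f \<in> Hom C X Y"
      using G.inv_closed[of f] by (simp add: neg_def) }
  { assume "f \<in> Hom C X Y" "g \<in> Hom C X Y" "h \<in> Hom C X Y"
    then show "Add C X Y (Add C X Y f g) h = Add C X Y f (Add C X Y g h)"
      using G.m_assoc[of f g h] by simp }
  { assume "f \<in> Hom C X Y" "g \<in> Hom C X Y" then show "Add C X Y f g = Add C X Y g f"
      using G.m_comm[of f g] by simp }
  { assume "f \<in> Hom C X Y" then show "Add C X Y (Zer C X Y) f = f"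
      using G.l_one[of f] by simp }
  { assume "f \<in> Hom C X Y" then show "Add C X Y (neg C X Y f) f = Zer C X Y"
      using G.l_inv[of f] by (simp add: neg_def) }
qed

text \<open>An idempotent of a group is neutral. This is how additive operations are seen to
  preserve zero, as in the next lemma.\<close>

lemma Add_Add_cancel:
  assumes "X \<in> Obj C" "Y \<in> Obj C" "f \<in> Hom C X Y" "Add C X Y f f = f"
  shows "f = Zer C X Y"
  using assms by (metis Add_Zer Add_assoc Add_neg neg_in)

lemma Cmp_Zer_right:
  assumes "X \<in> Obj C" "Y \<in> Obj C" "Z \<in> Obj C" "g \<in> Hom C Y Z"
  shows "Cmp C X Y Z g (Zer C X Y) = Zer C X Z"
  using assms Cmp_Add_right[of X Y Z "Zer C X Y" "Zer C X Y" g]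
  by (intro Add_Add_cancel) (auto simp: Add_Zer Zer_in Cmp_in)

end

text \<open>The ring has to be a type, which cannot depend on a category; therefore an element
  ranges over all categories at once. The fixed value \<open>undefined\<close> at meaningless
  arguments makes elements equal as soon as they agree where they mean something, so the group laws
  hold as equations.\<close>

typedef ('o, 'm) gel = "{m :: ('o, 'm) acat \<Rightarrow> 'o \<Rightarrow> 'o \<Rightarrow> 'm.
  \<forall>C W X. if preadditive_category C \<and> W \<in> Obj C \<and> X \<in> Obj C then m C W X \<in> Hom C W X
    else m C W X = undefined}"
  morphisms gel_at Abs_gel
  by (rule exI[of _ "\<lambda>C W X. if preadditive_category C \<and> W \<in> Obj C \<and> X \<in> Obj C
        then Zer C W X else undefined"])
    (auto simp: preadditive_category.Zer_in)

definition mk_gel :: "(('o, 'm) acat \<Rightarrow> 'o \<Rightarrow> 'o \<Rightarrow> 'm) \<Rightarrow> ('o, 'm) gel" where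
  "mk_gel m = Abs_gel (\<lambda>C W X. if preadditive_category C \<and> W \<in> Obj C \<and> X \<in> Obj C
    then m C W X else undefined)"

lemma gel_at_in:
  "\<lbrakk>preadditive_category C; W \<in> Obj C; X \<in> Obj C\<rbrakk> \<Longrightarrow> gel_at m C W X \<in> Hom C W X"
  using gel_at[of m] by auto

lemma gel_at_mk:
  assumes "\<And>C W X. \<lbrakk>preadditive_category C; W \<in> Obj C; X \<in> Obj C\<rbrakk> \<Longrightarrow> m C W X \<in> Hom C W X"
  shows "preadditive_category C \<Longrightarrow> W \<in> Obj C \<Longrightarrow> X \<in> Obj C \<Longrightarrow> gel_at (mk_gel m) C W X = m C W X"
  unfolding mk_gel_def by (subst Abs_gel_inverse) (auto simp: assms)

lemma gel_eqI:
  assumes "\<And>C W X. \<lbrakk>preadditive_category C; W \<in> Obj C; X \<in> Obj C\<rbrakk>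
    \<Longrightarrow> gel_at m C W X = gel_at m' C W X"
  shows "m = m'"
proof -
  have "gel_at m C W X = gel_at m' C W X" for C W X
  proof (cases "preadditive_category C \<and> W \<in> Obj C \<and> X \<in> Obj C")
    case False
    then show ?thesis using gel_at[of m] gel_at[of m'] by (simp split: if_splits)
  qed (simp add: assms)
  then have "gel_at m = gel_at m'" by blast
  then show ?thesis by (simp add: gel_at_inject)
qed

instantiation gel :: (type, type) ab_group_add
begin

definition "0 = mk_gel (\<lambda>C W X. Zer C W X)"
definition "m + m' = mk_gel (\<lambda>C W X. Add C W X (gel_at m C W X) (gel_at m' C W X))"
definition "- m = mk_gel (\<lambda>C W X. neg C W X (gel_at m C W X))"
definition "m - m' = m + - (m' :: ('a, 'b) gel)"

lemma gel_at_ops: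
  assumes "preadditive_category C" "W \<in> Obj C" "X \<in> Obj C"
  shows gel_at_zero: "gel_at 0 C W X = Zer C W X"
    and gel_at_plus: "gel_at (m + m') C W X = Add C W X (gel_at m C W X) (gel_at m' C W X)"
    and gel_at_uminus: "gel_at (- m) C W X = neg C W X (gel_at m C W X)"
  unfolding zero_gel_def plus_gel_def uminus_gel_def
  by (subst gel_at_mk; simp add: assms gel_at_in preadditive_category.Zer_in
      preadditive_category.Add_in preadditive_category.neg_in)+

instance
proof
  fix a b c :: "('a, 'b) gel"
  show "a + b + c = a + (b + c)"
    by (rule gel_eqI) (simp add: gel_at_ops gel_at_in preadditive_category.Add_assoc)
  show "a + b = b + a"
    by (rule gel_eqI) (simp add: gel_at_ops, rule preadditive_category.Add_commute;
        simp add: gel_at_in)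
  show "0 + a = a"
    by (rule gel_eqI) (simp add: gel_at_ops gel_at_in preadditive_category.Add_Zer)
  show "- a + a = 0"
    by (rule gel_eqI) (simp add: gel_at_ops gel_at_in preadditive_category.Add_neg)
qed (simp add: minus_gel_def)

end

text \<open>Additivity of the maps is what makes composition distribute over sums on the left. The
  ring is used without a unit; the idempotents \<open>ide X\<close> take the role of local
  units.\<close>

typedef (overloaded) ('o, 'm) endo =
  "{f :: ('o, 'm) gel \<Rightarrow> ('o, 'm) gel. \<forall>x y. f (x + y) = f x + f y}"
  morphisms app_endo Abs_endo
  by (rule exI[of _ "\<lambda>x. x"]) simp

lemma app_endo_add [simp]: "app_endo f (x + y) = app_endo f x + app_endo f y"
  using app_endo[of f] by simp

lemma endo_eqI: "(\<And>x. app_endo f x = app_endo g x) \<Longrightarrow> f = g"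
  by (simp add: app_endo_inject[symmetric] fun_eq_iff)

instantiation endo :: (type, type) ring
begin

definition "0 = Abs_endo (\<lambda>_. 0)"
definition "f + g = Abs_endo (\<lambda>x. app_endo f x + app_endo g x)"
definition "- f = Abs_endo (\<lambda>x. - app_endo f x)"
definition "f - g = f + - (g :: ('a, 'b) endo)"
definition "f * g = Abs_endo (\<lambda>x. app_endo f (app_endo g x))"

lemma app_endo_ops [simp]:
  shows "app_endo 0 x = 0" "app_endo (f + g) x = app_endo f x + app_endo g x"
    "app_endo (- f) x = - app_endo f x" "app_endo (f * g) x = app_endo f (app_endo g x)"
  unfolding zero_endo_def plus_endo_def uminus_endo_def times_endo_def
  by (subst Abs_endo_inverse; simp add: algebra_simps)+

instance
  by standard (auto intro!: endo_eqI simp: minus_endo_def algebra_simps)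

end

text \<open>All components of the result away from \<open>Y\<close> are zero rather than unchanged.
  This makes \<open>mor\<close> additive in \<open>f\<close> and lets morphisms with different
  sources and targets coexist in one ring.\<close>

definition mor :: "('o, 'm) acat \<Rightarrow> 'o \<Rightarrow> 'o \<Rightarrow> 'm \<Rightarrow> ('o, 'm) endo" where
  "mor C X Y f = Abs_endo (\<lambda>m. mk_gel (\<lambda>C' W Y'. if C' = C \<and> Y' = Y then Cmp C W X Y f (gel_at m C W X)
    else Zer C' W Y'))"

context preadditive_category
begin

lemma gel_at_mor:
  assumes X: "X \<in> Obj C" and Y: "Y \<in> Obj C" and f: "f \<in> Hom C X Y"
    and C': "preadditive_category C'" "W \<in> Obj C'" "Y' \<in> Obj C'"
  shows "gel_at (app_endo (mor C X Y f) m) C' W Y' =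
    (if C' = C \<and> Y' = Y then Cmp C W X Y f (gel_at m C W X) else Zer C' W Y')"
proof -
  let ?m = "\<lambda>m C' W Y'. if C' = C \<and> Y' = Y then Cmp C W X Y f (gel_at m C W X) else Zer C' W Y'"
  have C: "preadditive_category C" by unfold_locales
  have at: "gel_at (mk_gel (?m m)) C' W Y' = ?m m C' W Y'"
    if "preadditive_category C'" "W \<in> Obj C'" "Y' \<in> Obj C'" for C' W Y' m
    using that X Y f by (subst gel_at_mk) (auto simp: gel_at_in Cmp_in preadditive_category.Zer_in)
  have "mk_gel (?m (x + y)) = mk_gel (?m x) + mk_gel (?m y)" for x y
    using X Y f C
    by (intro gel_eqI)
      (auto simp: at gel_at_plus Cmp_Add_right gel_at_in preadditive_category.Zer_in
        preadditive_category.Add_Zer)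
  then show ?thesis
    unfolding mor_def using C' by (subst Abs_endo_inverse) (simp_all add: at)
qed

lemmas mor_eqI = endo_eqI[OF gel_eqI]

lemma mor_Cmp:
  assumes "X \<in> Obj C" "Y \<in> Obj C" "Z \<in> Obj C" "f \<in> Hom C X Y" "g \<in> Hom C Y Z"
  shows "mor C X Z (Cmp C X Y Z g f) = mor C Y Z g * mor C X Y f"
proof -
  have C: "preadditive_category C" by unfold_locales
  show ?thesis
    by (rule mor_eqI)
      (use assms C in \<open>auto simp: gel_at_mor Cmp_in Cmp_assoc gel_at_in\<close>)
qed

lemma mor_Add:
  assumes "X \<in> Obj C" "Y \<in> Obj C" "f \<in> Hom C X Y" "g \<in> Hom C X Y"
  shows "mor C X Y (Add C X Y f g) = mor C X Y f + mor C X Y g"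
proof -
  have C: "preadditive_category C" by unfold_locales
  show ?thesis
    by (rule mor_eqI)
      (use assms C in \<open>auto simp: gel_at_mor gel_at_plus Add_in Cmp_Add_left gel_at_in
        preadditive_category.Add_Zer preadditive_category.Zer_in\<close>)
qed

lemma mor_inject:
  assumes "X \<in> Obj C" "Y \<in> Obj C" "f \<in> Hom C X Y" "g \<in> Hom C X Y"
  shows "mor C X Y f = mor C X Y g \<longleftrightarrow> f = g"
proof
  assume eq: "mor C X Y f = mor C X Y g"
  have C: "preadditive_category C" by unfold_locales
  \<comment> \<open>The test element of the Yoneda argument: the identity at \<open>(X, X)\<close>,
    zero elsewhere.\<close>
  define m where "m = mk_gel (\<lambda>C' W Y. if C' = C \<and> W = X \<and> Y = X then Idn C X else Zer C' W Y)"
  have m: "gel_at m C X X = Idn C X"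
    unfolding m_def using C assms Idn_in
    by (subst gel_at_mk) (auto simp: preadditive_category.Zer_in)
  have "Cmp C X X Y f (gel_at m C X X) = Cmp C X X Y g (gel_at m C X X)"
    using arg_cong[OF eq, of "\<lambda>h. gel_at (app_endo h m) C X Y"] assms C
    by (simp add: gel_at_mor)
  then show "f = g" using m assms by (simp add: Idn_right)
qed simp

definition ide :: "'o \<Rightarrow> ('o, 'm) endo" where
  "ide X = mor C X X (Idn C X)"

definition hom :: "'o \<Rightarrow> 'o \<Rightarrow> ('o, 'm) endo set" where
  "hom X Y = mor C X Y ` Hom C X Y"

definition unmor :: "'o \<Rightarrow> 'o \<Rightarrow> ('o, 'm) endo \<Rightarrow> 'm" where
  "unmor X Y = inv_into (Hom C X Y) (mor C X Y)"

lemma mor_in: "f \<in> Hom C X Y \<Longrightarrow> mor C X Y f \<in> hom X Y"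
  by (simp add: hom_def)

lemma unmor_in: "a \<in> hom X Y \<Longrightarrow> unmor X Y a \<in> Hom C X Y"
  by (simp add: hom_def unmor_def inv_into_into)

lemma mor_unmor [simp]: "a \<in> hom X Y \<Longrightarrow> mor C X Y (unmor X Y a) = a"
  by (simp add: hom_def unmor_def f_inv_into_f)

lemma unmor_mor [simp]:
  "\<lbrakk>X \<in> Obj C; Y \<in> Obj C; f \<in> Hom C X Y\<rbrakk> \<Longrightarrow> unmor X Y (mor C X Y f) = f"
  unfolding unmor_def by (rule inv_into_f_f) (auto simp: inj_on_def mor_inject)

lemma mor_Zer: "\<lbrakk>X \<in> Obj C; Y \<in> Obj C\<rbrakk> \<Longrightarrow> mor C X Y (Zer C X Y) = 0"
  using mor_Add[of X Y "Zer C X Y" "Zer C X Y"] by (simp add: Zer_in Add_Zer)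

lemma mor_neg: "\<lbrakk>X \<in> Obj C; Y \<in> Obj C; f \<in> Hom C X Y\<rbrakk> \<Longrightarrow> mor C X Y (neg C X Y f) = - mor C X Y f"
  using mor_Add[of X Y "neg C X Y f" f]
  by (simp add: neg_in Add_neg mor_Zer eq_neg_iff_add_eq_0)

lemma mor_eq_0: "\<lbrakk>X \<in> Obj C; Y \<in> Obj C; f \<in> Hom C X Y\<rbrakk> \<Longrightarrow> mor C X Y f = 0 \<longleftrightarrow> f = Zer C X Y"
  using mor_inject[of X Y f "Zer C X Y"] by (simp add: Zer_in mor_Zer)

lemma ide_in [simp]: "X \<in> Obj C \<Longrightarrow> ide X \<in> hom X X"
  by (simp add: ide_def hom_def Idn_in)

lemma hom_0 [simp]: "\<lbrakk>X \<in> Obj C; Y \<in> Obj C\<rbrakk> \<Longrightarrow> 0 \<in> hom X Y"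
  using mor_in[OF Zer_in, of X Y] by (simp add: mor_Zer)

lemma hom_add: "\<lbrakk>X \<in> Obj C; Y \<in> Obj C; a \<in> hom X Y; b \<in> hom X Y\<rbrakk> \<Longrightarrow> a + b \<in> hom X Y"
  by (auto simp: hom_def mor_Add[symmetric] Add_in)

lemma hom_neg: "\<lbrakk>X \<in> Obj C; Y \<in> Obj C; a \<in> hom X Y\<rbrakk> \<Longrightarrow> - a \<in> hom X Y"
  by (auto simp: hom_def mor_neg[symmetric] neg_in)

lemma hom_diff: "\<lbrakk>X \<in> Obj C; Y \<in> Obj C; a \<in> hom X Y; b \<in> hom X Y\<rbrakk> \<Longrightarrow> a - b \<in> hom X Y"
  using hom_add[of X Y a "- b"] hom_neg[of X Y b] by simp

lemma hom_mult:
  "\<lbrakk>X \<in> Obj C; Y \<in> Obj C; Z \<in> Obj C; a \<in> hom X Y; b \<in> hom Y Z\<rbrakk> \<Longrightarrow> b * a \<in> hom X Z"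
  by (auto simp: hom_def mor_Cmp[symmetric] Cmp_in)

lemma ide_left [simp]: "\<lbrakk>X \<in> Obj C; Y \<in> Obj C; a \<in> hom X Y\<rbrakk> \<Longrightarrow> ide Y * a = a"
  unfolding hom_def ide_def using mor_Cmp[of X Y Y _ "Idn C Y"] by (auto simp: Idn_in Idn_left)

lemma ide_right [simp]: "\<lbrakk>X \<in> Obj C; Y \<in> Obj C; a \<in> hom X Y\<rbrakk> \<Longrightarrow> a * ide X = a"
  unfolding hom_def ide_def using mor_Cmp[of X X Y "Idn C X"] by (auto simp: Idn_in Idn_right)

text \<open>
  Variants for the simplifier, which solves premises from left to right and must find the
  missing object either from an object premise or from the morphism.
\<close>

lemma ide_left' [simp]: "\<lbrakk>a \<in> hom X Y; X \<in> Obj C; Y \<in> Obj C\<rbrakk> \<Longrightarrow> ide Y * a = a"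
  and ide_right' [simp]: "\<lbrakk>a \<in> hom X Y; X \<in> Obj C; Y \<in> Obj C\<rbrakk> \<Longrightarrow> a * ide X = a"
  by (rule ide_left, assumption+) (rule ide_right, assumption+)

lemmas hom_intros = hom_add hom_diff hom_neg hom_mult hom_0 ide_in

lemma unmor_eqI: "\<lbrakk>X \<in> Obj C; Y \<in> Obj C; f \<in> Hom C X Y; mor C X Y f = a\<rbrakk> \<Longrightarrow> f = unmor X Y a"
  by auto

lemma unmor_ops:
  assumes "X \<in> Obj C" "Y \<in> Obj C"
  shows unmor_Add: "a \<in> hom X Y \<Longrightarrow> b \<in> hom X Y \<Longrightarrow>
      Add C X Y (unmor X Y a) (unmor X Y b) = unmor X Y (a + b)"
    and unmor_Cmp: "Z \<in> Obj C \<Longrightarrow> a \<in> hom X Y \<Longrightarrow> c \<in> hom Y Z \<Longrightarrow>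
      Cmp C X Y Z (unmor Y Z c) (unmor X Y a) = unmor X Z (c * a)"
    and unmor_Zer: "Zer C X Y = unmor X Y 0"
  using assms
  by (auto intro!: unmor_eqI simp: unmor_in Add_in Zer_in Cmp_in mor_Add mor_Cmp mor_Zer)

lemma unmor_Idn: "X \<in> Obj C \<Longrightarrow> Idn C X = unmor X X (ide X)"
  by (simp add: ide_def Idn_in)

end

text \<open>Meant for categories whose morphisms are classes or families. The group axioms appear as
  separate equations that can be checked on representatives, and inverses are asked for by
  existence, so that \<open>neg\<close> of a class never has to be computed.\<close>

lemma preadditive_categoryI:
  assumes "\<And>X. X \<in> Obj C \<Longrightarrow> Idn C X \<in> Hom C X X"
    and "\<And>X Y Z f g. \<lbrakk>X \<in> Obj C; Y \<in> Obj C; Z \<in> Obj C; f \<in> Hom C X Y; g \<in> Hom C Y Z\<rbrakk>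
      \<Longrightarrow> Cmp C X Y Z g f \<in> Hom C X Z"
    and "\<And>X Y f. \<lbrakk>X \<in> Obj C; Y \<in> Obj C; f \<in> Hom C X Y\<rbrakk> \<Longrightarrow> Cmp C X Y Y (Idn C Y) f = f"
    and "\<And>X Y f. \<lbrakk>X \<in> Obj C; Y \<in> Obj C; f \<in> Hom C X Y\<rbrakk> \<Longrightarrow> Cmp C X X Y f (Idn C X) = f"
    and "\<And>W X Y Z f g h. \<lbrakk>W \<in> Obj C; X \<in> Obj C; Y \<in> Obj C; Z \<in> Obj C;
        f \<in> Hom C W X; g \<in> Hom C X Y; h \<in> Hom C Y Z\<rbrakk>
      \<Longrightarrow> Cmp C W Y Z h (Cmp C W X Y g f) = Cmp C W X Z (Cmp C X Y Z h g) f"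
    and "\<And>X Y f g. \<lbrakk>X \<in> Obj C; Y \<in> Obj C; f \<in> Hom C X Y; g \<in> Hom C X Y\<rbrakk> \<Longrightarrow> Add C X Y f g \<in> Hom C X Y"
    and "\<And>X Y. \<lbrakk>X \<in> Obj C; Y \<in> Obj C\<rbrakk> \<Longrightarrow> Zer C X Y \<in> Hom C X Y"
    and "\<And>X Y f g h. \<lbrakk>X \<in> Obj C; Y \<in> Obj C; f \<in> Hom C X Y; g \<in> Hom C X Y; h \<in> Hom C X Y\<rbrakk>
      \<Longrightarrow> Add C X Y (Add C X Y f g) h = Add C X Y f (Add C X Y g h)"
    and "\<And>X Y f g. \<lbrakk>X \<in> Obj C; Y \<in> Obj C; f \<in> Hom C X Y; g \<in> Hom C X Y\<rbrakk>
      \<Longrightarrow> Add C X Y f g = Add C X Y g f"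
    and "\<And>X Y f. \<lbrakk>X \<in> Obj C; Y \<in> Obj C; f \<in> Hom C X Y\<rbrakk> \<Longrightarrow> Add C X Y (Zer C X Y) f = f"
    and "\<And>X Y f. \<lbrakk>X \<in> Obj C; Y \<in> Obj C; f \<in> Hom C X Y\<rbrakk> \<Longrightarrow> \<exists>g\<in>Hom C X Y. Add C X Y g f = Zer C X Y"
    and "\<And>X Y Z f g h. \<lbrakk>X \<in> Obj C; Y \<in> Obj C; Z \<in> Obj C; f \<in> Hom C X Y; g \<in> Hom C Y Z; h \<in> Hom C Y Z\<rbrakk>
      \<Longrightarrow> Cmp C X Y Z (Add C Y Z g h) f = Add C X Z (Cmp C X Y Z g f) (Cmp C X Y Z h f)"
    and "\<And>X Y Z f g h. \<lbrakk>X \<in> Obj C; Y \<in> Obj C; Z \<in> Obj C; f \<in> Hom C X Y; g \<in> Hom C X Y; h \<in> Hom C Y Z\<rbrakk>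
      \<Longrightarrow> Cmp C X Y Z h (Add C X Y f g) = Add C X Z (Cmp C X Y Z h f) (Cmp C X Y Z h g)"
  shows "preadditive_category C"
proof (rule preadditive_category.intro)
  fix X Y assume XY: "X \<in> Obj C" "Y \<in> Obj C"
  show "comm_group (hom_group C X Y)"
    unfolding hom_group_def
    by (rule comm_groupI) (use XY assms in \<open>simp_all\<close>)
qed (fact assms)+

context preadditive_category
begin

section \<open>Biproducts, zero objects and isomorphisms as ring equations\<close>

definition rbiprod :: "'o \<Rightarrow> 'o \<Rightarrow> 'o \<Rightarrow> ('o, 'm) endo \<Rightarrow> ('o, 'm) endo \<Rightarrow> ('o, 'm) endo \<Rightarrow>
    ('o, 'm) endo \<Rightarrow> bool" where
  "rbiprod X Y B i j p q \<longleftrightarrow> X \<in> Obj C \<and> Y \<in> Obj C \<and> B \<in> Obj C \<and>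
    i \<in> hom X B \<and> j \<in> hom Y B \<and> p \<in> hom B X \<and> q \<in> hom B Y \<and>
    p * i = ide X \<and> q * j = ide Y \<and> p * j = 0 \<and> q * i = 0 \<and> i * p + j * q = ide B"

lemma is_biprod_unmor:
  assumes "rbiprod X Y B i j p q"
  shows "is_biprod C X Y B (unmor X B i) (unmor Y B j) (unmor B X p) (unmor B Y q)"
  using assms unfolding rbiprod_def is_biprod_def
  by (simp add: unmor_in unmor_ops unmor_Idn hom_mult[of B X B p i] hom_mult[of B Y B q j])

lemma is_biprodD:
  assumes "is_biprod C X Y B i j p q"
  shows "rbiprod X Y B (mor C X B i) (mor C Y B j) (mor C B X p) (mor C B Y q)"
  using assms unfolding rbiprod_def is_biprod_def ide_def
  by (simp add: mor_in mor_Cmp[symmetric] mor_Add[symmetric] mor_Zer Cmp_in)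

lemma zero_obj_iff: "zero_obj C Z \<longleftrightarrow> Z \<in> Obj C \<and> ide Z = 0"
proof
  assume Z: "zero_obj C Z"
  then have "Z \<in> Obj C" by (simp add: zero_obj_def)
  moreover from Z this have "\<exists>!f. f \<in> Hom C Z Z" by (auto simp: zero_obj_def)
  ultimately show "Z \<in> Obj C \<and> ide Z = 0"
    unfolding ide_def by (metis Idn_in Zer_in mor_Zer)
next
  assume Z: "Z \<in> Obj C \<and> ide Z = 0"
  have "f = Zer C X Z" if "X \<in> Obj C" "f \<in> Hom C X Z" for X f
    using that Z ide_left[of X Z "mor C X Z f"] by (simp add: mor_in mor_eq_0[symmetric])
  moreover have "f = Zer C Z X" if "X \<in> Obj C" "f \<in> Hom C Z X" for X f
    using that Z ide_right[of Z X "mor C Z X f"] by (simp add: mor_in mor_eq_0[symmetric])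
  ultimately show "zero_obj C Z"
    unfolding zero_obj_def using Z Zer_in by (metis (no_types, lifting))
qed

definition riso :: "'o \<Rightarrow> 'o \<Rightarrow> ('o, 'm) endo \<Rightarrow> bool" where
  "riso X Y a \<longleftrightarrow> a \<in> hom X Y \<and> (\<exists>b\<in>hom Y X. b * a = ide X \<and> a * b = ide Y)"

lemma is_iso_unmor:
  assumes "X \<in> Obj C" "Y \<in> Obj C" "riso X Y a"
  shows "is_iso C X Y (unmor X Y a)"
proof -
  obtain b where "b \<in> hom Y X" "b * a = ide X" "a * b = ide Y" "a \<in> hom X Y"
    using assms(3) by (auto simp: riso_def)
  then show ?thesis
    unfolding is_iso_def using assms(1,2)
    by (auto intro!: bexI[of _ "unmor Y X b"] simp: unmor_in unmor_ops unmor_Idn)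
qed

end

lemma (in additive_category) ex_rbiprod:
  "\<lbrakk>X \<in> Obj C; Y \<in> Obj C\<rbrakk> \<Longrightarrow> \<exists>B i j p q. rbiprod X Y B i j p q"
  using ex_biprod is_biprodD by blast

lemma (in preadditive_category) additive_categoryI:
  assumes "Z \<in> Obj C" "ide Z = 0"
    and "\<And>X Y. \<lbrakk>X \<in> Obj C; Y \<in> Obj C\<rbrakk> \<Longrightarrow> \<exists>B i j p q. rbiprod X Y B i j p q"
  shows "additive_category C"
proof unfold_locales
  show "\<exists>Z. zero_obj C Z" using assms(1,2) zero_obj_iff by blast
  show "\<exists>B i j p q. is_biprod C X Y B i j p q" if "X \<in> Obj C" "Y \<in> Obj C" for X Y
    using assms(3)[OF that] is_biprod_unmor by blast
qed

text \<open>Functors act on ring elements here; \<open>additive_functor\<close> returns to raw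
  morphisms. Preadditive categories are enough on both sides, so functors can be built between
  categories not yet known to be additive, and can then serve to prove additivity.\<close>

locale rfunctor = A: preadditive_category C + B: preadditive_category D
  for C :: "('o, 'm) acat" and D :: "('p, 'n) acat" +
  fixes Fo :: "'o \<Rightarrow> 'p" and F :: "'o \<Rightarrow> 'o \<Rightarrow> ('o, 'm) endo \<Rightarrow> ('p, 'n) endo"
  assumes Fo_in: "X \<in> Obj C \<Longrightarrow> Fo X \<in> Obj D"
    and F_in: "\<lbrakk>X \<in> Obj C; Y \<in> Obj C; a \<in> A.hom X Y\<rbrakk> \<Longrightarrow> F X Y a \<in> B.hom (Fo X) (Fo Y)"
    and F_ide: "X \<in> Obj C \<Longrightarrow> F X X (A.ide X) = B.ide (Fo X)"
    and F_mult: "\<lbrakk>X \<in> Obj C; Y \<in> Obj C; Z \<in> Obj C; a \<in> A.hom X Y; b \<in> A.hom Y Z\<rbrakk>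
      \<Longrightarrow> F X Z (b * a) = F Y Z b * F X Y a"
    and F_add: "\<lbrakk>X \<in> Obj C; Y \<in> Obj C; a \<in> A.hom X Y; b \<in> A.hom X Y\<rbrakk>
      \<Longrightarrow> F X Y (a + b) = F X Y a + F X Y b"
begin

lemma F_0: "\<lbrakk>X \<in> Obj C; Y \<in> Obj C\<rbrakk> \<Longrightarrow> F X Y 0 = 0"
  using F_add[of X Y 0 0] by simp

lemma F_biprod:
  assumes "A.rbiprod X Y P i j p q"
  shows "B.rbiprod (Fo X) (Fo Y) (Fo P) (F X P i) (F Y P j) (F P X p) (F P Y q)"
  using assms unfolding A.rbiprod_def B.rbiprod_def
  by (simp add: Fo_in F_in F_mult[symmetric] F_add[symmetric] F_ide F_0
      A.hom_mult[of P X P p i] A.hom_mult[of P Y P q j])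

lemma F_iso:
  assumes "X \<in> Obj C" "Y \<in> Obj C" "A.riso X Y a"
  shows "B.riso (Fo X) (Fo Y) (F X Y a)"
proof -
  obtain b where b: "b \<in> A.hom Y X" "b * a = A.ide X" "a * b = A.ide Y" "a \<in> A.hom X Y"
    using assms(3) by (auto simp: A.riso_def)
  then show ?thesis unfolding B.riso_def
    using assms(1,2) F_mult[of X Y X a b] F_mult[of Y X Y b a]
    by (auto simp: F_in F_ide intro!: bexI[of _ "F Y X b"])
qed

lemma additive_functor:
  assumes "additive_category C" "additive_category D"
  shows "additive_functor C D Fo (\<lambda>X Y f. B.unmor (Fo X) (Fo Y) (F X Y (mor C X Y f)))"
proof -
  interpret A': additive_category C by fact
  interpret B': additive_category D by fact
  show ?thesis
    by unfold_locales
      (simp_all add: Fo_in F_in A.mor_in B.unmor_in A.ide_def[symmetric] F_ide A.mor_Cmp A.mor_Add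
        F_mult F_add B.unmor_ops B.unmor_Idn)
qed

end

lemma (in preadditive_category) rfunctor_id: "rfunctor C C (\<lambda>X. X) (\<lambda>X Y a. a)"
  by unfold_locales simp_all

lemma rfunctor_comp:
  assumes "rfunctor C D Fo F" "rfunctor D D' Go G"
  shows "rfunctor C D' (\<lambda>X. Go (Fo X)) (\<lambda>X Y a. G (Fo X) (Fo Y) (F X Y a))"
proof -
  interpret F: rfunctor C D Fo F by fact
  interpret G: rfunctor D D' Go G by fact
  show ?thesis
    by unfold_locales (simp_all add: F.Fo_in G.Fo_in F.F_in G.F_in F.F_ide G.F_ide F.F_mult G.F_mult
        F.F_add G.F_add)
qed

text \<open>A functor that is the identity on objects carries the ring equations of zero objects and
  biproducts from \<open>C\<close> to \<open>D\<close>. For localizations the functor is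
  \<open>loc\<close>.\<close>

lemma additive_same_objects:
  assumes "rfunctor C D (\<lambda>X. X) F" "Obj D = Obj C" "additive_category C"
  shows "additive_category D"
proof -
  interpret F: rfunctor C D "\<lambda>X. X" F by fact
  interpret C: additive_category C by fact
  obtain Z where Z: "Z \<in> Obj C" "F.A.ide Z = 0"
    using C.ex_zero_obj by (auto simp: F.A.zero_obj_iff)
  show ?thesis
  proof (rule F.B.additive_categoryI)
    show "Z \<in> Obj D" "F.B.ide Z = 0"
      using Z F.F_ide[of Z] F.F_0[of Z Z] assms(2) by simp_all
    show "\<exists>B i j p q. F.B.rbiprod X Y B i j p q" if "X \<in> Obj D" "Y \<in> Obj D" for X Y
      using that C.ex_rbiprod[of X Y] F.F_biprod[of X Y] assms(2) by fastforce
  qed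
qed

section \<open>Quotients by ideals\<close>

locale hom_ideal = preadditive_category C for C :: "('o, 'm) acat" +
  fixes I :: "'o \<Rightarrow> 'o \<Rightarrow> 'm set" and II
  defines "II \<equiv> \<lambda>X Y. mor C X Y ` I X Y"
  assumes I_in: "\<lbrakk>X \<in> Obj C; Y \<in> Obj C\<rbrakk> \<Longrightarrow> I X Y \<subseteq> Hom C X Y"
    and II_0: "\<lbrakk>X \<in> Obj C; Y \<in> Obj C\<rbrakk> \<Longrightarrow> 0 \<in> II X Y"
    and II_diff: "\<lbrakk>X \<in> Obj C; Y \<in> Obj C; a \<in> II X Y; b \<in> II X Y\<rbrakk> \<Longrightarrow> a - b \<in> II X Y"
    and II_left: "\<lbrakk>X \<in> Obj C; Y \<in> Obj C; Z \<in> Obj C; a \<in> II X Y; b \<in> hom Y Z\<rbrakk> \<Longrightarrow> b * a \<in> II X Z"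
    and II_right: "\<lbrakk>X \<in> Obj C; Y \<in> Obj C; Z \<in> Obj C; a \<in> hom X Y; b \<in> II Y Z\<rbrakk> \<Longrightarrow> b * a \<in> II X Z"
begin

lemma II_neg: "\<lbrakk>X \<in> Obj C; Y \<in> Obj C; a \<in> II X Y\<rbrakk> \<Longrightarrow> - a \<in> II X Y"
  using II_diff[of X Y 0 a] II_0 by simp

lemma II_add: "\<lbrakk>X \<in> Obj C; Y \<in> Obj C; a \<in> II X Y; b \<in> II X Y\<rbrakk> \<Longrightarrow> a + b \<in> II X Y"
  using II_diff[of X Y a "- b"] II_neg by simp

abbreviation "Q \<equiv> quotient_category C I"

text \<open>Classes are indexed by ring elements, so congruent elements name the same set and the
  operations on classes become ring operations on the indices.\<close>

definition qcl :: "'o \<Rightarrow> 'o \<Rightarrow> ('o, 'm) endo \<Rightarrow> 'm set" where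
  "qcl X Y a = {f \<in> Hom C X Y. mor C X Y f - a \<in> II X Y}"

lemma coset_mor_eq:
  assumes "X \<in> Obj C" "Y \<in> Obj C" "f \<in> Hom C X Y"
  shows "coset_mor C I X Y f = qcl X Y (mor C X Y f)"
proof -
  have "g \<in> coset_mor C I X Y f" if g: "g \<in> Hom C X Y" "mor C X Y g - mor C X Y f \<in> II X Y" for g
  proof -
    obtain t where t: "t \<in> I X Y" "mor C X Y g - mor C X Y f = mor C X Y t"
      using g(2) by (auto simp: II_def)
    have "t \<in> Hom C X Y" using t I_in assms by blast
    then have "g = Add C X Y f t"
      using t assms g by (simp add: mor_inject[symmetric] Add_in mor_Add algebra_simps)
    then show ?thesis using t by (simp add: coset_mor_def)
  qed
  moreover have "Add C X Y f t \<in> qcl X Y (mor C X Y f)" if "t \<in> I X Y" for t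
    using that I_in[of X Y] assms by (auto simp: qcl_def Add_in mor_Add II_def)
  ultimately show ?thesis by (auto simp: coset_mor_def qcl_def)
qed

lemma qcl_eq_iff:
  assumes "X \<in> Obj C" "Y \<in> Obj C" "a \<in> hom X Y" "b \<in> hom X Y"
  shows "qcl X Y a = qcl X Y b \<longleftrightarrow> a - b \<in> II X Y"
proof
  assume "qcl X Y a = qcl X Y b"
  moreover have "unmor X Y a \<in> qcl X Y a" using assms by (simp add: qcl_def unmor_in II_0)
  ultimately show "a - b \<in> II X Y" using assms by (simp add: qcl_def)
next
  assume ab: "a - b \<in> II X Y"
  have "x - a \<in> II X Y \<longleftrightarrow> x - b \<in> II X Y" for x
    using II_add[of X Y "x - a" "a - b"] II_diff[of X Y "x - b" "a - b"] ab assms by auto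
  then show "qcl X Y a = qcl X Y b" by (auto simp: qcl_def)
qed

lemma qcl_nonempty: "\<lbrakk>X \<in> Obj C; Y \<in> Obj C; a \<in> hom X Y\<rbrakk> \<Longrightarrow> unmor X Y a \<in> qcl X Y a"
  by (simp add: qcl_def unmor_in II_0)

lemma Obj_Q [simp]: "Obj Q = Obj C"
  by (simp add: quotient_category_def)

lemma Hom_Q: "\<lbrakk>X \<in> Obj C; Y \<in> Obj C\<rbrakk> \<Longrightarrow> Hom Q X Y = qcl X Y ` hom X Y"
  by (auto simp: quotient_category_def coset_mor_eq hom_def)

lemma Idn_Q: "X \<in> Obj C \<Longrightarrow> Idn Q X = qcl X X (ide X)"
  by (simp add: quotient_category_def coset_mor_eq Idn_in ide_def)

lemma Zer_Q: "X \<in> Obj C \<Longrightarrow> Y \<in> Obj C \<Longrightarrow> Zer Q X Y = qcl X Y 0"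
  by (simp add: quotient_category_def coset_mor_eq Zer_in mor_Zer)

lemma Cmp_Q:
  assumes XYZ: "X \<in> Obj C" "Y \<in> Obj C" "Z \<in> Obj C" and a: "a \<in> hom X Y" and b: "b \<in> hom Y Z"
  shows "Cmp Q X Y Z (qcl Y Z b) (qcl X Y a) = qcl X Z (b * a)"
proof -
  have "coset_mor C I X Z (Cmp C X Y Z g f) = qcl X Z (b * a)"
    if "g \<in> qcl Y Z b" "f \<in> qcl X Y a" for f g
  proof -
    have fg: "f \<in> Hom C X Y" "g \<in> Hom C Y Z" "mor C X Y f - a \<in> II X Y" "mor C Y Z g - b \<in> II Y Z"
      using that by (auto simp: qcl_def)
    \<comment> \<open>This is \<open>g * f - b * a\<close>, split so that each summand has one
      factor in the ideal.\<close>
    have "(mor C Y Z g - b) * mor C X Y f + b * (mor C X Y f - a) \<in> II X Z"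
      using fg XYZ a b by (intro II_add II_left[of X Y Z] II_right[of X Y Z]) (simp_all add: mor_in)
    then show ?thesis
      using fg XYZ a b
      by (simp add: coset_mor_eq Cmp_in qcl_eq_iff mor_Cmp hom_mult mor_in algebra_simps)
  qed
  then show ?thesis
    unfolding quotient_category_def using qcl_nonempty[OF XYZ(1,2) a] qcl_nonempty[OF XYZ(2,3) b]
    by auto
qed

lemma Add_Q:
  assumes XY: "X \<in> Obj C" "Y \<in> Obj C" and a: "a \<in> hom X Y" and b: "b \<in> hom X Y"
  shows "Add Q X Y (qcl X Y a) (qcl X Y b) = qcl X Y (a + b)"
proof -
  have "coset_mor C I X Y (Add C X Y f g) = qcl X Y (a + b)"
    if "g \<in> qcl X Y b" "f \<in> qcl X Y a" for f g
  proof -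
    have fg: "f \<in> Hom C X Y" "g \<in> Hom C X Y" "mor C X Y f - a \<in> II X Y" "mor C X Y g - b \<in> II X Y"
      using that by (auto simp: qcl_def)
    have "(mor C X Y f - a) + (mor C X Y g - b) \<in> II X Y"
      using fg XY by (intro II_add)
    then show ?thesis
      using fg XY a b
      by (simp add: coset_mor_eq Add_in qcl_eq_iff mor_Add hom_add mor_in algebra_simps)
  qed
  then show ?thesis
    unfolding quotient_category_def using qcl_nonempty[OF XY a] qcl_nonempty[OF XY b]
    by auto
qed

lemma preadditive_Q: "preadditive_category Q"
proof (rule preadditive_categoryI, goal_cases)
  case (11 X Y f)
  then obtain a where "a \<in> hom X Y" "f = qcl X Y a" by (auto simp: Hom_Q)
  then show ?case using 11 by (intro bexI[of _ "qcl X Y (- a)"]) (auto simp: Hom_Q Add_Q Zer_Q hom_neg)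
qed (auto simp: Hom_Q Idn_Q Zer_Q Cmp_Q Add_Q hom_intros mult.assoc algebra_simps)

sublocale Q: preadditive_category Q
  by (rule preadditive_Q)

definition proj :: "'o \<Rightarrow> 'o \<Rightarrow> ('o, 'm) endo \<Rightarrow> ('o, 'm set) endo" where
  "proj X Y a = mor Q X Y (qcl X Y a)"

lemma hom_Q: "\<lbrakk>X \<in> Obj C; Y \<in> Obj C\<rbrakk> \<Longrightarrow> Q.hom X Y = proj X Y ` hom X Y"
  by (auto simp: Q.hom_def proj_def Hom_Q)

lemma proj_eq_iff:
  "\<lbrakk>X \<in> Obj C; Y \<in> Obj C; a \<in> hom X Y; b \<in> hom X Y\<rbrakk> \<Longrightarrow> proj X Y a = proj X Y b \<longleftrightarrow> a - b \<in> II X Y"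
  unfolding proj_def by (simp add: Q.mor_inject Hom_Q qcl_eq_iff)

lemma rfunctor_proj: "rfunctor C Q (\<lambda>X. X) proj"
  by unfold_locales
    (simp_all add: hom_Q proj_def Q.ide_def Idn_Q Q.mor_Cmp[symmetric] Q.mor_Add[symmetric]
      Hom_Q Cmp_Q Add_Q)

sublocale proj: rfunctor C Q "\<lambda>X. X" proj
  by (rule rfunctor_proj)

end

section \<open>Localizations\<close>

locale mult_system = preadditive_category C + multiplicative_system C S
  for C :: "('o, 'm) acat" and S
begin

definition SS :: "'o \<Rightarrow> 'o \<Rightarrow> ('o, 'm) endo set" where
  "SS X Y = mor C X Y ` S X Y"

lemma SS_in: "\<lbrakk>X \<in> Obj C; Y \<in> Obj C; s \<in> SS X Y\<rbrakk> \<Longrightarrow> s \<in> hom X Y"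
  using S_in unfolding SS_def hom_def by blast

lemma mor_in_SS_iff: "\<lbrakk>X \<in> Obj C; Y \<in> Obj C; f \<in> Hom C X Y\<rbrakk> \<Longrightarrow> mor C X Y f \<in> SS X Y \<longleftrightarrow> f \<in> S X Y"
  unfolding SS_def using S_in[of X Y] mor_inject[of X Y f] by blast

lemma unmor_in_S: "\<lbrakk>X \<in> Obj C; Y \<in> Obj C; s \<in> SS X Y\<rbrakk> \<Longrightarrow> unmor X Y s \<in> S X Y"
  using mor_in_SS_iff[of X Y "unmor X Y s"] by (simp add: unmor_in SS_in)

lemma SS_ide: "X \<in> Obj C \<Longrightarrow> ide X \<in> SS X X"
  unfolding SS_def ide_def using S_Idn by blast

lemma SS_mult:
  assumes "X \<in> Obj C" "Y \<in> Obj C" "Z \<in> Obj C" "s \<in> SS X Y" "t \<in> SS Y Z"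
  shows "t * s \<in> SS X Z"
  using assms S_Cmp[of X Y Z "unmor X Y s" "unmor Y Z t"]
    mor_in_SS_iff[of X Z "Cmp C X Y Z (unmor Y Z t) (unmor X Y s)"]
  by (simp add: unmor_in_S unmor_in SS_in Cmp_in mor_Cmp)

lemma ore_right:
  assumes O: "X \<in> Obj C" "Y \<in> Obj C" "Z \<in> Obj C" and f: "f \<in> hom X Y" and s: "s \<in> SS Z Y"
  obtains W t g where "W \<in> Obj C" "t \<in> SS W X" "g \<in> hom W Z" "f * t = s * g"
proof -
  obtain W t g where W: "W \<in> Obj C" "t \<in> S W X" "g \<in> Hom C W Z"
    "Cmp C W X Y (unmor X Y f) t = Cmp C W Z Y (unmor Z Y s) g"
    using right_ore[OF O, of "unmor X Y f" "unmor Z Y s"] O f s by (auto simp: unmor_in unmor_in_S)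
  then have "t \<in> Hom C W X" using S_in O by blast
  then have "f * mor C W X t = s * mor C W Z g"
    using arg_cong[OF W(4), of "mor C W Y"] O W(1,3) f s by (simp add: mor_Cmp unmor_in SS_in)
  then show ?thesis using that[of W "mor C W X t" "mor C W Z g"] W(1-3) by (simp add: SS_def mor_in)
qed

lemma cancel_right:
  assumes O: "X \<in> Obj C" "Y \<in> Obj C" "Z \<in> Obj C" and f: "f \<in> hom X Y" "g \<in> hom X Y"
    and s: "s \<in> SS Y Z" and eq: "s * f = s * g"
  obtains W t where "W \<in> Obj C" "t \<in> SS W X" "f * t = g * t"
proof -
  have "Cmp C X Y Z (unmor Y Z s) (unmor X Y f) = Cmp C X Y Z (unmor Y Z s) (unmor X Y g)"
    using O f s eq by (simp add: unmor_Cmp SS_in)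
  then obtain W t where W: "W \<in> Obj C" "t \<in> S W X"
    "Cmp C W X Y (unmor X Y f) t = Cmp C W X Y (unmor X Y g) t"
    using right_cancel[OF O, of "unmor X Y f" "unmor X Y g" "unmor Y Z s"] O f s
    by (auto simp: unmor_in unmor_in_S)
  then have "t \<in> Hom C W X" using S_in O by blast
  then have "f * mor C W X t = g * mor C W X t"
    using arg_cong[OF W(3), of "mor C W Y"] O W(1) f s by (simp add: mor_Cmp unmor_in SS_in)
  then show ?thesis using that[of W "mor C W X t"] W(1,2) by (simp add: SS_def)
qed

text \<open>Equality of right fractions by a common refinement. Only the composite
  \<open>s * a\<close> is asked to lie in the system, while \<open>a\<close> itself may lie outside;
  this is the difficulty that \<open>meet\<close> resolves.\<close>

definition req where
  "req X Y U s f U' s' f' \<longleftrightarrow> (\<exists>W\<in>Obj C. \<exists>a\<in>hom W U. \<exists>b\<in>hom W U'.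
    s * a \<in> SS W X \<and> s * a = s' * b \<and> f * a = f' * b)"

lemma reqI:
  "\<lbrakk>W \<in> Obj C; a \<in> hom W U; b \<in> hom W U'; s * a \<in> SS W X; s * a = s' * b; f * a = f' * b\<rbrakk>
    \<Longrightarrow> req X Y U s f U' s' f'"
  unfolding req_def by blast

definition roof where
  "roof X Y U s f \<longleftrightarrow> X \<in> Obj C \<and> Y \<in> Obj C \<and> U \<in> Obj C \<and> s \<in> SS U X \<and> f \<in> hom U Y"

lemma roofD:
  "roof X Y U s f \<Longrightarrow> X \<in> Obj C" "roof X Y U s f \<Longrightarrow> Y \<in> Obj C" "roof X Y U s f \<Longrightarrow> U \<in> Obj C"
  "roof X Y U s f \<Longrightarrow> s \<in> SS U X" "roof X Y U s f \<Longrightarrow> f \<in> hom U Y" "roof X Y U s f \<Longrightarrow> s \<in> hom U X"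
  by (auto simp: roof_def SS_in)

lemma req_sym: "req X Y U s f U' s' f' \<Longrightarrow> req X Y U' s' f' U s f"
  unfolding req_def by metis

lemma req_refine:
  assumes "roof X Y U s f" "W \<in> Obj C" "a \<in> hom W U" "s * a \<in> SS W X"
  shows "req X Y U s f W (s * a) (f * a)"
  unfolding req_def using assms roofD[OF assms(1)]
  by (intro bexI[of _ W] bexI[of _ a] bexI[of _ "ide W"])
    (auto simp: hom_mult[of W U] mult.assoc)

lemma req_refl: "roof X Y U s f \<Longrightarrow> req X Y U s f U s f"
  using req_refine[of X Y U s f U "ide U"] by (auto simp: roof_def SS_in)

text \<open>An Ore square for \<open>s * a\<close> against \<open>s * b\<close>, followed by a
  cancellation of \<open>s\<close>. It stands in for the Ore condition at the leg \<open>b\<close>,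
  of which only the composite with \<open>s\<close> is known to lie in the system.\<close>

lemma meet:
  assumes O: "X \<in> Obj C" "U \<in> Obj C" "P \<in> Obj C" "Q \<in> Obj C"
    and s: "s \<in> SS U X" and a: "a \<in> hom P U" and b: "b \<in> hom Q U" and sb: "s * b \<in> SS Q X"
  obtains R r k where "R \<in> Obj C" "r \<in> SS R P" "k \<in> hom R Q" "a * r = b * k"
proof -
  have "s * a \<in> hom P X" using O s a by (simp add: hom_mult[of P U] SS_in)
  then obtain R r k where R: "R \<in> Obj C" "r \<in> SS R P" "k \<in> hom R Q" "s * a * r = s * b * k"
    using O sb ore_right by metis
  have "a * r \<in> hom R U" "b * k \<in> hom R U"
    using R O a b by (auto simp: hom_mult[of R P] hom_mult[of R Q] SS_in)
  then obtain R' t where R': "R' \<in> Obj C" "t \<in> SS R' R" "a * r * t = b * k * t"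
    using cancel_right[of R U X "a * r" "b * k" s] R O s by (auto simp: mult.assoc)
  then show ?thesis
    using that[of R' "r * t" "k * t"] R O by (simp add: mult.assoc SS_mult[of R' R] hom_mult[of R' R] SS_in)
qed

text \<open>The refinements witnessing the two equalities both map to the middle vertex
  \<open>U1\<close>, where \<open>meet\<close> joins them. The leg \<open>r\<close> lies in the
  system, so restriction along it keeps the denominator there.\<close>

lemma req_trans:
  assumes r: "roof X Y U s f" "roof X Y U1 s1 f1" "roof X Y U2 s2 f2"
    and e: "req X Y U s f U1 s1 f1" "req X Y U1 s1 f1 U2 s2 f2"
  shows "req X Y U s f U2 s2 f2"
proof -
  note O = roofD[OF r(1)] roofD[OF r(2)] roofD[OF r(3)]
  obtain P a b where P: "P \<in> Obj C" "a \<in> hom P U" "b \<in> hom P U1" "s * a \<in> SS P X"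
    "s * a = s1 * b" "f * a = f1 * b" using e(1) by (auto simp: req_def)
  obtain Q c d where Q: "Q \<in> Obj C" "c \<in> hom Q U1" "d \<in> hom Q U2" "s1 * c \<in> SS Q X"
    "s1 * c = s2 * d" "f1 * c = f2 * d" using e(2) by (auto simp: req_def)
  obtain R r k where R: "R \<in> Obj C" "r \<in> SS R P" "k \<in> hom R Q" "b * r = c * k"
    by (rule meet[of X U1 P Q s1 b c]) (use O P(1,3) Q(1,2,4) in blast)+
  show ?thesis
  proof (rule reqI[OF R(1)])
    show "a * r \<in> hom R U" "d * k \<in> hom R U2"
      using R(1-3) P(1,2) Q(1,3) O by (simp_all add: hom_mult[of R P] hom_mult[of R Q] SS_in)
    show "s * (a * r) \<in> SS R X"
      using SS_mult[OF _ _ _ R(2) P(4)] R(1) P(1) O by (simp add: mult.assoc)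
    show "s * (a * r) = s2 * (d * k)" "f * (a * r) = f2 * (d * k)"
      using P(5,6) Q(5,6) R(4) by (metis mult.assoc)+
  qed
qed

text \<open>Composition is independent of both representatives and of the Ore squares at once. The
  first factors are replaced by their refinements \<open>(s * p, f * p)\<close> and
  \<open>(s1 * p1, f1 * p1)\<close>, whose numerators factor through \<open>t\<close> and
  \<open>t1\<close>. The refinement identifying these and the one identifying the second factors are
  then joined over \<open>V\<close>.\<close>

lemma req_compose:
  assumes r: "roof X Y U s f" "roof X Y U1 s1 f1" "req X Y U s f U1 s1 f1"
    and r': "roof Y Z V t g" "roof Y Z V1 t1 g1" "req Y Z V t g V1 t1 g1"
    and W: "W \<in> Obj C" "p \<in> SS W U" "h \<in> hom W V" "f * p = t * h"
    and W1: "W1 \<in> Obj C" "p1 \<in> SS W1 U1" "h1 \<in> hom W1 V1" "f1 * p1 = t1 * h1"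
  shows "req X Z W (s * p) (g * h) W1 (s1 * p1) (g1 * h1)"
proof -
  note O = roofD[OF r(1)] roofD[OF r(2)] roofD[OF r'(1)] roofD[OF r'(2)]
  have p: "p \<in> hom W U" "p1 \<in> hom W1 U1" using O W(1,2) W1(1,2) SS_in by blast+
  have fp: "f * p \<in> hom W Y" "f1 * p1 \<in> hom W1 Y" using O p W(1) W1(1) hom_mult by blast+
  have sp: "s * p \<in> SS W X" "s1 * p1 \<in> SS W1 X" using O W(1,2) W1(1,2) SS_mult by blast+
  note p = p fp sp
  have "req X Y U s f W (s * p) (f * p)" "req X Y U1 s1 f1 W1 (s1 * p1) (f1 * p1)"
    by (rule req_refine[OF r(1) W(1) p(1) p(5)], rule req_refine[OF r(2) W1(1) p(2) p(6)])
  moreover have "roof X Y W (s * p) (f * p)" "roof X Y W1 (s1 * p1) (f1 * p1)"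
    using p O W(1) W1(1) by (simp_all add: roof_def)
  ultimately have "req X Y W (s * p) (f * p) W1 (s1 * p1) (f1 * p1)"
    using req_trans[OF _ r(1) r(2) req_sym r(3)] req_trans[OF _ r(2)] by blast
  then obtain P a a1 where P: "P \<in> Obj C" "a \<in> hom P W" "a1 \<in> hom P W1"
    "s * p * a \<in> SS P X" "s * p * a = s1 * p1 * a1" "f * p * a = f1 * p1 * a1"
    by (auto simp: req_def)
  obtain Q c c1 where Q: "Q \<in> Obj C" "c \<in> hom Q V" "c1 \<in> hom Q V1"
    "t * c \<in> SS Q Y" "t * c = t1 * c1" "g * c = g1 * c1"
    using r'(3) by (auto simp: req_def)
  have h: "h * a \<in> hom P V" "h1 * a1 \<in> hom P V1"
    using P W W1 O by (auto simp: hom_mult[of P W] hom_mult[of P W1])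
  obtain R r k where R: "R \<in> Obj C" "r \<in> SS R P" "k \<in> hom R Q" "h * a * r = c * k"
    by (rule meet[of Y V P Q t "h * a" c]) (use O P(1) Q(1,2,4) h in blast)+
  have rk: "h1 * a1 * r \<in> hom R V1" "c1 * k \<in> hom R V1"
    using hom_mult[OF R(1) P(1) _ SS_in[OF R(1) P(1) R(2)] h(2)] hom_mult[OF R(1) Q(1) _ R(3) Q(3)] O
    by blast+
  \<comment> \<open>The join was made over \<open>V\<close>. The corresponding maps to
    \<open>V1\<close> agree only after \<open>t1\<close>, which is cancelled at the price of one
    more refinement.\<close>
  have "t1 * (h1 * a1 * r) = t1 * (c1 * k)"
  proof -
    have "t1 * (h1 * a1 * r) = f1 * p1 * a1 * r" using W1(4) by (simp add: mult.assoc[symmetric])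
    also have "\<dots> = t * h * a * r" using P(6) W(4) by simp
    also have "\<dots> = t * c * k" using R(4) by (simp add: mult.assoc)
    finally show ?thesis using Q(5) by (simp add: mult.assoc)
  qed
  then obtain R' t' where R': "R' \<in> Obj C" "t' \<in> SS R' R" "h1 * a1 * r * t' = c1 * k * t'"
    by - (rule cancel_right[of R V1 Y "h1 * a1 * r" "c1 * k" t1]; use rk R(1) O in blast)
  have rt: "r * t' \<in> SS R' P" using SS_mult[of R' R P] R R' P by simp
  have "s * p * a * (r * t') \<in> SS R' X" using SS_mult[OF _ _ _ rt P(4)] R' P O by simp
  moreover have "g * h * (a * (r * t')) = g1 * h1 * (a1 * (r * t'))"
  proof -
    have "g * h * (a * (r * t')) = g * c * k * t'"
      using arg_cong[OF R(4), of "\<lambda>x. g * x * t'"] by (simp add: mult.assoc)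
    also have "\<dots> = g1 * (c1 * k * t')" using Q(6) by (simp add: mult.assoc)
    also have "\<dots> = g1 * h1 * (a1 * (r * t'))" using R'(3) by (simp add: mult.assoc)
    finally show ?thesis .
  qed
  moreover have "s * p * (a * (r * t')) = s1 * p1 * (a1 * (r * t'))"
    using P(5) by (simp add: mult.assoc[symmetric])
  moreover have "a * (r * t') \<in> hom R' W" "a1 * (r * t') \<in> hom R' W1"
    using R'(1) P(1-3) W(1) W1(1) SS_in[OF _ _ rt] by (simp_all add: hom_mult[of R' P])
  ultimately show ?thesis
    using R'(1) by (intro reqI[of R' "a * (r * t')" _ "a1 * (r * t')"]) (simp_all only: mult.assoc)
qed

text \<open>The equalities for \<open>f\<close> and for \<open>g\<close> may come from different
  refinements \<open>P\<close> and \<open>Q\<close>. They are joined over \<open>U\<close>, and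
  cancelling \<open>s1\<close> makes the maps to \<open>U1\<close> agree as well.\<close>

lemma req_add:
  assumes r: "roof X Y U s f" "roof X Y U1 s1 f1" "req X Y U s f U1 s1 f1"
    and r': "roof X Y U s g" "roof X Y U1 s1 g1" "req X Y U s g U1 s1 g1"
  shows "req X Y U s (f + g) U1 s1 (f1 + g1)"
proof -
  note O = roofD[OF r(1)] roofD[OF r(2)]
  obtain P a b where P: "P \<in> Obj C" "a \<in> hom P U" "b \<in> hom P U1" "s * a \<in> SS P X"
    "s * a = s1 * b" "f * a = f1 * b" using r(3) by (auto simp: req_def)
  obtain Q c d where Q: "Q \<in> Obj C" "c \<in> hom Q U" "d \<in> hom Q U1" "s * c \<in> SS Q X"
    "s * c = s1 * d" "g * c = g1 * d" using r'(3) by (auto simp: req_def)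
  obtain R r k where R: "R \<in> Obj C" "r \<in> SS R P" "k \<in> hom R Q" "a * r = c * k"
    by (rule meet[of X U P Q s a c]) (use O P(1,2) Q(1,2,4) in blast)+
  have "s1 * (b * r) = s1 * (d * k)" using P(5) Q(5) R(4) by (metis mult.assoc)
  moreover have "b * r \<in> hom R U1" "d * k \<in> hom R U1"
    using hom_mult[OF R(1) P(1) _ SS_in[OF R(1) P(1) R(2)] P(3)] hom_mult[OF R(1) Q(1) _ R(3) Q(3)] O
    by blast+
  ultimately obtain R' t where R': "R' \<in> Obj C" "t \<in> SS R' R" "b * r * t = d * k * t"
    by - (rule cancel_right[of R U1 X "b * r" "d * k" s1]; use R(1) O in blast)
  have rt: "r * t \<in> SS R' P" using SS_mult[of R' R P] R R' P by simp
  have "s * a * (r * t) \<in> SS R' X" using SS_mult[OF _ _ _ rt P(4)] R' P O by simp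
  moreover have "s * (a * (r * t)) = s1 * (b * (r * t))"
    using P(5) by (simp add: mult.assoc[symmetric])
  moreover have "(f + g) * (a * (r * t)) = (f1 + g1) * (b * (r * t))"
  proof -
    have "f * (a * (r * t)) = f1 * (b * (r * t))" using P(6) by (simp add: mult.assoc[symmetric])
    moreover have "g * (a * (r * t)) = g1 * (b * (r * t))"
    proof -
      have "g * (a * (r * t)) = g * c * (k * t)"
        using arg_cong[OF R(4), of "\<lambda>x. g * x * t"] by (simp add: mult.assoc)
      also have "\<dots> = g1 * (d * k * t)" using Q(6) by (simp add: mult.assoc)
      also have "\<dots> = g1 * (b * (r * t))" using R'(3) by (simp add: mult.assoc)
      finally show ?thesis .
    qed
    ultimately show ?thesis by (simp add: distrib_right)
  qed
  moreover have "a * (r * t) \<in> hom R' U" "b * (r * t) \<in> hom R' U1"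
    using R'(1) P(1-3) O SS_in[OF _ _ rt] by (simp_all add: hom_mult[of R' P])
  ultimately show ?thesis
    using R'(1) by (intro reqI[of R' "a * (r * t)" _ "b * (r * t)"]) (simp_all only: mult.assoc)
qed

section \<open>The category of right fractions\<close>

abbreviation "L \<equiv> localization C S"

text \<open>The class \<open>fraction\<close> for a roof of ring elements. Its members remain raw
  triples, as the definition of the localization demands, but the index can be calculated
  with.\<close>

definition fr :: "'o \<Rightarrow> 'o \<Rightarrow> 'o \<Rightarrow> ('o, 'm) endo \<Rightarrow> ('o, 'm) endo \<Rightarrow> ('o \<times> 'm \<times> 'm) set" where
  "fr X Y U s f = {(U', s', f'). U' \<in> Obj C \<and> s' \<in> S U' X \<and> f' \<in> Hom C U' Y \<and>
    req X Y U s f U' (mor C U' X s') (mor C U' Y f')}"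

lemma roof_mor:
  "\<lbrakk>X \<in> Obj C; Y \<in> Obj C; U \<in> Obj C; s \<in> S U X; f \<in> Hom C U Y\<rbrakk> \<Longrightarrow> roof X Y U (mor C U X s) (mor C U Y f)"
  by (simp add: roof_def SS_def mor_in)

lemma fraction_eq:
  assumes "X \<in> Obj C" "Y \<in> Obj C" "U \<in> Obj C" "s \<in> S U X" "f \<in> Hom C U Y"
  shows "fraction C S X Y (U, s, f) = fr X Y U (mor C U X s) (mor C U Y f)"
proof -
  have S: "s \<in> Hom C U X" if "s \<in> S U X" "U \<in> Obj C" for s U
    using S_in that assms by blast
  have *: "Cmp C W U X s a \<in> S W X \<longleftrightarrow> mor C U X s * mor C W U a \<in> SS W X"
    if "W \<in> Obj C" "a \<in> Hom C W U" for W a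
    using that assms S by (simp add: mor_Cmp[symmetric] mor_in_SS_iff Cmp_in)
  have "roof_eq C S X Y (U, s, f) (U', s', f') \<longleftrightarrow>
      req X Y U (mor C U X s) (mor C U Y f) U' (mor C U' X s') (mor C U' Y f')"
    if "U' \<in> Obj C" "s' \<in> S U' X" "f' \<in> Hom C U' Y" for U' s' f'
    unfolding roof_eq_def req_def
    using that assms S
    by (auto simp: hom_def mor_Cmp[symmetric] * mor_inject Cmp_in intro!: bexI)
  then show ?thesis by (auto simp: fraction_def fr_def roofs_def)
qed

lemma fr_eq_iff:
  assumes r: "roof X Y U s f" "roof X Y U1 s1 f1"
  shows "fr X Y U s f = fr X Y U1 s1 f1 \<longleftrightarrow> req X Y U s f U1 s1 f1"
proof
  note O = roofD[OF r(1)] roofD[OF r(2)]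
  assume eq: "fr X Y U s f = fr X Y U1 s1 f1"
  have "(U1, unmor U1 X s1, unmor U1 Y f1) \<in> fr X Y U1 s1 f1"
    using O req_refl[OF r(2)] by (simp add: fr_def unmor_in unmor_in_S)
  then have "(U1, unmor U1 X s1, unmor U1 Y f1) \<in> fr X Y U s f" by (simp only: eq)
  then show "req X Y U s f U1 s1 f1" using O by (simp add: fr_def)
next
  assume *: "req X Y U s f U1 s1 f1"
  have "req X Y U s f U' (mor C U' X s') (mor C U' Y f') \<longleftrightarrow>
      req X Y U1 s1 f1 U' (mor C U' X s') (mor C U' Y f')"
    if "U' \<in> Obj C" "s' \<in> S U' X" "f' \<in> Hom C U' Y" for U' s' f'
    using req_trans[OF r(1) r(2), of U' "mor C U' X s'" "mor C U' Y f'"]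
      req_trans[OF r(2) r(1), of U' "mor C U' X s'" "mor C U' Y f'"] * req_sym[OF *]
      roof_mor[of X Y U' s' f'] that roofD[OF r(1)] by blast
  then show "fr X Y U s f = fr X Y U1 s1 f1" by (auto simp: fr_def)
qed

lemma mem_fr:
  assumes "roof X Y U s f"
  shows "(U', s', f') \<in> fr X Y U s f \<longleftrightarrow>
    U' \<in> Obj C \<and> s' \<in> S U' X \<and> f' \<in> Hom C U' Y \<and> req X Y U s f U' (mor C U' X s') (mor C U' Y f')"
  by (simp add: fr_def)

lemma fr_self:
  assumes "roof X Y U s f"
  shows "(U, unmor U X s, unmor U Y f) \<in> fr X Y U s f"
  using assms req_refl[OF assms] roofD[OF assms] by (simp add: fr_def unmor_in unmor_in_S)

lemma fr_refine:
  assumes "roof X Y U s f" "W \<in> Obj C" "a \<in> hom W U" "s * a \<in> SS W X"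
  shows "fr X Y U s f = fr X Y W (s * a) (f * a)"
  using assms req_refine[OF assms] roofD[OF assms(1)]
  by (subst fr_eq_iff) (auto simp: roof_def hom_mult[of W U])

lemma Obj_L [simp]: "Obj L = Obj C"
  by (simp add: localization_def)

lemma Hom_L: "\<lbrakk>X \<in> Obj C; Y \<in> Obj C\<rbrakk> \<Longrightarrow> Hom L X Y = {fr X Y U s f | U s f. roof X Y U s f}"
proof -
  assume XY: "X \<in> Obj C" "Y \<in> Obj C"
  have "\<exists>r\<in>roofs C S X Y. fr X Y U s f = fraction C S X Y r" if "roof X Y U s f" for U s f
    using roofD[OF that] XY
    by (intro bexI[of _ "(U, unmor U X s, unmor U Y f)"])
      (simp_all add: fraction_eq unmor_in unmor_in_S roofs_def)
  moreover have "\<exists>U s f. fraction C S X Y r = fr X Y U s f \<and> roof X Y U s f" if "r \<in> roofs C S X Y" for r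
    using that XY fraction_eq[OF XY] roof_mor[OF XY] by (cases r) (auto simp: roofs_def, blast)
  moreover have "Hom L X Y = fraction C S X Y ` roofs C S X Y" by (simp add: localization_def)
  ultimately show ?thesis by (auto simp: image_iff)
qed

lemma Idn_L: "X \<in> Obj C \<Longrightarrow> Idn L X = fr X X X (ide X) (ide X)"
  by (simp add: localization_def fraction_eq S_Idn Idn_in ide_def)

lemma Zer_L: "\<lbrakk>X \<in> Obj C; Y \<in> Obj C\<rbrakk> \<Longrightarrow> Zer L X Y = fr X Y X (ide X) 0"
  by (simp add: localization_def fraction_eq S_Idn Zer_in mor_Zer ide_def)

text \<open>The definition of composition collects the fractions of all Ore squares on all
  representatives. By \<open>req_compose\<close> they are one and the same set, so their union is
  that set, and any single Ore square computes the composite.\<close>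

lemma Cmp_L:
  assumes r: "roof X Y U s f" "roof Y Z V t g"
    and W: "W \<in> Obj C" "p \<in> SS W U" "h \<in> hom W V" "f * p = t * h"
  shows "Cmp L X Y Z (fr Y Z V t g) (fr X Y U s f) = fr X Z W (s * p) (g * h)"
proof -
  note O = roofD[OF r(1)] roofD[OF r(2)]
  have *: "fraction C S X Z (W', Cmp C W' U' X s' p', Cmp C W' V' Z g' h') = fr X Z W (s * p) (g * h)"
    if A: "(U', s', f') \<in> fr X Y U s f" "(V', t', g') \<in> fr Y Z V t g"
      and W': "W' \<in> Obj C" "p' \<in> S W' U'" "h' \<in> Hom C W' V'"
        "Cmp C W' U' Y f' p' = Cmp C W' V' Y t' h'" for U' V' W' s' f' t' g' p' h'
  proof -
    have A': "U' \<in> Obj C" "s' \<in> S U' X" "f' \<in> Hom C U' Y" "V' \<in> Obj C" "t' \<in> S V' Y" "g' \<in> Hom C V' Z"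
      "s' \<in> Hom C U' X" "t' \<in> Hom C V' Y" "p' \<in> Hom C W' U'"
      using A W' S_in O by (auto simp: fr_def)
    have "mor C U' Y f' * mor C W' U' p' = mor C V' Y t' * mor C W' V' h'"
      using arg_cong[OF W'(4), of "mor C W' Y"] A' W'(1,3) O by (simp add: mor_Cmp)
    then have "req X Z W (s * p) (g * h) W' (mor C U' X s' * mor C W' U' p') (mor C V' Z g' * mor C W' V' h')"
      using A A' W' W O by (intro req_compose[OF r(1) roof_mor _ r(2) roof_mor])
        (auto simp: mem_fr[OF r(1)] mem_fr[OF r(2)] SS_def mor_in)
    moreover have "roof X Z W (s * p) (g * h)"
      using W O by (simp add: roof_def SS_mult[of W U] hom_mult[of W V])
    moreover have "roof X Z W' (mor C U' X s' * mor C W' U' p') (mor C V' Z g' * mor C W' V' h')"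
      using roof_mor[of X Z W' "Cmp C W' U' X s' p'" "Cmp C W' V' Z g' h'"] A' W' O S_Cmp
      by (simp add: mor_Cmp Cmp_in)
    ultimately have "fr X Z W (s * p) (g * h) =
        fr X Z W' (mor C U' X s' * mor C W' U' p') (mor C V' Z g' * mor C W' V' h')"
      by (simp add: fr_eq_iff)
    then show ?thesis
      using A' W'(1-3) O S_Cmp by (simp add: fraction_eq Cmp_in mor_Cmp)
  qed
  have e: "unmor W U p \<in> S W U" "unmor W V h \<in> Hom C W V"
    "Cmp C W U Y (unmor U Y f) (unmor W U p) = Cmp C W V Y (unmor V Y t) (unmor W V h)"
    using W O by (simp_all add: unmor_in unmor_in_S unmor_Cmp SS_in)
  note e = fr_self[OF r(1)] fr_self[OF r(2)] W(1) this
  have "Cmp L X Y Z (fr Y Z V t g) (fr X Y U s f) =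
    \<Union>{fraction C S X Z (W', Cmp C W' U' X s' p', Cmp C W' V' Z g' h') | U' V' W' s' f' t' g' p' h'.
        (U', s', f') \<in> fr X Y U s f \<and> (V', t', g') \<in> fr Y Z V t g \<and> W' \<in> Obj C \<and>
          p' \<in> S W' U' \<and> h' \<in> Hom C W' V' \<and> Cmp C W' U' Y f' p' = Cmp C W' V' Y t' h'}"
    by (simp add: localization_def)
  also have "{fraction C S X Z (W', Cmp C W' U' X s' p', Cmp C W' V' Z g' h') | U' V' W' s' f' t' g' p' h'.
        (U', s', f') \<in> fr X Y U s f \<and> (V', t', g') \<in> fr Y Z V t g \<and> W' \<in> Obj C \<and>
          p' \<in> S W' U' \<and> h' \<in> Hom C W' V' \<and> Cmp C W' U' Y f' p' = Cmp C W' V' Y t' h'}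
      = {fr X Z W (s * p) (g * h)}" (is "?M = _")
  proof
    show "?M \<subseteq> {fr X Z W (s * p) (g * h)}" using * by auto
    \<comment> \<open>The given square, read on the canonical representatives, is one of those
      collected; so the collection is not empty.\<close>
    show "{fr X Z W (s * p) (g * h)} \<subseteq> ?M"
      unfolding *[OF e, symmetric] using e by blast
  qed
  finally show ?thesis by simp
qed

lemma Add_L:
  assumes r: "roof X Y U s f" "roof X Y U s g"
  shows "Add L X Y (fr X Y U s f) (fr X Y U s g) = fr X Y U s (f + g)"
proof -
  note O = roofD[OF r(1)] roofD[OF r(2)]
  have *: "fraction C S X Y (U', s', Add C U' Y f' g') = fr X Y U s (f + g)"
    if A: "(U', s', f') \<in> fr X Y U s f" "(U', s', g') \<in> fr X Y U s g" for U' s' f' g'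
  proof -
    have A': "U' \<in> Obj C" "s' \<in> S U' X" "f' \<in> Hom C U' Y" "g' \<in> Hom C U' Y"
      using A O by (auto simp: fr_def)
    have "req X Y U s (f + g) U' (mor C U' X s') (mor C U' Y f' + mor C U' Y g')"
      using A A' O by (intro req_add[OF r(1) roof_mor _ r(2) roof_mor])
        (auto simp: mem_fr[OF r(1)] mem_fr[OF r(2)])
    moreover have "roof X Y U s (f + g)"
      using O by (simp add: roof_def hom_add)
    moreover have "roof X Y U' (mor C U' X s') (mor C U' Y f' + mor C U' Y g')"
      using roof_mor[of X Y U' s' "Add C U' Y f' g'"] A' O by (simp add: mor_Add Add_in)
    ultimately have "fr X Y U s (f + g) = fr X Y U' (mor C U' X s') (mor C U' Y f' + mor C U' Y g')"
      by (simp add: fr_eq_iff)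
    then show ?thesis
      using A' O by (simp add: fraction_eq Add_in mor_Add)
  qed
  have "Add L X Y (fr X Y U s f) (fr X Y U s g) =
    \<Union>{fraction C S X Y (U', s', Add C U' Y f' g') | U' s' f' g'.
        (U', s', f') \<in> fr X Y U s f \<and> (U', s', g') \<in> fr X Y U s g}"
    by (simp add: localization_def)
  also have "{fraction C S X Y (U', s', Add C U' Y f' g') | U' s' f' g'.
        (U', s', f') \<in> fr X Y U s f \<and> (U', s', g') \<in> fr X Y U s g} = {fr X Y U s (f + g)}" (is "?M = _")
  proof
    show "?M \<subseteq> {fr X Y U s (f + g)}" using * by auto
    note e = fr_self[OF r(1)] fr_self[OF r(2)]
    show "{fr X Y U s (f + g)} \<subseteq> ?M"
      unfolding *[OF e, symmetric] using e by blast
  qed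
  finally show ?thesis by simp
qed

lemma common_roof:
  assumes r: "roof X Y U s f" "roof X Y' U1 s1 f1"
  obtains W a b where "W \<in> Obj C" "a \<in> hom W U" "b \<in> hom W U1" "s * a \<in> SS W X" "s * a = s1 * b"
proof -
  note O = roofD[OF r(1)] roofD[OF r(2)]
  obtain W t g where W: "W \<in> Obj C" "t \<in> SS W U" "g \<in> hom W U1" "s * t = s1 * g"
    using ore_right[of U X U1 s s1] O by metis
  then show ?thesis
    using that[of W t g] SS_mult[of W U X t s] SS_in[of W U t] O by simp
qed

lemma roof_comp:
  assumes r: "roof X Y U s f" "roof Y Z V t g"
  obtains W p h where "W \<in> Obj C" "p \<in> SS W U" "h \<in> hom W V" "f * p = t * h" "p \<in> hom W U"
    "roof X Z W (s * p) (g * h)"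
proof -
  note O = roofD[OF r(1)] roofD[OF r(2)]
  obtain W p h where W: "W \<in> Obj C" "p \<in> SS W U" "h \<in> hom W V" "f * p = t * h"
    using ore_right[of U Y V f t] O by metis
  moreover have "s * p \<in> SS W X" "g * h \<in> hom W Z" "p \<in> hom W U"
    using W(1-3) O SS_mult hom_mult SS_in by blast+
  ultimately show ?thesis using that O by (simp add: roof_def)
qed

lemma roof_refine:
  "\<lbrakk>roof X Y U s f; W \<in> Obj C; a \<in> hom W U; s * a \<in> SS W X\<rbrakk> \<Longrightarrow> roof X Y W (s * a) (f * a)"
  using hom_mult[of W U Y a f] by (simp add: roof_def)

lemma two_roofs:
  assumes "roof X Y U s f" "roof X Y' U1 s1 f1"
  obtains W r f' f1' where "fr X Y U s f = fr X Y W r f'" "fr X Y' U1 s1 f1 = fr X Y' W r f1'"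
    "roof X Y W r f'" "roof X Y' W r f1'"
proof -
  obtain W a b where W: "W \<in> Obj C" "a \<in> hom W U" "b \<in> hom W U1" "s * a \<in> SS W X" "s * a = s1 * b"
    using common_roof[OF assms] .
  then show ?thesis
    using that[of W "s * a" "f * a" "f1 * b"] fr_refine[OF assms(1), of W a] fr_refine[OF assms(2), of W b]
      roof_refine[OF assms(1), of W a] roof_refine[OF assms(2), of W b] by simp
qed

lemma roof_ide: "\<lbrakk>X \<in> Obj C; Y \<in> Obj C; f \<in> hom X Y\<rbrakk> \<Longrightarrow> roof X Y X (ide X) f"
  by (simp add: roof_def SS_ide)

lemma Hom_LE:
  assumes "A \<in> Hom L X Y" "X \<in> Obj L" "Y \<in> Obj L"
  obtains U s f where "roof X Y U s f" "A = fr X Y U s f"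
  using assms by (auto simp: Hom_L)

lemma roof_add: "roof X Y U s f \<Longrightarrow> roof X Y U s g \<Longrightarrow> roof X Y U s (f + g)"
  by (auto simp: roof_def hom_add)

lemma roof_in_Hom: "roof X Y U s f \<Longrightarrow> fr X Y U s f \<in> Hom L X Y"
  using roofD(1,2)[of X Y U s f] by (auto simp: Hom_L)

text \<open>Two Ore squares suffice: \<open>P\<close> for \<open>g\<close> against
  \<open>t'\<close>, and \<open>Q\<close> for \<open>f\<close> against \<open>t * p\<close>. The
  second also serves as a square for \<open>f\<close> against \<open>t\<close>, so both bracketings
  are computed at the vertex \<open>Q\<close>.\<close>

lemma Cmp_assoc_L:
  assumes r: "roof W X U s f" "roof X Y V t g" "roof Y Z V' t' g'"
  shows "Cmp L W Y Z (fr Y Z V' t' g') (Cmp L W X Y (fr X Y V t g) (fr W X U s f)) =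
    Cmp L W X Z (Cmp L X Y Z (fr Y Z V' t' g') (fr X Y V t g)) (fr W X U s f)"
proof -
  note O = roofD[OF r(1)] roofD[OF r(2)] roofD[OF r(3)]
  obtain P p h where P: "P \<in> Obj C" "p \<in> SS P V" "h \<in> hom P V'" "g * p = t' * h" "p \<in> hom P V"
    and rP: "roof X Z P (t * p) (g' * h)"
    using roof_comp[OF r(2,3)] .
  obtain Q q k where Q: "Q \<in> Obj C" "q \<in> SS Q U" "k \<in> hom Q P" "f * q = t * p * k" "q \<in> hom Q U"
    using roof_comp[OF r(1) rP] .
  have pk: "p * k \<in> hom Q V" "h * k \<in> hom Q V'"
    using P Q O by (simp_all add: hom_mult[of Q P])
  have e: "f * q = t * (p * k)" "g * (p * k) = t' * (h * k)"
    using P(4) Q(4) by (simp_all add: mult.assoc[symmetric])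
  have BA: "Cmp L W X Y (fr X Y V t g) (fr W X U s f) = fr W Y Q (s * q) (g * (p * k))"
    using Cmp_L[OF r(1,2) Q(1,2) pk(1) e(1)] .
  have rBA: "roof W Y Q (s * q) (g * (p * k))"
    using Q(1,2) pk O SS_mult[of Q U W q s] by (simp add: roof_def hom_mult[of Q V])
  \<comment> \<open>The numerator \<open>g * (p * k)\<close> already factors through
    \<open>t'\<close>, so an identity completes the Ore square.\<close>
  have "Cmp L W Y Z (fr Y Z V' t' g') (fr W Y Q (s * q) (g * (p * k))) = fr W Z Q (s * q * ide Q) (g' * (h * k))"
    using Q(1) pk(2) e(2) SS_ide[of Q] roofD[OF rBA] by (intro Cmp_L[OF rBA r(3)]) auto
  moreover have "Cmp L X Y Z (fr Y Z V' t' g') (fr X Y V t g) = fr X Z P (t * p) (g' * h)"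
    using Cmp_L[OF r(2,3) P(1-4)] .
  moreover have "Cmp L W X Z (fr X Z P (t * p) (g' * h)) (fr W X U s f) = fr W Z Q (s * q) (g' * h * k)"
    using Cmp_L[OF r(1) rP Q(1-4)] .
  moreover have "s * q * ide Q = s * q" using Q roofD[OF rBA] by simp
  ultimately show ?thesis by (simp add: BA mult.assoc)
qed

lemma preadditive_L: "preadditive_category L"
proof (rule preadditive_categoryI; (elim Hom_LE; simp only: Obj_L)?)
  fix X assume "X \<in> Obj L"
  then show "Idn L X \<in> Hom L X X"
    by (simp add: Idn_L roof_in_Hom roof_ide)
next
  fix X Y assume "X \<in> Obj L" "Y \<in> Obj L"
  then show "Zer L X Y \<in> Hom L X Y"
    by (simp add: Zer_L roof_in_Hom roof_ide)
next
  fix X Y Z U s f V t g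
  assume r: "roof X Y U s f" "roof Y Z V t g"
  obtain W p h where "W \<in> Obj C" "p \<in> SS W U" "h \<in> hom W V" "f * p = t * h" "p \<in> hom W U"
    "roof X Z W (s * p) (g * h)"
    using roof_comp[OF r] .
  then show "Cmp L X Y Z (fr Y Z V t g) (fr X Y U s f) \<in> Hom L X Z"
    using Cmp_L[OF r, of W p h] by (simp add: roof_in_Hom)
next
  fix X Y U s f assume r: "roof X Y U s f"
  have "Cmp L X Y Y (fr Y Y Y (ide Y) (ide Y)) (fr X Y U s f) = fr X Y U (s * ide U) (ide Y * f)"
    using roofD[OF r] by (intro Cmp_L[OF r roof_ide]) (auto simp: SS_ide)
  then show "Cmp L X Y Y (Idn L Y) (fr X Y U s f) = fr X Y U s f"
    using roofD[OF r] by (simp add: Idn_L)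
  have "Cmp L X X Y (fr X Y U s f) (fr X X X (ide X) (ide X)) = fr X Y U (ide X * s) (f * ide U)"
    using roofD[OF r] by (intro Cmp_L[OF roof_ide r]) auto
  then show "Cmp L X X Y (fr X Y U s f) (Idn L X) = fr X Y U s f"
    using roofD[OF r] by (simp add: Idn_L)
next
  fix W X Y Z U s f V t g V' t' g'
  assume "roof W X U s f" "roof X Y V t g" "roof Y Z V' t' g'"
  then show "Cmp L W Y Z (fr Y Z V' t' g') (Cmp L W X Y (fr X Y V t g) (fr W X U s f)) =
    Cmp L W X Z (Cmp L X Y Z (fr Y Z V' t' g') (fr X Y V t g)) (fr W X U s f)"
    by (rule Cmp_assoc_L)
next
  fix X Y U s f U' s' f'
  assume r: "roof X Y U s f" "roof X Y U' s' f'"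
  obtain W r f1 f2 where W: "fr X Y U s f = fr X Y W r f1" "fr X Y U' s' f' = fr X Y W r f2"
    "roof X Y W r f1" "roof X Y W r f2"
    using two_roofs[OF r] .
  show "Add L X Y (fr X Y U s f) (fr X Y U' s' f') \<in> Hom L X Y"
    using W by (simp add: Add_L roof_in_Hom roof_add)
  show "Add L X Y (fr X Y U s f) (fr X Y U' s' f') = Add L X Y (fr X Y U' s' f') (fr X Y U s f)"
    using W by (simp add: Add_L add.commute)
next
  fix X Y U s f U1 s1 f1 U2 s2 f2
  assume r: "roof X Y U s f" "roof X Y U1 s1 f1" "roof X Y U2 s2 f2"
  obtain W t g g1 where W: "fr X Y U s f = fr X Y W t g" "fr X Y U1 s1 f1 = fr X Y W t g1"
    "roof X Y W t g" "roof X Y W t g1"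
    using two_roofs[OF r(1,2)] .
  obtain V a b where V: "V \<in> Obj C" "a \<in> hom V W" "b \<in> hom V U2" "t * a \<in> SS V X" "t * a = s2 * b"
    using common_roof[OF W(3) r(3)] .
  note fr_refine[OF W(3) V(1,2,4)] fr_refine[OF W(4) V(1,2,4)]
    fr_refine[OF r(3) V(1,3) V(4)[unfolded V(5)], folded V(5)]
  moreover note roof_refine[OF W(3) V(1,2,4)] roof_refine[OF W(4) V(1,2,4)]
    roof_refine[OF r(3) V(1,3) V(4)[unfolded V(5)], folded V(5)]
  ultimately show "Add L X Y (Add L X Y (fr X Y U s f) (fr X Y U1 s1 f1)) (fr X Y U2 s2 f2) =
    Add L X Y (fr X Y U s f) (Add L X Y (fr X Y U1 s1 f1) (fr X Y U2 s2 f2))"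
    by (simp add: W(1,2) Add_L roof_add add.assoc)
next
  fix X Y U s f assume r: "roof X Y U s f"
  note O = roofD[OF r]
  have z: "fr X Y X (ide X) 0 = fr X Y U s 0" "roof X Y U s 0"
    using fr_refine[OF roof_ide, of X Y 0 U s] O by (simp_all add: roof_def)
  then show "Add L X Y (Zer L X Y) (fr X Y U s f) = fr X Y U s f"
    using O r by (simp add: Zer_L Add_L)
  have "roof X Y U s (- f)" using r by (auto simp: roof_def hom_neg)
  then show "\<exists>g\<in>Hom L X Y. Add L X Y g (fr X Y U s f) = Zer L X Y"
    using O r z by (intro bexI[of _ "fr X Y U s (- f)"]) (simp_all add: Zer_L Add_L roof_in_Hom)
next
  fix X Y Z U s f V t g V' t' g'
  assume r: "roof X Y U s f" "roof Y Z V t g" "roof Y Z V' t' g'"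
  obtain W r g1 g2 where W: "fr Y Z V t g = fr Y Z W r g1" "fr Y Z V' t' g' = fr Y Z W r g2"
    "roof Y Z W r g1" "roof Y Z W r g2"
    using two_roofs[OF r(2,3)] .
  obtain P p h where P: "P \<in> Obj C" "p \<in> SS P U" "h \<in> hom P W" "f * p = r * h"
    using roof_comp[OF r(1) W(3)] by metis
  have hh: "roof X Z P (s * p) (g1 * h)" "roof X Z P (s * p) (g2 * h)"
    using P(1-3) roofD[OF r(1)] roofD[OF W(3)] roofD[OF W(4)] SS_mult[of P U X p s]
    by (simp_all add: roof_def hom_mult[of P W])
  show "Cmp L X Y Z (Add L Y Z (fr Y Z V t g) (fr Y Z V' t' g')) (fr X Y U s f) =
    Add L X Z (Cmp L X Y Z (fr Y Z V t g) (fr X Y U s f)) (Cmp L X Y Z (fr Y Z V' t' g') (fr X Y U s f))"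
    using W(3,4) hh by (simp add: W(1,2) Add_L Cmp_L[OF r(1) _ P] roof_add distrib_right)
next
  fix X Y Z U s f U' s' f' V t g
  assume r: "roof X Y U s f" "roof X Y U' s' f'" "roof Y Z V t g"
  obtain W r f1 f2 where W: "fr X Y U s f = fr X Y W r f1" "fr X Y U' s' f' = fr X Y W r f2"
    "roof X Y W r f1" "roof X Y W r f2"
    using two_roofs[OF r(1,2)] .
  note O = roofD[OF W(3)] roofD[OF W(4)] roofD[OF r(3)]
  \<comment> \<open>One Ore vertex must serve both numerators. A square for \<open>f1\<close> comes
    first, then one for \<open>f2 * p\<close>, and the former is restricted to the vertex
    \<open>Q\<close> of the latter.\<close>
  obtain P p h where P: "P \<in> Obj C" "p \<in> SS P W" "h \<in> hom P V" "f1 * p = t * h" "p \<in> hom P W"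
    using roof_comp[OF W(3) r(3)] .
  have r2: "roof X Y P (r * p) (f2 * p)"
    using roof_refine[OF W(4) P(1,5)] SS_mult[of P W X p r] P(1,2) O by simp
  obtain Q q k where Q: "Q \<in> Obj C" "q \<in> SS Q P" "k \<in> hom Q V" "f2 * p * q = t * k" "q \<in> hom Q P"
    using roof_comp[OF r2 r(3)] .
  have pq: "p * q \<in> SS Q W" "h * q \<in> hom Q V" using P(1-3) Q O SS_mult[of Q P W q p] by (simp_all add: hom_mult[of Q P])
  have e: "f1 * (p * q) = t * (h * q)" "f2 * (p * q) = t * k"
    using P(4) Q(4) by (simp_all add: mult.assoc[symmetric])
  then have e3: "(f1 + f2) * (p * q) = t * (h * q + k)" by (simp add: algebra_simps)
  have hqk: "h * q + k \<in> hom Q V" using pq Q(1,3) O by (simp add: hom_add)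
  have rr: "roof X Z Q (r * (p * q)) (g * (h * q))" "roof X Z Q (r * (p * q)) (g * k)"
    using Q(1,3) pq O SS_mult[of Q W X "p * q" r] by (simp_all add: roof_def hom_mult[of Q V])
  show "Cmp L X Y Z (fr Y Z V t g) (Add L X Y (fr X Y U s f) (fr X Y U' s' f')) =
    Add L X Z (Cmp L X Y Z (fr Y Z V t g) (fr X Y U s f)) (Cmp L X Y Z (fr Y Z V t g) (fr X Y U' s' f'))"
    unfolding W(1,2) Add_L[OF W(3,4)] Cmp_L[OF roof_add[OF W(3,4)] r(3) Q(1) pq(1) hqk e3]
      Cmp_L[OF W(3) r(3) Q(1) pq e(1)] Cmp_L[OF W(4) r(3) Q(1) pq(1) Q(3) e(2)] Add_L[OF rr]
    by (simp add: distrib_left)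
qed

sublocale L: preadditive_category L
  by (rule preadditive_L)

definition loc :: "'o \<Rightarrow> 'o \<Rightarrow> ('o, 'm) endo \<Rightarrow> ('o, ('o \<times> 'm \<times> 'm) set) endo" where
  "loc X Y f = mor L X Y (fr X Y X (ide X) f)"

lemma loc_Cmp:
  assumes "roof X Y U s f" "V \<in> Obj C" "g \<in> hom Y V"
  shows "Cmp L X Y V (fr Y V Y (ide Y) g) (fr X Y U s f) = fr X V U s (g * f)"
proof -
  note O = roofD[OF assms(1)]
  have "Cmp L X Y V (fr Y V Y (ide Y) g) (fr X Y U s f) = fr X V U (s * ide U) (g * f)"
    using O assms by (intro Cmp_L[OF assms(1) roof_ide]) (auto simp: SS_ide)
  then show ?thesis using O by simp
qed

sublocale loc: rfunctor C L "\<lambda>X. X" loc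
proof unfold_locales
  fix X Y a assume "X \<in> Obj C" "Y \<in> Obj C" "a \<in> hom X Y"
  then show "loc X Y a \<in> L.hom X Y" by (simp add: loc_def L.mor_in roof_in_Hom roof_ide)
next
  fix X assume "X \<in> Obj C"
  then show "loc X X (ide X) = L.ide X" by (simp add: loc_def L.ide_def Idn_L)
next
  fix X Y Z a b assume "X \<in> Obj C" "Y \<in> Obj C" "Z \<in> Obj C" "a \<in> hom X Y" "b \<in> hom Y Z"
  then show "loc X Z (b * a) = loc Y Z b * loc X Y a"
    using loc_Cmp[of X Y X "ide X" a Z b]
    by (simp add: loc_def L.mor_Cmp[symmetric] roof_in_Hom roof_ide)
next
  fix X Y a b assume "X \<in> Obj C" "Y \<in> Obj C" "a \<in> hom X Y" "b \<in> hom X Y"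
  then show "loc X Y (a + b) = loc X Y a + loc X Y b"
    by (simp add: loc_def L.mor_Add[symmetric] roof_in_Hom roof_ide Add_L)
qed simp

text \<open>With identities as denominators the two legs of a refinement coincide and lie in the
  system.\<close>

lemma loc_eq_iff:
  assumes O: "X \<in> Obj C" "Y \<in> Obj C" "a \<in> hom X Y" "b \<in> hom X Y"
  shows "loc X Y a = loc X Y b \<longleftrightarrow> (\<exists>W\<in>Obj C. \<exists>t\<in>SS W X. a * t = b * t)"
proof -
  have "loc X Y a = loc X Y b \<longleftrightarrow> req X Y X (ide X) a X (ide X) b"
    unfolding loc_def using O by (simp add: L.mor_inject roof_in_Hom roof_ide fr_eq_iff)
  also have "\<dots> \<longleftrightarrow> (\<exists>W\<in>Obj C. \<exists>t\<in>SS W X. a * t = b * t)"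
  proof
    assume "req X Y X (ide X) a X (ide X) b"
    then obtain W c d where "W \<in> Obj C" "c \<in> hom W X" "d \<in> hom W X" "ide X * c \<in> SS W X"
      "ide X * c = ide X * d" "a * c = b * d" unfolding req_def by blast
    with O show "\<exists>W\<in>Obj C. \<exists>t\<in>SS W X. a * t = b * t" by auto
  next
    assume "\<exists>W\<in>Obj C. \<exists>t\<in>SS W X. a * t = b * t"
    then obtain W t where W: "W \<in> Obj C" "t \<in> SS W X" "a * t = b * t" by blast
    then have "t \<in> hom W X" using O SS_in by blast
    then show "req X Y X (ide X) a X (ide X) b"
      using W O by (intro reqI[of W t _ t]) simp_all
  qed
  finally show ?thesis .
qed

text \<open>A fraction is handled through the equation it satisfies, with the denominator moved to
  the other side. Functors on the localization can then be treated without naming inverses.\<close>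

lemma loc_roof:
  assumes "\<phi> \<in> L.hom X Y" "X \<in> Obj C" "Y \<in> Obj C"
  obtains U s f where "roof X Y U s f" "\<phi> * loc U X s = loc U Y f"
proof -
  obtain U s f where r: "roof X Y U s f" "\<phi> = mor L X Y (fr X Y U s f)"
    using assms by (auto simp: L.hom_def Hom_L)
  note O = roofD[OF r(1)]
  have "Cmp L U X Y (fr X Y U s f) (fr U X U (ide U) s) = fr U Y U (ide U * ide U) (f * ide U)"
    using O by (intro Cmp_L[OF roof_ide r(1)]) (auto simp: SS_ide)
  then have "\<phi> * loc U X s = loc U Y f"
    using O r by (simp add: loc_def L.mor_Cmp[symmetric] roof_in_Hom roof_ide)
  then show ?thesis using that r(1) by blast
qed

text \<open>The inverse is the roof with denominator \<open>s\<close> and an identity as numerator.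
  One of the two equations says that the roof \<open>(s, s)\<close> is a refinement of an
  identity.\<close>

lemma loc_iso:
  assumes O: "X \<in> Obj C" "Y \<in> Obj C" "s \<in> SS X Y"
  shows "L.riso X Y (loc X Y s)"
proof -
  have s: "s \<in> hom X Y" using SS_in O by blast
  have r: "roof Y X X s (ide X)" using O by (simp add: roof_def)
  have "Cmp L X Y X (fr Y X X s (ide X)) (fr X Y X (ide X) s) = fr X X X (ide X * ide X) (ide X * ide X)"
    using O s by (intro Cmp_L[OF roof_ide r]) (auto simp: SS_ide)
  then have 1: "mor L Y X (fr Y X X s (ide X)) * loc X Y s = L.ide X"
    using O s r by (simp add: loc_def L.mor_Cmp[symmetric] roof_in_Hom roof_ide L.ide_def Idn_L)
  have "Cmp L Y X Y (fr X Y X (ide X) s) (fr Y X X s (ide X)) = fr Y Y X s s"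
    using loc_Cmp[OF r, of Y s] O s by simp
  also have "\<dots> = fr Y Y Y (ide Y) (ide Y)"
    using fr_refine[OF roof_ide, of Y Y "ide Y" X s] O s by simp
  finally have 2: "loc X Y s * mor L Y X (fr Y X X s (ide X)) = L.ide Y"
    using O s r by (simp add: loc_def L.mor_Cmp[symmetric] roof_in_Hom roof_ide L.ide_def Idn_L)
  show ?thesis
    unfolding L.riso_def using 1 2 O s r loc.F_in[of X Y s]
    by (auto intro!: bexI[of _ "mor L Y X (fr Y X X s (ide X))"] simp: L.mor_in roof_in_Hom)
qed

lemma additive_L: "additive_category C \<Longrightarrow> additive_category L"
  by (rule additive_same_objects[OF loc.rfunctor_axioms]) simp_all

end

context preadditive_category
begin

lemma risoD: "riso X Y s \<Longrightarrow> s \<in> hom X Y"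
  by (simp add: riso_def)

lemma riso_cancel_right:
  assumes O: "X \<in> Obj C" "Y \<in> Obj C" "Z \<in> Obj C" and s: "riso X Y s"
    and ab: "a \<in> hom Y Z" "b \<in> hom Y Z" and eq: "a * s = b * s"
  shows "a = b"
proof -
  obtain t where "s * t = ide Y" using s by (auto simp: riso_def)
  then have "a * ide Y = b * ide Y" using arg_cong[OF eq, of "\<lambda>x. x * t"] by (simp add: mult.assoc)
  then show ?thesis using O ab by simp
qed

text \<open>The inverse of \<open>t\<close> is \<open>r * s\<close>, where \<open>r\<close> inverts
  \<open>s * t\<close>.\<close>

lemma riso_factor:
  assumes O: "X \<in> Obj C" "Y \<in> Obj C" "Z \<in> Obj C" and s: "riso Y Z s" and st: "riso X Z (s * t)"
    and t: "t \<in> hom X Y"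
  shows "riso X Y t"
proof -
  obtain s' where s': "s' \<in> hom Z Y" "s' * s = ide Y" "s * s' = ide Z" using s by (auto simp: riso_def)
  obtain r where r: "r \<in> hom Z X" "r * (s * t) = ide X" "s * t * r = ide Z" using st by (auto simp: riso_def)
  have sh: "s \<in> hom Y Z" using s by (rule risoD)
  have "t * (r * s) = s' * s * (t * (r * s))"
    using O s' t r sh by (simp add: hom_mult[of Y X Y "r * s" t] hom_mult[of Y Z X s r])
  also have "\<dots> = s' * (s * t * r) * s" by (simp add: mult.assoc)
  also have "\<dots> = ide Y" using O s' r sh by simp
  finally show ?thesis
    unfolding riso_def using t r O sh
    by (intro conjI bexI[of _ "r * s"]) (simp_all add: mult.assoc hom_mult[of Y Z X s r])
qed

lemma riso_ide: "X \<in> Obj C \<Longrightarrow> riso X X (ide X)"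
  unfolding riso_def by (auto intro!: bexI[of _ "ide X"])

text \<open>Passing to the difference of two morphisms reduces the cancellation axioms to the case
  in which one of them is zero; \<open>rc\<close> and \<open>lc\<close> are these forms.\<close>

lemma multiplicative_systemI:
  fixes S
  defines "SS \<equiv> \<lambda>X Y. mor C X Y ` S X Y"
  assumes S: "\<And>X Y. \<lbrakk>X \<in> Obj C; Y \<in> Obj C\<rbrakk> \<Longrightarrow> S X Y \<subseteq> Hom C X Y"
    and ide: "\<And>X. X \<in> Obj C \<Longrightarrow> ide X \<in> SS X X"
    and mult: "\<And>X Y Z s t. \<lbrakk>X \<in> Obj C; Y \<in> Obj C; Z \<in> Obj C; s \<in> SS X Y; t \<in> SS Y Z\<rbrakk> \<Longrightarrow> t * s \<in> SS X Z"
    and ro: "\<And>X Y Z f s. \<lbrakk>X \<in> Obj C; Y \<in> Obj C; Z \<in> Obj C; f \<in> hom X Y; s \<in> SS Z Y\<rbrakk>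
      \<Longrightarrow> \<exists>W\<in>Obj C. \<exists>t\<in>SS W X. \<exists>g\<in>hom W Z. f * t = s * g"
    and lo: "\<And>X Y Z f s. \<lbrakk>X \<in> Obj C; Y \<in> Obj C; Z \<in> Obj C; f \<in> hom X Y; s \<in> SS X Z\<rbrakk>
      \<Longrightarrow> \<exists>W\<in>Obj C. \<exists>t\<in>SS Y W. \<exists>g\<in>hom Z W. t * f = g * s"
    and rc: "\<And>X Y Z f s. \<lbrakk>X \<in> Obj C; Y \<in> Obj C; Z \<in> Obj C; f \<in> hom X Y; s \<in> SS Y Z; s * f = 0\<rbrakk>
      \<Longrightarrow> \<exists>W\<in>Obj C. \<exists>t\<in>SS W X. f * t = 0"
    and lc: "\<And>X Y Z f s. \<lbrakk>X \<in> Obj C; Y \<in> Obj C; Z \<in> Obj C; f \<in> hom X Y; s \<in> SS Z X; f * s = 0\<rbrakk>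
      \<Longrightarrow> \<exists>W\<in>Obj C. \<exists>t\<in>SS Y W. t * f = 0"
  shows "multiplicative_system C S"
proof
  have Sm: "mor C X Y s \<in> SS X Y" if "s \<in> S X Y" for X Y s using that by (simp add: SS_def)
  have SH: "s \<in> Hom C X Y" if "X \<in> Obj C" "Y \<in> Obj C" "s \<in> S X Y" for X Y s using that S by blast
  have mS: "s \<in> S X Y" if "X \<in> Obj C" "Y \<in> Obj C" "s \<in> Hom C X Y" "mor C X Y s \<in> SS X Y" for X Y s
    using that S[of X Y] unfolding SS_def by (auto simp: mor_inject subsetD)
  note [simp] = mor_Cmp mor_in Cmp_in
  show "S X Y \<subseteq> Hom C X Y" if "X \<in> Obj C" "Y \<in> Obj C" for X Y using that by (rule S)
  show "Idn C X \<in> S X X" if "X \<in> Obj C" for X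
    using that ide by (intro mS) (simp_all add: Idn_in ide_def)
  show "Cmp C X Y Z t s \<in> S X Z" if "X \<in> Obj C" "Y \<in> Obj C" "Z \<in> Obj C" "s \<in> S X Y" "t \<in> S Y Z" for X Y Z s t
    using that mult[of X Y Z "mor C X Y s" "mor C Y Z t"] by (intro mS) (simp_all add: SH Sm)
  show "\<exists>W\<in>Obj C. \<exists>t\<in>S W X. \<exists>g\<in>Hom C W Z. Cmp C W X Y f t = Cmp C W Z Y s g"
    if O: "X \<in> Obj C" "Y \<in> Obj C" "Z \<in> Obj C" "f \<in> Hom C X Y" "s \<in> S Z Y" for X Y Z f s
  proof -
    obtain W t g where W: "W \<in> Obj C" "t \<in> S W X" "g \<in> Hom C W Z"
      "mor C X Y f * mor C W X t = mor C Z Y s * mor C W Z g"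
      using ro[OF O(1-3) mor_in[OF O(4)] Sm[OF O(5)]] unfolding hom_def SS_def by blast
    have "mor C W Y (Cmp C W X Y f t) = mor C W Y (Cmp C W Z Y s g)" using O W by (simp add: SH)
    then have "Cmp C W X Y f t = Cmp C W Z Y s g" using O W by (subst (asm) mor_inject) (simp_all add: SH)
    then show ?thesis using W by blast
  qed
  show "\<exists>W\<in>Obj C. \<exists>t\<in>S Y W. \<exists>g\<in>Hom C Z W. Cmp C X Y W t f = Cmp C X Z W g s"
    if O: "X \<in> Obj C" "Y \<in> Obj C" "Z \<in> Obj C" "f \<in> Hom C X Y" "s \<in> S X Z" for X Y Z f s
  proof -
    obtain W t g where W: "W \<in> Obj C" "t \<in> S Y W" "g \<in> Hom C Z W"
      "mor C Y W t * mor C X Y f = mor C Z W g * mor C X Z s"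
      using lo[OF O(1-3) mor_in[OF O(4)] Sm[OF O(5)]] unfolding hom_def SS_def by blast
    have "mor C X W (Cmp C X Y W t f) = mor C X W (Cmp C X Z W g s)" using O W by (simp add: SH)
    then have "Cmp C X Y W t f = Cmp C X Z W g s" using O W by (subst (asm) mor_inject) (simp_all add: SH)
    then show ?thesis using W by blast
  qed
  show "\<exists>W\<in>Obj C. \<exists>t\<in>S W X. Cmp C W X Y f t = Cmp C W X Y g t"
    if O: "X \<in> Obj C" "Y \<in> Obj C" "Z \<in> Obj C" "f \<in> Hom C X Y" "g \<in> Hom C X Y" "s \<in> S Y Z"
      and eq: "Cmp C X Y Z s f = Cmp C X Y Z s g" for X Y Z f g s
  proof -
    have "mor C Y Z s * (mor C X Y f - mor C X Y g) = 0"
      using arg_cong[OF eq, of "mor C X Z"] O by (simp add: SH right_diff_distrib)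
    then obtain W t where W: "W \<in> Obj C" "t \<in> S W X" "(mor C X Y f - mor C X Y g) * mor C W X t = 0"
      using rc[OF O(1-3) hom_diff[OF O(1,2) mor_in[OF O(4)] mor_in[OF O(5)]] Sm[OF O(6)]]
      unfolding SS_def by blast
    have "mor C W Y (Cmp C W X Y f t) = mor C W Y (Cmp C W X Y g t)"
      using O W by (simp add: SH left_diff_distrib)
    then have "Cmp C W X Y f t = Cmp C W X Y g t" using O W by (subst (asm) mor_inject) (simp_all add: SH)
    then show ?thesis using W by blast
  qed
  show "\<exists>W\<in>Obj C. \<exists>t\<in>S Y W. Cmp C X Y W t f = Cmp C X Y W t g"
    if O: "X \<in> Obj C" "Y \<in> Obj C" "Z \<in> Obj C" "f \<in> Hom C X Y" "g \<in> Hom C X Y" "s \<in> S Z X"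
      and eq: "Cmp C Z X Y f s = Cmp C Z X Y g s" for X Y Z f g s
  proof -
    have "(mor C X Y f - mor C X Y g) * mor C Z X s = 0"
      using arg_cong[OF eq, of "mor C Z Y"] O by (simp add: SH left_diff_distrib)
    then obtain W t where W: "W \<in> Obj C" "t \<in> S Y W" "mor C Y W t * (mor C X Y f - mor C X Y g) = 0"
      using lc[OF O(1-3) hom_diff[OF O(1,2) mor_in[OF O(4)] mor_in[OF O(5)]] Sm[OF O(6)]]
      unfolding SS_def by blast
    have "mor C X W (Cmp C X Y W t f) = mor C X W (Cmp C X Y W t g)"
      using O W by (simp add: SH right_diff_distrib)
    then have "Cmp C X Y W t f = Cmp C X Y W t g" using O W by (subst (asm) mor_inject) (simp_all add: SH)
    then show ?thesis using W by blast
  qed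
qed

end

context mult_system
begin

lemma ore_left:
  assumes O: "X \<in> Obj C" "Y \<in> Obj C" "Z \<in> Obj C" and f: "f \<in> hom X Y" and s: "s \<in> SS X Z"
  obtains W t g where "W \<in> Obj C" "t \<in> SS Y W" "g \<in> hom Z W" "t * f = g * s"
proof -
  obtain W t g where W: "W \<in> Obj C" "t \<in> S Y W" "g \<in> Hom C Z W"
    "Cmp C X Y W t (unmor X Y f) = Cmp C X Z W g (unmor X Z s)"
    using left_ore[OF O, of "unmor X Y f" "unmor X Z s"] O f s by (auto simp: unmor_in unmor_in_S)
  then have "t \<in> Hom C Y W" using S_in O by blast
  then have "mor C Y W t * f = mor C Z W g * s"
    using arg_cong[OF W(4), of "mor C X W"] O W(1,3) f s by (simp add: mor_Cmp unmor_in SS_in)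
  then show ?thesis using that[of W "mor C Y W t" "mor C Z W g"] W(1-3) by (simp add: SS_def mor_in)
qed

lemma cancel_left:
  assumes O: "X \<in> Obj C" "Y \<in> Obj C" "Z \<in> Obj C" and f: "f \<in> hom X Y" "g \<in> hom X Y"
    and s: "s \<in> SS Z X" and eq: "f * s = g * s"
  obtains W t where "W \<in> Obj C" "t \<in> SS Y W" "t * f = t * g"
proof -
  have "Cmp C Z X Y (unmor X Y f) (unmor Z X s) = Cmp C Z X Y (unmor X Y g) (unmor Z X s)"
    using O f s eq by (simp add: unmor_Cmp SS_in)
  then obtain W t where W: "W \<in> Obj C" "t \<in> S Y W"
    "Cmp C X Y W t (unmor X Y f) = Cmp C X Y W t (unmor X Y g)"
    using left_cancel[OF O, of "unmor X Y f" "unmor X Y g" "unmor Z X s"] O f s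
    by (auto simp: unmor_in unmor_in_S)
  then have "t \<in> Hom C Y W" using S_in O by blast
  then have "mor C Y W t * f = mor C Y W t * g"
    using arg_cong[OF W(3), of "mor C X W"] O W(1) f s by (simp add: mor_Cmp unmor_in SS_in)
  then show ?thesis using that[of W "mor C Y W t"] W(1,2) by (simp add: SS_def)
qed

end

text \<open>An Ore or cancellation problem is sent to \<open>D\<close> by \<open>J\<close>, solved
  there, and the solution is carried to \<open>C\<close> by \<open>H\<close>. Its ends are moved
  from \<open>Ho (Jo X)\<close> back to \<open>X\<close> along \<open>\<eta>\<close> or
  \<open>\<eta>'\<close>; as these lie in \<open>S\<close> and \<open>S\<close> is closed under
  composition, the new denominators lie in \<open>S\<close> too.\<close>

lemma multiplicative_system_transfer:
  fixes C :: "('o, 'm) acat" and D :: "('p, 'n) acat"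
  assumes T: "mult_system D T" and J: "rfunctor C D Jo J" and H: "rfunctor D C Ho H"
    and S_in: "\<And>X Y. \<lbrakk>X \<in> Obj C; Y \<in> Obj C\<rbrakk> \<Longrightarrow> S X Y \<subseteq> Hom C X Y"
    and JS: "\<And>X Y s. \<lbrakk>X \<in> Obj C; Y \<in> Obj C; s \<in> mor C X Y ` S X Y\<rbrakk> \<Longrightarrow> J X Y s \<in> mor D (Jo X) (Jo Y) ` T (Jo X) (Jo Y)"
    and HT: "\<And>X Y s. \<lbrakk>X \<in> Obj D; Y \<in> Obj D; s \<in> mor D X Y ` T X Y\<rbrakk> \<Longrightarrow> H X Y s \<in> mor C (Ho X) (Ho Y) ` S (Ho X) (Ho Y)"
    and mult: "\<And>X Y Z s t. \<lbrakk>X \<in> Obj C; Y \<in> Obj C; Z \<in> Obj C; s \<in> mor C X Y ` S X Y; t \<in> mor C Y Z ` S Y Z\<rbrakk>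
      \<Longrightarrow> t * s \<in> mor C X Z ` S X Z"
    and eta: "\<And>X. X \<in> Obj C \<Longrightarrow> \<eta> X \<in> mor C X (Ho (Jo X)) ` S X (Ho (Jo X))"
    and eta': "\<And>X. X \<in> Obj C \<Longrightarrow> \<eta>' X \<in> mor C (Ho (Jo X)) X ` S (Ho (Jo X)) X"
    and inv: "\<And>X. X \<in> Obj C \<Longrightarrow> \<eta>' X * \<eta> X = preadditive_category.ide C X"
      "\<And>X. X \<in> Obj C \<Longrightarrow> \<eta> X * \<eta>' X = preadditive_category.ide C (Ho (Jo X))"
    and nat: "\<And>X Y a. \<lbrakk>X \<in> Obj C; Y \<in> Obj C; a \<in> preadditive_category.hom C X Y\<rbrakk>
      \<Longrightarrow> \<eta> Y * a = H (Jo X) (Jo Y) (J X Y a) * \<eta> X"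
  shows "multiplicative_system C S"
proof -
  interpret D: mult_system D T by fact
  interpret J: rfunctor C D Jo J by fact
  interpret H: rfunctor D C Ho H by fact
  let ?SS = "\<lambda>X Y. mor C X Y ` S X Y"
  have SSh: "s \<in> J.A.hom X Y" if "X \<in> Obj C" "Y \<in> Obj C" "s \<in> ?SS X Y" for X Y s
    using that S_in unfolding J.A.hom_def by blast
  have o: "Ho (Jo X) \<in> Obj C" "Jo X \<in> Obj D" if "X \<in> Obj C" for X
    using that by (simp_all add: J.Fo_in H.Fo_in)
  have eh: "\<eta> X \<in> J.A.hom X (Ho (Jo X))" "\<eta>' X \<in> J.A.hom (Ho (Jo X)) X" if "X \<in> Obj C" for X
    using SSh eta eta' o that by auto
  \<comment> \<open>Multiplying by the inverse pair on both sides turns naturality of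
    \<open>\<eta>\<close> into naturality of \<open>\<eta>'\<close>.\<close>
  have nat': "a * \<eta>' X = \<eta>' Y * H (Jo X) (Jo Y) (J X Y a)"
    if O: "X \<in> Obj C" "Y \<in> Obj C" "a \<in> J.A.hom X Y" for X Y a
  proof -
    let ?b = "H (Jo X) (Jo Y) (J X Y a)"
    have b: "?b \<in> J.A.hom (Ho (Jo X)) (Ho (Jo Y))" using O by (simp add: H.F_in J.F_in o)
    have "\<eta>' Y * (\<eta> Y * a) * \<eta>' X = \<eta>' Y * (?b * \<eta> X) * \<eta>' X" using nat[OF O] by simp
    then have "(\<eta>' Y * \<eta> Y) * (a * \<eta>' X) = \<eta>' Y * (?b * (\<eta> X * \<eta>' X))" by (simp only: mult.assoc)
    moreover have "a * \<eta>' X \<in> J.A.hom (Ho (Jo X)) Y" using J.A.hom_mult[OF o(1)[OF O(1)] O(1,2) eh(2)[OF O(1)] O(3)] .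
    ultimately show ?thesis
      using O b o by (simp add: inv)
  qed
  show ?thesis
  proof (rule J.A.multiplicative_systemI)
    show "S X Y \<subseteq> Hom C X Y" if "X \<in> Obj C" "Y \<in> Obj C" for X Y using that by (rule S_in)
    show "t * s \<in> ?SS X Z" if "X \<in> Obj C" "Y \<in> Obj C" "Z \<in> Obj C" "s \<in> ?SS X Y" "t \<in> ?SS Y Z" for X Y Z s t
      using that by (rule mult)
    \<comment> \<open>The identity is the composite \<open>\<eta>' X * \<eta> X\<close> of two
      members of \<open>S\<close>.\<close>
    show "J.A.ide X \<in> ?SS X X" if "X \<in> Obj C" for X
      using mult[OF that o(1)[OF that] that eta eta'] that by (simp add: inv)
    fix X Y Z f s assume O: "X \<in> Obj C" "Y \<in> Obj C" "Z \<in> Obj C" and f: "f \<in> J.A.hom X Y"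
    { assume s: "s \<in> ?SS Z Y"
      obtain W t g where W: "W \<in> Obj D" "t \<in> D.SS W (Jo X)" "g \<in> D.hom W (Jo Z)" "J X Y f * t = J Z Y s * g"
        using D.ore_right[OF o(2)[OF O(1)] o(2)[OF O(2)] o(2)[OF O(3)] J.F_in[OF O(1,2) f]
          JS[OF O(3,2) s, folded D.SS_def]] by blast
      have t: "t \<in> D.hom W (Jo X)" using W O o D.SS_in by blast
      have "f * (\<eta>' X * H W (Jo X) t) = \<eta>' Y * H W (Jo Y) (J X Y f * t)"
        using nat'[OF O(1,2) f] H.F_mult[OF W(1) o(2)[OF O(1)] o(2)[OF O(2)] t J.F_in[OF O(1,2) f]]
        by (simp add: mult.assoc[symmetric])
      also have "\<dots> = s * (\<eta>' Z * H W (Jo Z) g)"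
        using nat'[OF O(3,2) SSh[OF O(3,2) s]]
          H.F_mult[OF W(1) o(2)[OF O(3)] o(2)[OF O(2)] W(3) J.F_in[OF O(3,2) SSh[OF O(3,2) s]]]
        by (simp add: mult.assoc[symmetric] W(4))
      finally have "f * (\<eta>' X * H W (Jo X) t) = s * (\<eta>' Z * H W (Jo Z) g)" .
      moreover have "\<eta>' X * H W (Jo X) t \<in> ?SS (Ho W) X"
        using W(1,2) O o by (intro mult[of "Ho W" "Ho (Jo X)"] HT eta') (simp_all add: H.Fo_in D.SS_def)
      moreover have "\<eta>' Z * H W (Jo Z) g \<in> J.A.hom (Ho W) Z"
        using W(1,3) O o eh by (intro J.A.hom_mult[of "Ho W" "Ho (Jo Z)"]) (simp_all add: H.Fo_in H.F_in)
      ultimately show "\<exists>W\<in>Obj C. \<exists>t\<in>?SS W X. \<exists>g\<in>J.A.hom W Z. f * t = s * g"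
        using H.Fo_in[OF W(1)] by blast }
    { assume s: "s \<in> ?SS X Z"
      obtain W t g where W: "W \<in> Obj D" "t \<in> D.SS (Jo Y) W" "g \<in> D.hom (Jo Z) W" "t * J X Y f = g * J X Z s"
        using D.ore_left[OF o(2)[OF O(1)] o(2)[OF O(2)] o(2)[OF O(3)] J.F_in[OF O(1,2) f]
          JS[OF O(1,3) s, folded D.SS_def]] by blast
      have t: "t \<in> D.hom (Jo Y) W" using W O o D.SS_in by blast
      have "H (Jo Y) W t * \<eta> Y * f = H (Jo X) W (t * J X Y f) * \<eta> X"
        using nat[OF O(1,2) f] H.F_mult[OF o(2)[OF O(1)] o(2)[OF O(2)] W(1) J.F_in[OF O(1,2) f] t]
        by (simp add: mult.assoc)
      also have "\<dots> = H (Jo Z) W g * \<eta> Z * s"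
        using nat[OF O(1,3) SSh[OF O(1,3) s]]
          H.F_mult[OF o(2)[OF O(1)] o(2)[OF O(3)] W(1) J.F_in[OF O(1,3) SSh[OF O(1,3) s]] W(3)]
        by (simp add: mult.assoc W(4))
      finally have "H (Jo Y) W t * \<eta> Y * f = H (Jo Z) W g * \<eta> Z * s" .
      moreover have "H (Jo Y) W t * \<eta> Y \<in> ?SS Y (Ho W)"
        using W(1,2) O o by (intro mult[of _ "Ho (Jo Y)"] HT eta) (simp_all add: H.Fo_in D.SS_def)
      moreover have "H (Jo Z) W g * \<eta> Z \<in> J.A.hom Z (Ho W)"
        using W(1,3) O o eh by (intro J.A.hom_mult[of _ "Ho (Jo Z)"]) (simp_all add: H.Fo_in H.F_in)
      ultimately show "\<exists>W\<in>Obj C. \<exists>t\<in>?SS Y W. \<exists>g\<in>J.A.hom Z W. t * f = g * s"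
        using H.Fo_in[OF W(1)] by blast }
    { assume s: "s \<in> ?SS Y Z" and eq: "s * f = 0"
      have "J Y Z s * J X Y f = J Y Z s * 0"
        using J.F_mult[OF O f SSh[OF O(2,3) s]] eq O by (simp add: J.F_0)
      then obtain W t where W: "W \<in> Obj D" "t \<in> D.SS W (Jo X)" "J X Y f * t = 0 * t"
        using D.cancel_right[OF o(2)[OF O(1)] o(2)[OF O(2)] o(2)[OF O(3)] J.F_in[OF O(1,2) f]
            D.hom_0[OF o(2)[OF O(1)] o(2)[OF O(2)]] JS[OF O(2,3) s, folded D.SS_def]] by blast
      have t: "t \<in> D.hom W (Jo X)" using W O o D.SS_in by blast
      have "f * (\<eta>' X * H W (Jo X) t) = \<eta>' Y * H W (Jo Y) (J X Y f * t)"
        using nat'[OF O(1,2) f] H.F_mult[OF W(1) o(2)[OF O(1)] o(2)[OF O(2)] t J.F_in[OF O(1,2) f]]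
        by (simp add: mult.assoc[symmetric])
      then have "f * (\<eta>' X * H W (Jo X) t) = 0" using W O o by (simp add: H.F_0)
      moreover have "\<eta>' X * H W (Jo X) t \<in> ?SS (Ho W) X"
        using W(1,2) O o by (intro mult[of "Ho W" "Ho (Jo X)"] HT eta') (simp_all add: H.Fo_in D.SS_def)
      ultimately show "\<exists>W\<in>Obj C. \<exists>t\<in>?SS W X. f * t = 0"
        using H.Fo_in[OF W(1)] by blast }
    { assume s: "s \<in> ?SS Z X" and eq: "f * s = 0"
      have "J X Y f * J Z X s = 0 * J Z X s"
        using J.F_mult[OF O(3,1,2) SSh[OF O(3,1) s] f] eq O by (simp add: J.F_0)
      then obtain W t where W: "W \<in> Obj D" "t \<in> D.SS (Jo Y) W" "t * J X Y f = t * 0"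
        using D.cancel_left[OF o(2)[OF O(1)] o(2)[OF O(2)] o(2)[OF O(3)] J.F_in[OF O(1,2) f]
            D.hom_0[OF o(2)[OF O(1)] o(2)[OF O(2)]] JS[OF O(3,1) s, folded D.SS_def]] by blast
      have t: "t \<in> D.hom (Jo Y) W" using W O o D.SS_in by blast
      have "H (Jo Y) W t * \<eta> Y * f = H (Jo X) W (t * J X Y f) * \<eta> X"
        using nat[OF O(1,2) f] H.F_mult[OF o(2)[OF O(1)] o(2)[OF O(2)] W(1) J.F_in[OF O(1,2) f] t]
        by (simp add: mult.assoc)
      then have "H (Jo Y) W t * \<eta> Y * f = 0" using W O o by (simp add: H.F_0)
      moreover have "H (Jo Y) W t * \<eta> Y \<in> ?SS Y (Ho W)"
        using W(1,2) O o by (intro mult[of _ "Ho (Jo Y)"] HT eta) (simp_all add: H.Fo_in D.SS_def)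
      ultimately show "\<exists>W\<in>Obj C. \<exists>t\<in>?SS Y W. t * f = 0"
        using H.Fo_in[OF W(1)] by blast }
  qed
qed


section \<open>Functors on localizations\<close>

locale loc_functor = mult_system C S + F: rfunctor C D Fo F
  for C :: "('o, 'm) acat" and S and D :: "('p, 'n) acat" and Fo F +
  assumes F_SS: "\<lbrakk>X \<in> Obj C; Y \<in> Obj C; s \<in> SS X Y\<rbrakk> \<Longrightarrow> F.B.riso (Fo X) (Fo Y) (F X Y s)"
begin

text \<open>The equation is demanded for all roofs of \<open>\<phi>\<close> at once, so independence
  of the roof is built in; \<open>is_liftI\<close> shows that a single roof is enough to
  check.\<close>

definition is_lift where
  "is_lift X Y \<phi> \<psi> \<longleftrightarrow> \<psi> \<in> F.B.hom (Fo X) (Fo Y) \<and>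
    (\<forall>U s f. roof X Y U s f \<longrightarrow> \<phi> * loc U X s = loc U Y f \<longrightarrow> \<psi> * F U X s = F U Y f)"

text \<open>Two roofs of \<open>\<phi>\<close> have a common denominator, over which the numerators
  agree after a further member of the system. So the equation for one roof yields the equation for
  the other, composed with \<open>F\<close> of the leg into \<open>U'\<close>; and that leg becomes
  invertible in \<open>D\<close>.\<close>

lemma lift_indep:
  assumes \<phi>: "\<phi> \<in> L.hom X Y" and r: "roof X Y U s f" "roof X Y U' s' f'"
    and e: "\<phi> * loc U X s = loc U Y f" "\<phi> * loc U' X s' = loc U' Y f'"
    and \<psi>: "\<psi> \<in> F.B.hom (Fo X) (Fo Y)" "\<psi> * F U X s = F U Y f"
  shows "\<psi> * F U' X s' = F U' Y f'"
proof -
  note O = roofD[OF r(1)] roofD[OF r(2)]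
  obtain W a b where W: "W \<in> Obj C" "a \<in> hom W U" "b \<in> hom W U'" "s * a \<in> SS W X" "s * a = s' * b"
    using common_roof[OF r] .
  have fa: "f * a \<in> hom W Y" "f' * b \<in> hom W Y" using W O hom_mult by blast+
  have "loc W Y (f * a) = \<phi> * loc W X (s * a)"
    using O W(1-3) by (simp add: loc.F_mult[of W U] e(1)[symmetric] mult.assoc)
  also have "\<dots> = loc W Y (f' * b)"
    unfolding W(5) using O W(1-3) by (simp add: loc.F_mult[of W U'] e(2)[symmetric] mult.assoc)
  finally obtain V t where V: "V \<in> Obj C" "t \<in> SS V W" "f * a * t = f' * b * t"
    using loc_eq_iff[OF W(1) O(2) fa] by blast
  have t: "t \<in> hom V W" using SS_in V W by blast
  have at: "a * t \<in> hom V U" "b * t \<in> hom V U'" using hom_mult[OF V(1) W(1) _ t] W O by blast+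
  have "\<psi> * F U' X s' * F V U' (b * t) = \<psi> * F V X (s' * (b * t))"
    using F.F_mult[OF V(1) _ _ at(2), of X s'] O by (simp add: mult.assoc)
  also have "s' * (b * t) = s * (a * t)" using W(5) by (simp add: mult.assoc[symmetric])
  also have "\<psi> * F V X (s * (a * t)) = F U Y f * F V U (a * t)"
    using F.F_mult[OF V(1) _ _ at(1), of X s] O \<psi>(2) by (simp add: mult.assoc[symmetric])
  also have "\<dots> = F V Y (f' * (b * t))"
    using F.F_mult[OF V(1) _ _ at(1), of Y f] O V(3) by (simp add: mult.assoc)
  also have "\<dots> = F U' Y f' * F V U' (b * t)"
    using F.F_mult[OF V(1) _ _ at(2), of Y f'] O by simp
  finally have eq: "\<psi> * F U' X s' * F V U' (b * t) = F U' Y f' * F V U' (b * t)" .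
  have "s' * (b * t) \<in> SS V X" using SS_mult[OF V(1) W(1) O(1) V(2) W(4)] W(5) by (simp add: mult.assoc)
  then have "F.B.riso (Fo V) (Fo X) (F U' X s' * F V U' (b * t))"
    using F_SS[of V X "s' * (b * t)"] F.F_mult[OF V(1) _ _ at(2), of X s'] O V by simp
  then have iso: "F.B.riso (Fo V) (Fo U') (F V U' (b * t))"
    using F.B.riso_factor[of "Fo V" "Fo U'" "Fo X" "F U' X s'"] F_SS O V at by (simp add: F.Fo_in F.F_in)
  show ?thesis
    using O V \<psi>(1) F.B.hom_mult[of "Fo U'" "Fo X" "Fo Y" "F U' X s'" \<psi>]
    by - (rule F.B.riso_cancel_right[of "Fo V" "Fo U'" "Fo Y", OF _ _ _ iso _ _ eq]; simp add: F.Fo_in F.F_in)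
qed

lemma is_lift_unique:
  assumes O: "X \<in> Obj C" "Y \<in> Obj C" and \<phi>: "\<phi> \<in> L.hom X Y" and "is_lift X Y \<phi> \<psi>" "is_lift X Y \<phi> \<psi>'"
  shows "\<psi> = \<psi>'"
proof -
  obtain U s f where r: "roof X Y U s f" "\<phi> * loc U X s = loc U Y f"
    using loc_roof[OF \<phi> O] .
  note O' = roofD[OF r(1)]
  have "\<psi> * F U X s = F U Y f" "\<psi>' * F U X s = F U Y f" "\<psi> \<in> F.B.hom (Fo X) (Fo Y)" "\<psi>' \<in> F.B.hom (Fo X) (Fo Y)"
    using assms(4,5) r unfolding is_lift_def by blast+
  then show ?thesis
    using F.B.riso_cancel_right[OF F.Fo_in F.Fo_in F.Fo_in F_SS, OF O'(3,1,2,3,1,4)] by simp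
qed

lemma is_liftI:
  assumes "\<phi> \<in> L.hom X Y" "roof X Y U s f" "\<phi> * loc U X s = loc U Y f"
    "\<psi> \<in> F.B.hom (Fo X) (Fo Y)" "\<psi> * F U X s = F U Y f"
  shows "is_lift X Y \<phi> \<psi>"
  unfolding is_lift_def using lift_indep[OF assms(1,2) _ assms(3) _ assms(4,5)] assms(4) by blast

definition lift where
  "lift X Y \<phi> = (THE \<psi>. is_lift X Y \<phi> \<psi>)"

lemma lift_eqI:
  assumes "X \<in> Obj C" "Y \<in> Obj C" "\<phi> \<in> L.hom X Y" "is_lift X Y \<phi> \<psi>"
  shows "lift X Y \<phi> = \<psi>"
  unfolding lift_def using is_lift_unique assms by blast

lemma is_lift_lift:
  assumes O: "X \<in> Obj C" "Y \<in> Obj C" and \<phi>: "\<phi> \<in> L.hom X Y"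
  shows "is_lift X Y \<phi> (lift X Y \<phi>)"
proof -
  obtain U s f where r: "roof X Y U s f" "\<phi> * loc U X s = loc U Y f"
    using loc_roof[OF \<phi> O] .
  note O' = roofD[OF r(1)]
  obtain t where t: "t \<in> F.B.hom (Fo X) (Fo U)" "t * F U X s = F.B.ide (Fo U)"
    using F_SS[OF O'(3,1,4)] by (auto simp: F.B.riso_def)
  \<comment> \<open>Here \<open>t\<close> is the inverse of \<open>F U X s\<close>, so the candidate
    is the image of the fraction.\<close>
  have "is_lift X Y \<phi> (F U Y f * t)"
    using O' t r F.B.hom_mult[of "Fo X" "Fo U" "Fo Y" t "F U Y f"]
      F.B.ide_right[OF F.Fo_in[OF O'(3)] F.Fo_in[OF O'(2)] F.F_in[OF O'(3,2,5)]]
    by (intro is_liftI[OF \<phi> r]) (simp_all add: mult.assoc F.Fo_in F.F_in)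
  then show ?thesis using lift_eqI[OF O \<phi>] by simp
qed

lemma lift_in: "\<lbrakk>X \<in> Obj C; Y \<in> Obj C; \<phi> \<in> L.hom X Y\<rbrakk> \<Longrightarrow> lift X Y \<phi> \<in> F.B.hom (Fo X) (Fo Y)"
  using is_lift_lift by (simp add: is_lift_def)

lemma lift_roof:
  "\<lbrakk>\<phi> \<in> L.hom X Y; roof X Y U s f; \<phi> * loc U X s = loc U Y f\<rbrakk> \<Longrightarrow> lift X Y \<phi> * F U X s = F U Y f"
  using is_lift_lift roofD(1,2) by (simp add: is_lift_def)

lemma lift_loc:
  assumes O: "X \<in> Obj C" "Y \<in> Obj C" and f: "f \<in> hom X Y"
  shows "lift X Y (loc X Y f) = F X Y f"
proof -
  have "lift X Y (loc X Y f) * F X X (ide X) = F X Y f"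
    using O f by (intro lift_roof roof_ide) (simp_all add: loc.F_in loc.F_ide)
  then show ?thesis using O f lift_in[OF O loc.F_in[OF O f]] by (simp add: F.F_ide F.Fo_in)
qed

lemma rfunctor_lift: "rfunctor L D Fo lift"
proof unfold_locales
  fix X assume "X \<in> Obj L"
  then show "Fo X \<in> Obj D" "lift X X (L.ide X) = F.B.ide (Fo X)"
    using lift_loc[of X X "ide X"] by (simp_all add: F.Fo_in F.F_ide loc.F_ide)
next
  fix X Y a assume "X \<in> Obj L" "Y \<in> Obj L" "a \<in> L.hom X Y"
  then show "lift X Y a \<in> F.B.hom (Fo X) (Fo Y)" by (simp add: lift_in)
next
  fix X Y Z a b assume O: "X \<in> Obj L" "Y \<in> Obj L" "Z \<in> Obj L" and a: "a \<in> L.hom X Y" and b: "b \<in> L.hom Y Z"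
  obtain U s f where r: "roof X Y U s f" "a * loc U X s = loc U Y f"
    using loc_roof[OF a] O by auto
  obtain V t g where r': "roof Y Z V t g" "b * loc V Y t = loc V Z g"
    using loc_roof[OF b] O by auto
  \<comment> \<open>The composite fraction has the roof \<open>(s * p, g * h)\<close> over this Ore
    square, and it is enough to test the composite of the lifts on that one roof.\<close>
  obtain W p h where W: "W \<in> Obj C" "p \<in> SS W U" "h \<in> hom W V" "f * p = t * h" "p \<in> hom W U"
    "roof X Z W (s * p) (g * h)"
    using roof_comp[OF r(1) r'(1)] .
  note O' = roofD[OF r(1)] roofD[OF r'(1)]
  have fp: "loc U Y f * loc W U p = loc V Y t * loc W V h" "F U Y f * F W U p = F V Y t * F W V h"
    using O' W loc.F_mult[OF W(1) O'(3,2) W(5), of f] loc.F_mult[OF W(1) O'(9,2) W(3), of t]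
      F.F_mult[OF W(1) O'(3,2) W(5), of f] F.F_mult[OF W(1) O'(9,2) W(3), of t] by simp_all
  have "b * a * loc W X (s * p) = b * (a * loc U X s) * loc W U p"
    using O' W loc.F_mult[OF W(1) O'(3,1) W(5), of s] by (simp add: mult.assoc)
  also have "\<dots> = loc W Z (g * h)"
    using O' W loc.F_mult[OF W(1) O'(9,8) W(3), of g] fp(1) r'(2)
    by (simp add: mult.assoc r(2)) (simp add: mult.assoc[symmetric])
  finally have ba: "b * a * loc W X (s * p) = loc W Z (g * h)" .
  have "lift Y Z b * lift X Y a * F W X (s * p) = lift Y Z b * (lift X Y a * F U X s) * F W U p"
    using O' W F.F_mult[OF W(1) O'(3,1) W(5), of s] by (simp add: mult.assoc)
  also have "\<dots> = lift Y Z b * F V Y t * F W V h"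
    using lift_roof[OF a r] fp(2) by (simp add: mult.assoc)
  also have "\<dots> = F W Z (g * h)"
    using lift_roof[OF b r'] O' W F.F_mult[OF W(1) O'(9,8) W(3), of g] by simp
  finally have *: "lift Y Z b * lift X Y a * F W X (s * p) = F W Z (g * h)" .
  have bah: "b * a \<in> L.hom X Z" using L.hom_mult[OF O a b] .
  have "lift Y Z b * lift X Y a \<in> F.B.hom (Fo X) (Fo Z)"
    using O a b by (intro F.B.hom_mult[of _ "Fo Y"]) (simp_all add: F.Fo_in lift_in)
  then show "lift X Z (b * a) = lift Y Z b * lift X Y a"
    using O * ba bah W(6) by (intro lift_eqI is_liftI[OF bah W(6)]) simp_all
next
  fix X Y a b assume O: "X \<in> Obj L" "Y \<in> Obj L" and a: "a \<in> L.hom X Y" and b: "b \<in> L.hom X Y"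
  obtain U s f where r: "roof X Y U s f" "a * loc U X s = loc U Y f"
    using loc_roof[OF a] O by auto
  obtain V t g where r': "roof X Y V t g" "b * loc V X t = loc V Y g"
    using loc_roof[OF b] O by auto
  obtain W p q where W: "W \<in> Obj C" "p \<in> hom W U" "q \<in> hom W V" "s * p \<in> SS W X" "s * p = t * q"
    using common_roof[OF r(1) r'(1)] .
  note O' = roofD[OF r(1)] roofD[OF r'(1)]
  have rr: "roof X Y W (s * p) (f * p)" "roof X Y W (s * p) (g * q)"
    using roof_refine[OF r(1) W(1,2,4)] roof_refine[OF r'(1) W(1,3)] W(4,5) by simp_all
  have ea: "a * loc W X (s * p) = loc W Y (f * p)"
    using O' W(1-3) loc.F_mult[OF W(1) O'(3) _ W(2)] r(2) by (simp add: mult.assoc[symmetric])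
  have eb: "b * loc W X (s * p) = loc W Y (g * q)"
    unfolding W(5) using O' W(1-3) loc.F_mult[OF W(1) O'(9) _ W(3)] r'(2) by (simp add: mult.assoc[symmetric])
  have ab: "a + b \<in> L.hom X Y" using O a b by (simp add: L.hom_add)
  have "is_lift X Y (a + b) (lift X Y a + lift X Y b)"
  proof (rule is_liftI[OF ab roof_add[OF rr]])
    show "(a + b) * loc W X (s * p) = loc W Y (f * p + g * q)"
      using O' W(1) roofD[OF rr(1)] roofD[OF rr(2)] by (simp add: distrib_right ea eb loc.F_add)
    show "lift X Y a + lift X Y b \<in> F.B.hom (Fo X) (Fo Y)"
      using O a b by (simp add: F.B.hom_add lift_in F.Fo_in)
    show "(lift X Y a + lift X Y b) * F W X (s * p) = F W Y (f * p + g * q)"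
      using O' W(1) roofD[OF rr(1)] roofD[OF rr(2)] lift_roof[OF a rr(1) ea] lift_roof[OF b rr(2) eb]
      by (simp add: distrib_right F.F_add)
  qed
  then show "lift X Y (a + b) = lift X Y a + lift X Y b"
    using O ab by (intro lift_eqI) simp_all
qed

end

text \<open>A fraction satisfies \<open>\<phi> * s = f\<close> in the localization, so naturality at
  \<open>s\<close> and at \<open>f\<close> gives naturality at \<open>\<phi>\<close> once the
  isomorphism \<open>G1 s\<close> is cancelled. The class \<open>P\<close> admits transformations
  that are natural only on part of \<open>C\<close>; it has to contain the vertex of every roof over
  one of its objects.\<close>

lemma (in mult_system) natural_on_localization:
  assumes G: "rfunctor L D G1o G1" "rfunctor L D G2o G2"
    and \<eta>: "\<And>X. \<lbrakk>X \<in> Obj C; P X\<rbrakk> \<Longrightarrow> \<eta> X \<in> preadditive_category.hom D (G1o X) (G2o X)"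
    and P: "\<And>X U s. \<lbrakk>X \<in> Obj C; P X; U \<in> Obj C; s \<in> SS U X\<rbrakk> \<Longrightarrow> P U"
    and nat: "\<And>X Y f. \<lbrakk>X \<in> Obj C; P X; Y \<in> Obj C; P Y; f \<in> hom X Y\<rbrakk>
      \<Longrightarrow> \<eta> Y * G1 X Y (loc X Y f) = G2 X Y (loc X Y f) * \<eta> X"
    and O: "X \<in> Obj C" "P X" "Y \<in> Obj C" "P Y" and \<phi>: "\<phi> \<in> L.hom X Y"
  shows "\<eta> Y * G1 X Y \<phi> = G2 X Y \<phi> * \<eta> X"
proof -
  interpret G1: rfunctor L D G1o G1 by fact
  interpret G2: rfunctor L D G2o G2 by fact
  obtain U s f where r: "roof X Y U s f" "\<phi> * loc U X s = loc U Y f"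
    using loc_roof[OF \<phi>] O by auto
  note O' = roofD[OF r(1)]
  have PU: "P U" using P O O' by blast
  have ls: "loc U X s \<in> L.hom U X" using O' by (simp add: loc.F_in)
  have g1: "G1 U Y (loc U Y f) = G1 X Y \<phi> * G1 U X (loc U X s)"
    using G1.F_mult[of U X Y "loc U X s" \<phi>] O' ls \<phi> r(2) by simp
  have g2: "G2 U Y (loc U Y f) = G2 X Y \<phi> * G2 U X (loc U X s)"
    using G2.F_mult[of U X Y "loc U X s" \<phi>] O' ls \<phi> r(2) by simp
  have "\<eta> Y * G1 X Y \<phi> * G1 U X (loc U X s) = \<eta> Y * G1 U Y (loc U Y f)"
    by (simp add: g1 mult.assoc)
  also have "\<dots> = G2 X Y \<phi> * (G2 U X (loc U X s) * \<eta> U)"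
    using nat[OF O'(3) PU O(3,4) O'(5)] by (simp add: g2 mult.assoc)
  also have "\<dots> = G2 X Y \<phi> * \<eta> X * G1 U X (loc U X s)"
    using nat[OF O'(3) PU O(1,2) O'(6)] by (simp add: mult.assoc)
  finally have eq: "\<eta> Y * G1 X Y \<phi> * G1 U X (loc U X s) = G2 X Y \<phi> * \<eta> X * G1 U X (loc U X s)" .
  have "G1.B.riso (G1o U) (G1o X) (G1 U X (loc U X s))"
    using G1.F_iso[OF _ _ loc_iso[OF O'(3,1,4)]] O' by simp
  moreover have "\<eta> Y * G1 X Y \<phi> \<in> G1.B.hom (G1o X) (G2o Y)"
    using O \<phi> \<eta> by (intro G1.B.hom_mult[of _ "G1o Y"]) (simp_all add: G1.Fo_in G2.Fo_in G1.F_in)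
  moreover have "G2 X Y \<phi> * \<eta> X \<in> G1.B.hom (G1o X) (G2o Y)"
    using O \<phi> \<eta> by (intro G1.B.hom_mult[of _ "G2o X"]) (simp_all add: G1.Fo_in G2.Fo_in G2.F_in)
  ultimately show ?thesis
    using O'
    by - (rule G1.B.riso_cancel_right[of "G1o U" "G1o X" "G2o Y", OF _ _ _ _ _ _ eq];
        simp add: G1.Fo_in G2.Fo_in)
qed

section \<open>Full subcategories and equivalences\<close>

lemma full_subcategory_simps [simp]:
  "Obj (full_subcategory C P) = {X \<in> Obj C. P X}"
  "Hom (full_subcategory C P) = Hom C" "Idn (full_subcategory C P) = Idn C"
  "Cmp (full_subcategory C P) = Cmp C" "Add (full_subcategory C P) = Add C"
  "Zer (full_subcategory C P) = Zer C" "hom_group (full_subcategory C P) = hom_group C"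
  by (simp_all add: full_subcategory_def hom_group_def fun_eq_iff)

lemma (in preadditive_category) preadditive_full: "preadditive_category (full_subcategory C P)"
  by (rule preadditive_category.intro)
    (auto intro: Idn_in Cmp_in Idn_left Idn_right Cmp_assoc hom_comm_group Cmp_Add_left Cmp_Add_right)

locale full_sub = preadditive_category C for C :: "('o, 'm) acat" + fixes P :: "'o \<Rightarrow> bool"
begin

abbreviation "D \<equiv> full_subcategory C P"

sublocale D: preadditive_category D
  by (rule preadditive_full)

text \<open>The hom-sets of \<open>C\<close> and \<open>D\<close> agree, but \<open>mor\<close>
  records the category, so one morphism gives two different ring elements. \<open>emb\<close> and
  \<open>res\<close> translate between them.\<close>

definition emb :: "'o \<Rightarrow> 'o \<Rightarrow> ('o, 'm) endo \<Rightarrow> ('o, 'm) endo" where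
  "emb X Y a = mor C X Y (D.unmor X Y a)"

definition res :: "'o \<Rightarrow> 'o \<Rightarrow> ('o, 'm) endo \<Rightarrow> ('o, 'm) endo" where
  "res X Y a = mor D X Y (unmor X Y a)"

lemma emb_rfunctor: "rfunctor D C (\<lambda>X. X) emb"
  using D.unmor_in
  by unfold_locales
    (auto simp: emb_def mor_in mor_Cmp[symmetric] mor_Add[symmetric] D.unmor_ops[simplified]
      D.unmor_Idn[symmetric, simplified] ide_def)

lemma res_in: "\<lbrakk>X \<in> Obj D; Y \<in> Obj D; a \<in> hom X Y\<rbrakk> \<Longrightarrow> res X Y a \<in> D.hom X Y"
  using unmor_in[of a X Y] D.mor_in[of _ X Y] by (simp add: res_def)

lemma emb_res [simp]: "\<lbrakk>X \<in> Obj D; Y \<in> Obj D; a \<in> hom X Y\<rbrakk> \<Longrightarrow> emb X Y (res X Y a) = a"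
  using D.unmor_mor[of X Y "unmor X Y a"] unmor_in[of a X Y] by (simp add: emb_def res_def)

lemma res_emb [simp]: "\<lbrakk>X \<in> Obj D; Y \<in> Obj D; a \<in> D.hom X Y\<rbrakk> \<Longrightarrow> res X Y (emb X Y a) = a"
  using unmor_mor[of X Y "D.unmor X Y a"] D.unmor_in[of a X Y] by (simp add: emb_def res_def)

sublocale emb: rfunctor D C "\<lambda>X. X" emb
  by (rule emb_rfunctor)

lemma res_mult:
  assumes O: "X \<in> Obj D" "Y \<in> Obj D" "Z \<in> Obj D" and a: "a \<in> hom X Y" and b: "b \<in> hom Y Z"
  shows "res X Z (b * a) = res Y Z b * res X Y a"
proof -
  have "emb X Z (res Y Z b * res X Y a) = b * a"
    using emb.F_mult[OF O res_in[OF O(1,2) a] res_in[OF O(2,3) b]] emb_res[OF O(1,2) a] emb_res[OF O(2,3) b]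
    by simp
  then show ?thesis
    using res_emb[OF O(1,3) D.hom_mult[OF O res_in[OF O(1,2) a] res_in[OF O(2,3) b]]] by simp
qed

lemma res_add:
  assumes O: "X \<in> Obj D" "Y \<in> Obj D" and a: "a \<in> hom X Y" "b \<in> hom X Y"
  shows "res X Y (a + b) = res X Y a + res X Y b"
proof -
  have "emb X Y (res X Y a + res X Y b) = a + b"
    using emb.F_add[OF O res_in[OF O a(1)] res_in[OF O a(2)]] emb_res[OF O a(1)] emb_res[OF O a(2)] by simp
  then show ?thesis
    using res_emb[OF O D.hom_add[OF O res_in[OF O a(1)] res_in[OF O a(2)]]] by simp
qed

lemma res_ide: "X \<in> Obj D \<Longrightarrow> res X X (ide X) = D.ide X"
  using res_emb[of X X "D.ide X"] emb.F_ide[of X] by simp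

lemma res_iso:
  assumes O: "X \<in> Obj D" "Y \<in> Obj D" and a: "riso X Y a"
  shows "D.riso X Y (res X Y a)"
proof -
  obtain b where b: "a \<in> hom X Y" "b \<in> hom Y X" "b * a = ide X" "a * b = ide Y" using a by (auto simp: riso_def)
  then show ?thesis
    unfolding D.riso_def using res_mult[OF O O(1) b(1,2)] res_mult[OF O(2,1,2) b(2,1)] O
    by (intro conjI bexI[of _ "res Y X b"]) (simp_all add: res_in res_ide)
qed

lemma rfunctor_res:
  assumes "rfunctor A C Fo F" "\<And>X. X \<in> Obj A \<Longrightarrow> P (Fo X)"
  shows "rfunctor A D Fo (\<lambda>X Y a. res (Fo X) (Fo Y) (F X Y a))"
proof -
  interpret F: rfunctor A C Fo F by fact
  note [simp del] = full_subcategory_simps(1)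
  have o: "Fo X \<in> Obj D" if "X \<in> Obj A" for X using assms(2) F.Fo_in that by (simp add: full_subcategory_simps)
  show ?thesis
    by unfold_locales (simp_all add: o F.F_in res_in F.F_ide res_ide F.F_mult F.F_add
        res_mult[OF o o o F.F_in F.F_in] res_add[OF o o F.F_in F.F_in])
qed

text \<open>As the subcategory is full, the structure maps of a biproduct of \<open>C\<close>
  restrict as soon as the object itself satisfies \<open>P\<close>.\<close>

lemma additive_full:
  assumes "Z \<in> Obj C" "P Z" "ide Z = 0"
    and "\<And>X Y. \<lbrakk>X \<in> Obj C; P X; Y \<in> Obj C; P Y\<rbrakk> \<Longrightarrow> \<exists>B i j p q. P B \<and> rbiprod X Y B i j p q"
  shows "additive_category D"
proof (rule D.additive_categoryI)
  show "Z \<in> Obj D" using assms by simp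
  then show "D.ide Z = 0"
    using res_ide[of Z] res_add[of Z Z 0 0] assms by simp
  fix X Y assume O: "X \<in> Obj D" "Y \<in> Obj D"
  then obtain B i j p q where B: "P B" "rbiprod X Y B i j p q" using assms(4) by fastforce
  then have *: "B \<in> Obj D" by (simp add: rbiprod_def)
  have r0: "res X Y 0 = 0" if "X \<in> Obj D" "Y \<in> Obj D" for X Y
    using res_add[OF that, of 0 0] that by simp
  have "D.rbiprod X Y B (res X B i) (res Y B j) (res B X p) (res B Y q)"
    using B(2) O * unfolding D.rbiprod_def rbiprod_def
    by (simp del: full_subcategory_simps(1) add: res_in res_mult[symmetric] res_add[symmetric] res_ide r0
        hom_mult[of B X B p i] hom_mult[of B Y B q j])
  then show "\<exists>B i j p q. D.rbiprod X Y B i j p q" by blast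
qed

end

lemma equivalent_categoriesI:
  fixes C :: "('o, 'm) acat" and D :: "('p, 'n) acat"
  assumes add: "additive_category C" "additive_category D"
    and J: "rfunctor C D Jo J" and H: "rfunctor D C Ho H"
    and \<eta>: "\<And>X. X \<in> Obj C \<Longrightarrow> preadditive_category.riso C X (Ho (Jo X)) (\<eta> X)"
      "\<And>X Y a. \<lbrakk>X \<in> Obj C; Y \<in> Obj C; a \<in> preadditive_category.hom C X Y\<rbrakk>
        \<Longrightarrow> \<eta> Y * a = H (Jo X) (Jo Y) (J X Y a) * \<eta> X"
    and \<epsilon>: "\<And>X. X \<in> Obj D \<Longrightarrow> preadditive_category.riso D (Jo (Ho X)) X (\<epsilon> X)"
      "\<And>X Y a. \<lbrakk>X \<in> Obj D; Y \<in> Obj D; a \<in> preadditive_category.hom D X Y\<rbrakk>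
        \<Longrightarrow> \<epsilon> Y * J (Ho X) (Ho Y) (H X Y a) = a * \<epsilon> X"
  shows "equivalent_categories C D"
proof -
  interpret J: rfunctor C D Jo J by fact
  interpret H: rfunctor D C Ho H by fact
  let ?J = "\<lambda>X Y f. J.B.unmor (Jo X) (Jo Y) (J X Y (mor C X Y f))"
  let ?H = "\<lambda>X Y f. J.A.unmor (Ho X) (Ho Y) (H X Y (mor D X Y f))"
  have "nat_iso C C (\<lambda>X. X) (\<lambda>X Y f. f) (\<lambda>X. Ho (Jo X)) (\<lambda>X Y f. ?H (Jo X) (Jo Y) (?J X Y f))
      (\<lambda>X. J.A.unmor X (Ho (Jo X)) (\<eta> X))"
    unfolding nat_iso_def
  proof (intro conjI ballI)
    fix X assume "X \<in> Obj C"
    then show "is_iso C X (Ho (Jo X)) (J.A.unmor X (Ho (Jo X)) (\<eta> X))"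
      by (intro J.A.is_iso_unmor \<eta>) (simp_all add: J.Fo_in H.Fo_in)
  next
    fix X Y f assume O: "X \<in> Obj C" "Y \<in> Obj C" "f \<in> Hom C X Y"
    have h: "\<eta> X \<in> J.A.hom X (Ho (Jo X))" "\<eta> Y \<in> J.A.hom Y (Ho (Jo Y))"
      using \<eta>(1) O J.A.risoD by blast+
    have "J.A.unmor X Y (mor C X Y f) = f" using O by simp
    then show "Cmp C X Y (Ho (Jo Y)) (J.A.unmor Y (Ho (Jo Y)) (\<eta> Y)) f =
      Cmp C X (Ho (Jo X)) (Ho (Jo Y)) (?H (Jo X) (Jo Y) (?J X Y f)) (J.A.unmor X (Ho (Jo X)) (\<eta> X))"
      using O h \<eta>(2)[OF O(1,2) J.A.mor_in[OF O(3)]]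
        J.A.unmor_Cmp[of X Y "Ho (Jo Y)" "mor C X Y f" "\<eta> Y"]
      by (simp add: J.A.unmor_Cmp J.Fo_in H.Fo_in J.F_in H.F_in J.A.mor_in)
  qed
  moreover have "nat_iso D D (\<lambda>X. Jo (Ho X)) (\<lambda>X Y f. ?J (Ho X) (Ho Y) (?H X Y f)) (\<lambda>X. X) (\<lambda>X Y f. f)
      (\<lambda>X. J.B.unmor (Jo (Ho X)) X (\<epsilon> X))"
    unfolding nat_iso_def
  proof (intro conjI ballI)
    fix X assume "X \<in> Obj D"
    then show "is_iso D (Jo (Ho X)) X (J.B.unmor (Jo (Ho X)) X (\<epsilon> X))"
      by (intro J.B.is_iso_unmor \<epsilon>) (simp_all add: J.Fo_in H.Fo_in)
  next
    fix X Y f assume O: "X \<in> Obj D" "Y \<in> Obj D" "f \<in> Hom D X Y"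
    have h: "\<epsilon> X \<in> J.B.hom (Jo (Ho X)) X" "\<epsilon> Y \<in> J.B.hom (Jo (Ho Y)) Y"
      using \<epsilon>(1) O J.B.risoD by blast+
    have "J.B.unmor X Y (mor D X Y f) = f" using O by simp
    then show "Cmp D (Jo (Ho X)) (Jo (Ho Y)) Y (J.B.unmor (Jo (Ho Y)) Y (\<epsilon> Y)) (?J (Ho X) (Ho Y) (?H X Y f)) =
      Cmp D (Jo (Ho X)) X Y f (J.B.unmor (Jo (Ho X)) X (\<epsilon> X))"
      using O h \<epsilon>(2)[OF O(1,2) J.B.mor_in[OF O(3)]]
        J.B.unmor_Cmp[of "Jo (Ho X)" X Y "\<epsilon> X" "mor D X Y f"]
      by (simp add: J.B.unmor_Cmp J.Fo_in H.Fo_in J.F_in H.F_in J.B.mor_in)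
  qed
  ultimately show ?thesis
    unfolding equivalent_categories_def
    using J.additive_functor[OF add] H.additive_functor[OF add(2,1)] by blast
qed

section \<open>Regular categories\<close>

context preadditive_category
begin

text \<open>Unlike \<open>hom\<close>, membership in \<open>arr\<close> includes that source and target are objects.\<close>

definition arr :: "'o \<Rightarrow> 'o \<Rightarrow> ('o, 'm) endo set" where
  "arr X Y = {a \<in> hom X Y. X \<in> Obj C \<and> Y \<in> Obj C}"

lemma arr_iff: "a \<in> arr X Y \<longleftrightarrow> a \<in> hom X Y \<and> X \<in> Obj C \<and> Y \<in> Obj C"
  by (simp add: arr_def)

lemma arr_obj: "a \<in> arr X Y \<Longrightarrow> X \<in> Obj C" "a \<in> arr X Y \<Longrightarrow> Y \<in> Obj C"
  by (auto simp: arr_def)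

lemma arr_add: "\<lbrakk>a \<in> arr X Y; b \<in> arr X Y\<rbrakk> \<Longrightarrow> a + b \<in> arr X Y"
  and arr_diff: "\<lbrakk>a \<in> arr X Y; b \<in> arr X Y\<rbrakk> \<Longrightarrow> a - b \<in> arr X Y"
  and arr_neg: "a \<in> arr X Y \<Longrightarrow> - a \<in> arr X Y"
  and arr_mult: "\<lbrakk>a \<in> arr X Y; b \<in> arr Y Z\<rbrakk> \<Longrightarrow> b * a \<in> arr X Z"
  and arr_0: "\<lbrakk>X \<in> Obj C; Y \<in> Obj C\<rbrakk> \<Longrightarrow> 0 \<in> arr X Y"
  and arr_ide: "X \<in> Obj C \<Longrightarrow> ide X \<in> arr X X"
  by (auto simp: arr_def intro: hom_add hom_diff hom_neg hom_mult)

lemmas arr_intros = arr_add arr_diff arr_neg arr_mult arr_0 arr_ide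

lemma arr_ide_left: "a \<in> arr X Y \<Longrightarrow> ide Y * a = a"
  and arr_ide_right: "a \<in> arr X Y \<Longrightarrow> a * ide X = a"
  by (auto simp: arr_def)

lemma mor_arr: "\<lbrakk>X \<in> Obj C; Y \<in> Obj C; f \<in> Hom C X Y\<rbrakk> \<Longrightarrow> mor C X Y f \<in> arr X Y"
  by (simp add: arr_def mor_in)

lemma arrE:
  assumes "a \<in> arr X Y"
  obtains f where "X \<in> Obj C" "Y \<in> Obj C" "f \<in> Hom C X Y" "a = mor C X Y f"
  using assms by (auto simp: arr_def hom_def)

lemma ball_arr: "\<lbrakk>X \<in> Obj C; Y \<in> Obj C\<rbrakk> \<Longrightarrow> (\<forall>a\<in>arr X Y. P a) \<longleftrightarrow> (\<forall>f\<in>Hom C X Y. P (mor C X Y f))"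
  by (auto simp: arr_def hom_def)

lemma ex1_arr:
  assumes O: "X \<in> Obj C" "Y \<in> Obj C"
  shows "(\<exists>!a. a \<in> arr X Y \<and> P a) \<longleftrightarrow> (\<exists>!f. f \<in> Hom C X Y \<and> P (mor C X Y f))"
proof
  assume "\<exists>!a. a \<in> arr X Y \<and> P a"
  then obtain a where a: "a \<in> arr X Y" "P a" "\<And>b. b \<in> arr X Y \<Longrightarrow> P b \<Longrightarrow> b = a" by blast
  obtain f where f: "f \<in> Hom C X Y" "a = mor C X Y f" using a(1) by (rule arrE)
  have "g = f" if "g \<in> Hom C X Y" "P (mor C X Y g)" for g
    using a(3)[OF mor_arr[OF O that(1)] that(2)] f that O by (simp add: mor_inject)
  then show "\<exists>!f. f \<in> Hom C X Y \<and> P (mor C X Y f)" using f a(2) by blast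
next
  assume "\<exists>!f. f \<in> Hom C X Y \<and> P (mor C X Y f)"
  then obtain f where f: "f \<in> Hom C X Y" "P (mor C X Y f)"
    "\<And>g. g \<in> Hom C X Y \<Longrightarrow> P (mor C X Y g) \<Longrightarrow> g = f" by blast
  have "a = mor C X Y f" if "a \<in> arr X Y" "P a" for a
    using that(1) by (rule arrE) (use f(3) that(2) in blast)
  then show "\<exists>!a. a \<in> arr X Y \<and> P a"
    using f(1,2) mor_arr[OF O f(1)] by blast
qed

lemma Cmp_eq_iff:
  assumes "X \<in> Obj C" "Y \<in> Obj C" "Z \<in> Obj C" "f \<in> Hom C X Y" "g \<in> Hom C Y Z"
  shows "h \<in> Hom C X Z \<Longrightarrow> Cmp C X Y Z g f = h \<longleftrightarrow> mor C Y Z g * mor C X Y f = mor C X Z h"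
    and "\<lbrakk>Y' \<in> Obj C; f' \<in> Hom C X Y'; g' \<in> Hom C Y' Z\<rbrakk> \<Longrightarrow>
      Cmp C X Y Z g f = Cmp C X Y' Z g' f' \<longleftrightarrow> mor C Y Z g * mor C X Y f = mor C Y' Z g' * mor C X Y' f'"
    and "Cmp C X Y Z g f = Zer C X Z \<longleftrightarrow> mor C Y Z g * mor C X Y f = 0"
  using assms by (simp_all add: mor_inject[symmetric] Cmp_in Zer_in mor_Cmp mor_Zer)

text \<open>By subtraction, cancellability is tested against zero only.\<close>

definition rmono :: "'o \<Rightarrow> 'o \<Rightarrow> ('o, 'm) endo \<Rightarrow> bool" where
  "rmono X Y m \<longleftrightarrow> m \<in> arr X Y \<and> (\<forall>W. \<forall>a\<in>arr W X. m * a = 0 \<longrightarrow> a = 0)"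

lemma rmono_cancel: "\<lbrakk>rmono X Y m; a \<in> arr W X; b \<in> arr W X; m * a = m * b\<rbrakk> \<Longrightarrow> a = b"
  unfolding rmono_def using arr_diff[of a W X b] by (metis eq_iff_diff_eq_0 right_diff_distrib)

lemma is_mono_iff:
  assumes "X \<in> Obj C" "Y \<in> Obj C" "m \<in> Hom C X Y"
  shows "is_mono C X Y m \<longleftrightarrow> rmono X Y (mor C X Y m)"
proof -
  have "rmono X Y (mor C X Y m)" if "is_mono C X Y m"
    unfolding rmono_def
  proof (intro conjI allI ballI impI)
    show "mor C X Y m \<in> arr X Y" using assms by (simp add: mor_arr)
    fix W a assume "a \<in> arr W X" and 0: "mor C X Y m * a = 0"
    then obtain f where f: "W \<in> Obj C" "f \<in> Hom C W X" "a = mor C W X f" by (auto elim: arrE)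
    then have "Cmp C W X Y m f = Cmp C W X Y m (Zer C W X)"
      using 0 assms by (simp add: Cmp_Zer_right Cmp_eq_iff)
    then have "f = Zer C W X" using that f assms Zer_in unfolding is_mono_def by blast
    then show "a = 0" using f assms by (simp add: mor_Zer)
  qed
  moreover have "is_mono C X Y m" if "rmono X Y (mor C X Y m)"
    unfolding is_mono_def
  proof (intro conjI ballI impI)
    fix W a b assume "W \<in> Obj C" "a \<in> Hom C W X" "b \<in> Hom C W X" "Cmp C W X Y m a = Cmp C W X Y m b"
    then show "a = b"
      using rmono_cancel[OF that, of "mor C W X a" W "mor C W X b"] assms
      by (simp add: Cmp_eq_iff mor_arr mor_inject)
  qed (use assms in simp)
  ultimately show ?thesis by blast
qed

text \<open>Uniqueness of the factorization is moved into \<open>rmono\<close>, which leaves a pure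
  existence statement; \<open>rcok\<close> is the dual form.\<close>

definition rker :: "'o \<Rightarrow> 'o \<Rightarrow> 'o \<Rightarrow> ('o, 'm) endo \<Rightarrow> ('o, 'm) endo \<Rightarrow> bool" where
  "rker K X Y k f \<longleftrightarrow> rmono K X k \<and> f \<in> arr X Y \<and> f * k = 0 \<and>
    (\<forall>W. \<forall>g\<in>arr W X. f * g = 0 \<longrightarrow> (\<exists>h\<in>arr W K. k * h = g))"

lemma is_kernel_iff:
  assumes O: "K \<in> Obj C" "X \<in> Obj C" "Y \<in> Obj C" "k \<in> Hom C K X" "f \<in> Hom C X Y"
  shows "is_kernel C K X Y k f \<longleftrightarrow> rker K X Y (mor C K X k) (mor C X Y f)" (is "_ \<longleftrightarrow> rker K X Y ?k ?f")
proof -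
  have kf: "?k \<in> arr K X" "?f \<in> arr X Y" using O by (simp_all add: mor_arr)
  have "is_kernel C K X Y k f \<longleftrightarrow> ?f * ?k = 0 \<and>
    (\<forall>W\<in>Obj C. \<forall>g\<in>arr W X. ?f * g = 0 \<longrightarrow> (\<exists>!h. h \<in> arr W K \<and> ?k * h = g))"
    using O by (simp add: is_kernel_def ball_arr ex1_arr Cmp_eq_iff cong: conj_cong)
  also have "\<dots> \<longleftrightarrow> rker K X Y ?k ?f"
  proof
    assume a: "?f * ?k = 0 \<and>
      (\<forall>W\<in>Obj C. \<forall>g\<in>arr W X. ?f * g = 0 \<longrightarrow> (\<exists>!h. h \<in> arr W K \<and> ?k * h = g))"
    have "h = 0" if "h \<in> arr W K" "?k * h = 0" for W h
    proof -
      have "\<exists>!h. h \<in> arr W K \<and> ?k * h = 0" using a arr_obj(1)[OF that(1)] arr_0 O by simp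
      then show ?thesis using that arr_0[OF arr_obj[OF that(1)]] by auto
    qed
    then show "rker K X Y ?k ?f" unfolding rker_def rmono_def using a kf arr_obj by blast
  next
    assume r: "rker K X Y ?k ?f"
    then have m: "rmono K X ?k" by (simp add: rker_def)
    have "\<exists>!h. h \<in> arr W K \<and> ?k * h = g" if "g \<in> arr W X" "?f * g = 0" for W g
      using r rmono_cancel[OF m] that unfolding rker_def by metis
    then show "?f * ?k = 0 \<and>
      (\<forall>W\<in>Obj C. \<forall>g\<in>arr W X. ?f * g = 0 \<longrightarrow> (\<exists>!h. h \<in> arr W K \<and> ?k * h = g))"
      using r by (simp add: rker_def)
  qed
  finally show ?thesis .
qed

definition repi :: "'o \<Rightarrow> 'o \<Rightarrow> ('o, 'm) endo \<Rightarrow> bool" where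
  "repi X Y q \<longleftrightarrow> q \<in> arr X Y \<and> (\<forall>W. \<forall>a\<in>arr Y W. a * q = 0 \<longrightarrow> a = 0)"

lemma repi_cancel: "\<lbrakk>repi X Y q; a \<in> arr Y W; b \<in> arr Y W; a * q = b * q\<rbrakk> \<Longrightarrow> a = b"
  unfolding repi_def using arr_diff[of a Y W b] by (metis eq_iff_diff_eq_0 left_diff_distrib)

definition rcok :: "'o \<Rightarrow> 'o \<Rightarrow> 'o \<Rightarrow> ('o, 'm) endo \<Rightarrow> ('o, 'm) endo \<Rightarrow> bool" where
  "rcok X Y Q f q \<longleftrightarrow> repi Y Q q \<and> f \<in> arr X Y \<and> q * f = 0 \<and>
    (\<forall>W. \<forall>g\<in>arr Y W. g * f = 0 \<longrightarrow> (\<exists>h\<in>arr Q W. h * q = g))"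

lemma is_cokernel_iff:
  assumes O: "X \<in> Obj C" "Y \<in> Obj C" "Q \<in> Obj C" "f \<in> Hom C X Y" "q \<in> Hom C Y Q"
  shows "is_cokernel C X Y Q f q \<longleftrightarrow> rcok X Y Q (mor C X Y f) (mor C Y Q q)" (is "_ \<longleftrightarrow> rcok X Y Q ?f ?q")
proof -
  have kf: "?q \<in> arr Y Q" "?f \<in> arr X Y" using O by (simp_all add: mor_arr)
  have "is_cokernel C X Y Q f q \<longleftrightarrow> ?q * ?f = 0 \<and>
    (\<forall>W\<in>Obj C. \<forall>g\<in>arr Y W. g * ?f = 0 \<longrightarrow> (\<exists>!h. h \<in> arr Q W \<and> h * ?q = g))"
    using O by (simp add: is_cokernel_def ball_arr ex1_arr Cmp_eq_iff cong: conj_cong)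
  also have "\<dots> \<longleftrightarrow> rcok X Y Q ?f ?q"
  proof
    assume a: "?q * ?f = 0 \<and>
      (\<forall>W\<in>Obj C. \<forall>g\<in>arr Y W. g * ?f = 0 \<longrightarrow> (\<exists>!h. h \<in> arr Q W \<and> h * ?q = g))"
    have "h = 0" if "h \<in> arr Q W" "h * ?q = 0" for W h
    proof -
      have "\<exists>!h. h \<in> arr Q W \<and> h * ?q = 0" using a arr_obj(2)[OF that(1)] arr_0 O by simp
      then show ?thesis using that arr_0[OF arr_obj[OF that(1)]] by auto
    qed
    then show "rcok X Y Q ?f ?q" unfolding rcok_def repi_def using a kf arr_obj by blast
  next
    assume r: "rcok X Y Q ?f ?q"
    then have m: "repi Y Q ?q" by (simp add: rcok_def)
    have "\<exists>!h. h \<in> arr Q W \<and> h * ?q = g" if "g \<in> arr Y W" "g * ?f = 0" for W g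
      using r repi_cancel[OF m] that unfolding rcok_def by metis
    then show "?q * ?f = 0 \<and>
      (\<forall>W\<in>Obj C. \<forall>g\<in>arr Y W. g * ?f = 0 \<longrightarrow> (\<exists>!h. h \<in> arr Q W \<and> h * ?q = g))"
      using r by (simp add: rcok_def)
  qed
  finally show ?thesis .
qed

text \<open>The last clause says that \<open>a\<close> and \<open>b\<close> are jointly monic; by
  subtraction this is the uniqueness in the universal property.\<close>

definition rpb where
  "rpb P X Y Z a b f g \<longleftrightarrow> a \<in> arr P X \<and> b \<in> arr P Y \<and> f \<in> arr X Z \<and> g \<in> arr Y Z \<and> f * a = g * b \<and>
    (\<forall>W. \<forall>x\<in>arr W X. \<forall>y\<in>arr W Y. f * x = g * y \<longrightarrow> (\<exists>h\<in>arr W P. a * h = x \<and> b * h = y)) \<and>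
    (\<forall>W. \<forall>h\<in>arr W P. a * h = 0 \<longrightarrow> b * h = 0 \<longrightarrow> h = 0)"

definition rpo where
  "rpo P X Y Z a b f g \<longleftrightarrow> a \<in> arr P X \<and> b \<in> arr P Y \<and> f \<in> arr X Z \<and> g \<in> arr Y Z \<and> f * a = g * b \<and>
    (\<forall>W. \<forall>x\<in>arr X W. \<forall>y\<in>arr Y W. x * a = y * b \<longrightarrow> (\<exists>h\<in>arr Z W. h * f = x \<and> h * g = y)) \<and>
    (\<forall>W. \<forall>h\<in>arr Z W. h * f = 0 \<longrightarrow> h * g = 0 \<longrightarrow> h = 0)"

lemma is_pullback_iff:
  assumes O: "P \<in> Obj C" "X \<in> Obj C" "Y \<in> Obj C" "Z \<in> Obj C"
    "a \<in> Hom C P X" "b \<in> Hom C P Y" "f \<in> Hom C X Z" "g \<in> Hom C Y Z"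
  shows "is_pullback C P X Y Z a b f g \<longleftrightarrow> rpb P X Y Z (mor C P X a) (mor C P Y b) (mor C X Z f) (mor C Y Z g)"
    (is "_ \<longleftrightarrow> rpb P X Y Z ?a ?b ?f ?g")
proof -
  have A: "?a \<in> arr P X" "?b \<in> arr P Y" "?f \<in> arr X Z" "?g \<in> arr Y Z" using O by (simp_all add: mor_arr)
  have "is_pullback C P X Y Z a b f g \<longleftrightarrow> ?f * ?a = ?g * ?b \<and>
    (\<forall>W\<in>Obj C. \<forall>x\<in>arr W X. \<forall>y\<in>arr W Y. ?f * x = ?g * y \<longrightarrow> (\<exists>!h. h \<in> arr W P \<and> ?a * h = x \<and> ?b * h = y))"
  proof -
    have 1: "(\<exists>!h. h \<in> Hom C W P \<and> Cmp C W P X a h = x \<and> Cmp C W P Y b h = y) \<longleftrightarrow>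
        (\<exists>!h. h \<in> arr W P \<and> ?a * h = mor C W X x \<and> ?b * h = mor C W Y y)"
      if "W \<in> Obj C" "x \<in> Hom C W X" "y \<in> Hom C W Y" for W x y
      using O that by (simp add: ex1_arr Cmp_eq_iff(1) cong: conj_cong)
    have 2: "Cmp C W X Z f x = Cmp C W Y Z g y \<longleftrightarrow> ?f * mor C W X x = ?g * mor C W Y y"
      if "W \<in> Obj C" "x \<in> Hom C W X" "y \<in> Hom C W Y" for W x y
      using O that by (intro Cmp_eq_iff(2))
    show ?thesis
      using O 2[of P a b] by (simp add: is_pullback_def comm_square_def ball_arr 1 2)
  qed
  also have "\<dots> \<longleftrightarrow> rpb P X Y Z ?a ?b ?f ?g"
  proof
    assume a: "?f * ?a = ?g * ?b \<and>
    (\<forall>W\<in>Obj C. \<forall>x\<in>arr W X. \<forall>y\<in>arr W Y. ?f * x = ?g * y \<longrightarrow> (\<exists>!h. h \<in> arr W P \<and> ?a * h = x \<and> ?b * h = y))"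
    have "h = 0" if h: "h \<in> arr W P" "?a * h = 0" "?b * h = 0" for W h
    proof -
      have "\<exists>!h. h \<in> arr W P \<and> ?a * h = 0 \<and> ?b * h = 0" using a arr_obj(1)[OF h(1)] arr_0 O by simp
      then show ?thesis using h arr_0[OF arr_obj[OF h(1)]] by (metis mult_zero_right)
    qed
    then show "rpb P X Y Z ?a ?b ?f ?g" unfolding rpb_def using a A arr_obj by blast
  next
    assume r: "rpb P X Y Z ?a ?b ?f ?g"
    have "\<exists>!h. h \<in> arr W P \<and> ?a * h = x \<and> ?b * h = y" if xy: "x \<in> arr W X" "y \<in> arr W Y" "?f * x = ?g * y" for W x y
    proof (rule ex_ex1I)
      show "\<exists>h. h \<in> arr W P \<and> ?a * h = x \<and> ?b * h = y" using r xy unfolding rpb_def by blast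
      fix h h' assume h: "h \<in> arr W P \<and> ?a * h = x \<and> ?b * h = y" "h' \<in> arr W P \<and> ?a * h' = x \<and> ?b * h' = y"
      then have "h - h' \<in> arr W P" "?a * (h - h') = 0" "?b * (h - h') = 0"
        by (auto simp: right_diff_distrib intro: arr_diff)
      then have "h - h' = 0" using r unfolding rpb_def by blast
      then show "h = h'" by simp
    qed
    then show "?f * ?a = ?g * ?b \<and>
      (\<forall>W\<in>Obj C. \<forall>x\<in>arr W X. \<forall>y\<in>arr W Y. ?f * x = ?g * y \<longrightarrow> (\<exists>!h. h \<in> arr W P \<and> ?a * h = x \<and> ?b * h = y))"
      using r by (simp add: rpb_def)
  qed
  finally show ?thesis .
qed

lemma is_pushout_iff:
  assumes O: "P \<in> Obj C" "X \<in> Obj C" "Y \<in> Obj C" "Z \<in> Obj C"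
    "a \<in> Hom C P X" "b \<in> Hom C P Y" "f \<in> Hom C X Z" "g \<in> Hom C Y Z"
  shows "is_pushout C P X Y Z a b f g \<longleftrightarrow> rpo P X Y Z (mor C P X a) (mor C P Y b) (mor C X Z f) (mor C Y Z g)"
    (is "_ \<longleftrightarrow> rpo P X Y Z ?a ?b ?f ?g")
proof -
  have A: "?a \<in> arr P X" "?b \<in> arr P Y" "?f \<in> arr X Z" "?g \<in> arr Y Z" using O by (simp_all add: mor_arr)
  have "is_pushout C P X Y Z a b f g \<longleftrightarrow> ?f * ?a = ?g * ?b \<and>
    (\<forall>W\<in>Obj C. \<forall>x\<in>arr X W. \<forall>y\<in>arr Y W. x * ?a = y * ?b \<longrightarrow> (\<exists>!h. h \<in> arr Z W \<and> h * ?f = x \<and> h * ?g = y))"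
  proof -
    have 1: "(\<exists>!h. h \<in> Hom C Z W \<and> Cmp C X Z W h f = x \<and> Cmp C Y Z W h g = y) \<longleftrightarrow>
        (\<exists>!h. h \<in> arr Z W \<and> h * ?f = mor C X W x \<and> h * ?g = mor C Y W y)"
      if "W \<in> Obj C" "x \<in> Hom C X W" "y \<in> Hom C Y W" for W x y
      using O that by (simp add: ex1_arr Cmp_eq_iff(1) cong: conj_cong)
    have 2: "Cmp C P X W x a = Cmp C P Y W y b \<longleftrightarrow> mor C X W x * ?a = mor C Y W y * ?b"
      if "W \<in> Obj C" "x \<in> Hom C X W" "y \<in> Hom C Y W" for W x y
      using O that by (intro Cmp_eq_iff(2))
    show ?thesis
      using O 2[of Z f g] by (simp add: is_pushout_def comm_square_def ball_arr 1 2)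
  qed
  also have "\<dots> \<longleftrightarrow> rpo P X Y Z ?a ?b ?f ?g"
  proof
    assume a: "?f * ?a = ?g * ?b \<and>
    (\<forall>W\<in>Obj C. \<forall>x\<in>arr X W. \<forall>y\<in>arr Y W. x * ?a = y * ?b \<longrightarrow> (\<exists>!h. h \<in> arr Z W \<and> h * ?f = x \<and> h * ?g = y))"
    have "h = 0" if h: "h \<in> arr Z W" "h * ?f = 0" "h * ?g = 0" for W h
    proof -
      have "\<exists>!h. h \<in> arr Z W \<and> h * ?f = 0 \<and> h * ?g = 0" using a arr_obj(2)[OF h(1)] arr_0 O by simp
      then show ?thesis using h arr_0[OF arr_obj[OF h(1)]] by (metis mult_zero_left)
    qed
    then show "rpo P X Y Z ?a ?b ?f ?g" unfolding rpo_def using a A arr_obj by blast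
  next
    assume r: "rpo P X Y Z ?a ?b ?f ?g"
    have "\<exists>!h. h \<in> arr Z W \<and> h * ?f = x \<and> h * ?g = y" if xy: "x \<in> arr X W" "y \<in> arr Y W" "x * ?a = y * ?b" for W x y
    proof (rule ex_ex1I)
      show "\<exists>h. h \<in> arr Z W \<and> h * ?f = x \<and> h * ?g = y" using r xy unfolding rpo_def by blast
      fix h h' assume h: "h \<in> arr Z W \<and> h * ?f = x \<and> h * ?g = y" "h' \<in> arr Z W \<and> h' * ?f = x \<and> h' * ?g = y"
      then have "h - h' \<in> arr Z W" "(h - h') * ?f = 0" "(h - h') * ?g = 0"
        by (auto simp: left_diff_distrib intro: arr_diff)
      then have "h - h' = 0" using r unfolding rpo_def by blast
      then show "h = h'" by simp
    qed
    then show "?f * ?a = ?g * ?b \<and>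
      (\<forall>W\<in>Obj C. \<forall>x\<in>arr X W. \<forall>y\<in>arr Y W. x * ?a = y * ?b \<longrightarrow> (\<exists>!h. h \<in> arr Z W \<and> h * ?f = x \<and> h * ?g = y))"
      using r by (simp add: rpo_def)
  qed
  finally show ?thesis .
qed

section \<open>Covers, images and kernels in an additive regular category\<close>

definition cover :: "'o \<Rightarrow> 'o \<Rightarrow> ('o, 'm) endo \<Rightarrow> bool" where
  "cover Y Q q \<longleftrightarrow> (\<exists>X f. rcok X Y Q f q)"

lemma cover_arr: "cover Y Q q \<Longrightarrow> q \<in> arr Y Q"
  by (auto simp: cover_def rcok_def repi_def)

lemma cover_epi: "cover Y Q q \<Longrightarrow> repi Y Q q"
  by (auto simp: cover_def rcok_def)

lemma cover_cancel: "\<lbrakk>cover Y Q q; a * q = b * q; a \<in> arr Q W; b \<in> arr Q W\<rbrakk> \<Longrightarrow> a = b"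
  using cover_epi repi_cancel by blast

lemma cokernel_mor_cover: "cokernel_mor C Y Q q \<Longrightarrow> cover Y Q (mor C Y Q q) \<and> q \<in> Hom C Y Q"
  unfolding cokernel_mor_def cover_def
  using is_cokernel_iff by (metis is_cokernel_def)

lemma cover_cokernel_mor:
  assumes "cover Y Q (mor C Y Q q)" "q \<in> Hom C Y Q"
  shows "cokernel_mor C Y Q q"
proof -
  obtain X f where r: "rcok X Y Q f (mor C Y Q q)" using assms by (auto simp: cover_def)
  then have f: "f \<in> arr X Y" by (simp add: rcok_def)
  then obtain f' where "X \<in> Obj C" "Y \<in> Obj C" "f' \<in> Hom C X Y" "f = mor C X Y f'" by (rule arrE)
  then show ?thesis
    unfolding cokernel_mor_def using is_cokernel_iff[of X Y Q f' q] r arr_obj cover_arr assms by blast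
qed

text \<open>Covers are orthogonal to monomorphisms: if \<open>e\<close> is the cokernel of
  \<open>f\<close>, then \<open>m * a * f = b * e * f = 0\<close>, hence \<open>a * f = 0\<close>,
  and \<open>a\<close> descends along \<open>e\<close>. In this form local solutions become global
  ones.\<close>

lemma cover_lift:
  assumes e: "cover W' W e" and m: "rmono X Y m" and a: "a \<in> arr W' X" and b: "b \<in> arr W Y"
    and eq: "m * a = b * e"
  obtains c where "c \<in> arr W X" "c * e = a" "m * c = b"
proof -
  obtain V f where f: "rcok V W' W f e" using e by (auto simp: cover_def)
  have fa: "f \<in> arr V W'" "e * f = 0" using f by (auto simp: rcok_def)
  have "m * (a * f) = b * (e * f)" using eq by (simp add: mult.assoc[symmetric])
  then have "m * (a * f) = 0" using fa by simp
  then have "a * f = 0" using m arr_mult[OF fa(1) a] by (auto simp: rmono_def)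
  then obtain c where c: "c \<in> arr W X" "c * e = a" using f a by (auto simp: rcok_def)
  have ma: "m \<in> arr X Y" using m by (simp add: rmono_def)
  have "m * c = b"
  proof (rule cover_cancel[OF e])
    show "m * c * e = b * e" using eq c by (simp add: mult.assoc)
    show "m * c \<in> arr W Y" using arr_mult[OF c(1) ma] .
  qed (rule b)
  then show ?thesis using that c by blast
qed

lemma cover_iso:
  assumes e: "cover W' W e" and i: "i \<in> arr W V" "j \<in> arr V W" "j * i = ide W" "i * j = ide V"
  shows "cover W' V (i * e)"
proof -
  obtain U f where f: "rcok U W' W f e" using e by (auto simp: cover_def)
  have ea: "e \<in> arr W' W" using e by (rule cover_arr)
  have "rcok U W' V f (i * e)"
    unfolding rcok_def repi_def
  proof (intro conjI allI ballI impI)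
    show "i * e \<in> arr W' V" using arr_mult[OF ea i(1)] .
    show "f \<in> arr U W'" using f by (simp add: rcok_def)
    show "i * e * f = 0" using f by (simp add: rcok_def mult.assoc)
    fix T a assume a: "a \<in> arr V T"
    { assume "a * (i * e) = 0"
      then have "a * i = 0" using f arr_mult[OF i(1) a] by (auto simp: rcok_def repi_def mult.assoc)
      then have "a * (i * j) = 0" by (simp add: mult.assoc[symmetric])
      then show "a = 0" using i arr_ide_right[OF a] by simp }
  next
    fix T g assume g: "g \<in> arr W' T" "g * f = 0"
    then obtain h where h: "h \<in> arr W T" "h * e = g" using f by (auto simp: rcok_def)
    have "h * j * (i * e) = h * (j * i) * e" by (simp add: mult.assoc)
    then show "\<exists>h\<in>arr V T. h * (i * e) = g"
      using h i arr_mult[OF i(2) h(1)] arr_ide_right[OF h(1)] by (intro bexI[of _ "h * j"]) auto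
  qed
  then show ?thesis by (auto simp: cover_def)
qed

end

context additive_regular_category
begin

lemma ex_zero: obtains Z where "Z \<in> Obj C" "ide Z = 0"
  using ex_zero_obj by (auto simp: zero_obj_iff)

lemma cover_ide: assumes X: "X \<in> Obj C" shows "cover X X (ide X)"
proof -
  obtain Z where "Z \<in> Obj C" "ide Z = 0" by (rule ex_zero)
  then have "rcok Z X X 0 (ide X)"
    using X unfolding rcok_def repi_def by (auto simp: arr_intros arr_ide_right)
  then show ?thesis by (auto simp: cover_def)
qed

lemma image:
  assumes f: "f \<in> arr X Y"
  obtains I p m where "cover X I p" "rmono I Y m" "f = m * p"
proof -
  obtain f' where f': "X \<in> Obj C" "Y \<in> Obj C" "f' \<in> Hom C X Y" "f = mor C X Y f'" using f by (rule arrE)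
  then obtain I p m where I: "I \<in> Obj C" "cokernel_mor C X I p" "is_mono C I Y m" "f' = Cmp C X I Y m p"
    using Reg1 by blast
  then have "m \<in> Hom C I Y" by (simp add: is_mono_def)
  then show ?thesis
    using that[of I "mor C X I p" "mor C I Y m"] I f' cokernel_mor_cover[OF I(2)]
    by (simp add: is_mono_iff mor_Cmp)
qed

text \<open>A converse to orthogonality: the image \<open>m\<close> of \<open>f\<close> is monic and
  by hypothesis has a right inverse, so it is invertible, and \<open>f\<close> is a cover followed
  by an isomorphism. \<open>cover_comp\<close> and \<open>cover_factor\<close> rest on this
  criterion.\<close>

lemma cover_of_lifting:
  assumes f: "f \<in> arr X Y"
    and lift: "\<And>I m a. \<lbrakk>rmono I Y m; a \<in> arr X I; m * a = f\<rbrakk> \<Longrightarrow> \<exists>c\<in>arr Y I. m * c = ide Y"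
  shows "cover X Y f"
proof -
  obtain I p m where I: "cover X I p" "rmono I Y m" "f = m * p" using image[OF f] .
  have m: "m \<in> arr I Y" using I by (simp add: rmono_def)
  obtain c where c: "c \<in> arr Y I" "m * c = ide Y" using lift[OF I(2) cover_arr[OF I(1)]] I(3) by auto
  have "m * (c * m) = m * ide I"
    using c arr_ide_left[OF m] arr_ide_right[OF m] by (simp add: mult.assoc[symmetric])
  then have "c * m = ide I"
    using rmono_cancel[OF I(2) arr_mult[OF m c(1)] arr_ide[OF arr_obj(1)[OF m]]] by simp
  then show ?thesis using cover_iso[OF I(1) m c(1)] c I(3) by simp
qed

text \<open>A factorization through a monomorphism is lifted twice, first along \<open>d\<close> and
  then along \<open>e\<close>.\<close>

lemma cover_comp:
  assumes e: "cover V W e" and d: "cover U V d"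
  shows "cover U W (e * d)"
proof (rule cover_of_lifting)
  show "e * d \<in> arr U W" using arr_mult cover_arr e d by blast
  fix I m a assume m: "rmono I W m" "a \<in> arr U I" "m * a = e * d"
  obtain c where c: "c \<in> arr V I" "m * c = e"
    using cover_lift[OF d m(1,2) cover_arr[OF e]] m(3) by metis
  have "W \<in> Obj C" using cover_arr[OF e] arr_obj by blast
  then obtain c' where "c' \<in> arr W I" "m * c' = ide W"
    using cover_lift[OF e m(1) c(1) arr_ide] c(2) arr_ide_left[OF cover_arr[OF e]] by metis
  then show "\<exists>c\<in>arr W I. m * c = ide W" by blast
qed

text \<open>If \<open>p\<close> factors through a monomorphism, so does the cover
  \<open>p * h\<close>, and orthogonality splits the monomorphism. Thus a morphism through which
  some cover of its target factors is itself a cover.\<close>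

lemma cover_factor:
  assumes ph: "cover W Y (p * h)" and h: "h \<in> arr W X" and p: "p \<in> arr X Y"
  shows "cover X Y p"
proof (rule cover_of_lifting[OF p])
  fix I m a assume m: "rmono I Y m" "a \<in> arr X I" "m * a = p"
  have "Y \<in> Obj C" using p arr_obj by blast
  then obtain c where "c \<in> arr Y I" "m * c = ide Y"
    using cover_lift[OF ph m(1) arr_mult[OF h m(2)] arr_ide] m(3) arr_ide_left[OF cover_arr[OF ph]]
    by (metis mult.assoc)
  then show "\<exists>c\<in>arr Y I. m * c = ide Y" by blast
qed

lemma pullback_cover:
  assumes e: "cover X Z e" and g: "g \<in> arr Y Z"
  obtains P a b where "rpb P X Y Z a b e g" "cover P Y b"
proof -
  obtain e' where e': "X \<in> Obj C" "Z \<in> Obj C" "e' \<in> Hom C X Z" "e = mor C X Z e'"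
    using cover_arr[OF e] by (rule arrE)
  obtain g' where g': "Y \<in> Obj C" "g' \<in> Hom C Y Z" "g = mor C Y Z g'"
    using g by (rule arrE)
  have c: "cokernel_mor C X Z e'" using cover_cokernel_mor e e' by blast
  then obtain P a b where P: "is_pullback C P X Y Z a b e' g'" using Reg2_ex e' g' by blast
  then have "P \<in> Obj C" "a \<in> Hom C P X" "b \<in> Hom C P Y" by (auto simp: is_pullback_def comm_square_def)
  then show ?thesis
    using that[of P "mor C P X a" "mor C P Y b"] is_pullback_iff[of P X Y Z a b e' g'] P e' g'
      cokernel_mor_cover[OF Reg2_coker[OF c P]] by simp
qed

lemma cover_pullback:
  assumes e: "cover W' W e" and g: "g \<in> arr V W"
  obtains V' e' g' where "cover V' V e'" "g' \<in> arr V' W'" "e * g' = g * e'"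
proof -
  obtain P a b where "rpb P W' V W a b e g" "cover P V b" using pullback_cover[OF e g] .
  then show ?thesis using that unfolding rpb_def by blast
qed

text \<open>With \<open>f = m * p\<close>, the kernel of \<open>f\<close> is that of the cover
  \<open>p\<close>, and this is the pullback of \<open>p\<close> along the morphism from a zero
  object, which Reg2 provides.\<close>

lemma kernel_exists:
  assumes f: "f \<in> arr X Y"
  obtains K k where "rker K X Y k f"
proof -
  obtain I p m where I: "cover X I p" "rmono I Y m" "f = m * p" using image[OF f] .
  obtain Z where Z: "Z \<in> Obj C" "ide Z = 0" by (rule ex_zero)
  have Io: "I \<in> Obj C" using cover_arr[OF I(1)] arr_obj by blast
  obtain P a b where P: "rpb P X Z I a b p 0" using pullback_cover[OF I(1) arr_0[OF Z(1) Io]] by blast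
  have z: "b = 0" if "b \<in> arr W Z" for W b using arr_ide_left[OF that] Z by simp
  have P': "a \<in> arr P X" "p * a = 0" "b \<in> arr P Z" using P by (auto simp: rpb_def)
  have "rker P X Y a f"
    unfolding rker_def rmono_def
  proof (intro conjI allI ballI impI)
    fix W h assume h: "h \<in> arr W P" "a * h = 0"
    then show "h = 0" using P z[OF arr_mult[OF h(1) P'(3)]] unfolding rpb_def by blast
  next
    fix W g assume g: "g \<in> arr W X" "f * g = 0"
    have "p * g = 0 * 0"
      using I g arr_mult[OF g(1) cover_arr[OF I(1)]] by (auto simp: rmono_def mult.assoc)
    moreover have "0 \<in> arr W Z" using arr_0 arr_obj g Z by blast
    ultimately show "\<exists>h\<in>arr W P. a * h = g" using P g unfolding rpb_def by blast
  qed (use P' I f in \<open>auto simp: mult.assoc\<close>)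
  then show ?thesis using that by blast
qed

text \<open>A cokernel is the cokernel of its kernel, and a cover \<open>g\<close> in front of the
  kernel does not change the cokernel. The kernel may be that of another morphism \<open>e'\<close>
  annihilating the same elements; in the application \<open>e'\<close> is a differential and
  \<open>e\<close> its corestriction.\<close>

lemma cover_cokernel_of_kernel:
  assumes e: "cover Y Q e" and k: "rker K Y Q' k e'" and ee: "\<And>W a. a \<in> arr W Y \<Longrightarrow> e * a = 0 \<longleftrightarrow> e' * a = 0"
    and g: "cover X K g"
  shows "rcok X Y Q (k * g) e"
proof -
  obtain V f where f: "rcok V Y Q f e" using e by (auto simp: cover_def)
  have ka: "k \<in> arr K Y" "e' * k = 0" using k by (auto simp: rker_def rmono_def)
  have fa: "f \<in> arr V Y" "e * f = 0" using f by (auto simp: rcok_def)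
  show ?thesis
    unfolding rcok_def
  proof (intro conjI allI ballI impI)
    show "repi Y Q e" using f by (simp add: rcok_def)
    show "k * g \<in> arr X Y" using arr_mult[OF cover_arr[OF g] ka(1)] .
    have "e * k = 0" using ee[OF ka(1)] ka(2) by simp
    then show "e * (k * g) = 0" by (simp add: mult.assoc[symmetric])
    fix W t assume t: "t \<in> arr Y W" "t * (k * g) = 0"
    have tk: "t * k \<in> arr K W" using arr_mult[OF ka(1) t(1)] .
    have "0 \<in> arr K W" using tk arr_0 arr_obj by blast
    then have tk0: "t * k = 0" using cover_cancel[OF g, of "t * k" 0 W] t(2) tk by (simp add: mult.assoc)
    obtain h where h: "h \<in> arr V K" "k * h = f"
      using k fa ee[OF fa(1)] unfolding rker_def by blast
    have "t * f = t * k * h" using h by (simp add: mult.assoc)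
    then show "\<exists>h\<in>arr Q W. h * e = t" using f t(1) tk0 by (auto simp: rcok_def)
  qed
qed

end

section \<open>Complexes and the homotopy category\<close>

context additive_category
begin

definition dd :: "('a, 'b) cpx \<Rightarrow> int \<Rightarrow> ('a, 'b) endo" where
  "dd X n = mor C (ob X n) (ob X (n + 1)) (df X n)"

definition mk_cpx :: "(int \<Rightarrow> 'a) \<Rightarrow> (int \<Rightarrow> ('a, 'b) endo) \<Rightarrow> ('a, 'b) cpx" where
  "mk_cpx Xo d = (Xo, \<lambda>n. unmor (Xo n) (Xo (n + 1)) (d n))"

lemma ob_mk [simp]: "ob (mk_cpx Xo d) n = Xo n"
  by (simp add: mk_cpx_def)

lemma dd_mk: "d n \<in> arr (Xo n) (Xo (n + 1)) \<Longrightarrow> dd (mk_cpx Xo d) n = d n"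
  by (simp add: dd_def mk_cpx_def arr_iff)

lemma add_1_1: "n + 1 + 1 = n + (2::int)" and diff_1_add_2: "n - 1 + 2 = n + (1::int)"
  by simp_all

lemma is_complexD:
  assumes "is_complex C X"
  shows ob_in: "ob X n \<in> Obj C" and df_in: "df X n \<in> Hom C (ob X n) (ob X (n + 1))"
    and dd_arr: "dd X n \<in> arr (ob X n) (ob X (n + 1))"
    and dd_arr': "dd X (n - 1) \<in> arr (ob X (n - 1)) (ob X n)"
    and dd_dd: "dd X (n + 1) * dd X n = 0"
    and dd_dd': "dd X n * dd X (n - 1) = 0"
proof -
  have *: "ob X n \<in> Obj C" "df X n \<in> Hom C (ob X n) (ob X (n + 1))"
    "Cmp C (ob X n) (ob X (n + 1)) (ob X (n + 2)) (df X (n + 1)) (df X n) = Zer C (ob X n) (ob X (n + 2))" for n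
    using assms unfolding is_complex_def by blast+
  show "ob X n \<in> Obj C" "df X n \<in> Hom C (ob X n) (ob X (n + 1))" using * by blast+
  show a: "dd X n \<in> arr (ob X n) (ob X (n + 1))" for n using * by (simp add: dd_def mor_arr)
  show "dd X (n - 1) \<in> arr (ob X (n - 1)) (ob X n)" using a[of "n - 1"] by simp
  show b: "dd X (n + 1) * dd X n = 0" for n
    using *(3)[of n] *(2)[of "n + 1"] * unfolding dd_def add_1_1
    by (subst (asm) Cmp_eq_iff) simp_all
  show "dd X n * dd X (n - 1) = 0" using b[of "n - 1"] by simp
qed

lemma is_complex_mk:
  assumes "\<And>n. d n \<in> arr (Xo n) (Xo (n + 1))" "\<And>n. d (n + 1) * d n = 0"
  shows "is_complex C (mk_cpx Xo d)"
  unfolding is_complex_def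
proof (intro allI conjI)
  fix n
  have O: "Xo n \<in> Obj C" for n using assms(1) arr_obj by blast
  have d: "unmor (Xo n) (Xo (n + 1)) (d n) \<in> Hom C (Xo n) (Xo (n + 1))"
    "mor C (Xo n) (Xo (n + 1)) (unmor (Xo n) (Xo (n + 1)) (d n)) = d n" for n
    using assms(1) by (simp_all add: arr_iff unmor_in)
  show "ob (mk_cpx Xo d) n \<in> Obj C"
    "df (mk_cpx Xo d) n \<in> Hom C (ob (mk_cpx Xo d) n) (ob (mk_cpx Xo d) (n + 1))"
    using O d by (simp_all add: mk_cpx_def)
  show "Cmp C (ob (mk_cpx Xo d) n) (ob (mk_cpx Xo d) (n + 1)) (ob (mk_cpx Xo d) (n + 2))
     (df (mk_cpx Xo d) (n + 1)) (df (mk_cpx Xo d) n) = Zer C (ob (mk_cpx Xo d) n) (ob (mk_cpx Xo d) (n + 2))"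
    using O d[of n] d[of "n + 1"] assms(2)[of n]
    by (simp add: mk_cpx_def add_1_1 Cmp_eq_iff(3))
qed

section \<open>Chain maps and homotopies as families of ring elements\<close>

definition cmap where
  "cmap X Y \<phi> \<longleftrightarrow> (\<forall>n. \<phi> n \<in> arr (ob X n) (ob Y n) \<and> \<phi> (n + 1) * dd X n = dd Y n * \<phi> n)"

definition htp where
  "htp X Y \<phi> \<longleftrightarrow> (\<exists>h. \<forall>n. h n \<in> arr (ob X n) (ob Y (n - 1)) \<and> \<phi> n = dd Y (n - 1) * h n + h (n + 1) * dd X n)"

lemma cmapI: "\<lbrakk>\<And>n. \<phi> n \<in> arr (ob X n) (ob Y n); \<And>n. \<phi> (n + 1) * dd X n = dd Y n * \<phi> n\<rbrakk> \<Longrightarrow> cmap X Y \<phi>"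
  by (simp add: cmap_def)

lemma cmap_arr: "cmap X Y \<phi> \<Longrightarrow> \<phi> n \<in> arr (ob X n) (ob Y n)"
  and cmap_comm: "cmap X Y \<phi> \<Longrightarrow> \<phi> (n + 1) * dd X n = dd Y n * \<phi> n"
  and cmap_comm': "cmap X Y \<phi> \<Longrightarrow> \<phi> n * dd X (n - 1) = dd Y (n - 1) * \<phi> (n - 1)"
  by (simp_all add: cmap_def) (metis diff_add_cancel)

lemma htpI: "\<lbrakk>\<And>n. h n \<in> arr (ob X n) (ob Y (n - 1)); \<And>n. \<phi> n = dd Y (n - 1) * h n + h (n + 1) * dd X n\<rbrakk>
  \<Longrightarrow> htp X Y \<phi>"
  unfolding htp_def by blast

lemma htp_cmap:
  assumes X: "is_complex C X" and Y: "is_complex C Y" and h: "htp X Y \<phi>"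
  shows "cmap X Y \<phi>"
proof -
  obtain h where h: "\<And>n. h n \<in> arr (ob X n) (ob Y (n - 1))"
    "\<And>n. \<phi> n = dd Y (n - 1) * h n + h (n + 1) * dd X n"
    using h unfolding htp_def by blast
  have h': "h (n + 1) \<in> arr (ob X (n + 1)) (ob Y n)" for n using h(1)[of "n + 1"] by simp
  show ?thesis
  proof (rule cmapI)
    fix n
    show "\<phi> n \<in> arr (ob X n) (ob Y n)"
      unfolding h(2) using arr_mult[OF h(1) dd_arr'[OF Y]] arr_mult[OF dd_arr[OF X] h'] by (rule arr_add)
    have "h (n + 1 + 1) * dd X (n + 1) * dd X n = 0" "dd Y n * (dd Y (n - 1) * h n) = 0"
      using dd_dd[OF X, of n] dd_dd'[OF Y, of n] by (simp_all add: mult.assoc) (simp add: mult.assoc[symmetric])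
    then show "\<phi> (n + 1) * dd X n = dd Y n * \<phi> n"
      by (simp add: h(2) distrib_left distrib_right mult.assoc)
  qed
qed

lemma cmap_comp: "\<lbrakk>cmap X Y \<phi>; cmap Y Z \<psi>\<rbrakk> \<Longrightarrow> cmap X Z (\<lambda>n. \<psi> n * \<phi> n)"
  unfolding cmap_def by (auto intro: arr_mult) (metis mult.assoc)

lemma cmap_add: "\<lbrakk>cmap X Y \<phi>; cmap X Y \<psi>\<rbrakk> \<Longrightarrow> cmap X Y (\<lambda>n. \<phi> n + \<psi> n)"
  and cmap_diff: "\<lbrakk>cmap X Y \<phi>; cmap X Y \<psi>\<rbrakk> \<Longrightarrow> cmap X Y (\<lambda>n. \<phi> n - \<psi> n)"
  and cmap_neg: "cmap X Y \<phi> \<Longrightarrow> cmap X Y (\<lambda>n. - \<phi> n)"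
  unfolding cmap_def by (simp_all add: arr_intros algebra_simps)

lemma cmap_ide: "is_complex C X \<Longrightarrow> cmap X X (\<lambda>n. ide (ob X n))"
  unfolding cmap_def using arr_ide_left[OF dd_arr] arr_ide_right[OF dd_arr] by (simp add: arr_ide ob_in)

lemma cmap_0: "is_complex C X \<Longrightarrow> is_complex C Y \<Longrightarrow> cmap X Y (\<lambda>n. 0)"
  unfolding cmap_def by (simp add: arr_0 ob_in)

definition fam where
  "fam X Y f = (\<lambda>n. mor C (ob X n) (ob Y n) (f n))"

definition unfam where
  "unfam X Y \<phi> = (\<lambda>n. unmor (ob X n) (ob Y n) (\<phi> n))"

lemma chain_maps_iff:
  assumes X: "is_complex C X" and Y: "is_complex C Y"
  shows "f \<in> chain_maps C X Y \<longleftrightarrow> (\<forall>n. f n \<in> Hom C (ob X n) (ob Y n)) \<and> cmap X Y (fam X Y f)"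
proof -
  have "Cmp C (ob X n) (ob X (n + 1)) (ob Y (n + 1)) (f (n + 1)) (df X n)
      = Cmp C (ob X n) (ob Y n) (ob Y (n + 1)) (df Y n) (f n) \<longleftrightarrow>
      fam X Y f (n + 1) * dd X n = dd Y n * fam X Y f n" if "\<forall>n. f n \<in> Hom C (ob X n) (ob Y n)" for n
    unfolding fam_def dd_def using that ob_in[OF X] ob_in[OF Y] df_in[OF X] df_in[OF Y]
    by (intro Cmp_eq_iff(2)) simp_all
  then show ?thesis
    unfolding chain_maps_def cmap_def using ob_in[OF X] ob_in[OF Y] by (auto simp: fam_def mor_arr)
qed

lemma unfam_fam [simp]:
  "\<lbrakk>is_complex C X; is_complex C Y; f \<in> chain_maps C X Y\<rbrakk> \<Longrightarrow> unfam X Y (fam X Y f) = f"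
  by (simp add: chain_maps_iff unfam_def fam_def fun_eq_iff ob_in)

lemma fam_unfam [simp]: "cmap X Y \<phi> \<Longrightarrow> fam X Y (unfam X Y \<phi>) = \<phi>"
  using cmap_arr[of X Y \<phi>] by (simp add: unfam_def fam_def fun_eq_iff arr_iff)

lemma unfam_in: "\<lbrakk>is_complex C X; is_complex C Y; cmap X Y \<phi>\<rbrakk> \<Longrightarrow> unfam X Y \<phi> \<in> chain_maps C X Y"
  using cmap_arr[of X Y \<phi>] by (simp add: chain_maps_iff) (simp add: unfam_def arr_iff unmor_in)

lemma fam_cmap: "\<lbrakk>is_complex C X; is_complex C Y; f \<in> chain_maps C X Y\<rbrakk> \<Longrightarrow> cmap X Y (fam X Y f)"
  by (simp add: chain_maps_iff)

abbreviation "CC \<equiv> complexes C"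

lemma complexes_simps [simp]:
  "Obj CC = {X. is_complex C X}" "Hom CC = chain_maps C" "Idn CC X = (\<lambda>n. Idn C (ob X n))"
  "Cmp CC X Y Z g f = (\<lambda>n. Cmp C (ob X n) (ob Y n) (ob Z n) (g n) (f n))"
  "Add CC X Y f g = (\<lambda>n. Add C (ob X n) (ob Y n) (f n) (g n))"
  "Zer CC X Y = (\<lambda>n. Zer C (ob X n) (ob Y n))"
  by (simp_all add: complexes_def fun_eq_iff)

lemma chain_mapsE:
  assumes "f \<in> chain_maps C X Y" "is_complex C X" "is_complex C Y"
  obtains \<phi> where "cmap X Y \<phi>" "f = unfam X Y \<phi>"
  using that[OF fam_cmap] assms by simp

lemma unfam_ops:
  assumes X: "is_complex C X" and Y: "is_complex C Y"
  shows "cmap X Y \<phi> \<Longrightarrow> cmap X Y \<psi> \<Longrightarrow> Add CC X Y (unfam X Y \<phi>) (unfam X Y \<psi>) = unfam X Y (\<lambda>n. \<phi> n + \<psi> n)"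
    and "is_complex C Z \<Longrightarrow> cmap X Y \<phi> \<Longrightarrow> cmap Y Z \<chi> \<Longrightarrow>
      Cmp CC X Y Z (unfam Y Z \<chi>) (unfam X Y \<phi>) = unfam X Z (\<lambda>n. \<chi> n * \<phi> n)"
    and "Zer CC X Y = unfam X Y (\<lambda>n. 0)" and "Idn CC X = unfam X X (\<lambda>n. ide (ob X n))"
  unfolding unfam_def using ob_in[OF X] ob_in[OF Y] ob_in[of Z] cmap_arr[of X Y] cmap_arr[of Y Z]
  by (simp_all add: fun_eq_iff arr_iff unmor_Add unmor_Cmp unmor_Zer unmor_Idn)

lemma preadditive_complexes: "preadditive_category CC"
proof (rule preadditive_categoryI; simp only: complexes_simps(1,2) mem_Collect_eq; (elim chain_mapsE; simp only:)?)
  fix X Y \<phi> assume "is_complex C X" "is_complex C Y" "cmap X Y \<phi>"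
  then show "\<exists>g\<in>chain_maps C X Y. Add CC X Y g (unfam X Y \<phi>) = Zer CC X Y"
    by (intro bexI[of _ "unfam X Y (\<lambda>n. - \<phi> n)"])
      (simp_all add: unfam_ops unfam_in cmap_neg del: complexes_simps)
qed (simp_all del: complexes_simps add: unfam_ops unfam_in cmap_comp cmap_add cmap_0 cmap_ide
    arr_ide_left[OF cmap_arr] arr_ide_right[OF cmap_arr] mult.assoc algebra_simps)

end

sublocale additive_category \<subseteq> CC: preadditive_category "complexes C"
  by (rule preadditive_complexes)

context additive_category
begin

definition cm where
  "cm X Y \<phi> = mor CC X Y (unfam X Y \<phi>)"

lemma CC_hom: "\<lbrakk>is_complex C X; is_complex C Y\<rbrakk> \<Longrightarrow> CC.hom X Y = cm X Y ` {\<phi>. cmap X Y \<phi>}"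
  unfolding CC.hom_def cm_def by (auto simp: unfam_in elim: chain_mapsE)

lemma cm_inject: "\<lbrakk>is_complex C X; is_complex C Y; cmap X Y \<phi>; cmap X Y \<psi>\<rbrakk> \<Longrightarrow> cm X Y \<phi> = cm X Y \<psi> \<longleftrightarrow> \<phi> = \<psi>"
  unfolding cm_def by (simp add: CC.mor_inject unfam_in) (metis fam_unfam)

lemma cm_in: "\<lbrakk>is_complex C X; is_complex C Y; cmap X Y \<phi>\<rbrakk> \<Longrightarrow> cm X Y \<phi> \<in> CC.hom X Y"
  by (simp add: CC_hom)

lemma cm_ops:
  assumes X: "is_complex C X" and Y: "is_complex C Y"
  shows cm_add: "cmap X Y \<phi> \<Longrightarrow> cmap X Y \<psi> \<Longrightarrow> cm X Y (\<lambda>n. \<phi> n + \<psi> n) = cm X Y \<phi> + cm X Y \<psi>"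
    and cm_mult: "is_complex C Z \<Longrightarrow> cmap X Y \<phi> \<Longrightarrow> cmap Y Z \<chi> \<Longrightarrow> cm X Z (\<lambda>n. \<chi> n * \<phi> n) = cm Y Z \<chi> * cm X Y \<phi>"
    and cm_0: "cm X Y (\<lambda>n. 0) = 0" and cm_ide: "cm X X (\<lambda>n. ide (ob X n)) = CC.ide X"
  using assms unfolding cm_def CC.ide_def
  by (simp_all add: unfam_ops[symmetric] CC.mor_Add CC.mor_Cmp CC.mor_Zer unfam_in del: complexes_simps(3-6))

lemma cm_diff:
  assumes X: "is_complex C X" and Y: "is_complex C Y" and "cmap X Y \<phi>" "cmap X Y \<psi>"
  shows "cm X Y (\<lambda>n. \<phi> n - \<psi> n) = cm X Y \<phi> - cm X Y \<psi>"
  using cm_add[OF X Y cmap_diff[OF assms(3,4)] assms(4)] by simp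

lemma htp_ops:
  assumes X: "is_complex C X" and Y: "is_complex C Y"
  shows htp_0: "htp X Y (\<lambda>n. 0)"
    and htp_diff: "htp X Y \<phi> \<Longrightarrow> htp X Y \<psi> \<Longrightarrow> htp X Y (\<lambda>n. \<phi> n - \<psi> n)"
    and htp_left: "is_complex C Z \<Longrightarrow> htp X Y \<phi> \<Longrightarrow> cmap Y Z \<chi> \<Longrightarrow> htp X Z (\<lambda>n. \<chi> n * \<phi> n)"
    and htp_right: "is_complex C Z \<Longrightarrow> cmap X Y \<chi> \<Longrightarrow> htp Y Z \<phi> \<Longrightarrow> htp X Z (\<lambda>n. \<phi> n * \<chi> n)"
proof -
  show "htp X Y (\<lambda>n. 0)" by (rule htpI[of "\<lambda>n. 0"]) (simp_all add: arr_0 ob_in X Y)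
next
  assume "htp X Y \<phi>" "htp X Y \<psi>"
  then obtain h k where "\<And>n. h n \<in> arr (ob X n) (ob Y (n - 1))" "\<And>n. \<phi> n = dd Y (n - 1) * h n + h (n + 1) * dd X n"
    "\<And>n. k n \<in> arr (ob X n) (ob Y (n - 1))" "\<And>n. \<psi> n = dd Y (n - 1) * k n + k (n + 1) * dd X n"
    unfolding htp_def by blast
  then show "htp X Y (\<lambda>n. \<phi> n - \<psi> n)"
    by (intro htpI[of "\<lambda>n. h n - k n"]) (simp_all add: arr_diff algebra_simps)
next
  assume Z: "is_complex C Z" and "htp X Y \<phi>" and \<chi>: "cmap Y Z \<chi>"
  then obtain h where h: "\<And>n. h n \<in> arr (ob X n) (ob Y (n - 1))" "\<And>n. \<phi> n = dd Y (n - 1) * h n + h (n + 1) * dd X n"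
    unfolding htp_def by blast
  have "\<chi> n * (dd Y (n - 1) * h n) = dd Z (n - 1) * (\<chi> (n - 1) * h n)" for n
    using cmap_comm'[OF \<chi>, of n] by (simp add: mult.assoc[symmetric])
  then show "htp X Z (\<lambda>n. \<chi> n * \<phi> n)"
    by (intro htpI[of "\<lambda>n. \<chi> (n - 1) * h n"])
      (auto simp: h(2) distrib_left mult.assoc intro: arr_mult[OF h(1) cmap_arr[OF \<chi>]])
next
  assume Z: "is_complex C Z" and "htp Y Z \<phi>" and \<chi>: "cmap X Y \<chi>"
  then obtain h where h: "\<And>n. h n \<in> arr (ob Y n) (ob Z (n - 1))" "\<And>n. \<phi> n = dd Z (n - 1) * h n + h (n + 1) * dd Y n"
    unfolding htp_def by blast
  have "h (n + 1) * dd Y n * \<chi> n = h (n + 1) * \<chi> (n + 1) * dd X n" for n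
    using cmap_comm[OF \<chi>, of n] by (simp add: mult.assoc)
  then show "htp X Z (\<lambda>n. \<phi> n * \<chi> n)"
    by (intro htpI[of "\<lambda>n. h n * \<chi> n"])
      (auto simp: h(2) distrib_right mult.assoc[symmetric] intro: arr_mult[OF cmap_arr[OF \<chi>] h(1)])
qed

lemma null_homotopic_iff:
  assumes X: "is_complex C X" and Y: "is_complex C Y"
  shows "f \<in> null_homotopic C X Y \<longleftrightarrow> (\<forall>n. f n \<in> Hom C (ob X n) (ob Y n)) \<and> htp X Y (fam X Y f)"
proof
  note O = ob_in[OF X] ob_in[OF Y] df_in[OF X] df_in[OF Y]
  have dY: "df Y (n - 1) \<in> Hom C (ob Y (n - 1)) (ob Y n)" for n using df_in[OF Y, of "n - 1"] by simp
  have dd': "dd Y (n - 1) = mor C (ob Y (n - 1)) (ob Y n) (df Y (n - 1))" for n by (simp add: dd_def)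
  { assume "f \<in> null_homotopic C X Y"
    then obtain h where h: "\<And>n. h n \<in> Hom C (ob X n) (ob Y (n - 1))" "\<And>n. f n = Add C (ob X n) (ob Y n)
      (Cmp C (ob X n) (ob Y (n - 1)) (ob Y n) (df Y (n - 1)) (h n))
      (Cmp C (ob X n) (ob X (n + 1)) (ob Y n) (h (n + 1)) (df X n))"
      unfolding null_homotopic_def by blast
    have h': "h (n + 1) \<in> Hom C (ob X (n + 1)) (ob Y n)" for n using h(1)[of "n + 1"] by simp
    have "htp X Y (fam X Y f)"
      by (rule htpI[of "\<lambda>n. mor C (ob X n) (ob Y (n - 1)) (h n)"])
        (simp_all add: mor_arr O h(1) fam_def h(2) mor_Add mor_Cmp Cmp_in dY h' dd' dd_def[of X])
    then show "(\<forall>n. f n \<in> Hom C (ob X n) (ob Y n)) \<and> htp X Y (fam X Y f)"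
      by (simp add: h(2) Add_in Cmp_in O h dY h') }
  assume f: "(\<forall>n. f n \<in> Hom C (ob X n) (ob Y n)) \<and> htp X Y (fam X Y f)"
  then obtain h where h: "\<And>n. h n \<in> arr (ob X n) (ob Y (n - 1))"
    "\<And>n. fam X Y f n = dd Y (n - 1) * h n + h (n + 1) * dd X n"
    unfolding htp_def by blast
  let ?h = "\<lambda>n. unmor (ob X n) (ob Y (n - 1)) (h n)"
  have u: "?h n \<in> Hom C (ob X n) (ob Y (n - 1))" "mor C (ob X n) (ob Y (n - 1)) (?h n) = h n" for n
    using h(1) by (simp_all add: arr_iff unmor_in)
  have u': "?h (n + 1) \<in> Hom C (ob X (n + 1)) (ob Y n)" "mor C (ob X (n + 1)) (ob Y n) (?h (n + 1)) = h (n + 1)" for n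
    using u[of "n + 1"] by simp_all
  have eq: "f n = Add C (ob X n) (ob Y n)
      (Cmp C (ob X n) (ob Y (n - 1)) (ob Y n) (df Y (n - 1)) (?h n))
      (Cmp C (ob X n) (ob X (n + 1)) (ob Y n) (?h (n + 1)) (df X n))" for n
    by (rule iffD1[OF mor_inject[of "ob X n" "ob Y n"]])
      (use h(2)[of n] f u[of n] u'[of n] O dY in
        \<open>simp_all add: Add_in Cmp_in mor_Add mor_Cmp fam_def dd' dd_def[of X]\<close>)
  show "f \<in> null_homotopic C X Y"
    unfolding null_homotopic_def by (intro CollectI exI[of _ ?h] allI conjI u(1) eq)
qed

abbreviation null_mor where
  "null_mor X Y \<equiv> mor CC X Y ` null_homotopic C X Y"

lemma null_homotopic_chain_maps:
  assumes X: "is_complex C X" and Y: "is_complex C Y"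
  shows "null_homotopic C X Y \<subseteq> chain_maps C X Y"
  using htp_cmap[OF X Y] by (auto simp: null_homotopic_iff[OF X Y] chain_maps_iff[OF X Y])

lemma null_mor_eq:
  assumes X: "is_complex C X" and Y: "is_complex C Y"
  shows "null_mor X Y = cm X Y ` {\<phi>. htp X Y \<phi>}"
proof -
  have "\<exists>\<phi>. htp X Y \<phi> \<and> mor CC X Y f = cm X Y \<phi>" if "f \<in> null_homotopic C X Y" for f
    using that null_homotopic_chain_maps[OF X Y]
    by (intro exI[of _ "fam X Y f"])
      (simp add: cm_def X Y unfam_fam[OF X Y subsetD] del: unfam_fam, simp add: null_homotopic_iff[OF X Y])
  moreover have "unfam X Y \<phi> \<in> null_homotopic C X Y" if "htp X Y \<phi>" for \<phi>
    using that htp_cmap[OF X Y that] unfam_in[OF X Y htp_cmap[OF X Y that]]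
    by (simp add: null_homotopic_iff[OF X Y] chain_maps_iff[OF X Y])
  ultimately show ?thesis by (auto simp: cm_def)
qed

lemma ideal_null: "hom_ideal CC (null_homotopic C)"
proof (unfold_locales; (simp only: complexes_simps(1) mem_Collect_eq CC_hom null_mor_eq)?)
  fix X Y assume X: "is_complex C X" and Y: "is_complex C Y"
  show "null_homotopic C X Y \<subseteq> Hom CC X Y" using null_homotopic_chain_maps[OF X Y] by simp
  show "0 \<in> cm X Y ` {\<phi>. htp X Y \<phi>}" using htp_0[OF X Y] cm_0[OF X Y] by (metis imageI mem_Collect_eq)
  show "a - b \<in> cm X Y ` {\<phi>. htp X Y \<phi>}"
    if ab: "a \<in> cm X Y ` {\<phi>. htp X Y \<phi>}" "b \<in> cm X Y ` {\<phi>. htp X Y \<phi>}" for a b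
  proof -
    obtain \<phi> \<psi> where "htp X Y \<phi>" "htp X Y \<psi>" "a = cm X Y \<phi>" "b = cm X Y \<psi>" using ab by blast
    then have "htp X Y (\<lambda>n. \<phi> n - \<psi> n)" "a - b = cm X Y (\<lambda>n. \<phi> n - \<psi> n)"
      using htp_diff[OF X Y] cm_diff[OF X Y] htp_cmap[OF X Y] by auto
    then show ?thesis by blast
  qed
  fix Z a b assume Z: "is_complex C Z"
  show "b * a \<in> cm X Z ` {\<phi>. htp X Z \<phi>}" if ab: "a \<in> cm X Y ` {\<phi>. htp X Y \<phi>}" "b \<in> cm Y Z ` {\<phi>. cmap Y Z \<phi>}"
  proof -
    obtain \<phi> \<psi> where *: "htp X Y \<phi>" "cmap Y Z \<psi>" "a = cm X Y \<phi>" "b = cm Y Z \<psi>" using ab by blast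
    then have "b * a = cm X Z (\<lambda>n. \<psi> n * \<phi> n)" using cm_mult[OF X Y Z] htp_cmap[OF X Y] by auto
    then show ?thesis using htp_left[OF X Y Z *(1,2)] by blast
  qed
  show "b * a \<in> cm X Z ` {\<phi>. htp X Z \<phi>}" if ab: "a \<in> cm X Y ` {\<phi>. cmap X Y \<phi>}" "b \<in> cm Y Z ` {\<phi>. htp Y Z \<phi>}"
  proof -
    obtain \<phi> \<psi> where *: "cmap X Y \<phi>" "htp Y Z \<psi>" "a = cm X Y \<phi>" "b = cm Y Z \<psi>" using ab by blast
    then have "b * a = cm X Z (\<lambda>n. \<psi> n * \<phi> n)" using cm_mult[OF X Y Z] htp_cmap[OF Y Z] by auto
    then show ?thesis using htp_right[OF X Y Z *(1,2)] by blast
  qed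
qed

end

sublocale additive_category \<subseteq> KK: hom_ideal "complexes C" "null_homotopic C"
    "\<lambda>X Y. mor (complexes C) X Y ` null_homotopic C X Y"
  by (rule ideal_null, rule reflexive)

context additive_category
begin

abbreviation "K \<equiv> homotopy_category C"

lemma K_eq: "K = quotient_category (complexes C) (null_homotopic C)"
  by (simp add: homotopy_category_def)

lemma Obj_K [simp]: "Obj K = {X. is_complex C X}"
  by (simp add: K_eq)

end

sublocale additive_category \<subseteq> K: preadditive_category "homotopy_category C"
  unfolding homotopy_category_def by (rule KK.preadditive_Q)

context additive_category
begin

definition kap where
  "kap X Y \<phi> = mor K X Y (KK.qcl X Y (cm X Y \<phi>))"

lemma kap_proj: "kap X Y \<phi> = KK.proj X Y (cm X Y \<phi>)"
  by (simp add: kap_def KK.proj_def K_eq)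

lemma K_hom:
  assumes X: "is_complex C X" and Y: "is_complex C Y"
  shows "K.hom X Y = kap X Y ` {\<phi>. cmap X Y \<phi>}"
  using KK.hom_Q[of X Y] X Y unfolding K_eq[symmetric] by (auto simp: CC_hom kap_proj)

lemma kap_in: "\<lbrakk>is_complex C X; is_complex C Y; cmap X Y \<phi>\<rbrakk> \<Longrightarrow> kap X Y \<phi> \<in> K.hom X Y"
  by (simp add: K_hom)

lemma K_homE:
  assumes "a \<in> K.hom X Y" "is_complex C X" "is_complex C Y"
  obtains \<phi> where "cmap X Y \<phi>" "a = kap X Y \<phi>"
  using assms by (auto simp: K_hom)

lemma kap_eq_iff:
  assumes X: "is_complex C X" and Y: "is_complex C Y" and "cmap X Y \<phi>" "cmap X Y \<psi>"
  shows "kap X Y \<phi> = kap X Y \<psi> \<longleftrightarrow> htp X Y (\<lambda>n. \<phi> n - \<psi> n)"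
proof -
  have "kap X Y \<phi> = kap X Y \<psi> \<longleftrightarrow> cm X Y (\<lambda>n. \<phi> n - \<psi> n) \<in> null_mor X Y"
    using assms by (simp add: kap_proj KK.proj_eq_iff cm_in cm_diff)
  also have "\<dots> \<longleftrightarrow> htp X Y (\<lambda>n. \<phi> n - \<psi> n)"
    using assms cm_inject[OF X Y cmap_diff[OF assms(3,4)] htp_cmap[OF X Y]]
    by (auto simp: null_mor_eq image_iff)
  finally show ?thesis .
qed

lemma kap_ops:
  assumes X: "is_complex C X" and Y: "is_complex C Y"
  shows kap_add: "cmap X Y \<phi> \<Longrightarrow> cmap X Y \<psi> \<Longrightarrow> kap X Y (\<lambda>n. \<phi> n + \<psi> n) = kap X Y \<phi> + kap X Y \<psi>"
    and kap_mult: "is_complex C Z \<Longrightarrow> cmap X Y \<phi> \<Longrightarrow> cmap Y Z \<chi> \<Longrightarrow> kap X Z (\<lambda>n. \<chi> n * \<phi> n) = kap Y Z \<chi> * kap X Y \<phi>"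
    and kap_0: "kap X Y (\<lambda>n. 0) = 0" and kap_ide: "kap X X (\<lambda>n. ide (ob X n)) = K.ide X"
  using KK.proj.F_add[of X Y "cm X Y \<phi>" "cm X Y \<psi>"] KK.proj.F_mult[of X Y Z "cm X Y \<phi>" "cm Y Z \<chi>"]
    KK.proj.F_0[of X Y] KK.proj.F_ide[of X] assms
  by (simp_all add: kap_proj cm_ops cm_in K_eq[symmetric])

lemma kap_eq_0_iff:
  assumes X: "is_complex C X" and Y: "is_complex C Y" and "cmap X Y \<phi>"
  shows "kap X Y \<phi> = 0 \<longleftrightarrow> htp X Y \<phi>"
  using kap_eq_iff[OF assms cmap_0[OF X Y]] kap_0[OF X Y] by simp

lemma K_Hom:
  assumes X: "is_complex C X" and Y: "is_complex C Y"
  shows "F \<in> Hom K X Y \<longleftrightarrow> (\<exists>\<phi>. cmap X Y \<phi> \<and> F = KK.qcl X Y (cm X Y \<phi>))"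
  using KK.Hom_Q[of X Y] X Y unfolding K_eq[symmetric] by (auto simp: CC_hom)

lemma mem_qcl_iff:
  assumes X: "is_complex C X" and Y: "is_complex C Y" and \<phi>: "cmap X Y \<phi>"
  shows "f \<in> KK.qcl X Y (cm X Y \<phi>) \<longleftrightarrow> f \<in> chain_maps C X Y \<and> htp X Y (\<lambda>n. fam X Y f n - \<phi> n)"
proof -
  have "mor CC X Y f - cm X Y \<phi> \<in> null_mor X Y \<longleftrightarrow> htp X Y (\<lambda>n. fam X Y f n - \<phi> n)"
    if f: "f \<in> chain_maps C X Y"
  proof -
    have f': "cmap X Y (fam X Y f)" using fam_cmap[OF X Y f] .
    have "mor CC X Y f - cm X Y \<phi> = cm X Y (\<lambda>n. fam X Y f n - \<phi> n)"
      using cm_diff[OF X Y f' \<phi>] f X Y by (simp add: cm_def)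
    then show ?thesis
      using cm_inject[OF X Y cmap_diff[OF f' \<phi>] htp_cmap[OF X Y]] by (auto simp: null_mor_eq[OF X Y] image_iff)
  qed
  then show ?thesis using X Y by (auto simp: KK.qcl_def)
qed

end

section \<open>Twisted sums and cones\<close>

context preadditive_category
begin

lemma rbiprodD:
  assumes "rbiprod X Y B i j p q"
  shows "i \<in> arr X B" "j \<in> arr Y B" "p \<in> arr B X" "q \<in> arr B Y"
    "p * i = ide X" "q * j = ide Y" "p * j = 0" "q * i = 0" "i * p + j * q = ide B"
  using assms by (auto simp: rbiprod_def arr_iff)

lemma rbiprod_elem:
  assumes b: "rbiprod X Y B i j p q"
  shows "x \<in> arr W X \<Longrightarrow> p * (i * x) = x" "y \<in> arr W Y \<Longrightarrow> q * (j * y) = y"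
    "p * (j * z) = 0" "q * (i * z) = 0" "w \<in> arr W B \<Longrightarrow> i * (p * w) + j * (q * w) = w"
proof -
  note B = rbiprodD[OF b]
  show "x \<in> arr W X \<Longrightarrow> p * (i * x) = x" using B(5) arr_ide_left by (simp add: mult.assoc[symmetric])
  show "y \<in> arr W Y \<Longrightarrow> q * (j * y) = y" using B(6) arr_ide_left by (simp add: mult.assoc[symmetric])
  show "p * (j * z) = 0" using B(7) by (simp add: mult.assoc[symmetric])
  show "q * (i * z) = 0" using B(8) by (simp add: mult.assoc[symmetric])
  show "i * (p * w) + j * (q * w) = w" if "w \<in> arr W B"
  proof -
    have "i * (p * w) + j * (q * w) = (i * p + j * q) * w" by (simp add: distrib_right mult.assoc)
    then show ?thesis using B(9) arr_ide_left[OF that] by simp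
  qed
qed

lemma rker_is_kernel:
  assumes "rker A X Y k f"
  shows "is_kernel C A X Y (unmor A X k) (unmor X Y f)"
proof -
  have "k \<in> arr A X" "f \<in> arr X Y" using assms by (auto simp: rker_def rmono_def)
  then show ?thesis
    using assms by (subst is_kernel_iff) (simp_all add: arr_iff unmor_in)
qed

lemma rcok_is_cokernel:
  assumes "rcok X Y A f q"
  shows "is_cokernel C X Y A (unmor X Y f) (unmor Y A q)"
proof -
  have "q \<in> arr Y A" "f \<in> arr X Y" using assms by (auto simp: rcok_def repi_def)
  then show ?thesis
    using assms by (subst is_cokernel_iff) (simp_all add: arr_iff unmor_in)
qed

lemma rbiprod_iso:
  assumes b: "rbiprod X Y B i j p q" and O: "X' \<in> Obj C" "Y' \<in> Obj C"
    and a: "a \<in> hom X' X" "a' \<in> hom X X'" "a' * a = ide X'" "a * a' = ide X"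
    and c: "c \<in> hom Y' Y" "c' \<in> hom Y Y'" "c' * c = ide Y'" "c * c' = ide Y"
  shows "rbiprod X' Y' B (i * a) (j * c) (a' * p) (c' * q)"
proof -
  have O': "X \<in> Obj C" "Y \<in> Obj C" "B \<in> Obj C" using b by (simp_all add: rbiprod_def)
  note R = rbiprodD[OF b]
  have A: "a \<in> arr X' X" "a' \<in> arr X X'" "c \<in> arr Y' Y" "c' \<in> arr Y Y'" using O O' a c by (simp_all add: arr_iff)
  have e: "p * (i * a) = a" "q * (j * c) = c" "p * (j * c) = 0" "q * (i * a) = 0"
    using rbiprod_elem(1)[OF b A(1)] rbiprod_elem(2)[OF b A(3)] rbiprod_elem(3,4)[OF b] by blast+
  have f: "a * (a' * p) = p" "c * (c' * q) = q"
    using a(4) c(4) arr_ide_left[OF R(3)] arr_ide_left[OF R(4)] by (simp_all add: mult.assoc[symmetric])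
  show ?thesis
    unfolding rbiprod_def
    using O O'(3) arr_mult[OF A(1) R(1)] arr_mult[OF A(3) R(2)] arr_mult[OF R(3) A(2)] arr_mult[OF R(4) A(4)]
      a(3) c(3) R(9) by (simp add: arr_iff mult.assoc e f)
qed

end

context additive_category
begin

text \<open>A degreewise split extension of \<open>A\<close> by \<open>B\<close>: the sum
  \<open>A \<oplus> B\<close> with a triangular differential whose off-diagonal entry is
  \<open>\<phi>\<close>. Cones are the case \<open>A = X[1]\<close>; other choices give the vertices
  for the Ore and cancellation conditions.\<close>

definition is_ext where
  "is_ext A B \<phi> T i j p q \<longleftrightarrow> is_complex C A \<and> is_complex C B \<and> is_complex C T \<and>
    (\<forall>n. rbiprod (ob A n) (ob B n) (ob T n) (i n) (j n) (p n) (q n)) \<and>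
    (\<forall>n. \<phi> n \<in> arr (ob A n) (ob B (n + 1))) \<and>
    (\<forall>n. dd T n * i n = i (n + 1) * dd A n + j (n + 1) * \<phi> n) \<and>
    (\<forall>n. dd T n * j n = j (n + 1) * dd B n)"

lemma is_extD:
  assumes "is_ext A B \<phi> T i j p q"
  shows "is_complex C A" "is_complex C B" "is_complex C T"
    "rbiprod (ob A n) (ob B n) (ob T n) (i n) (j n) (p n) (q n)"
    "\<phi> n \<in> arr (ob A n) (ob B (n + 1))"
    "dd T n * i n = i (n + 1) * dd A n + j (n + 1) * \<phi> n"
    "dd T n * j n = j (n + 1) * dd B n"
    "p (n + 1) * dd T n = dd A n * p n"
    "q (n + 1) * dd T n = \<phi> n * p n + dd B n * q n"
proof -
  show A: "is_complex C A" "is_complex C B" "is_complex C T" and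
    b: "rbiprod (ob A n) (ob B n) (ob T n) (i n) (j n) (p n) (q n)" and
    phi: "\<phi> n \<in> arr (ob A n) (ob B (n + 1))" and
    d: "dd T n * i n = i (n + 1) * dd A n + j (n + 1) * \<phi> n" "dd T n * j n = j (n + 1) * dd B n" for n
    using assms unfolding is_ext_def by blast+
  note B = rbiprodD[OF b]
  \<comment> \<open>The differential is recovered from its restrictions to the two summands; the
    equations for the projections are then read off.\<close>
  have e: "dd T n = (i (n + 1) * dd A n + j (n + 1) * \<phi> n) * p n + j (n + 1) * dd B n * q n"
  proof -
    have "dd T n = dd T n * (i n * p n + j n * q n)" using B(9) arr_ide_right[OF dd_arr[OF A(3)]] by simp
    also have "\<dots> = dd T n * i n * p n + dd T n * j n * q n" by (simp add: distrib_left mult.assoc)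
    finally show ?thesis by (simp add: d)
  qed
  have aA: "dd A n * p n \<in> arr (ob T n) (ob A (n + 1))" using arr_mult[OF B(3) dd_arr[OF A(1)]] .
  have aB: "dd B n * q n \<in> arr (ob T n) (ob B (n + 1))" using arr_mult[OF B(4) dd_arr[OF A(2)]] .
  have aP: "\<phi> n * p n \<in> arr (ob T n) (ob B (n + 1))" using arr_mult[OF B(3) phi] .
  show "p (n + 1) * dd T n = dd A n * p n" "q (n + 1) * dd T n = \<phi> n * p n + dd B n * q n"
    unfolding e using rbiprod_elem[OF b[of "n + 1"]] aA aB aP
    by (simp_all add: distrib_left distrib_right mult.assoc)
qed

lemma rbiprod_sequence:
  assumes "\<And>n. X n \<in> Obj C" "\<And>n. Y n \<in> Obj C"
  obtains B i j p q where "\<And>n::int. rbiprod (X n) (Y n) (B n) (i n) (j n) (p n) (q n)"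
proof -
  have "\<forall>n. \<exists>t. case t of (B, i, j, p, q) \<Rightarrow> rbiprod (X n) (Y n) B i j p q"
    using ex_rbiprod[OF assms] by fastforce
  then obtain t where "\<forall>n. case t n of (B, i, j, p, q) \<Rightarrow> rbiprod (X n) (Y n) B i j p q" by metis
  then show ?thesis
    using that[of "\<lambda>n. fst (t n)" "\<lambda>n. fst (snd (t n))" "\<lambda>n. fst (snd (snd (t n)))"
        "\<lambda>n. fst (snd (snd (snd (t n))))" "\<lambda>n. snd (snd (snd (snd (t n))))"]
    by (simp add: split_beta)
qed

text \<open>The condition that \<open>\<phi>\<close> anticommutes with the differentials is the
  off-diagonal entry of \<open>d * d = 0\<close>. It says that \<open>\<phi>\<close> is a chain map
  from \<open>A\<close> to \<open>B[1]\<close>.\<close>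

lemma ext_exists:
  assumes A: "is_complex C A" and B: "is_complex C B"
    and \<phi>: "\<And>n. \<phi> n \<in> arr (ob A n) (ob B (n + 1))" "\<And>n. dd B (n + 1) * \<phi> n + \<phi> (n + 1) * dd A n = 0"
  obtains T i j p q where "is_ext A B \<phi> T i j p q"
proof -
  obtain To i j p q where b: "\<And>n. rbiprod (ob A n) (ob B n) (To n) (i n) (j n) (p n) (q n)"
    using rbiprod_sequence[of "ob A" "ob B"] ob_in[OF A] ob_in[OF B] by metis
  note R = rbiprodD[OF b]
  define d where "d n = i (n + 1) * (dd A n * p n) + j (n + 1) * (\<phi> n * p n + dd B n * q n)" for n
  have aA: "dd A n * p n \<in> arr (To n) (ob A (n + 1))" for n using arr_mult[OF R(3) dd_arr[OF A]] .
  have aB: "\<phi> n * p n + dd B n * q n \<in> arr (To n) (ob B (n + 1))" for n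
    using arr_mult[OF R(4) dd_arr[OF B]] arr_mult[OF R(3) \<phi>(1)] arr_add by blast
  have d: "d n \<in> arr (To n) (To (n + 1))" for n
    unfolding d_def using arr_mult[OF aA R(1)] arr_mult[OF aB R(2)] by (rule arr_add)
  have pd: "p (n + 1) * d n = dd A n * p n" "q (n + 1) * d n = \<phi> n * p n + dd B n * q n" for n
    unfolding d_def distrib_left[of "p (n + 1)"] distrib_left[of "q (n + 1)"]
    using rbiprod_elem(1)[OF b aA] rbiprod_elem(2)[OF b aB] rbiprod_elem(3,4)[OF b] by simp_all
  have "d (n + 1) * d n = 0" for n
  proof -
    have "d (n + 1) * d n = i (n + 1 + 1) * (dd A (n + 1) * (p (n + 1) * d n)) +
        j (n + 1 + 1) * (\<phi> (n + 1) * (p (n + 1) * d n) + dd B (n + 1) * (q (n + 1) * d n))"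
      by (simp only: d_def[of "n + 1"] distrib_left distrib_right mult.assoc)
    also have "\<dots> = i (n + 1 + 1) * ((dd A (n + 1) * dd A n) * p n) +
        j (n + 1 + 1) * ((dd B (n + 1) * \<phi> n + \<phi> (n + 1) * dd A n) * p n + (dd B (n + 1) * dd B n) * q n)"
      by (simp only: pd) (simp add: distrib_left distrib_right mult.assoc add.commute add.left_commute)
    finally show ?thesis by (simp add: dd_dd[OF A] dd_dd[OF B] \<phi>(2))
  qed
  then have T: "is_complex C (mk_cpx To d)" using d by (intro is_complex_mk)
  have "is_ext A B \<phi> (mk_cpx To d) i j p q"
    unfolding is_ext_def
  proof (intro conjI allI A B T)
    fix n
    have *: "d n * i n = i (n + 1) * (dd A n * (p n * i n)) + j (n + 1) * (\<phi> n * (p n * i n) + dd B n * (q n * i n))"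
      "d n * j n = i (n + 1) * (dd A n * (p n * j n)) + j (n + 1) * (\<phi> n * (p n * j n) + dd B n * (q n * j n))"
      by (simp_all only: d_def distrib_left distrib_right mult.assoc)
    show "dd (mk_cpx To d) n * i n = i (n + 1) * dd A n + j (n + 1) * \<phi> n"
      "dd (mk_cpx To d) n * j n = j (n + 1) * dd B n"
      using d[of n] * R(5-8)[of n] arr_ide_right[OF dd_arr[OF A]] arr_ide_right[OF dd_arr[OF B]] arr_ide_right[OF \<phi>(1)]
      by (simp_all add: dd_mk)
  qed (use b \<phi> in simp_all)
  then show ?thesis using that by blast
qed

lemma ob_shift [simp]: "ob (shift C X) n = ob X (n + 1)" "ob (unshift C X) n = ob X (n - 1)"
  by (simp_all add: shift_def unshift_def)

lemma dd_shift:
  assumes "is_complex C X"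
  shows "dd (shift C X) n = - dd X (n + 1)" "dd (unshift C X) n = - dd X (n - 1)"
  using assms df_in[OF assms, of "n + 1"] df_in[OF assms, of "n - 1"]
  by (simp_all add: dd_def shift_def unshift_def mor_neg ob_in add_1_1)

lemma shift_complex:
  assumes X: "is_complex C X"
  shows "is_complex C (shift C X)" "is_complex C (unshift C X)"
proof -
  have *: "shift C X = mk_cpx (\<lambda>n. ob X (n + 1)) (\<lambda>n. - dd X (n + 1))"
    "unshift C X = mk_cpx (\<lambda>n. ob X (n - 1)) (\<lambda>n. - dd X (n - 1))"
    using df_in[OF X, of "n + 1" for n, unfolded add_1_1] ob_in[OF X] df_in[OF X, of "n - 1" for n]
    by (auto simp: shift_def unshift_def mk_cpx_def dd_def fun_eq_iff mor_neg[symmetric] neg_in add_1_1)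
  show "is_complex C (shift C X)" "is_complex C (unshift C X)"
    unfolding * using dd_dd'[OF X]
    by (intro is_complex_mk arr_neg dd_arr[OF X], simp only: minus_mult_minus dd_dd[OF X])
      (intro is_complex_mk, simp_all add: arr_neg dd_arr'[OF X] dd_dd'[OF X])
qed

text \<open>The minus sign in the differential of a cone is the one of the shifted complex, so a
  cone is a twisted sum of \<open>X[1]\<close> and \<open>Y\<close>; its off-diagonal entry in
  degree \<open>n\<close> is \<open>f\<close> in degree \<open>n + 1\<close>.\<close>

lemma is_cone_iff:
  assumes X: "is_complex C X" and Y: "is_complex C Y" and f: "f \<in> chain_maps C X Y"
  shows "is_cone C X Y f T \<longleftrightarrow> (\<exists>i j p q. is_ext (shift C X) Y (\<lambda>n. fam X Y f (n + 1)) T i j p q)"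
proof
  have fH: "f n \<in> Hom C (ob X n) (ob Y n)" for n using f by (simp add: chain_maps_iff X Y)
  have fa: "fam X Y f n \<in> arr (ob X n) (ob Y n)" for n using cmap_arr[OF fam_cmap[OF X Y f]] .
  note O = ob_in[OF X] ob_in[OF Y] df_in[OF X] df_in[OF Y]
  have dX: "dd (shift C X) n = mor C (ob X (n + 1)) (ob X (n + 2)) (neg C (ob X (n + 1)) (ob X (n + 2)) (df X (n + 1)))"
    and nX: "neg C (ob X (n + 1)) (ob X (n + 2)) (df X (n + 1)) \<in> Hom C (ob X (n + 1)) (ob X (n + 2))" for n
    using O(3)[of "n + 1"] by (simp_all add: dd_def shift_def add_1_1 neg_in O)
  { assume c: "is_cone C X Y f T"
    then obtain i j p q where T: "is_complex C T" and
      b: "\<And>n. is_biprod C (ob X (n + 1)) (ob Y n) (ob T n) (i n) (j n) (p n) (q n)" and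
      d: "\<And>n. Cmp C (ob X (n + 1)) (ob T n) (ob T (n + 1)) (df T n) (i n) =
        Add C (ob X (n + 1)) (ob T (n + 1))
          (Cmp C (ob X (n + 1)) (ob X (n + 2)) (ob T (n + 1)) (i (n + 1))
            (neg C (ob X (n + 1)) (ob X (n + 2)) (df X (n + 1))))
          (Cmp C (ob X (n + 1)) (ob Y (n + 1)) (ob T (n + 1)) (j (n + 1)) (f (n + 1)))"
      "\<And>n. Cmp C (ob Y n) (ob T n) (ob T (n + 1)) (df T n) (j n) =
        Cmp C (ob Y n) (ob Y (n + 1)) (ob T (n + 1)) (j (n + 1)) (df Y n)"
      unfolding is_cone_def by blast
    have ij: "i n \<in> Hom C (ob X (n + 1)) (ob T n)" "j n \<in> Hom C (ob Y n) (ob T n)" for n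
      using b[of n] by (simp_all add: is_biprod_def)
    have i': "i (n + 1) \<in> Hom C (ob X (n + 2)) (ob T (n + 1))" for n using ij(1)[of "n + 1"] by (simp add: add_1_1)
    note OT = ob_in[OF T] df_in[OF T]
    have "dd T n * mor C (ob X (n + 1)) (ob T n) (i n) =
      mor C (ob X (n + 2)) (ob T (n + 1)) (i (n + 1)) * dd (shift C X) n +
      mor C (ob Y (n + 1)) (ob T (n + 1)) (j (n + 1)) * fam X Y f (n + 1)"
      "dd T n * mor C (ob Y n) (ob T n) (j n) = mor C (ob Y (n + 1)) (ob T (n + 1)) (j (n + 1)) * dd Y n" for n
      using arg_cong[OF d(1)[of n], of "mor C (ob X (n + 1)) (ob T (n + 1))"]
        arg_cong[OF d(2)[of n], of "mor C (ob Y n) (ob T (n + 1))"]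
      by (simp_all add: mor_Add mor_Cmp Cmp_in O OT ij i' nX fH dX fam_def dd_def[of T] dd_def[of Y])
    then have "is_ext (shift C X) Y (\<lambda>n. fam X Y f (n + 1)) T (\<lambda>n. mor C (ob X (n + 1)) (ob T n) (i n))
        (\<lambda>n. mor C (ob Y n) (ob T n) (j n)) (\<lambda>n. mor C (ob T n) (ob X (n + 1)) (p n)) (\<lambda>n. mor C (ob T n) (ob Y n) (q n))"
      unfolding is_ext_def using T Y X is_biprodD[OF b] fa by (simp add: shift_complex add_1_1)
    then show "\<exists>i j p q. is_ext (shift C X) Y (\<lambda>n. fam X Y f (n + 1)) T i j p q" by blast }
  assume "\<exists>i j p q. is_ext (shift C X) Y (\<lambda>n. fam X Y f (n + 1)) T i j p q"
  then obtain i j p q where e: "is_ext (shift C X) Y (\<lambda>n. fam X Y f (n + 1)) T i j p q" by blast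
  note T = is_extD(3)[OF e]
  note OT = ob_in[OF T] df_in[OF T]
  have b: "rbiprod (ob X (n + 1)) (ob Y n) (ob T n) (i n) (j n) (p n) (q n)" for n
    using is_extD(4)[OF e, of n] by simp
  define i' where "i' n = unmor (ob X (n + 1)) (ob T n) (i n)" for n
  define j' where "j' n = unmor (ob Y n) (ob T n) (j n)" for n
  have ij: "i' n \<in> Hom C (ob X (n + 1)) (ob T n)" "j' n \<in> Hom C (ob Y n) (ob T n)"
    "mor C (ob X (n + 1)) (ob T n) (i' n) = i n" "mor C (ob Y n) (ob T n) (j' n) = j n" for n
    using rbiprodD(1,2)[OF b, of n] by (simp_all add: i'_def j'_def arr_iff unmor_in)
  have ii: "i' (n + 1) \<in> Hom C (ob X (n + 2)) (ob T (n + 1))"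
    "mor C (ob X (n + 2)) (ob T (n + 1)) (i' (n + 1)) = i (n + 1)" for n using ij[of "n + 1"] by (simp_all add: add_1_1)
  have d: "Cmp C (ob X (n + 1)) (ob T n) (ob T (n + 1)) (df T n) (i' n) =
        Add C (ob X (n + 1)) (ob T (n + 1))
          (Cmp C (ob X (n + 1)) (ob X (n + 2)) (ob T (n + 1)) (i' (n + 1))
            (neg C (ob X (n + 1)) (ob X (n + 2)) (df X (n + 1))))
          (Cmp C (ob X (n + 1)) (ob Y (n + 1)) (ob T (n + 1)) (j' (n + 1)) (f (n + 1)))"
      "Cmp C (ob Y n) (ob T n) (ob T (n + 1)) (df T n) (j' n) =
        Cmp C (ob Y n) (ob Y (n + 1)) (ob T (n + 1)) (j' (n + 1)) (df Y n)" for n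
    using is_extD(6,7)[OF e, of n]
    by (intro iffD1[OF mor_inject[of "ob X (n + 1)" "ob T (n + 1)"]]
        iffD1[OF mor_inject[of "ob Y n" "ob T (n + 1)"]];
        simp add: Cmp_in Add_in mor_Add mor_Cmp O OT ij ii nX fH dX fam_def dd_def[of T] dd_def[of Y])+
  show "is_cone C X Y f T"
    unfolding is_cone_def
    by (rule conjI[OF T], rule exI[of _ i'], rule exI[of _ j'],
        rule exI[of _ "\<lambda>n. unmor (ob T n) (ob X (n + 1)) (p n)"],
        rule exI[of _ "\<lambda>n. unmor (ob T n) (ob Y n) (q n)"], intro conjI allI d)
      (rule is_biprod_unmor[OF b, folded i'_def j'_def])
qed

end

section \<open>Local exactness\<close>

text \<open>
  Exactness is tested on generalized elements \<open>W \<rightarrow> X\<close>, after pulling back along covers of \<open>W\<close>.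
  Closure of the exact complexes under shifts, cones and summands becomes diagram chasing.
\<close>

context additive_regular_category
begin

definition cyc where
  "cyc X n W x \<longleftrightarrow> x \<in> arr W (ob X n) \<and> dd X n * x = 0"

definition bnd where
  "bnd X n W x \<longleftrightarrow> (\<exists>W' e y. cover W' W e \<and> y \<in> arr W' (ob X (n - 1)) \<and> x * e = dd X (n - 1) * y)"

definition exact_cpx where
  "exact_cpx X \<longleftrightarrow> is_complex C X \<and> (\<forall>n W x. cyc X n W x \<longrightarrow> bnd X n W x)"

text \<open>The two clauses stand for injectivity and surjectivity on cohomology, for which
  \<open>E\<close> has no objects.\<close>

definition qis where
  "qis X Y \<phi> \<longleftrightarrow> is_complex C X \<and> is_complex C Y \<and> cmap X Y \<phi> \<and>
    (\<forall>n W x. cyc X n W x \<longrightarrow> bnd Y n W (\<phi> n * x) \<longrightarrow> bnd X n W x) \<and>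
    (\<forall>n W z. cyc Y n W z \<longrightarrow> (\<exists>W' e x y. cover W' W e \<and> cyc X n W' x \<and> y \<in> arr W' (ob Y (n - 1)) \<and>
      z * e = \<phi> n * x + dd Y (n - 1) * y))"

lemma qisD:
  assumes "qis X Y \<phi>"
  shows "is_complex C X" "is_complex C Y" "cmap X Y \<phi>"
    and qis_inj: "\<lbrakk>cyc X n W x; bnd Y n W (\<phi> n * x)\<rbrakk> \<Longrightarrow> bnd X n W x"
  using assms unfolding qis_def by blast+

lemma qis_surj:
  assumes "qis X Y \<phi>" "cyc Y n W z"
  obtains W' e x y where "cover W' W e" "cyc X n W' x" "y \<in> arr W' (ob Y (n - 1))"
    "z * e = \<phi> n * x + dd Y (n - 1) * y"
  using assms unfolding qis_def by blast

lemma bndE: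
  assumes "bnd X n W x"
  obtains W' e y where "cover W' W e" "y \<in> arr W' (ob X (n - 1))" "x * e = dd X (n - 1) * y"
  using assms unfolding bnd_def by blast

lemma bndI: "\<lbrakk>cover W' W e; y \<in> arr W' (ob X (n - 1)); x * e = dd X (n - 1) * y\<rbrakk> \<Longrightarrow> bnd X n W x"
  unfolding bnd_def by blast

lemma bnd_global:
  assumes "x \<in> arr W A" "y \<in> arr W (ob X (n - 1))" "x = dd X (n - 1) * y"
  shows "bnd X n W x"
  using bndI[OF cover_ide assms(2)] assms arr_obj(1)[OF assms(1)] arr_ide_right[OF assms(1)] by metis

text \<open>Covers compose, so being a boundary is a local property.\<close>

lemma bnd_local:
  assumes "cover W' W e" "bnd X n W' (x * e)"
  shows "bnd X n W x"
proof -
  obtain V d y where "cover V W' d" "y \<in> arr V (ob X (n - 1))" "x * e * d = dd X (n - 1) * y"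
    using assms(2) by (rule bndE)
  then show ?thesis using bndI[OF cover_comp[OF assms(1)]] by (metis mult.assoc)
qed

lemma cyc_restrict: "\<lbrakk>cyc X n W x; e \<in> arr W' W\<rbrakk> \<Longrightarrow> cyc X n W' (x * e)"
  unfolding cyc_def by (auto simp: mult.assoc[symmetric] intro: arr_mult)

lemma cyc_arr: "cyc X n W x \<Longrightarrow> x \<in> arr W (ob X n)"
  by (simp add: cyc_def)

lemma cyc_map: "\<lbrakk>cmap X Y \<phi>; cyc X n W x\<rbrakk> \<Longrightarrow> cyc Y n W (\<phi> n * x)"
  unfolding cyc_def using cmap_comm[of X Y \<phi> n, symmetric]
  by (auto simp: mult.assoc[symmetric] intro: arr_mult[OF _ cmap_arr]; simp add: mult.assoc)

lemma bnd_map: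
  assumes "cmap X Y \<phi>" "bnd X n W x"
  shows "bnd Y n W (\<phi> n * x)"
proof -
  obtain W' e y where y: "cover W' W e" "y \<in> arr W' (ob X (n - 1))" "x * e = dd X (n - 1) * y"
    using assms(2) by (rule bndE)
  have "\<phi> n * x * e = dd Y (n - 1) * (\<phi> (n - 1) * y)"
    using cmap_comm'[OF assms(1), of n] y(3) by (simp add: mult.assoc) (simp add: mult.assoc[symmetric])
  then show ?thesis using bndI[OF y(1) arr_mult[OF y(2) cmap_arr[OF assms(1)]]] by simp
qed

lemma bnd_add:
  assumes "bnd X n W x" and y: "y \<in> arr W (ob X (n - 1))" and X: "is_complex C X"
  shows "bnd X n W (x + dd X (n - 1) * y)"
proof -
  obtain W' e z where z: "cover W' W e" "z \<in> arr W' (ob X (n - 1))" "x * e = dd X (n - 1) * z"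
    using assms(1) by (rule bndE)
  have "(x + dd X (n - 1) * y) * e = dd X (n - 1) * (z + y * e)"
    using z(3) by (simp add: distrib_left distrib_right mult.assoc)
  then show ?thesis using bndI[OF z(1) arr_add[OF z(2) arr_mult[OF cover_arr[OF z(1)] y]]] by simp
qed

lemma cyc_boundary:
  "\<lbrakk>is_complex C X; y \<in> arr W (ob X (n - 1))\<rbrakk> \<Longrightarrow> cyc X n W (dd X (n - 1) * y)"
  unfolding cyc_def using dd_dd'[of X n] arr_mult[OF _ dd_arr'] by (simp add: mult.assoc[symmetric])

lemma cyc_add: "\<lbrakk>cyc X n W x; cyc X n W y\<rbrakk> \<Longrightarrow> cyc X n W (x + y)"
  and cyc_diff: "\<lbrakk>cyc X n W x; cyc X n W y\<rbrakk> \<Longrightarrow> cyc X n W (x - y)"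
  unfolding cyc_def by (simp_all add: arr_add arr_diff distrib_left right_diff_distrib)

lemma exactD: "exact_cpx X \<Longrightarrow> is_complex C X" "\<lbrakk>exact_cpx X; cyc X n W x\<rbrakk> \<Longrightarrow> bnd X n W x"
  unfolding exact_cpx_def by blast+

lemma qis_ide: "is_complex C X \<Longrightarrow> qis X X (\<lambda>n. ide (ob X n))"
  unfolding qis_def
proof (intro conjI allI impI)
  fix n W x assume "is_complex C X" "cyc X n W x" "bnd X n W (ide (ob X n) * x)"
  then show "bnd X n W x" using arr_ide_left[OF cyc_arr] by metis
next
  fix n W z assume X: "is_complex C X" and z: "cyc X n W z"
  have W: "W \<in> Obj C" using arr_obj cyc_arr[OF z] by blast
  show "\<exists>W' e x y. cover W' W e \<and> cyc X n W' x \<and> y \<in> arr W' (ob X (n - 1)) \<and>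
      z * e = ide (ob X n) * x + dd X (n - 1) * y"
    using cover_ide[OF W] z arr_0[OF W ob_in[OF X]] arr_ide_left[OF cyc_arr[OF z]] arr_ide_right[OF cyc_arr[OF z]]
    by (intro exI[of _ W] exI[of _ "ide W"] exI[of _ z] exI[of _ 0]) simp
qed (simp_all add: cmap_ide)

lemma qis_comp:
  assumes f: "qis X Y \<phi>" and g: "qis Y Z \<psi>"
  shows "qis X Z (\<lambda>n. \<psi> n * \<phi> n)"
  unfolding qis_def
proof (intro conjI allI impI)
  note F = qisD[OF f] and G = qisD[OF g]
  show "is_complex C X" "is_complex C Z" "cmap X Z (\<lambda>n. \<psi> n * \<phi> n)" using F G cmap_comp by blast+
  fix n W
  { fix x assume x: "cyc X n W x" "bnd Z n W (\<psi> n * \<phi> n * x)"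
    then show "bnd X n W x" using qis_inj[OF g cyc_map[OF F(3) x(1)]] qis_inj[OF f] by (simp add: mult.assoc) }
  fix z assume z: "cyc Z n W z"
  obtain W' e y u where y: "cover W' W e" "cyc Y n W' y" "u \<in> arr W' (ob Z (n - 1))"
    "z * e = \<psi> n * y + dd Z (n - 1) * u" using qis_surj[OF g z] .
  obtain W'' e' x v where x: "cover W'' W' e'" "cyc X n W'' x" "v \<in> arr W'' (ob Y (n - 1))"
    "y * e' = \<phi> n * x + dd Y (n - 1) * v" using qis_surj[OF f y(2)] .
  have "z * (e * e') = \<psi> n * (y * e') + dd Z (n - 1) * (u * e')"
    using y(4) by (simp add: mult.assoc[symmetric] distrib_right)
  also have "\<dots> = \<psi> n * \<phi> n * x + \<psi> n * dd Y (n - 1) * v + dd Z (n - 1) * (u * e')"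
    by (simp add: x(4) distrib_left mult.assoc)
  also have "\<dots> = \<psi> n * \<phi> n * x + dd Z (n - 1) * (\<psi> (n - 1) * v + u * e')"
    using cmap_comm'[OF G(3), of n] by (simp add: distrib_left mult.assoc[symmetric])
  finally have "z * (e * e') = \<psi> n * \<phi> n * x + dd Z (n - 1) * (\<psi> (n - 1) * v + u * e')" .
  moreover have "\<psi> (n - 1) * v + u * e' \<in> arr W'' (ob Z (n - 1))"
    using arr_add[OF arr_mult[OF x(3) cmap_arr[OF G(3)]] arr_mult[OF cover_arr[OF x(1)] y(3)]] .
  ultimately show "\<exists>W' e x y. cover W' W e \<and> cyc X n W' x \<and> y \<in> arr W' (ob Z (n - 1)) \<and>
      z * e = \<psi> n * \<phi> n * x + dd Z (n - 1) * y"
    using cover_comp[OF y(1) x(1)] x(2) by blast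
qed

text \<open>On cycles the term of the homotopy that contains the differential of \<open>X\<close>
  vanishes, so homotopic maps differ there by a boundary, given explicitly by
  \<open>k\<close>.\<close>

lemma htp_cyc:
  assumes h: "htp X Y (\<lambda>n. \<phi> n - \<psi> n)"
  obtains k where "\<And>n. k n \<in> arr (ob X n) (ob Y (n - 1))"
    "\<And>n W x. cyc X n W x \<Longrightarrow> \<phi> n * x = \<psi> n * x + dd Y (n - 1) * (k n * x)"
proof -
  obtain k where k: "\<And>n. k n \<in> arr (ob X n) (ob Y (n - 1))"
    "\<And>n. \<phi> n - \<psi> n = dd Y (n - 1) * k n + k (n + 1) * dd X n"
    using h unfolding htp_def by blast
  have "\<phi> n * x = \<psi> n * x + dd Y (n - 1) * (k n * x)" if "cyc X n W x" for n W x
  proof -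
    have "(\<phi> n - \<psi> n) * x = dd Y (n - 1) * (k n * x)"
      using that by (simp add: k(2) distrib_right mult.assoc cyc_def)
    then show ?thesis by (simp add: left_diff_distrib algebra_simps)
  qed
  then show ?thesis using that k(1) by blast
qed

text \<open>By \<open>htp_cyc\<close> the two maps agree on cycles up to boundaries, and both
  clauses of \<open>qis\<close> are insensitive to boundaries.\<close>

lemma qis_homotopic:
  assumes f: "qis X Y \<phi>" and h: "htp X Y (\<lambda>n. \<phi> n - \<psi> n)" and c: "cmap X Y \<psi>"
  shows "qis X Y \<psi>"
  unfolding qis_def
proof (intro conjI allI impI)
  note F = qisD[OF f]
  show "is_complex C X" "is_complex C Y" "cmap X Y \<psi>" using F c by blast+
  obtain k where k: "\<And>n. k n \<in> arr (ob X n) (ob Y (n - 1))"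
    "\<And>n W x. cyc X n W x \<Longrightarrow> \<phi> n * x = \<psi> n * x + dd Y (n - 1) * (k n * x)"
    using htp_cyc[OF h] by metis
  fix n W
  { fix x assume x: "cyc X n W x" "bnd Y n W (\<psi> n * x)"
    have "k n * x \<in> arr W (ob Y (n - 1))" using arr_mult[OF cyc_arr[OF x(1)] k(1)] .
    then show "bnd X n W x" using bnd_add[OF x(2) _ F(2)] k(2)[OF x(1)] qis_inj[OF f x(1)] by simp }
  fix z assume z: "cyc Y n W z"
  obtain W' e x u where x: "cover W' W e" "cyc X n W' x" "u \<in> arr W' (ob Y (n - 1))"
    "z * e = \<phi> n * x + dd Y (n - 1) * u" using qis_surj[OF f z] .
  have "z * e = \<psi> n * x + dd Y (n - 1) * (k n * x + u)"
    using x(4) k(2)[OF x(2)] by (simp add: distrib_left add.assoc)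
  then show "\<exists>W' e x y. cover W' W e \<and> cyc X n W' x \<and> y \<in> arr W' (ob Y (n - 1)) \<and>
      z * e = \<psi> n * x + dd Y (n - 1) * y"
    using x(1,2) arr_add[OF arr_mult[OF cyc_arr[OF x(2)] k(1)] x(3)] by blast
qed

text \<open>An element of \<open>T\<close> is a pair \<open>(x, y)\<close> with differential
  \<open>(- d x, \<phi> x + d y)\<close>. A cycle of \<open>T\<close> is thus a cycle
  \<open>x\<close> of \<open>X\<close> together with a reason why \<open>\<phi> x\<close> bounds,
  and exactness of \<open>T\<close> contains both clauses of \<open>qis\<close>.\<close>

lemma exact_cone:
  assumes e: "is_ext (shift C X) Y (\<lambda>n. \<phi> (n + 1)) T i j p q"
    and X: "is_complex C X" and c: "cmap X Y \<phi>"
  shows "exact_cpx T \<longleftrightarrow> qis X Y \<phi>"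
proof
  note Y = is_extD(2)[OF e] and T = is_extD(3)[OF e]
  have b: "rbiprod (ob X (n + 1)) (ob Y n) (ob T n) (i n) (j n) (p n) (q n)" for n
    using is_extD(4)[OF e, of n] by simp
  note B = rbiprodD[OF b]
  have di: "dd T n * i n = j (n + 1) * \<phi> (n + 1) - i (n + 1) * dd X (n + 1)" for n
    using is_extD(6)[OF e, of n] by (simp add: dd_shift X)
  have dj: "dd T n * j n = j (n + 1) * dd Y n" for n using is_extD(7)[OF e] .
  have pd: "p (n + 1) * dd T n = - (dd X (n + 1) * p n)" for n
    using is_extD(8)[OF e, of n] by (simp add: dd_shift X)
  have qd: "q (n + 1) * dd T n = \<phi> (n + 1) * p n + dd Y n * q n" for n using is_extD(9)[OF e] .
  have B': "p (n - 1) \<in> arr (ob T (n - 1)) (ob X n)" "i (n - 1) \<in> arr (ob X n) (ob T (n - 1))" for n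
    using B(1,3)[of "n - 1"] by simp_all
  { assume ex: "exact_cpx T"
    show "qis X Y \<phi>" unfolding qis_def
    proof (intro conjI allI impI X Y c)
      fix n W
      { fix x assume x: "cyc X n W x" "bnd Y n W (\<phi> n * x)"
        obtain W' e y where y: "cover W' W e" "y \<in> arr W' (ob Y (n - 1))" "\<phi> n * x * e = dd Y (n - 1) * y"
          using x(2) by (rule bndE)
        \<comment> \<open>The pair \<open>(x, - y)\<close> over \<open>W'\<close> is a cycle of the
          cone because \<open>\<phi> x\<close> bounds there. The first component of a preimage of it
          is minus a preimage of \<open>x\<close>.\<close>
        let ?w = "i (n - 1) * (x * e) - j (n - 1) * y"
        have xe: "x * e \<in> arr W' (ob X n)" using arr_mult[OF cover_arr[OF y(1)] cyc_arr[OF x(1)]] .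
        have w: "?w \<in> arr W' (ob T (n - 1))"
          using arr_diff[OF arr_mult[OF xe B'(2)] arr_mult[OF y(2) B(2)]] .
        have "dd T (n - 1) * ?w = j n * (\<phi> n * x * e - dd Y (n - 1) * y) - i n * (dd X n * x) * e"
          using di[of "n - 1"] dj[of "n - 1"]
          by (simp add: right_diff_distrib mult.assoc[symmetric]) (simp add: left_diff_distrib mult.assoc)
        then have "cyc T (n - 1) W' ?w" using w x(1) y(3) by (simp add: cyc_def)
        then obtain W'' e' u where u: "cover W'' W' e'" "u \<in> arr W'' (ob T (n - 1 - 1))"
          "?w * e' = dd T (n - 1 - 1) * u"
          using exactD(2)[OF ex] bndE by metis
        have "p (n - 1) * ?w = x * e"
          using rbiprod_elem(1)[OF b[of "n - 1"], of "x * e" W'] rbiprod_elem(3)[OF b[of "n - 1"]] xe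
          by (simp add: right_diff_distrib)
        then have "x * e * e' = p (n - 1) * (dd T (n - 1 - 1) * u)"
          using u(3) by (metis mult.assoc)
        also have "\<dots> = dd X (n - 1) * (- (p (n - 1 - 1) * u))"
          using pd[of "n - 1 - 1"] by (simp add: mult.assoc[symmetric])
        finally have "x * e * e' = dd X (n - 1) * (- (p (n - 1 - 1) * u))" .
        moreover have "- (p (n - 1 - 1) * u) \<in> arr W'' (ob X (n - 1))"
          using arr_neg[OF arr_mult[OF u(2) B'(1)]] .
        ultimately show "bnd X n W x"
          using bnd_local[OF y(1)] bndI[OF u(1)] by blast }
      fix z assume z: "cyc Y n W z"
      \<comment> \<open>The pair \<open>(0, z)\<close> is a cycle. If it is the differential of
        \<open>u\<close>, the first component of \<open>u\<close> is the cycle of \<open>X\<close>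
        sought and the second gives the boundary.\<close>
      have "cyc T n W (j n * z)"
        using arr_mult[OF cyc_arr[OF z] B(2)] z dj[of n] by (simp add: cyc_def mult.assoc[symmetric]) (simp add: mult.assoc)
      then obtain W' e u where u: "cover W' W e" "u \<in> arr W' (ob T (n - 1))" "j n * z * e = dd T (n - 1) * u"
        using exactD(2)[OF ex] bndE by metis
      have ze: "z * e \<in> arr W' (ob Y n)" using arr_mult[OF cover_arr[OF u(1)] cyc_arr[OF z]] .
      have "p n * (dd T (n - 1) * u) = 0" "q n * (dd T (n - 1) * u) = z * e"
        unfolding u(3)[symmetric] using rbiprod_elem(2)[OF b ze] rbiprod_elem(3)[OF b] by (simp_all add: mult.assoc)
      then have *: "dd X n * (p (n - 1) * u) = 0" "z * e = \<phi> n * (p (n - 1) * u) + dd Y (n - 1) * (q (n - 1) * u)"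
        using pd[of "n - 1"] qd[of "n - 1"] by (simp_all add: mult.assoc[symmetric] distrib_right[symmetric])
      then have "cyc X n W' (p (n - 1) * u)" using arr_mult[OF u(2) B'(1)] by (simp add: cyc_def)
      then show "\<exists>W' e x y. cover W' W e \<and> cyc X n W' x \<and> y \<in> arr W' (ob Y (n - 1)) \<and>
        z * e = \<phi> n * x + dd Y (n - 1) * y"
        using u(1) *(2) arr_mult[OF u(2) B(4)] by blast
    qed }
  assume qi: "qis X Y \<phi>"
  show "exact_cpx T" unfolding exact_cpx_def
  proof (intro conjI allI impI T)
    fix n W w assume w: "cyc T n W w"
    note wa = cyc_arr[OF w]
    have pw: "p n * w \<in> arr W (ob X (n + 1))" and qw: "q n * w \<in> arr W (ob Y n)"
      using arr_mult[OF wa] B by blast+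
    have "p (n + 1) * (dd T n * w) = 0" "q (n + 1) * (dd T n * w) = 0" using w by (simp_all add: cyc_def)
    then have dw: "dd X (n + 1) * (p n * w) = 0" "\<phi> (n + 1) * (p n * w) = - (dd Y n * (q n * w))"
      using pd[of n] qd[of n] by (simp_all add: mult.assoc[symmetric] distrib_right eq_neg_iff_add_eq_0)
    have "cyc X (n + 1) W (p n * w)" using pw dw by (simp add: cyc_def)
    moreover have "bnd Y (n + 1) W (\<phi> (n + 1) * (p n * w))"
      using bnd_global[of "\<phi> (n + 1) * (p n * w)" W "ob Y (n + 1)" "- (q n * w)" Y "n + 1"]
        arr_mult[OF pw cmap_arr[OF c]] arr_neg[OF qw] dw(2) by simp
    ultimately have "bnd X (n + 1) W (p n * w)" by (rule qis_inj[OF qi])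
    then obtain W' e x where x: "cover W' W e" "x \<in> arr W' (ob X n)" "p n * w * e = dd X n * x"
      by (rule bndE) simp
    note ea = cover_arr[OF x(1)]
    \<comment> \<open>Injectivity has bounded the first component of \<open>w\<close> by
      \<open>x\<close>. Adding \<open>\<phi> n * x\<close> to the second one yields a cycle of
      \<open>Y\<close>, to which surjectivity applies.\<close>
    have y: "q n * w * e + \<phi> n * x \<in> arr W' (ob Y n)"
      using arr_add[OF arr_mult[OF ea qw] arr_mult[OF x(2) cmap_arr[OF c]]] .
    have "dd Y n * (q n * w * e + \<phi> n * x) = dd Y n * (q n * w) * e + \<phi> (n + 1) * (dd X n * x)"
      using cmap_comm[OF c, of n] by (simp add: distrib_left mult.assoc[symmetric])
    also have "\<dots> = dd Y n * (q n * w) * e + \<phi> (n + 1) * (p n * w) * e"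
      by (simp add: x(3)[symmetric] mult.assoc)
    also have "\<dots> = 0" by (simp add: dw(2))
    finally have "cyc Y n W' (q n * w * e + \<phi> n * x)" using y by (simp add: cyc_def)
    then obtain W'' e' x' v where v: "cover W'' W' e'" "cyc X n W'' x'" "v \<in> arr W'' (ob Y (n - 1))"
      "(q n * w * e + \<phi> n * x) * e' = \<phi> n * x' + dd Y (n - 1) * v" by (rule qis_surj[OF qi])
    \<comment> \<open>The sign of \<open>x\<close> compensates the sign in the differential of
      \<open>X[1]\<close>; the cycle \<open>x'\<close> is the correction that surjectivity
      supplies.\<close>
    let ?u = "i (n - 1) * (x' - x * e') + j (n - 1) * v"
    have xa: "x' - x * e' \<in> arr W'' (ob X n)"
      using arr_diff[OF cyc_arr[OF v(2)] arr_mult[OF cover_arr[OF v(1)] x(2)]] .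
    have u: "?u \<in> arr W'' (ob T (n - 1))"
      using arr_add[OF arr_mult[OF xa B'(2)] arr_mult[OF v(3) B(2)]] .
    have 1: "dd T (n - 1) * ?u = j n * (\<phi> n * (x' - x * e') + dd Y (n - 1) * v) - i n * (dd X n * (x' - x * e'))"
      using di[of "n - 1"] dj[of "n - 1"]
      by (simp add: distrib_left mult.assoc[symmetric]) (simp add: left_diff_distrib mult.assoc)
    have 2: "\<phi> n * (x' - x * e') + dd Y (n - 1) * v = q n * (w * (e * e'))"
      using v(4) by (simp add: right_diff_distrib distrib_right mult.assoc algebra_simps)
    have 3: "dd X n * (x' - x * e') = - (p n * (w * (e * e')))"
      using v(2) x(3) by (simp add: right_diff_distrib cyc_def mult.assoc[symmetric])
    have we: "w * (e * e') \<in> arr W'' (ob T n)"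
      using arr_mult[OF arr_mult[OF cover_arr[OF v(1)] ea] wa] .
    have "w * (e * e') = dd T (n - 1) * ?u"
      unfolding 1 2 3 using rbiprod_elem(5)[OF b we] by (simp add: add.commute)
    then show "bnd T n W w" using bndI[OF cover_comp[OF x(1) v(1)] u] by simp
  qed
qed

text \<open>The long exact sequence of the extension on elements: when \<open>A\<close> has no
  cohomology, that of \<open>B\<close> and that of \<open>T\<close> agree. Each time the component
  in \<open>A\<close> is bounded first and its contribution through \<open>\<phi>\<close> is
  subtracted in \<open>B\<close>.\<close>

lemma ext_inclusion_qis:
  assumes e: "is_ext A B \<phi> T i j p q" and A: "exact_cpx A"
  shows "qis B T j"
  unfolding qis_def
proof (intro conjI allI impI is_extD[OF e])
  note E = is_extD[OF e]
  note R = rbiprodD[OF E(4)]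
  show c: "cmap B T j" using R E(7) by (intro cmapI) auto
  have pd: "p n * dd T (n - 1) = dd A (n - 1) * p (n - 1)" "q n * dd T (n - 1) = \<phi> (n - 1) * p (n - 1) + dd B (n - 1) * q (n - 1)" for n
    using E(8,9)[of "n - 1"] by simp_all
  have ph: "\<phi> (n - 1) \<in> arr (ob A (n - 1)) (ob B n)" for n using E(5)[of "n - 1"] by simp
  \<comment> \<open>The off-diagonal entry of \<open>d * d = 0\<close> in \<open>T\<close>, from
    degree \<open>n - 2\<close> to degree \<open>n\<close>.\<close>
  have anti: "dd B (n - 1) * \<phi> (n - 1 - 1) + \<phi> (n - 1) * dd A (n - 1 - 1) = 0" for n
  proof -
    let ?m = "n - 1 - 1"
    have "q n * (dd T (n - 1) * (dd T ?m * i ?m)) = q n * 0"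
      using dd_dd'[OF E(3), of "n - 1"] by (simp add: mult.assoc[symmetric])
    moreover have "dd T ?m * i ?m = i (n - 1) * dd A ?m + j (n - 1) * \<phi> ?m" using E(6)[of ?m] by simp
    moreover have "q n * (dd T (n - 1) * x) = \<phi> (n - 1) * (p (n - 1) * x) + dd B (n - 1) * (q (n - 1) * x)" for x
      using pd(2)[of n] by (simp add: mult.assoc[symmetric] distrib_right)
    moreover have "dd A ?m \<in> arr (ob A ?m) (ob A (n - 1))" "\<phi> ?m \<in> arr (ob A ?m) (ob B (n - 1))"
      using dd_arr'[OF E(1), of "n - 1"] E(5)[of ?m] by simp_all
    ultimately show ?thesis
      using rbiprod_elem[OF E(4)[of "n - 1"]] by (simp add: distrib_left add.commute)
  qed
  fix n W
  { fix y assume y: "cyc B n W y" "bnd T n W (j n * y)"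
    obtain W' d w where w: "cover W' W d" "w \<in> arr W' (ob T (n - 1))" "j n * y * d = dd T (n - 1) * w"
      using y(2) by (rule bndE)
    have yd: "y * d \<in> arr W' (ob B n)" using arr_mult[OF cover_arr[OF w(1)] cyc_arr[OF y(1)]] .
    have "p n * (dd T (n - 1) * w) = 0" "q n * (dd T (n - 1) * w) = y * d"
      unfolding w(3)[symmetric] using rbiprod_elem(2)[OF E(4) yd] rbiprod_elem(3)[OF E(4)] by (simp_all add: mult.assoc)
    then have *: "dd A (n - 1) * (p (n - 1) * w) = 0"
      "y * d = \<phi> (n - 1) * (p (n - 1) * w) + dd B (n - 1) * (q (n - 1) * w)"
      using pd[of n] by (simp_all add: mult.assoc[symmetric] distrib_right[symmetric])
    have "cyc A (n - 1) W' (p (n - 1) * w)" using *(1) arr_mult[OF w(2) R(3)] by (simp add: cyc_def)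
    then obtain W'' d' a where a: "cover W'' W' d'" "a \<in> arr W'' (ob A (n - 1 - 1))"
      "p (n - 1) * w * d' = dd A (n - 1 - 1) * a"
      using exactD(2)[OF A] bndE by metis
    have ph2: "\<phi> (n - 1 - 1) * a \<in> arr W'' (ob B (n - 1))" using arr_mult[OF a(2) E(5)[of "n - 1 - 1"]] by simp
    have "\<phi> (n - 1) * (dd A (n - 1 - 1) * a) = - (dd B (n - 1) * (\<phi> (n - 1 - 1) * a))"
      using anti[of n] by (simp add: mult.assoc[symmetric] eq_neg_iff_add_eq_0) (simp add: distrib_right[symmetric] add.commute)
    then have "y * d * d' = dd B (n - 1) * (q (n - 1) * w * d' - \<phi> (n - 1 - 1) * a)"
      using *(2) a(3) by (simp add: distrib_right right_diff_distrib mult.assoc)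
    then show "bnd B n W y"
      using bnd_local[OF w(1)] bndI[OF a(1) arr_diff[OF arr_mult[OF cover_arr[OF a(1)] arr_mult[OF w(2) R(4)]] ph2]] by blast }
  fix w assume w: "cyc T n W w"
  have pw: "p n * w \<in> arr W (ob A n)" "q n * w \<in> arr W (ob B n)" using arr_mult[OF cyc_arr[OF w]] R by blast+
  have "p (n + 1) * (dd T n * w) = 0" using w by (simp add: cyc_def)
  then have "cyc A n W (p n * w)" using E(8)[of n] pw by (simp add: cyc_def mult.assoc[symmetric])
  then obtain W' d a where a: "cover W' W d" "a \<in> arr W' (ob A (n - 1))" "p n * w * d = dd A (n - 1) * a"
    using exactD(2)[OF A] bndE by metis
  \<comment> \<open>Subtracting the differential of \<open>i (n - 1) * a\<close> removes the
    component of \<open>w\<close> in \<open>A\<close>; what remains is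
    \<open>j n * ?x\<close>.\<close>
  let ?x = "q n * w * d - \<phi> (n - 1) * a"
  have wd: "w * d \<in> arr W' (ob T n)" using arr_mult[OF cover_arr[OF a(1)] cyc_arr[OF w]] .
  have x: "?x \<in> arr W' (ob B n)"
    using arr_diff[OF arr_mult[OF cover_arr[OF a(1)] pw(2)] arr_mult[OF a(2) ph]] .
  have "dd T (n - 1) * (i (n - 1) * a) = i n * (p n * w * d) + j n * (\<phi> (n - 1) * a)"
    using E(6)[of "n - 1"] a(3) by (simp add: mult.assoc[symmetric] distrib_right; simp add: mult.assoc)
  then have eq: "w * d = j n * ?x + dd T (n - 1) * (i (n - 1) * a)"
    using rbiprod_elem(5)[OF E(4) wd] by (simp add: right_diff_distrib mult.assoc add.commute)
  have ia: "i (n - 1) * a \<in> arr W' (ob T (n - 1))" using arr_mult[OF a(2) R(1)] .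
  have "cyc T n W' (w * d - dd T (n - 1) * (i (n - 1) * a))"
    using cyc_diff[OF cyc_restrict[OF w cover_arr[OF a(1)]] cyc_boundary[OF E(3) ia]] .
  then have "dd T n * (j n * ?x) = 0" by (simp add: eq cyc_def)
  then have "j (n + 1) * (dd B n * ?x) = 0" using E(7)[of n] by (simp add: mult.assoc[symmetric])
  then have "q (n + 1) * (j (n + 1) * (dd B n * ?x)) = 0" by simp
  then have "cyc B n W' ?x"
    using rbiprod_elem(2)[OF E(4) arr_mult[OF x dd_arr[OF E(2)]]] x by (simp add: cyc_def)
  then show "\<exists>W' e x y. cover W' W e \<and> cyc B n W' x \<and> y \<in> arr W' (ob T (n - 1)) \<and>
      w * e = j n * x + dd T (n - 1) * y"
    using a(1) eq ia by blast
qed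

text \<open>When \<open>B\<close> has no cohomology, that of \<open>T\<close> and that of
  \<open>A\<close> agree. A cycle \<open>a\<close> lifts because \<open>\<phi> n * a\<close> is a
  cycle of \<open>B\<close> and hence bounds; minus its bound is the second component of the
  lift.\<close>

lemma ext_projection_qis:
  assumes e: "is_ext A B \<phi> T i j p q" and B: "exact_cpx B"
    and anti: "\<And>n. dd B (n + 1) * \<phi> n + \<phi> (n + 1) * dd A n = 0"
  shows "qis T A p"
  unfolding qis_def
proof (intro conjI allI impI is_extD[OF e])
  note E = is_extD[OF e]
  note R = rbiprodD[OF E(4)]
  show c: "cmap T A p" using R E(8) by (intro cmapI) auto
  have ph: "\<phi> (n - 1) \<in> arr (ob A (n - 1)) (ob B n)" for n using E(5)[of "n - 1"] by simp
  fix n W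
  { fix w assume w: "cyc T n W w" "bnd A n W (p n * w)"
    obtain W' d a where a: "cover W' W d" "a \<in> arr W' (ob A (n - 1))" "p n * w * d = dd A (n - 1) * a"
      using w(2) by (rule bndE)
    let ?x = "q n * w * d - \<phi> (n - 1) * a"
    have wd: "w * d \<in> arr W' (ob T n)" using arr_mult[OF cover_arr[OF a(1)] cyc_arr[OF w(1)]] .
    have x: "?x \<in> arr W' (ob B n)"
      using arr_diff[OF arr_mult[OF cover_arr[OF a(1)] arr_mult[OF cyc_arr[OF w(1)] R(4)]] arr_mult[OF a(2) ph]] .
    have "dd T (n - 1) * (i (n - 1) * a) = i n * (p n * w * d) + j n * (\<phi> (n - 1) * a)"
      using E(6)[of "n - 1"] a(3) by (simp add: mult.assoc[symmetric] distrib_right; simp add: mult.assoc)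
    then have eq: "w * d = j n * ?x + dd T (n - 1) * (i (n - 1) * a)"
      using rbiprod_elem(5)[OF E(4) wd] by (simp add: right_diff_distrib mult.assoc add.commute)
    have ia: "i (n - 1) * a \<in> arr W' (ob T (n - 1))" using arr_mult[OF a(2) R(1)] .
    have "cyc T n W' (w * d - dd T (n - 1) * (i (n - 1) * a))"
      using cyc_diff[OF cyc_restrict[OF w(1) cover_arr[OF a(1)]] cyc_boundary[OF E(3) ia]] .
    then have "dd T n * (j n * ?x) = 0" by (simp add: eq cyc_def)
    then have "j (n + 1) * (dd B n * ?x) = 0" using E(7)[of n] by (simp add: mult.assoc[symmetric])
    then have "q (n + 1) * (j (n + 1) * (dd B n * ?x)) = 0" by simp
    then have "cyc B n W' ?x"
      using rbiprod_elem(2)[OF E(4) arr_mult[OF x dd_arr[OF E(2)]]] x by (simp add: cyc_def)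
    then obtain W'' d' b where b: "cover W'' W' d'" "b \<in> arr W'' (ob B (n - 1))" "?x * d' = dd B (n - 1) * b"
      using exactD(2)[OF B] bndE by metis
    have "w * d * d' = j n * (?x * d') + dd T (n - 1) * (i (n - 1) * a) * d'"
      by (subst eq) (simp add: distrib_right mult.assoc)
    also have "\<dots> = dd T (n - 1) * (j (n - 1) * b + i (n - 1) * a * d')"
      using E(7)[of "n - 1"] unfolding b(3) by (simp add: distrib_left mult.assoc[symmetric])
    finally show "bnd T n W w"
      using bnd_local[OF a(1)] bndI[OF b(1) arr_add[OF arr_mult[OF b(2) R(2)] arr_mult[OF cover_arr[OF b(1)] ia]]] by blast }
  fix a assume a: "cyc A n W a"
  have fa: "\<phi> n * a \<in> arr W (ob B (n + 1))" using arr_mult[OF cyc_arr[OF a] E(5)] .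
  have "dd B (n + 1) * (\<phi> n * a) = (dd B (n + 1) * \<phi> n + \<phi> (n + 1) * dd A n) * a"
    using a by (simp add: cyc_def distrib_right mult.assoc)
  then have "cyc B (n + 1) W (\<phi> n * a)" using fa anti by (simp add: cyc_def)
  then obtain W' d b where b: "cover W' W d" "b \<in> arr W' (ob B n)" "\<phi> n * a * d = dd B n * b"
    using exactD(2)[OF B] bndE[of B "n + 1"] by (metis add_diff_cancel_right')
  let ?w = "i n * (a * d) - j n * b"
  have ad: "a * d \<in> arr W' (ob A n)" using arr_mult[OF cover_arr[OF b(1)] cyc_arr[OF a]] .
  have w: "?w \<in> arr W' (ob T n)" using arr_diff[OF arr_mult[OF ad R(1)] arr_mult[OF b(2) R(2)]] .
  have "dd T n * ?w = i (n + 1) * (dd A n * a) * d + j (n + 1) * (\<phi> n * a * d - dd B n * b)"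
    using E(6,7)[of n] by (simp add: right_diff_distrib mult.assoc[symmetric] distrib_right)
  then have cw: "cyc T n W' ?w" using w a b(3) by (simp add: cyc_def)
  have "a * d = p n * ?w + dd A (n - 1) * 0"
    using rbiprod_elem(1)[OF E(4) ad] rbiprod_elem(3)[OF E(4)] by (simp add: right_diff_distrib)
  moreover have "0 \<in> arr W' (ob A (n - 1))" using arr_0[OF arr_obj(1)[OF ad] ob_in[OF E(1)]] .
  ultimately show "\<exists>W' e x y. cover W' W e \<and> cyc T n W' x \<and> y \<in> arr W' (ob A (n - 1)) \<and>
      a * e = p n * x + dd A (n - 1) * y"
    using b(1) cw by blast
qed

text \<open>The kernel inclusion \<open>k\<close> is a cycle over its own domain. Exactness makes it
  a boundary after a cover, so that cover factors through the corestriction \<open>p\<close>, and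
  \<open>cover_factor\<close> applies.\<close>

lemma image_kernel:
  assumes X: "exact_cpx X"
  shows "\<exists>A k p. rker A (ob X n) (ob X (n + 1)) k (dd X n) \<and> cover (ob X (n - 1)) A p \<and>
    dd X (n - 1) = k * p"
proof -
  note C = exactD(1)[OF X]
  obtain A k where k: "rker A (ob X n) (ob X (n + 1)) k (dd X n)" using kernel_exists[OF dd_arr[OF C]] .
  have km: "rmono A (ob X n) k" "dd X n * k = 0" using k by (auto simp: rker_def)
  then have ka: "k \<in> arr A (ob X n)" by (simp add: rmono_def)
  obtain p where p: "p \<in> arr (ob X (n - 1)) A" "k * p = dd X (n - 1)"
    using k dd_arr'[OF C, of n] dd_dd'[OF C, of n] unfolding rker_def by blast
  have "cyc X n A k" using ka km(2) by (simp add: cyc_def)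
  then obtain W e y where y: "cover W A e" "y \<in> arr W (ob X (n - 1))" "k * e = dd X (n - 1) * y"
    using exactD(2)[OF X] bndE by metis
  have "k * e = k * (p * y)" using y(3) p(2) by (simp add: mult.assoc[symmetric])
  then have "e = p * y" using rmono_cancel[OF km(1) cover_arr[OF y(1)] arr_mult[OF y(2) p(1)]] by blast
  then have "cover (ob X (n - 1)) A p" using cover_factor[of W A p y] y p by simp
  then show ?thesis using k p(2) by metis
qed

text \<open>\<open>q\<close> and \<open>f\<close> annihilate the same elements, so a kernel of one
  is a kernel of the other.\<close>

lemma conflationI:
  assumes "rker A X Y k f" "rcok A X Q k q" "\<And>W a. a \<in> arr W X \<Longrightarrow> q * a = 0 \<longleftrightarrow> f * a = 0"
  shows "conflation C A X Q (unmor A X k) (unmor X Q q)"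
proof -
  have "q \<in> arr X Q" "q * k = 0" using assms(2) by (auto simp: rcok_def repi_def)
  then have "rker A X Q k q" using assms(1,3) unfolding rker_def by blast
  then show ?thesis unfolding conflation_def using assms(2) by (simp add: rker_is_kernel rcok_is_cokernel)
qed

text \<open>The kernels of all differentials are chosen together, so that the cover onto
  \<open>A (n + 1)\<close> and the kernel \<open>A n\<close> refer to the same choices and form a
  conflation around \<open>X\<close> in degree \<open>n\<close>.\<close>

lemma exact_acyclic:
  assumes X: "exact_cpx X"
  shows "acyclic_complex C X"
proof -
  note XC = exactD(1)[OF X]
  have "\<forall>n. \<exists>t. case t of (A, k, p) \<Rightarrow> rker A (ob X n) (ob X (n + 1)) k (dd X n) \<and>
      cover (ob X (n - 1)) A p \<and> dd X (n - 1) = k * p"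
    using image_kernel[OF X] by simp
  from choice[OF this] obtain t where t: "\<forall>n. case t n of (A, k, p) \<Rightarrow> rker A (ob X n) (ob X (n + 1)) k (dd X n) \<and>
      cover (ob X (n - 1)) A p \<and> dd X (n - 1) = k * p" by blast
  define A where "A n = fst (t n)" for n
  define k where "k n = fst (snd (t n))" for n
  define p where "p n = snd (snd (t n))" for n
  have k: "rker (A n) (ob X n) (ob X (n + 1)) (k n) (dd X n)"
    and p: "cover (ob X (n - 1)) (A n) (p n)" and d: "dd X (n - 1) = k n * p n" for n
    using t[rule_format, of n] by (simp_all add: A_def k_def p_def split_beta)
  have km: "rmono (A n) (ob X n) (k n)" for n using k by (simp add: rker_def)
  have ka: "k n \<in> arr (A n) (ob X n)" for n using km by (simp add: rmono_def)
  \<comment> \<open>The differential in degree \<open>n\<close> is \<open>p (n + 1)\<close> followed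
    by the monomorphism \<open>k (n + 1)\<close>.\<close>
  have same: "p (n + 1) * a = 0 \<longleftrightarrow> dd X n * a = 0" if a: "a \<in> arr W (ob X n)" for n W a
  proof -
    have "p (n + 1) * a \<in> arr W (A (n + 1))" using arr_mult[OF a] cover_arr[OF p[of "n + 1"]] by simp
    then show ?thesis using km[of "n + 1"] d[of "n + 1"] unfolding rmono_def by (auto simp: mult.assoc)
  qed
  have p': "cover (ob X n) (A (n + 1)) (p (n + 1))" for n using p[of "n + 1"] by simp
  have AO: "A n \<in> Obj C" for n using ka arr_obj by blast
  have cok: "rcok (A n) (ob X n) (A (n + 1)) (k n) (p (n + 1))" for n
    using cover_cokernel_of_kernel[OF p' k same cover_ide[OF AO]] arr_ide_right[OF ka] by simp
  have cok': "rcok (ob X (n - 1)) (ob X n) (A (n + 1)) (dd X (n - 1)) (p (n + 1))" for n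
    using cover_cokernel_of_kernel[OF p' k same p] d by simp
  have confl: "conflation C (A n) (ob X n) (A (n + 1)) (unmor (A n) (ob X n) (k n)) (unmor (ob X n) (A (n + 1)) (p (n + 1)))" for n
    using conflationI[OF k cok same] .
  have du: "unmor (ob X n) (ob X (n + 1)) (dd X n) = df X n" for n
    using df_in[OF XC] ob_in[OF XC] by (simp add: dd_def)
  have du': "unmor (ob X (n - 1)) (ob X n) (dd X (n - 1)) = df X (n - 1)" for n
    using du[of "n - 1"] by simp
  show ?thesis
    unfolding acyclic_complex_def
  proof (intro conjI allI XC exI)
    fix n
    let ?p = "unmor (ob X (n - 1)) (A n) (p n)" and ?k = "unmor (A n) (ob X n) (k n)"
    show "df X (n - 1) = Cmp C (ob X (n - 1)) (A n) (ob X n) ?k ?p"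
      using ka[of n] cover_arr[OF p[of n]] d[of n] by (simp add: unmor_Cmp arr_iff du'[symmetric])
    show "deflation C (ob X (n - 1)) (A n) ?p"
      unfolding deflation_def using confl[of "n - 1"] by (metis diff_add_cancel)
    show "is_cokernel C (ob X (n - 2)) (ob X (n - 1)) (A n) (df X (n - 2)) ?p"
      using rcok_is_cokernel[OF cok'[of "n - 1"]] du'[of "n - 1"] by simp
    show "inflation C (A n) (ob X n) ?k"
      unfolding inflation_def using confl by blast
    show "is_kernel C (A n) (ob X n) (ob X (n + 1)) ?k (df X n)"
      using rker_is_kernel[OF k[of n]] du by simp
  qed
qed

text \<open>A cycle factors through the kernel, and pulling back the deflation onto that kernel
  gives the cover over which the cycle bounds.\<close>

lemma acyclic_exact:
  assumes "acyclic_complex C X"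
  shows "exact_cpx X"
  unfolding exact_cpx_def
proof (intro conjI allI impI)
  show X: "is_complex C X" using assms by (simp add: acyclic_complex_def)
  fix n W x assume x: "cyc X n W x"
  obtain A p i where A: "df X (n - 1) = Cmp C (ob X (n - 1)) A (ob X n) i p"
    "deflation C (ob X (n - 1)) A p" "is_kernel C A (ob X n) (ob X (n + 1)) i (df X n)"
    using assms unfolding acyclic_complex_def by blast
  have O: "A \<in> Obj C" "i \<in> Hom C A (ob X n)" using A(3) by (auto simp: is_kernel_def)
  have p: "cover (ob X (n - 1)) A (mor C (ob X (n - 1)) A p)" "p \<in> Hom C (ob X (n - 1)) A"
    using A(2) cokernel_mor_cover[of "ob X (n - 1)" A p]
    unfolding deflation_def conflation_def cokernel_mor_def by blast+
  have k: "rker A (ob X n) (ob X (n + 1)) (mor C A (ob X n) i) (dd X n)"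
    using A(3) is_kernel_iff[of A "ob X n" "ob X (n + 1)" i "df X n"] O ob_in[OF X] df_in[OF X] by (simp add: dd_def)
  obtain h where h: "h \<in> arr W A" "mor C A (ob X n) i * h = x"
    using x k unfolding cyc_def rker_def by blast
  obtain V e y where y: "cover V W e" "y \<in> arr V (ob X (n - 1))" "mor C (ob X (n - 1)) A p * y = h * e"
    using cover_pullback[OF p(1) h(1)] by metis
  have "dd X (n - 1) = mor C A (ob X n) i * mor C (ob X (n - 1)) A p"
    using A(1) O p(2) ob_in[OF X] by (simp add: dd_def mor_Cmp)
  then have "x * e = dd X (n - 1) * y" using h(2) y(3) by (simp add: mult.assoc) (simp add: mult.assoc[symmetric])
  then show "bnd X n W x" using bndI[OF y(1,2)] by blast
qed

lemma exact_shift: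
  assumes X: "exact_cpx X"
  shows "exact_cpx (shift C X)" "exact_cpx (unshift C X)"
proof -
  note XC = exactD(1)[OF X]
  show "exact_cpx (shift C X)" unfolding exact_cpx_def
  proof (intro conjI allI impI shift_complex XC)
    fix n W x assume "cyc (shift C X) n W x"
    then have "cyc X (n + 1) W x" by (simp add: cyc_def dd_shift XC)
    then obtain V e y where y: "cover V W e" "y \<in> arr V (ob X (n + 1 - 1))" "x * e = dd X (n + 1 - 1) * y"
      using exactD(2)[OF X] bndE by metis
    then show "bnd (shift C X) n W x"
      using bndI[OF y(1), of "- y" "shift C X" n x] arr_neg[OF y(2)] by (simp add: dd_shift XC)
  qed
  show "exact_cpx (unshift C X)" unfolding exact_cpx_def
  proof (intro conjI allI impI shift_complex XC)
    fix n W x assume "cyc (unshift C X) n W x"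
    then have "cyc X (n - 1) W x" by (simp add: cyc_def dd_shift XC)
    then obtain V e y where y: "cover V W e" "y \<in> arr V (ob X (n - 1 - 1))" "x * e = dd X (n - 1 - 1) * y"
      using exactD(2)[OF X] bndE by metis
    then show "bnd (unshift C X) n W x"
      using bndI[OF y(1), of "- y" "unshift C X" n x] arr_neg[OF y(2)] by (simp add: dd_shift XC)
  qed
qed

text \<open>All cycles on both sides bound, so zero serves as the required preimage.\<close>

lemma exact_qis_0:
  assumes X: "exact_cpx X" and Y: "exact_cpx Y" and c: "cmap X Y \<phi>"
  shows "qis X Y \<phi>"
  unfolding qis_def
proof (intro conjI allI impI exactD[OF X] exactD[OF Y] c)
  fix n W z assume z: "cyc Y n W z"
  obtain V e y where y: "cover V W e" "y \<in> arr V (ob Y (n - 1))" "z * e = dd Y (n - 1) * y"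
    using exactD(2)[OF Y z] by (rule bndE)
  have "cyc X n V 0" using arr_0[OF arr_obj(1)[OF y(2)] ob_in[OF exactD(1)[OF X]]] by (simp add: cyc_def)
  then show "\<exists>W' e x y. cover W' W e \<and> cyc X n W' x \<and> y \<in> arr W' (ob Y (n - 1)) \<and>
      z * e = \<phi> n * x + dd Y (n - 1) * y"
    using y by (intro exI[of _ V] exI[of _ e] exI[of _ "0 :: ('a, 'b) endo"] exI[of _ y]) simp
qed

text \<open>Exactness survives all closure rules: cones, because every chain map between exact
  complexes is a quasi-isomorphism, and summands, because a homotopy retract of an exact complex is
  exact. The inductive closure is thereby replaced by a condition on elements.\<close>

lemma thick_exact: "thick_closure C (acyclic_complex C) X \<longleftrightarrow> exact_cpx X"
proof
  assume "thick_closure C (acyclic_complex C) X"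
  then show "exact_cpx X"
  proof (induction rule: thick_closure.induct)
    case (cone X Y f T)
    note XY = exactD(1)[OF cone.IH(1)] exactD(1)[OF cone.IH(2)]
    obtain i j p q where "is_ext (shift C X) Y (\<lambda>n. fam X Y f (n + 1)) T i j p q"
      using cone.hyps is_cone_iff[OF XY] by blast
    then show ?case
      using exact_cone fam_cmap[OF XY cone.hyps(3)] exact_qis_0[OF cone.IH] XY by blast
  next
    case (summand X Y Y' i j p q)
    note X = exactD(1)[OF summand.IH]
    have "K.rbiprod Y Y' X (mor K Y X i) (mor K Y' X j) (mor K X Y p) (mor K X Y' q)"
      using K.is_biprodD[OF summand.hyps(2)] .
    then have b: "is_complex C Y" "mor K Y X i \<in> K.hom Y X" "mor K X Y p \<in> K.hom X Y"
      "mor K X Y p * mor K Y X i = K.ide Y" by (auto simp: K.rbiprod_def)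
    note Y = b(1)
    obtain \<iota> where i: "cmap Y X \<iota>" "mor K Y X i = kap Y X \<iota>" using K_homE[OF b(2) Y X] .
    obtain \<pi> where p: "cmap X Y \<pi>" "mor K X Y p = kap X Y \<pi>" using K_homE[OF b(3) X Y] .
    have "kap Y Y (\<lambda>n. ide (ob Y n)) = kap Y Y (\<lambda>n. \<pi> n * \<iota> n)"
      using b(4) i p kap_mult[OF Y X Y i(1) p(1)] kap_ide[OF Y Y] by simp
    then have h: "htp Y Y (\<lambda>n. ide (ob Y n) - \<pi> n * \<iota> n)"
      using kap_eq_iff[OF Y Y cmap_ide[OF Y] cmap_comp[OF i(1) p(1)]] by blast
    \<comment> \<open>The summand is a retract only up to homotopy; on cycles the error is a
      boundary.\<close>
    obtain k where k: "\<And>n. k n \<in> arr (ob Y n) (ob Y (n - 1))"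
      "\<And>n W x. cyc Y n W x \<Longrightarrow> ide (ob Y n) * x = \<pi> n * \<iota> n * x + dd Y (n - 1) * (k n * x)"
      using htp_cyc[OF h] by metis
    show ?case unfolding exact_cpx_def
    proof (intro conjI allI impI Y)
      fix n W y assume y: "cyc Y n W y"
      have "bnd Y n W (\<pi> n * (\<iota> n * y))"
        using bnd_map[OF p(1)] exactD(2)[OF summand.IH cyc_map[OF i(1) y]] by blast
      then have "bnd Y n W (\<pi> n * (\<iota> n * y) + dd Y (n - 1) * (k n * y))"
        using arr_mult[OF cyc_arr[OF y] k(1)] Y by (intro bnd_add)
      then show "bnd Y n W y" using k(2)[OF y] arr_ide_left[OF cyc_arr[OF y]] by (simp add: mult.assoc)
    qed
  qed (simp_all add: acyclic_exact exact_shift)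
qed (simp add: exact_acyclic thick_closure.base)

section \<open>The quasi-isomorphisms as a multiplicative system in the homotopy category\<close>

lemma cone_exists:
  assumes X: "is_complex C X" and Y: "is_complex C Y" and c: "cmap X Y \<phi>"
  obtains T i j p q where "is_ext (shift C X) Y (\<lambda>n. \<phi> (n + 1)) T i j p q"
proof (rule ext_exists[of "shift C X" Y "\<lambda>n. \<phi> (n + 1)"])
  fix n
  show "\<phi> (n + 1) \<in> arr (ob (shift C X) n) (ob Y (n + 1))" using cmap_arr[OF c] by simp
  show "dd Y (n + 1) * \<phi> (n + 1) + \<phi> (n + 1 + 1) * dd (shift C X) n = 0"
    using cmap_comm[OF c, of "n + 1"] by (simp add: dd_shift X)
qed (use shift_complex X Y that in auto)

abbreviation "KS \<equiv> cone_in C (thick_closure C (acyclic_complex C))"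

text \<open>The definition asks for some representative with some cone in the thick class.
  \<open>exact_cone\<close> reads this off any cone, and homotopy invariance transfers it to the
  representative naming the class.\<close>

lemma mor_KS: 
  assumes X: "is_complex C X" and Y: "is_complex C Y"
  shows "mor K X Y ` KS X Y = kap X Y ` {\<phi>. qis X Y \<phi>}"
proof (intro equalityI subsetI)
  fix a assume "a \<in> mor K X Y ` KS X Y"
  then obtain F f Q where F: "a = mor K X Y F" "F \<in> Hom K X Y" "f \<in> F" "is_cone C X Y f Q" "exact_cpx Q"
    by (auto simp: cone_in_def thick_exact)
  obtain \<phi> where phi: "cmap X Y \<phi>" "F = KK.qcl X Y (cm X Y \<phi>)" using F(2) K_Hom[OF X Y] by blast
  have f: "f \<in> chain_maps C X Y" "htp X Y (\<lambda>n. fam X Y f n - \<phi> n)"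
    using F(3) phi mem_qcl_iff[OF X Y phi(1)] by auto
  obtain i j p q where "is_ext (shift C X) Y (\<lambda>n. fam X Y f (n + 1)) Q i j p q"
    using is_cone_iff[OF X Y f(1)] F(4) by blast
  then have "qis X Y (fam X Y f)" using exact_cone X fam_cmap[OF X Y f(1)] F(5) by blast
  then have "qis X Y \<phi>" using qis_homotopic f(2) phi(1) by blast
  then show "a \<in> kap X Y ` {\<phi>. qis X Y \<phi>}" using F(1) phi(2) by (simp add: kap_def)
next
  fix a assume "a \<in> kap X Y ` {\<phi>. qis X Y \<phi>}"
  then obtain \<phi> where phi: "qis X Y \<phi>" "a = kap X Y \<phi>" by auto
  note c = qisD(3)[OF phi(1)]
  obtain Q i j p q where e: "is_ext (shift C X) Y (\<lambda>n. \<phi> (n + 1)) Q i j p q" using cone_exists[OF X Y c] .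
  have "exact_cpx Q" using exact_cone[OF e X c] phi(1) by blast
  moreover have "is_cone C X Y (unfam X Y \<phi>) Q"
    using is_cone_iff[OF X Y unfam_in[OF X Y c]] e c by auto
  moreover have "unfam X Y \<phi> \<in> KK.qcl X Y (cm X Y \<phi>)"
    using mem_qcl_iff[OF X Y c] unfam_in[OF X Y c] c htp_0[OF X Y] by simp
  moreover have "KK.qcl X Y (cm X Y \<phi>) \<in> Hom K X Y" using K_Hom[OF X Y] c by blast
  ultimately have "KK.qcl X Y (cm X Y \<phi>) \<in> KS X Y" unfolding cone_in_def thick_exact by blast
  then show "a \<in> mor K X Y ` KS X Y" by (simp add: phi(2) kap_def)
qed

lemma kap_in_KS: "qis X Y \<phi> \<Longrightarrow> kap X Y \<phi> \<in> mor K X Y ` KS X Y"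
  using mor_KS qisD by blast

lemma kap_comp_eq:
  assumes "is_complex C X" "is_complex C Y" "is_complex C Z" "is_complex C Y'" "cmap X Y \<phi>" "cmap Y Z \<psi>"
    "cmap X Y' \<phi>'" "cmap Y' Z \<psi>'" "htp X Z (\<lambda>n. \<psi> n * \<phi> n - \<psi>' n * \<phi>' n)"
  shows "kap Y Z \<psi> * kap X Y \<phi> = kap Y' Z \<psi>' * kap X Y' \<phi>'"
  using assms kap_eq_iff[of X Z "\<lambda>n. \<psi> n * \<phi> n" "\<lambda>n. \<psi>' n * \<phi>' n"] kap_mult[of X Y Z \<phi> \<psi>] kap_mult[of X Y' Z \<phi>' \<psi>']
  by (simp add: cmap_comp)

text \<open>
  With \<open>A\<close> the cone of \<open>s : X \<rightarrow> Z\<close> and \<open>W\<close> the twisted sum of \<open>A\<close> and \<open>Y\<close> along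
  \<open>A \<rightarrow> X[1] \<rightarrow> Y[1]\<close>, the inclusion \<open>Y \<rightarrow> W\<close> has exact cokernel \<open>A\<close>.
\<close>

lemma K_left_ore:
  assumes Y: "is_complex C Y" and f: "cmap X Y f" and s: "qis X Z s"
  obtains W t g where "qis Y W t" "cmap Z W g" "htp X W (\<lambda>n. t n * f n - g n * s n)"
proof -
  note X = qisD(1)[OF s] and Z = qisD(2)[OF s] and sc = qisD(3)[OF s]
  obtain A i j p q where e: "is_ext (shift C X) Z (\<lambda>n. s (n + 1)) A i j p q" using cone_exists[OF X Z sc] .
  note E = is_extD[OF e]
  have b: "rbiprod (ob X (n + 1)) (ob Z n) (ob A n) (i n) (j n) (p n) (q n)" for n using E(4)[of n] by simp
  note R = rbiprodD[OF b]
  have A: "exact_cpx A" using exact_cone[OF e X sc] s by blast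
  have pd: "p (n + 1) * dd A n = - (dd X (n + 1) * p n)" for n using E(8)[of n] by (simp add: dd_shift X)
  obtain W I J P Q where E': "is_ext A Y (\<lambda>n. f (n + 1) * p n) W I J P Q"
  proof (rule ext_exists[OF E(3) Y, of "\<lambda>n. f (n + 1) * p n"])
    fix n
    show "f (n + 1) * p n \<in> arr (ob A n) (ob Y (n + 1))" using arr_mult[OF R(3) cmap_arr[OF f]] .
    have "f (n + 1 + 1) * (p (n + 1) * dd A n) = - (dd Y (n + 1) * f (n + 1) * p n)"
      unfolding pd using cmap_comm[OF f, of "n + 1"] by (simp add: mult.assoc[symmetric])
    then show "dd Y (n + 1) * (f (n + 1) * p n) + f (n + 1 + 1) * p (n + 1) * dd A n = 0"
      by (simp add: mult.assoc)
  qed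
  note F = is_extD[OF E']
  note S = rbiprodD[OF F(4)]
  have pj: "p n * j n = 0" "p n * i n = ide (ob X (n + 1))" for n using R by blast+
  \<comment> \<open>The sign is dictated by the homotopy \<open>I * i\<close>, whose boundary is
    \<open>J * f + I * j * s\<close>.\<close>
  have g: "cmap Z W (\<lambda>n. - (I n * j n))"
  proof (rule cmapI)
    fix n
    show "- (I n * j n) \<in> arr (ob Z n) (ob W n)" using arr_neg[OF arr_mult[OF R(2) S(1)]] .
    have "dd W n * (I n * j n) = (dd W n * I n) * j n" by (simp add: mult.assoc)
    also have "\<dots> = I (n + 1) * (dd A n * j n) + J (n + 1) * (f (n + 1) * (p n * j n))"
      by (simp add: F(6) distrib_right mult.assoc)
    also have "\<dots> = I (n + 1) * j (n + 1) * dd Z n" by (simp add: E(7) pj mult.assoc)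
    finally show "- (I (n + 1) * j (n + 1)) * dd Z n = dd W n * - (I n * j n)" by simp
  qed
  have "htp X W (\<lambda>n. J n * f n - (- (I n * j n)) * s n)"
  proof (rule htpI[of "\<lambda>n. I (n - 1) * i (n - 1)"])
    fix n
    have iX: "i (n - 1) \<in> arr (ob X n) (ob A (n - 1))" using R(1)[of "n - 1"] by simp
    show "I (n - 1) * i (n - 1) \<in> arr (ob X n) (ob W (n - 1))" using arr_mult[OF iX S(1)] .
    have 1: "dd W (n - 1) * I (n - 1) = I n * dd A (n - 1) + J n * (f n * p (n - 1))" using F(6)[of "n - 1"] by simp
    have 2: "dd A (n - 1) * i (n - 1) = j n * s n - i n * dd X n"
      using E(6)[of "n - 1"] by (simp add: dd_shift X)
    have 3: "f n * ide (ob X n) = f n" using arr_ide_right[OF cmap_arr[OF f]] .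
    have "dd W (n - 1) * (I (n - 1) * i (n - 1)) = (dd W (n - 1) * I (n - 1)) * i (n - 1)" by (simp add: mult.assoc)
    also have "\<dots> = I n * (dd A (n - 1) * i (n - 1)) + J n * (f n * (p (n - 1) * i (n - 1)))"
      by (simp add: 1 distrib_right mult.assoc)
    also have "\<dots> = I n * (j n * s n) - I n * (i n * dd X n) + J n * f n"
      using 3 pj(2)[of "n - 1"] by (simp add: 2 right_diff_distrib)
    finally show "J n * f n - (- (I n * j n)) * s n =
        dd W (n - 1) * (I (n - 1) * i (n - 1)) + I (n + 1 - 1) * i (n + 1 - 1) * dd X n"
      by (simp add: mult.assoc)
  qed
  then show ?thesis using that ext_inclusion_qis[OF E' A] g by blast
qed

text \<open>Dual to the left condition: with \<open>A\<close> the cone of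
  \<open>s : Z \<rightarrow> Y\<close>, the vertex \<open>W\<close> is the twisted sum of
  \<open>X\<close> and \<open>A[-1]\<close> along \<open>X \<rightarrow> Y \<rightarrow> A\<close>.
  The projection to \<open>X\<close> has the exact kernel \<open>A[-1]\<close>; the two components
  of \<open>A\<close> give the map \<open>g\<close> to \<open>Z\<close> and the homotopy.\<close>

lemma K_right_ore:
  assumes X: "is_complex C X" and f: "cmap X Y f" and s: "qis Z Y s"
  obtains W t g where "qis W X t" "cmap W Z g" "htp W Y (\<lambda>n. f n * t n - s n * g n)"
proof -
  note Z = qisD(1)[OF s] and Y = qisD(2)[OF s] and sc = qisD(3)[OF s]
  obtain A i j p q where e: "is_ext (shift C Z) Y (\<lambda>n. s (n + 1)) A i j p q" using cone_exists[OF Z Y sc] .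
  note E = is_extD[OF e]
  have b: "rbiprod (ob Z (n + 1)) (ob Y n) (ob A n) (i n) (j n) (p n) (q n)" for n using E(4)[of n] by simp
  note R = rbiprodD[OF b]
  have A: "exact_cpx A" using exact_cone[OF e Z sc] s by blast
  have p': "p (n - 1) \<in> arr (ob A (n - 1)) (ob Z n)" for n using R(3)[of "n - 1"] by simp
  have pd: "p n * dd A (n - 1) = - (dd Z n * p (n - 1))" for n using E(8)[of "n - 1"] by (simp add: dd_shift Z)
  have qd: "q n * dd A (n - 1) = s n * p (n - 1) + dd Y (n - 1) * q (n - 1)" for n using E(9)[of "n - 1"] by simp
  have anti: "dd (unshift C A) (n + 1) * (j n * f n) + j (n + 1) * f (n + 1) * dd X n = 0" for n
  proof -
    have "j (n + 1) * f (n + 1) * dd X n = j (n + 1) * dd Y n * f n"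
      using cmap_comm[OF f, of n] by (simp add: mult.assoc)
    also have "\<dots> = dd A n * j n * f n" by (simp add: E(7))
    finally show ?thesis by (simp add: dd_shift E(3) mult.assoc)
  qed
  obtain W I J P Q where E': "is_ext X (unshift C A) (\<lambda>n. j n * f n) W I J P Q"
  proof (rule ext_exists[OF X shift_complex(2)[OF E(3)], of "\<lambda>n. j n * f n"])
    show "j n * f n \<in> arr (ob X n) (ob (unshift C A) (n + 1))" for n
      using arr_mult[OF cmap_arr[OF f] R(2)] by simp
  qed (use anti in simp_all)
  note F = is_extD[OF E']
  have B: "rbiprod (ob X n) (ob A (n - 1)) (ob W n) (I n) (J n) (P n) (Q n)" for n using F(4)[of n] by simp
  note S = rbiprodD[OF B]
  have Qd: "Q (n + 1) * dd W n = j n * f n * P n - dd A (n - 1) * Q n" for n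
    using F(9)[of n] by (simp add: dd_shift E(3))
  have pj: "p n * j n = 0" "q n * j n = ide (ob Y n)" for n using R by blast+
  have g: "cmap W Z (\<lambda>n. p (n - 1) * Q n)"
  proof (rule cmapI)
    fix n
    show "p (n - 1) * Q n \<in> arr (ob W n) (ob Z n)" using arr_mult[OF S(4) p'] .
    have "p n * (Q (n + 1) * dd W n) = (p n * j n) * f n * P n - p n * dd A (n - 1) * Q n"
      unfolding Qd by (simp add: right_diff_distrib mult.assoc)
    also have "\<dots> = dd Z n * (p (n - 1) * Q n)" by (simp add: pj pd mult.assoc)
    finally show "p (n + 1 - 1) * Q (n + 1) * dd W n = dd Z n * (p (n - 1) * Q n)" by (simp add: mult.assoc)
  qed
  have "htp W Y (\<lambda>n. f n * P n - s n * (p (n - 1) * Q n))"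
  proof (rule htpI[of "\<lambda>n. q (n - 1) * Q n"])
    fix n
    show "q (n - 1) * Q n \<in> arr (ob W n) (ob Y (n - 1))" using arr_mult[OF S(4) R(4)] .
    have "q n * (Q (n + 1) * dd W n) = (q n * j n) * (f n * P n) - q n * dd A (n - 1) * Q n"
      unfolding Qd by (simp add: right_diff_distrib mult.assoc)
    also have "\<dots> = f n * P n - s n * (p (n - 1) * Q n) - dd Y (n - 1) * (q (n - 1) * Q n)"
      using arr_ide_left[OF arr_mult[OF S(3) cmap_arr[OF f]]] by (simp add: pj qd distrib_right mult.assoc diff_diff_eq)
    finally show "f n * P n - s n * (p (n - 1) * Q n) =
        dd Y (n - 1) * (q (n - 1) * Q n) + q (n + 1 - 1) * Q (n + 1) * dd W n"
      by (simp add: mult.assoc)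
  qed
  moreover have "qis W X P" using ext_projection_qis[OF E' exact_shift(2)[OF A] anti] .
  ultimately show ?thesis using that g by blast
qed

text \<open>If \<open>f \<circ> s\<close> is null-homotopic, then \<open>f\<close> factors through the cone of \<open>s\<close>; dually below.\<close>

lemma K_left_cancel:
  assumes Y: "is_complex C Y" and f: "cmap X Y f" and s: "qis Z X s" and h: "htp Z Y (\<lambda>n. f n * s n)"
  obtains W t where "qis Y W t" "htp X W (\<lambda>n. t n * f n)"
proof -
  note Z = qisD(1)[OF s] and X = qisD(2)[OF s] and sc = qisD(3)[OF s]
  obtain k where k: "\<And>n. k n \<in> arr (ob Z n) (ob Y (n - 1))" "\<And>n. f n * s n = dd Y (n - 1) * k n + k (n + 1) * dd Z n"
    using h unfolding htp_def by blast
  obtain A i j p q where e: "is_ext (shift C Z) X (\<lambda>n. s (n + 1)) A i j p q" using cone_exists[OF Z X sc] .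
  note E = is_extD[OF e]
  have b: "rbiprod (ob Z (n + 1)) (ob X n) (ob A n) (i n) (j n) (p n) (q n)" for n using E(4)[of n] by simp
  note R = rbiprodD[OF b]
  have A: "exact_cpx A" using exact_cone[OF e Z sc] s by blast
  have k': "k (n + 1) \<in> arr (ob Z (n + 1)) (ob Y n)" for n using k(1)[of "n + 1"] by simp
  have pd: "p (n + 1) * dd A n = - (dd Z (n + 1) * p n)" for n using E(8)[of n] by (simp add: dd_shift Z)
  \<comment> \<open>The extension of \<open>f\<close> to the cone of \<open>s\<close>: it is
    \<open>f\<close> on \<open>X\<close> and the null-homotopy \<open>k\<close> on the shifted copy
    of \<open>Z\<close>.\<close>
  define g where "g n = f n * q n + k (n + 1) * p n" for n
  have g: "cmap A Y g"
  proof (rule cmapI)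
    fix n
    show "g n \<in> arr (ob A n) (ob Y n)"
      unfolding g_def using arr_add[OF arr_mult[OF R(4) cmap_arr[OF f]] arr_mult[OF R(3) k']] .
    have "g (n + 1) * dd A n = f (n + 1) * (q (n + 1) * dd A n) + k (n + 1 + 1) * (p (n + 1) * dd A n)"
      by (simp add: g_def distrib_right mult.assoc)
    also have "\<dots> = (f (n + 1) * s (n + 1)) * p n + f (n + 1) * dd X n * q n - k (n + 1 + 1) * dd Z (n + 1) * p n"
      by (simp add: pd E(9) distrib_left mult.assoc)
    also have "\<dots> = dd Y n * k (n + 1) * p n + f (n + 1) * dd X n * q n"
      using k(2)[of "n + 1"] by (simp add: distrib_right)
    also have "\<dots> = dd Y n * g n" using cmap_comm[OF f, of n] by (simp add: g_def distrib_left mult.assoc[symmetric])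
    finally show "g (n + 1) * dd A n = dd Y n * g n" .
  qed
  have gj: "g n * j n = f n" for n
    using R(6,7)[of n] arr_ide_right[OF cmap_arr[OF f]] by (simp add: g_def distrib_right mult.assoc)
  \<comment> \<open>The inclusion of \<open>Y\<close> into the cone of \<open>g\<close> makes
    \<open>g\<close>, and with it \<open>f = g * j\<close>, null-homotopic; its cokernel
    \<open>A[1]\<close> is exact.\<close>
  obtain W I J P Q where E': "is_ext (shift C A) Y (\<lambda>n. g (n + 1)) W I J P Q" using cone_exists[OF E(3) Y g] .
  note F = is_extD[OF E']
  have B: "rbiprod (ob A (n + 1)) (ob Y n) (ob W n) (I n) (J n) (P n) (Q n)" for n using F(4)[of n] by simp
  note S = rbiprodD[OF B]
  have "htp X W (\<lambda>n. J n * f n)"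
  proof (rule htpI[of "\<lambda>n. I (n - 1) * j n"])
    fix n
    have I': "I (n - 1) \<in> arr (ob A n) (ob W (n - 1))" using S(1)[of "n - 1"] by simp
    show "I (n - 1) * j n \<in> arr (ob X n) (ob W (n - 1))" using arr_mult[OF R(2) I'] .
    have "dd W (n - 1) * I (n - 1) = J n * g n - I n * dd A n" using F(6)[of "n - 1"] by (simp add: dd_shift E(3))
    then have "dd W (n - 1) * (I (n - 1) * j n) = J n * (g n * j n) - I n * (dd A n * j n)"
      by (simp add: mult.assoc[symmetric] left_diff_distrib)
    then show "J n * f n = dd W (n - 1) * (I (n - 1) * j n) + I (n + 1 - 1) * j (n + 1) * dd X n"
      using E(7)[of n] by (simp add: gj mult.assoc)
  qed
  then show ?thesis using that ext_inclusion_qis[OF E' exact_shift(1)[OF A]] by blast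
qed

lemma K_right_cancel:
  assumes X: "is_complex C X" and f: "cmap X Y f" and s: "qis Y Z s" and h: "htp X Z (\<lambda>n. s n * f n)"
  obtains W t where "qis W X t" "htp W Y (\<lambda>n. f n * t n)"
proof -
  note Y = qisD(1)[OF s] and Z = qisD(2)[OF s] and sc = qisD(3)[OF s]
  obtain k where k: "\<And>n. k n \<in> arr (ob X n) (ob Z (n - 1))" "\<And>n. s n * f n = dd Z (n - 1) * k n + k (n + 1) * dd X n"
    using h unfolding htp_def by blast
  obtain A i j p q where e: "is_ext (shift C Y) Z (\<lambda>n. s (n + 1)) A i j p q" using cone_exists[OF Y Z sc] .
  note E = is_extD[OF e]
  have b: "rbiprod (ob Y (n + 1)) (ob Z n) (ob A n) (i n) (j n) (p n) (q n)" for n using E(4)[of n] by simp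
  note R = rbiprodD[OF b]
  have A: "exact_cpx A" using exact_cone[OF e Y sc] s by blast
  let ?F = "unshift C A"
  have i': "i (n - 1) \<in> arr (ob Y n) (ob A (n - 1))" "p (n - 1) \<in> arr (ob A (n - 1)) (ob Y n)"
    "p (n - 1) * i (n - 1) = ide (ob Y n)" for n using R(1,3,5)[of "n - 1"] by simp_all
  have pd: "p n * dd A (n - 1) = - (dd Y n * p (n - 1))" for n using E(8)[of "n - 1"] by (simp add: dd_shift Y)
  have di: "dd A (n - 1) * i (n - 1) = j n * s n - i n * dd Y n" for n using E(6)[of "n - 1"] by (simp add: dd_shift Y)
  have dj: "dd A (n - 1) * j (n - 1) = j n * dd Z (n - 1)" for n using E(7)[of "n - 1"] by simp
  \<comment> \<open>The lift of \<open>f\<close> to \<open>A[-1]\<close>: it has \<open>f\<close> as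
    component in \<open>Y\<close>, and the null-homotopy \<open>k\<close> with a sign as component
    in \<open>Z\<close>.\<close>
  define g where "g n = i (n - 1) * f n - j (n - 1) * k n" for n
  have ga: "g n \<in> arr (ob X n) (ob A (n - 1))" for n
    unfolding g_def using arr_diff[OF arr_mult[OF cmap_arr[OF f] i'(1)] arr_mult[OF k(1) R(2)]] .
  have gd: "g (n + 1) * dd X n = - (dd A (n - 1) * g n)" for n
  proof -
    have "dd A (n - 1) * g n = (dd A (n - 1) * i (n - 1)) * f n - (dd A (n - 1) * j (n - 1)) * k n"
      by (simp add: g_def right_diff_distrib mult.assoc)
    also have "\<dots> = j n * (s n * f n - dd Z (n - 1) * k n) - i n * (dd Y n * f n)"
      by (simp add: di dj left_diff_distrib right_diff_distrib mult.assoc)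
    also have "\<dots> = j n * (k (n + 1) * dd X n) - i n * (f (n + 1) * dd X n)"
      using cmap_comm[OF f, of n] by (simp add: k(2))
    finally show ?thesis by (simp add: g_def left_diff_distrib mult.assoc)
  qed
  have pg: "p (n - 1) * g n = f n" for n
  proof -
    have "p (n - 1) * g n = (p (n - 1) * i (n - 1)) * f n - (p (n - 1) * j (n - 1)) * k n"
      by (simp add: g_def right_diff_distrib mult.assoc)
    then show ?thesis using i'(3) R(7) arr_ide_left[OF cmap_arr[OF f]] by simp
  qed
  \<comment> \<open>Shifting twice restores the sign of the differential. The vertex
    \<open>W\<close> is the twisted sum of \<open>X\<close> and \<open>A[-2]\<close> along
    \<open>g\<close>, the homotopy fibre of \<open>g : X \<rightarrow> A[-1]\<close>.\<close>
  let ?G = "unshift C ?F"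
  have G: "is_complex C ?F" "is_complex C ?G" using shift_complex E(3) by blast+
  have dG: "dd ?G n = dd A (n - 1 - 1)" for n by (simp add: dd_shift G E(3))
  have anti: "dd ?G (n + 1) * g n + g (n + 1) * dd X n = 0" for n by (simp add: dG gd)
  obtain W I J P Q where E': "is_ext X ?G g W I J P Q"
    by (rule ext_exists[OF X G(2), of g]) (use ga anti in simp_all)
  note F = is_extD[OF E']
  have B: "rbiprod (ob X n) (ob A (n - 1 - 1)) (ob W n) (I n) (J n) (P n) (Q n)" for n using F(4)[of n] by simp
  note S = rbiprodD[OF B]
  have Qd: "Q (n + 1) * dd W n = g n * P n + dd A (n - 1 - 1) * Q n" for n
    using F(9)[of n] by (simp add: dG)
  have "htp W Y (\<lambda>n. f n * P n)"
  proof (rule htpI[of "\<lambda>n. p (n - 1 - 1) * Q n"])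
    fix n
    show "p (n - 1 - 1) * Q n \<in> arr (ob W n) (ob Y (n - 1))" using arr_mult[OF S(4) i'(2)] .
    have "p (n - 1) * (Q (n + 1) * dd W n) = f n * P n - dd Y (n - 1) * (p (n - 1 - 1) * Q n)"
      unfolding Qd using pg[of n] pd[of "n - 1"] by (simp add: distrib_left mult.assoc[symmetric])
    then show "f n * P n = dd Y (n - 1) * (p (n - 1 - 1) * Q n) + p (n + 1 - 1 - 1) * Q (n + 1) * dd W n"
      by (simp add: mult.assoc)
  qed
  moreover have "qis W X P" using ext_projection_qis[OF E' exact_shift(2)[OF exact_shift(2)[OF A]] anti] .
  ultimately show ?thesis using that by blast
qed

lemma multiplicative_KS: "multiplicative_system K KS"
proof (rule K.multiplicative_systemI)
  have qisE: "\<exists>\<sigma>. qis X Y \<sigma> \<and> s = kap X Y \<sigma>"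
    if "s \<in> mor K X Y ` KS X Y" "X \<in> Obj K" "Y \<in> Obj K" for X Y s
    using that mor_KS[of X Y] by auto
  fix X Y assume XY: "X \<in> Obj K" "Y \<in> Obj K"
  then have X: "is_complex C X" and Y: "is_complex C Y" by simp_all
  show "KS X Y \<subseteq> Hom K X Y" by (auto simp: cone_in_def)
  show "K.ide X \<in> mor K X X ` KS X X"
    using kap_ide[OF X X] kap_in_KS[OF qis_ide[OF X]] by simp
  fix Z f s assume ZK: "Z \<in> Obj K"
  then have Z: "is_complex C Z" by simp
  { fix t assume "s \<in> mor K X Y ` KS X Y" "t \<in> mor K Y Z ` KS Y Z"
    then obtain \<phi> \<psi> where p: "qis X Y \<phi>" "qis Y Z \<psi>" "s = kap X Y \<phi>" "t = kap Y Z \<psi>"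
      using qisE XY ZK by metis
    then have "t * s = kap X Z (\<lambda>n. \<psi> n * \<phi> n)" using kap_mult[OF X Y Z] qisD(3) by simp
    then show "t * s \<in> mor K X Z ` KS X Z" using kap_in_KS[OF qis_comp[OF p(1,2)]] by simp }
  assume "f \<in> K.hom X Y"
  then obtain \<phi> where f: "cmap X Y \<phi>" "f = kap X Y \<phi>" using K_homE X Y by blast
  { assume "s \<in> mor K Z Y ` KS Z Y"
    then obtain \<sigma> where s: "qis Z Y \<sigma>" "s = kap Z Y \<sigma>"
      using qisE XY ZK by metis
    obtain W t g where W: "qis W X t" "cmap W Z g" "htp W Y (\<lambda>n. \<phi> n * t n - \<sigma> n * g n)"
      using K_right_ore[OF X f(1) s(1)] .
    then have "f * kap W X t = s * kap W Z g"
      unfolding f(2) s(2) using qisD[OF W(1)] qisD[OF s(1)] f(1) by (intro kap_comp_eq) auto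
    then show "\<exists>W\<in>Obj K. \<exists>t\<in>mor K W X ` KS W X. \<exists>g\<in>K.hom W Z. f * t = s * g"
      using kap_in_KS[OF W(1)] kap_in[OF qisD(1)[OF W(1)] Z W(2)] qisD(1)[OF W(1)]
      by (intro bexI[of _ W] bexI[of _ "kap W X t"] bexI[of _ "kap W Z g"]) simp_all }
  { assume "s \<in> mor K X Z ` KS X Z"
    then obtain \<sigma> where s: "qis X Z \<sigma>" "s = kap X Z \<sigma>"
      using qisE XY ZK by metis
    obtain W t g where W: "qis Y W t" "cmap Z W g" "htp X W (\<lambda>n. t n * \<phi> n - g n * \<sigma> n)"
      using K_left_ore[OF Y f(1) s(1)] .
    then have "kap Y W t * f = kap Z W g * s"
      unfolding f(2) s(2) using qisD[OF W(1)] qisD[OF s(1)] f(1) by (intro kap_comp_eq) auto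
    then show "\<exists>W\<in>Obj K. \<exists>t\<in>mor K Y W ` KS Y W. \<exists>g\<in>K.hom Z W. t * f = g * s"
      using kap_in_KS[OF W(1)] kap_in[OF Z qisD(2)[OF W(1)] W(2)] qisD(2)[OF W(1)]
      by (intro bexI[of _ W] bexI[of _ "kap Y W t"] bexI[of _ "kap Z W g"]) simp_all }
  { assume "s \<in> mor K Y Z ` KS Y Z" and 0: "s * f = 0"
    then obtain \<sigma> where s: "qis Y Z \<sigma>" "s = kap Y Z \<sigma>"
      using qisE XY ZK by metis
    have "htp X Z (\<lambda>n. \<sigma> n * \<phi> n)"
      using 0 f s kap_mult[OF X Y Z f(1) qisD(3)[OF s(1)]] kap_eq_0_iff[OF X Z cmap_comp[OF f(1) qisD(3)[OF s(1)]]] by simp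
    then obtain W t where W: "qis W X t" "htp W Y (\<lambda>n. \<phi> n * t n)"
      using K_right_cancel[OF X f(1) s(1)] by blast
    note Wt = qisD[OF W(1)]
    have "f * kap W X t = 0"
      using kap_mult[OF Wt(1) X Y Wt(3) f(1)] kap_eq_0_iff[OF Wt(1) Y cmap_comp[OF Wt(3) f(1)]] W(2) f(2) by simp
    then show "\<exists>W\<in>Obj K. \<exists>t\<in>mor K W X ` KS W X. f * t = 0"
      using kap_in_KS[OF W(1)] Wt(1)
      by (intro bexI[of _ W] bexI[of _ "kap W X t"]) simp_all }
  { assume "s \<in> mor K Z X ` KS Z X" and 0: "f * s = 0"
    then obtain \<sigma> where s: "qis Z X \<sigma>" "s = kap Z X \<sigma>"
      using qisE XY ZK by metis
    have "htp Z Y (\<lambda>n. \<phi> n * \<sigma> n)"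
      using 0 f s kap_mult[OF Z X Y qisD(3)[OF s(1)] f(1)] kap_eq_0_iff[OF Z Y cmap_comp[OF qisD(3)[OF s(1)] f(1)]] by simp
    then obtain W t where W: "qis Y W t" "htp X W (\<lambda>n. t n * \<phi> n)"
      using K_left_cancel[OF Y f(1) s(1)] by blast
    note Wt = qisD[OF W(1)]
    have "kap Y W t * f = 0"
      using kap_mult[OF X Y Wt(2) f(1) Wt(3)] kap_eq_0_iff[OF X Wt(2) cmap_comp[OF f(1) Wt(3)]] W(2) f(2) by simp
    then show "\<exists>W\<in>Obj K. \<exists>t\<in>mor K Y W ` KS Y W. t * f = 0"
      using kap_in_KS[OF W(1)] Wt(2)
      by (intro bexI[of _ W] bexI[of _ "kap Y W t"]) simp_all }
qed

section \<open>The category of monomorphisms up to homotopy\<close>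

text \<open>
  Since the target of a square is a monomorphism, a square \<open>(u, v)\<close> is determined by \<open>v\<close>; below,
  squares are represented by their component \<open>v\<close> in degree \<open>0\<close>.
\<close>

abbreviation "M \<equiv> mono_category C"

abbreviation sA :: "('a, 'b) arr \<Rightarrow> 'a" where "sA x \<equiv> fst x"
abbreviation sB :: "('a, 'b) arr \<Rightarrow> 'a" where "sB x \<equiv> fst (snd x)"

definition sd :: "('a, 'b) arr \<Rightarrow> ('a, 'b) endo" where
  "sd x = mor C (sA x) (sB x) (snd (snd x))"

lemma Obj_M: "x \<in> Obj M \<longleftrightarrow> snd (snd x) \<in> Hom C (sA x) (sB x) \<and> rmono (sA x) (sB x) (sd x)"
proof -
  have "x \<in> Obj M \<longleftrightarrow> sA x \<in> Obj C \<and> sB x \<in> Obj C \<and> is_mono C (sA x) (sB x) (snd (snd x))"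
    by (simp add: mono_category_def split_beta)
  then show ?thesis
    using is_mono_iff[of "sA x" "sB x" "snd (snd x)"] arr_obj[of "sd x" "sA x" "sB x"]
    unfolding sd_def by (auto simp: is_mono_def rmono_def)
qed

lemma mk_Obj_M: "rmono A B d \<Longrightarrow> (A, B, unmor A B d) \<in> Obj M \<and> sd (A, B, unmor A B d) = d"
  unfolding Obj_M sd_def by (simp add: rmono_def arr_iff unmor_in)

lemma sd_mono: "x \<in> Obj M \<Longrightarrow> rmono (sA x) (sB x) (sd x)"
  by (simp add: Obj_M)

lemma sd_arr: "x \<in> Obj M \<Longrightarrow> sd x \<in> arr (sA x) (sB x)"
  using sd_mono by (simp add: rmono_def)

lemma s_obj: "x \<in> Obj M \<Longrightarrow> sA x \<in> Obj C" "x \<in> Obj M \<Longrightarrow> sB x \<in> Obj C"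
  using sd_arr arr_obj by blast+

definition sqr where
  "sqr x y v \<longleftrightarrow> v \<in> arr (sB x) (sB y) \<and> (\<exists>u\<in>arr (sA x) (sA y). sd y * u = v * sd x)"

definition uu where
  "uu x y v = (SOME u. u \<in> arr (sA x) (sA y) \<and> sd y * u = v * sd x)"

lemma sqrI: "\<lbrakk>v \<in> arr (sB x) (sB y); u \<in> arr (sA x) (sA y); sd y * u = v * sd x\<rbrakk> \<Longrightarrow> sqr x y v"
  unfolding sqr_def by blast

lemma sqrD:
  assumes "sqr x y v"
  shows sqr_arr: "v \<in> arr (sB x) (sB y)" and uu_arr: "uu x y v \<in> arr (sA x) (sA y)"
    and uu_eq: "sd y * uu x y v = v * sd x"
proof -
  show "v \<in> arr (sB x) (sB y)" using assms by (simp add: sqr_def)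
  have "\<exists>u. u \<in> arr (sA x) (sA y) \<and> sd y * u = v * sd x" using assms by (auto simp: sqr_def)
  from someI_ex[OF this] show "uu x y v \<in> arr (sA x) (sA y)" "sd y * uu x y v = v * sd x"
    by (simp_all add: uu_def)
qed

lemma uu_unique:
  "\<lbrakk>y \<in> Obj M; sqr x y v; u \<in> arr (sA x) (sA y); sd y * u = v * sd x\<rbrakk> \<Longrightarrow> uu x y v = u"
  using rmono_cancel[OF sd_mono uu_arr] uu_eq by metis

definition un where
  "un x y v = (unmor (sA x) (sA y) (uu x y v), unmor (sB x) (sB y) v)"

lemma Hom_M: "Hom M x y = {f. fst f \<in> Hom C (sA x) (sA y) \<and> snd f \<in> Hom C (sB x) (sB y) \<and>
    Cmp C (sA x) (sB x) (sB y) (snd f) (snd (snd x)) = Cmp C (sA x) (sA y) (sB y) (snd (snd y)) (fst f)}"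
  by (auto simp: mono_category_def split_beta)

lemma M_ops:
  "Cmp M x y z g f = (Cmp C (sA x) (sA y) (sA z) (fst g) (fst f), Cmp C (sB x) (sB y) (sB z) (snd g) (snd f))"
  "Add M x y f g = (Add C (sA x) (sA y) (fst f) (fst g), Add C (sB x) (sB y) (snd f) (snd g))"
  "Zer M x y = (Zer C (sA x) (sA y), Zer C (sB x) (sB y))" "Idn M x = (Idn C (sA x), Idn C (sB x))"
  by (simp_all add: mono_category_def split_beta)

lemma Hom_M_iff:
  assumes x: "x \<in> Obj M" and y: "y \<in> Obj M"
  shows "f \<in> Hom M x y \<longleftrightarrow> fst f \<in> Hom C (sA x) (sA y) \<and> snd f \<in> Hom C (sB x) (sB y) \<and>
    sqr x y (mor C (sB x) (sB y) (snd f)) \<and> uu x y (mor C (sB x) (sB y) (snd f)) = mor C (sA x) (sA y) (fst f)"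
proof -
  note O = s_obj[OF x] s_obj[OF y]
  have d: "snd (snd x) \<in> Hom C (sA x) (sB x)" "snd (snd y) \<in> Hom C (sA y) (sB y)" using x y by (simp_all add: Obj_M)
  have "f \<in> Hom M x y \<longleftrightarrow> fst f \<in> Hom C (sA x) (sA y) \<and> snd f \<in> Hom C (sB x) (sB y) \<and>
    mor C (sB x) (sB y) (snd f) * sd x = sd y * mor C (sA x) (sA y) (fst f)"
    unfolding Hom_M sd_def using O d Cmp_eq_iff(2)[of "sA x" "sB x" "sB y" "snd (snd x)" "snd f" "sA y" "fst f" "snd (snd y)"]
    by auto
  then show ?thesis
    using sqrI[of "mor C (sB x) (sB y) (snd f)" x y "mor C (sA x) (sA y) (fst f)"]
      uu_unique[OF y, of x "mor C (sB x) (sB y) (snd f)" "mor C (sA x) (sA y) (fst f)"]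
      uu_eq[of x y "mor C (sB x) (sB y) (snd f)"] O by (auto simp: mor_arr)
qed

lemma un_in:
  assumes "x \<in> Obj M" "y \<in> Obj M" "sqr x y v"
  shows "un x y v \<in> Hom M x y"
  using assms sqr_arr[OF assms(3)] uu_arr[OF assms(3)]
  by (simp add: Hom_M_iff) (simp add: un_def arr_iff unmor_in)

lemma Hom_M_un:
  assumes "f \<in> Hom M x y" "x \<in> Obj M" "y \<in> Obj M"
  shows "sqr x y (mor C (sB x) (sB y) (snd f))" "f = un x y (mor C (sB x) (sB y) (snd f))"
proof -
  note f = assms(1)[unfolded Hom_M_iff[OF assms(2,3)]]
  show "sqr x y (mor C (sB x) (sB y) (snd f))" using f by blast
  show "f = un x y (mor C (sB x) (sB y) (snd f))"
    using f s_obj[OF assms(2)] s_obj[OF assms(3)] unfolding un_def by (intro prod_eqI) simp_all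
qed

lemma Hom_ME:
  assumes "f \<in> Hom M x y" "x \<in> Obj M" "y \<in> Obj M"
  obtains v where "sqr x y v" "f = un x y v"
  using that Hom_M_un[OF assms] by blast

lemma uu_ops:
  assumes x: "x \<in> Obj M" and y: "y \<in> Obj M"
  shows "sqr x y v \<Longrightarrow> sqr x y v' \<Longrightarrow> sqr x y (v + v') \<and> uu x y (v + v') = uu x y v + uu x y v'"
    and "sqr x y v \<Longrightarrow> sqr x y (- v) \<and> uu x y (- v) = - uu x y v"
    and "z \<in> Obj M \<Longrightarrow> sqr x y v \<Longrightarrow> sqr y z w \<Longrightarrow> sqr x z (w * v) \<and> uu x z (w * v) = uu y z w * uu x y v"
    and "sqr x y 0 \<and> uu x y 0 = 0" and "sqr x x (ide (sB x)) \<and> uu x x (ide (sB x)) = ide (sA x)"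
proof -
  have *: "sqr x y v \<and> uu x y v = u" if "y \<in> Obj M" "v \<in> arr (sB x) (sB y)" "u \<in> arr (sA x) (sA y)" "sd y * u = v * sd x" for x y u v
    using sqrI[OF that(2-4)] uu_unique[OF that(1) _ that(3,4)] by blast
  { assume v: "sqr x y v"
    note V = sqrD[OF v]
    { assume v': "sqr x y v'"
      note V' = sqrD[OF v']
      show "sqr x y (v + v') \<and> uu x y (v + v') = uu x y v + uu x y v'"
        using V V' by (intro * y) (simp_all add: arr_add distrib_left distrib_right) }
    show "sqr x y (- v) \<and> uu x y (- v) = - uu x y v"
      using V by (intro * y) (simp_all add: arr_neg)
    assume z: "z \<in> Obj M" and w: "sqr y z w"
    note W = sqrD[OF w]
    have "sd z * (uu y z w * uu x y v) = w * (sd y * uu x y v)" using W by (simp add: mult.assoc[symmetric])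
    then show "sqr x z (w * v) \<and> uu x z (w * v) = uu y z w * uu x y v"
      using V W by (intro * z arr_mult[OF V(1) W(1)] arr_mult[OF V(2) W(2)]) (simp add: mult.assoc) }
  show "sqr x y 0 \<and> uu x y 0 = 0" using s_obj[OF x] s_obj[OF y] by (intro * y) (simp_all add: arr_0)
  show "sqr x x (ide (sB x)) \<and> uu x x (ide (sB x)) = ide (sA x)"
    using s_obj[OF x] arr_ide_left[OF sd_arr[OF x]] arr_ide_right[OF sd_arr[OF x]]
    by (intro * x) (simp_all add: arr_ide)
qed

lemma un_ops:
  assumes x: "x \<in> Obj M" and y: "y \<in> Obj M"
  shows "sqr x y v \<Longrightarrow> sqr x y v' \<Longrightarrow> Add M x y (un x y v) (un x y v') = un x y (v + v')"
    and "z \<in> Obj M \<Longrightarrow> sqr x y v \<Longrightarrow> sqr y z w \<Longrightarrow> Cmp M x y z (un y z w) (un x y v) = un x z (w * v)"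
    and "Zer M x y = un x y 0" and "Idn M x = un x x (ide (sB x))"
proof -
  note O = s_obj[OF x] s_obj[OF y] and [simp] = un_def M_ops unmor_Add unmor_Cmp unmor_Zer unmor_Idn
  { assume v: "sqr x y v"
    show "Add M x y (un x y v) (un x y v') = un x y (v + v')" if "sqr x y v'"
      using O uu_ops(1)[OF x y v that] sqrD[OF v] sqrD[OF that] by (simp add: arr_iff)
    show "Cmp M x y z (un y z w) (un x y v) = un x z (w * v)" if "z \<in> Obj M" "sqr y z w"
      using O s_obj[OF that(1)] uu_ops(3)[OF x y that(1) v that(2)] sqrD[OF v] sqrD[OF that(2)] by (simp add: arr_iff) }
  show "Zer M x y = un x y 0" "Idn M x = un x x (ide (sB x))"
    using O uu_ops(4,5)[OF x y] by simp_all
qed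

lemma preadditive_M: "preadditive_category M"
proof (rule preadditive_categoryI; (elim Hom_ME; simp only:)?)
  fix x y v assume "x \<in> Obj M" "y \<in> Obj M" "sqr x y v"
  then show "\<exists>g\<in>Hom M x y. Add M x y g (un x y v) = Zer M x y"
    using uu_ops(2)[of x y v] by (intro bexI[of _ "un x y (- v)"]) (simp_all add: un_ops un_in)
qed (simp_all add: un_ops un_in uu_ops arr_ide_left[OF sqr_arr] arr_ide_right[OF sqr_arr] mult.assoc algebra_simps)

end

sublocale additive_regular_category \<subseteq> M: preadditive_category "mono_category C"
  by (rule preadditive_M)

context additive_regular_category
begin

definition mm where
  "mm x y v = mor M x y (un x y v)"

lemma un_inject: "\<lbrakk>sqr x y v; sqr x y v'; un x y v = un x y v'\<rbrakk> \<Longrightarrow> v = v'"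
  unfolding un_def using sqr_arr[of x y v] sqr_arr[of x y v'] by (metis arr_iff mor_unmor prod.inject)

lemma mm_ops:
  assumes x: "x \<in> Obj M" and y: "y \<in> Obj M"
  shows "sqr x y v \<Longrightarrow> sqr x y v' \<Longrightarrow> mm x y (v + v') = mm x y v + mm x y v'"
    and "z \<in> Obj M \<Longrightarrow> sqr x y v \<Longrightarrow> sqr y z w \<Longrightarrow> mm x z (w * v) = mm y z w * mm x y v"
    and "mm x y 0 = 0" and "mm x x (ide (sB x)) = M.ide x"
    and "sqr x y v \<Longrightarrow> sqr x y v' \<Longrightarrow> mm x y v = mm x y v' \<longleftrightarrow> v = v'"
    and "sqr x y v \<Longrightarrow> mm x y v \<in> M.hom x y"
  using x y un_inject[of x y v v']
  by (auto simp: mm_def M.ide_def un_ops[symmetric] M.mor_Add M.mor_Cmp M.mor_Zer un_in M.mor_inject M.mor_in)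

lemma mm_diff:
  assumes "x \<in> Obj M" "y \<in> Obj M" "sqr x y v" "sqr x y v'"
  shows "sqr x y (v - v')" "mm x y (v - v') = mm x y v - mm x y v'"
proof -
  show d: "sqr x y (v - v')" using uu_ops(1)[OF assms(1,2,3), of "- v'"] uu_ops(2)[OF assms(1,2,4)] by simp
  show "mm x y (v - v') = mm x y v - mm x y v'" using mm_ops(1)[OF assms(1,2) d assms(4)] by simp
qed

lemma M_hom: "\<lbrakk>x \<in> Obj M; y \<in> Obj M\<rbrakk> \<Longrightarrow> M.hom x y = mm x y ` {v. sqr x y v}"
  unfolding M.hom_def mm_def by (auto simp: un_in elim: Hom_ME)

text \<open>Of the two equations of a null square only the one in degree \<open>0\<close> is kept;
  cancelling the monomorphism \<open>sd y\<close> yields the other,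
  \<open>u = t * sd x\<close>.\<close>

definition nullsq where
  "nullsq x y v \<longleftrightarrow> (\<exists>t\<in>arr (sB x) (sA y). v = sd y * t)"

lemma nullsq_sqr:
  assumes x: "x \<in> Obj M" and y: "y \<in> Obj M" and "t \<in> arr (sB x) (sA y)" "v = sd y * t"
  shows "sqr x y v" "uu x y v = t * sd x"
proof -
  have a: "v \<in> arr (sB x) (sB y)" "t * sd x \<in> arr (sA x) (sA y)" "sd y * (t * sd x) = v * sd x"
    using arr_mult[OF assms(3) sd_arr[OF y]] arr_mult[OF sd_arr[OF x] assms(3)] assms(4) by (simp_all add: mult.assoc)
  show s: "sqr x y v" using sqrI[OF a] .
  show "uu x y v = t * sd x" using uu_unique[OF y s a(2,3)] .
qed

abbreviation null_sq_mor where
  "null_sq_mor x y \<equiv> mor M x y ` null_squares C x y"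

lemma null_squares_eq:
  assumes x: "x \<in> Obj M" and y: "y \<in> Obj M"
  shows "null_squares C x y = un x y ` {v. nullsq x y v}"
proof -
  note O = s_obj[OF x] s_obj[OF y]
  have d: "snd (snd x) \<in> Hom C (sA x) (sB x)" "snd (snd y) \<in> Hom C (sA y) (sB y)" using x y by (simp_all add: Obj_M)
  have 1: "(Cmp C (sA x) (sB x) (sA y) t (snd (snd x)), Cmp C (sB x) (sA y) (sB y) (snd (snd y)) t) =
      un x y (sd y * mor C (sB x) (sA y) t)" if "t \<in> Hom C (sB x) (sA y)" for t
    using nullsq_sqr(2)[OF x y mor_arr[OF O(2,3) that] refl] that O d
    by (simp add: un_def sd_def mor_Cmp[symmetric] Cmp_in)
  have "null_squares C x y = (\<lambda>t. (Cmp C (sA x) (sB x) (sA y) t (snd (snd x)),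
      Cmp C (sB x) (sA y) (sB y) (snd (snd y)) t)) ` Hom C (sB x) (sA y)"
    by (auto simp: null_squares_def split_beta)
  also have "\<dots> = (\<lambda>t. un x y (sd y * t)) ` arr (sB x) (sA y)"
    using O by (simp add: arr_def hom_def image_image 1 cong: image_cong)
  also have "\<dots> = un x y ` {v. nullsq x y v}" by (auto simp: nullsq_def)
  finally show ?thesis .
qed

lemma null_sq_mor_eq:
  assumes x: "x \<in> Obj M" and y: "y \<in> Obj M"
  shows "null_sq_mor x y = mm x y ` {v. nullsq x y v}"
  unfolding null_squares_eq[OF x y] mm_def by blast

lemma ideal_null_squares: "hom_ideal M (null_squares C)"
proof (unfold_locales)
  fix x y assume x: "x \<in> Obj M" and y: "y \<in> Obj M"
  note N = null_sq_mor_eq[OF x y]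
  show "null_squares C x y \<subseteq> Hom M x y"
    unfolding null_squares_eq[OF x y] using nullsq_sqr(1)[OF x y] un_in[OF x y] by (auto simp: nullsq_def)
  have "nullsq x y 0" using s_obj[OF x] s_obj[OF y] by (auto simp: nullsq_def intro!: bexI[of _ 0] arr_0)
  then show "0 \<in> null_sq_mor x y" unfolding N using mm_ops(3)[OF x y] by (metis imageI mem_Collect_eq)
  show "a - b \<in> null_sq_mor x y" if ab: "a \<in> null_sq_mor x y" "b \<in> null_sq_mor x y" for a b
  proof -
    obtain t t' where t: "t \<in> arr (sB x) (sA y)" "a = mm x y (sd y * t)" "t' \<in> arr (sB x) (sA y)" "b = mm x y (sd y * t')"
      using ab unfolding N nullsq_def by blast
    have "a - b = mm x y (sd y * (t - t'))"
      using mm_diff(2)[OF x y nullsq_sqr(1)[OF x y t(1) refl] nullsq_sqr(1)[OF x y t(3) refl]]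
      by (simp add: t(2,4) right_diff_distrib)
    then show ?thesis unfolding N nullsq_def using arr_diff[OF t(1,3)] by blast
  qed
  fix z assume z: "z \<in> Obj M"
  show "b * a \<in> null_sq_mor x z" if ab: "a \<in> null_sq_mor x y" "b \<in> M.hom y z" for a b
  proof -
    obtain t w where t: "t \<in> arr (sB x) (sA y)" "a = mm x y (sd y * t)" "sqr y z w" "b = mm y z w"
      using ab unfolding N nullsq_def M_hom[OF y z] by blast
    have "b * a = mm x z (w * (sd y * t))"
      using mm_ops(2)[OF x y z nullsq_sqr(1)[OF x y t(1) refl] t(3)] by (simp add: t)
    also have "w * (sd y * t) = sd z * (uu y z w * t)" using uu_eq[OF t(3)] by (simp add: mult.assoc[symmetric])
    finally show ?thesis
      unfolding null_sq_mor_eq[OF x z] nullsq_def using arr_mult[OF t(1) uu_arr[OF t(3)]] by blast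
  qed
  show "b * a \<in> null_sq_mor x z" if ab: "a \<in> M.hom x y" "b \<in> null_sq_mor y z" for a b
  proof -
    obtain t v where t: "t \<in> arr (sB y) (sA z)" "b = mm y z (sd z * t)" "sqr x y v" "a = mm x y v"
      using ab unfolding null_sq_mor_eq[OF y z] nullsq_def M_hom[OF x y] by blast
    have "b * a = mm x z (sd z * (t * v))"
      using mm_ops(2)[OF x y z t(3) nullsq_sqr(1)[OF y z t(1) refl]] by (simp add: t mult.assoc)
    then show ?thesis
      unfolding null_sq_mor_eq[OF x z] nullsq_def using arr_mult[OF sqr_arr[OF t(3)] t(1)] by blast
  qed
qed

end

sublocale additive_regular_category \<subseteq> MQ: hom_ideal "mono_category C" "null_squares C"
    "\<lambda>x y. mor (mono_category C) x y ` null_squares C x y"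
  by (rule ideal_null_squares, rule reflexive)

context additive_regular_category
begin

abbreviation "hM \<equiv> hMon C"

lemma hM_eq: "hM = quotient_category (mono_category C) (null_squares C)"
  by (simp add: hMon_def)

lemma Obj_hM [simp]: "Obj hM = Obj M"
  by (simp add: hM_eq)

end

sublocale additive_regular_category \<subseteq> hM: preadditive_category "hMon C"
  unfolding hMon_def by (rule MQ.preadditive_Q)

context additive_regular_category
begin

definition mu where
  "mu x y v = mor hM x y (MQ.qcl x y (mm x y v))"

lemma mu_proj: "mu x y v = MQ.proj x y (mm x y v)"
  by (simp add: mu_def MQ.proj_def hM_eq)

lemma hM_hom: "\<lbrakk>x \<in> Obj M; y \<in> Obj M\<rbrakk> \<Longrightarrow> hM.hom x y = mu x y ` {v. sqr x y v}"
  using MQ.hom_Q[of x y] unfolding hM_eq[symmetric] by (auto simp: M_hom mu_proj)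

lemma mu_in: "\<lbrakk>x \<in> Obj M; y \<in> Obj M; sqr x y v\<rbrakk> \<Longrightarrow> mu x y v \<in> hM.hom x y"
  by (simp add: hM_hom)

lemma hM_homE:
  assumes "a \<in> hM.hom x y" "x \<in> Obj M" "y \<in> Obj M"
  obtains v where "sqr x y v" "a = mu x y v"
  using assms by (auto simp: hM_hom)

lemma mu_eq_iff:
  assumes x: "x \<in> Obj M" and y: "y \<in> Obj M" and "sqr x y v" "sqr x y v'"
  shows "mu x y v = mu x y v' \<longleftrightarrow> nullsq x y (v - v')"
proof -
  have "mu x y v = mu x y v' \<longleftrightarrow> mm x y (v - v') \<in> null_sq_mor x y"
    using assms by (simp add: mu_proj MQ.proj_eq_iff mm_ops mm_diff)
  also have "\<dots> \<longleftrightarrow> nullsq x y (v - v')"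
    using mm_ops(5)[OF x y mm_diff(1)[OF assms]] nullsq_sqr(1)[OF x y]
    unfolding null_sq_mor_eq[OF x y] nullsq_def by auto
  finally show ?thesis .
qed

lemma mu_ops:
  assumes x: "x \<in> Obj M" and y: "y \<in> Obj M"
  shows "sqr x y v \<Longrightarrow> sqr x y v' \<Longrightarrow> mu x y (v + v') = mu x y v + mu x y v'"
    and "z \<in> Obj M \<Longrightarrow> sqr x y v \<Longrightarrow> sqr y z w \<Longrightarrow> mu x z (w * v) = mu y z w * mu x y v"
    and "mu x x (ide (sB x)) = hM.ide x"
  using MQ.proj.F_add[of x y "mm x y v" "mm x y v'"] MQ.proj.F_mult[of x y z "mm x y v" "mm y z w"]
    MQ.proj.F_ide[of x] assms
  by (simp_all add: mu_proj mm_ops hM_eq[symmetric])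

text \<open>The condition \<open>qis\<close> for the two-term complexes, spelled out in degree
  \<open>0\<close>, where elements of \<open>sB\<close> count modulo \<open>sA\<close>: one clause
  is injectivity, the other surjectivity. In degree \<open>-1\<close> the differentials are monic
  and there is no cohomology to compare.\<close>

definition bq where
  "bq x y v \<longleftrightarrow> x \<in> Obj M \<and> y \<in> Obj M \<and> sqr x y v \<and>
    (\<forall>W. \<forall>b\<in>arr W (sB x). \<forall>a'\<in>arr W (sA y). v * b = sd y * a' \<longrightarrow>
      (\<exists>W' e. \<exists>a\<in>arr W' (sA x). cover W' W e \<and> b * e = sd x * a)) \<and>
    (\<forall>W. \<forall>b'\<in>arr W (sB y). \<exists>W' e. \<exists>b\<in>arr W' (sB x). \<exists>a'\<in>arr W' (sA y).
      cover W' W e \<and> b' * e = v * b + sd y * a')"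

lemma bqD: "bq x y v \<Longrightarrow> x \<in> Obj M" "bq x y v \<Longrightarrow> y \<in> Obj M" "bq x y v \<Longrightarrow> sqr x y v"
  by (simp_all add: bq_def)

lemma bq_inj:
  assumes "bq x y v" "b \<in> arr W (sB x)" "a' \<in> arr W (sA y)" "v * b = sd y * a'"
  obtains W' e a where "a \<in> arr W' (sA x)" "cover W' W e" "b * e = sd x * a"
  using assms unfolding bq_def by blast

lemma bq_surj:
  assumes "bq x y v" "b' \<in> arr W (sB y)"
  obtains W' e b a' where "b \<in> arr W' (sB x)" "a' \<in> arr W' (sA y)" "cover W' W e" "b' * e = v * b + sd y * a'"
  using assms unfolding bq_def by blast

lemma bqI:
  assumes "x \<in> Obj M" "y \<in> Obj M" "sqr x y v"
    and "\<And>W b a'. \<lbrakk>b \<in> arr W (sB x); a' \<in> arr W (sA y); v * b = sd y * a'\<rbrakk> \<Longrightarrow>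
      \<exists>W' e. \<exists>a\<in>arr W' (sA x). cover W' W e \<and> b * e = sd x * a"
    and "\<And>W b'. b' \<in> arr W (sB y) \<Longrightarrow> \<exists>W' e. \<exists>b\<in>arr W' (sB x). \<exists>a'\<in>arr W' (sA y).
      cover W' W e \<and> b' * e = v * b + sd y * a'"
  shows "bq x y v"
  using assms unfolding bq_def by blast

lemma bq_comp:
  assumes v: "bq x y v" and w: "bq y z w"
  shows "bq x z (w * v)"
proof (rule bqI)
  note V = bqD[OF v] and W = bqD[OF w]
  show "x \<in> Obj M" "z \<in> Obj M" using V W by blast+
  show "sqr x z (w * v)" using uu_ops(3)[OF V(1,2) W(2) V(3) W(3)] by blast
  note sv = sqrD[OF V(3)] and sw = sqrD[OF W(3)]
  fix U
  { fix b a'' assume b: "b \<in> arr U (sB x)" "a'' \<in> arr U (sA z)" "w * v * b = sd z * a''"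
    obtain U' e a' where a': "a' \<in> arr U' (sA y)" "cover U' U e" "v * b * e = sd y * a'"
      using bq_inj[OF w arr_mult[OF b(1) sv(1)] b(2)] b(3) by (metis mult.assoc)
    obtain U'' e' a where a: "a \<in> arr U'' (sA x)" "cover U'' U' e'" "b * e * e' = sd x * a"
      using bq_inj[OF v arr_mult[OF cover_arr[OF a'(2)] b(1)] a'(1)] a'(3) by (metis mult.assoc)
    then show "\<exists>W' e. \<exists>a\<in>arr W' (sA x). cover W' U e \<and> b * e = sd x * a"
      using cover_comp[OF a'(2) a(2)] by (metis mult.assoc) }
  fix b'' assume b'': "b'' \<in> arr U (sB z)"
  obtain U' e b' a'' where b': "b' \<in> arr U' (sB y)" "a'' \<in> arr U' (sA z)" "cover U' U e" "b'' * e = w * b' + sd z * a''"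
    using bq_surj[OF w b''] .
  obtain U'' e' b a' where b: "b \<in> arr U'' (sB x)" "a' \<in> arr U'' (sA y)" "cover U'' U' e'" "b' * e' = v * b + sd y * a'"
    using bq_surj[OF v b'(1)] .
  have "b'' * (e * e') = w * (b' * e') + sd z * (a'' * e')"
    using b'(4) by (simp add: mult.assoc[symmetric] distrib_right)
  also have "\<dots> = w * v * b + (w * sd y) * a' + sd z * (a'' * e')" by (simp add: b(4) distrib_left mult.assoc)
  also have "\<dots> = w * v * b + sd z * (uu y z w * a' + a'' * e')"
    using sw(3)[symmetric] by (simp add: distrib_left mult.assoc)
  finally have "b'' * (e * e') = w * v * b + sd z * (uu y z w * a' + a'' * e')" .
  moreover have "uu y z w * a' + a'' * e' \<in> arr U'' (sA z)"
    using arr_add[OF arr_mult[OF b(2) sw(2)] arr_mult[OF cover_arr[OF b(3)] b'(2)]] .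
  ultimately show "\<exists>W' e. \<exists>b\<in>arr W' (sB x). \<exists>a'\<in>arr W' (sA z). cover W' U e \<and> b'' * e = w * v * b + sd z * a'"
    using cover_comp[OF b'(3) b(3)] b(1) by blast
qed

text \<open>The inverse \<open>w\<close> provides preimages over the identity cover, and its
  component \<open>uu y x w\<close> moves them into the subobject.\<close>

lemma bq_iso:
  assumes x: "x \<in> Obj M" and y: "y \<in> Obj M" and v: "sqr x y v" and w: "sqr y x w"
    and inv: "w * v = ide (sB x)" "v * w = ide (sB y)"
  shows "bq x y v"
proof (rule bqI[OF x y v])
  note V = sqrD[OF v] and W = sqrD[OF w]
  fix U
  { fix b a' assume b: "b \<in> arr U (sB x)" "a' \<in> arr U (sA y)" "v * b = sd y * a'"
    have "b = w * (v * b)" using inv(1) arr_ide_left[OF b(1)] by (simp add: mult.assoc[symmetric])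
    also have "\<dots> = sd x * (uu y x w * a')" using W(3) b(3) by (simp add: mult.assoc[symmetric])
    finally have "b * ide U = sd x * (uu y x w * a')" using arr_ide_right[OF b(1)] by simp
    then show "\<exists>W' e. \<exists>a\<in>arr W' (sA x). cover W' U e \<and> b * e = sd x * a"
      using arr_mult[OF b(2) W(2)] cover_ide[OF arr_obj(1)[OF b(1)]] by blast }
  fix b' assume b': "b' \<in> arr U (sB y)"
  have "b' * ide U = v * (w * b') + sd y * 0"
    using inv(2) arr_ide_left[OF b'] arr_ide_right[OF b'] by (simp add: mult.assoc[symmetric])
  then show "\<exists>W' e. \<exists>b\<in>arr W' (sB x). \<exists>a'\<in>arr W' (sA y). cover W' U e \<and> b' * e = v * b + sd y * a'"
    using arr_mult[OF b' W(1)] cover_ide[OF arr_obj(1)[OF b']] arr_0[OF arr_obj(1)[OF b'] s_obj(1)[OF y]] by blast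
qed

text \<open>A homotopy changes values only by elements of the subobject \<open>sA y\<close>. So one
  bicartesian representative makes every representative of a class bicartesian.\<close>

lemma bq_homotopic:
  assumes v: "bq x y v" and w: "sqr x y w" and n: "nullsq x y (v - w)"
  shows "bq x y w"
proof (rule bqI[OF bqD(1,2)[OF v] w])
  obtain t where t: "t \<in> arr (sB x) (sA y)" "v - w = sd y * t" using n by (auto simp: nullsq_def)
  then have vw: "v = w + sd y * t" by (simp add: algebra_simps)
  fix U
  { fix b a' assume b: "b \<in> arr U (sB x)" "a' \<in> arr U (sA y)" "w * b = sd y * a'"
    have "v * b = sd y * (a' + t * b)" using b(3) by (simp add: vw distrib_left distrib_right mult.assoc)
    then show "\<exists>W' e. \<exists>a\<in>arr W' (sA x). cover W' U e \<and> b * e = sd x * a"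
      using bq_inj[OF v b(1) arr_add[OF b(2) arr_mult[OF b(1) t(1)]]] by metis }
  fix b' assume b': "b' \<in> arr U (sB y)"
  obtain W' e b a' where b: "b \<in> arr W' (sB x)" "a' \<in> arr W' (sA y)" "cover W' U e" "b' * e = v * b + sd y * a'"
    using bq_surj[OF v b'] .
  have "b' * e = w * b + sd y * (t * b + a')" using b(4) by (simp add: vw distrib_left distrib_right mult.assoc add.assoc)
  then show "\<exists>W' e. \<exists>b\<in>arr W' (sB x). \<exists>a'\<in>arr W' (sA y). cover W' U e \<and> b' * e = w * b + sd y * a'"
    using b(1,3) arr_add[OF arr_mult[OF b(1) t(1)] b(2)] by blast
qed

text \<open>A bicartesian square exhibits \<open>A \<rightarrow> A' \<oplus> B \<rightarrow> B'\<close> as a kernel-cokernel pair.\<close>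

lemma bicartesian_bq:
  assumes x: "x \<in> Obj M" and y: "y \<in> Obj M" and v: "sqr x y v"
  shows "rpb (sA x) (sA y) (sB x) (sB y) (uu x y v) (sd x) (sd y) v \<and>
    rpo (sA x) (sA y) (sB x) (sB y) (uu x y v) (sd x) (sd y) v \<longleftrightarrow> bq x y v"
proof
  note V = sqrD[OF v] and dx = sd_arr[OF x] and dy = sd_arr[OF y]
  obtain B i j p q where b: "rbiprod (sA y) (sB x) B i j p q"
    using ex_rbiprod[OF s_obj(1)[OF y] s_obj(2)[OF x]] by blast
  note R = rbiprodD[OF b]
  \<comment> \<open>The biproduct is that of \<open>sA y\<close> and \<open>sB x\<close>; the sign
    in \<open>?a\<close> turns commutativity of the square into \<open>?c * ?a = 0\<close>.\<close>
  let ?c = "sd y * p + v * q" and ?a = "i * uu x y v - j * sd x"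
  have c: "?c \<in> arr B (sB y)" using arr_add[OF arr_mult[OF R(3) dy] arr_mult[OF R(4) V(1)]] .
  have a: "?a \<in> arr (sA x) B" using arr_diff[OF arr_mult[OF V(2) R(1)] arr_mult[OF dx R(2)]] .
  have ci: "?c * (i * z) = sd y * z" if "z \<in> arr W (sA y)" for W z
    using rbiprod_elem[OF b] that by (simp add: distrib_right mult.assoc)
  have cj: "?c * (j * z) = v * z" if "z \<in> arr W (sB x)" for W z
    using rbiprod_elem[OF b] that by (simp add: distrib_right mult.assoc)
  { assume bc: "rpb (sA x) (sA y) (sB x) (sB y) (uu x y v) (sd x) (sd y) v \<and>
      rpo (sA x) (sA y) (sB x) (sB y) (uu x y v) (sd x) (sd y) v"
    have "rcok (sA x) B (sB y) ?a ?c"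
      unfolding rcok_def repi_def
    proof (intro conjI allI ballI impI a c)
      show "?c * ?a = 0"
        using ci[OF V(2)] cj[OF dx] V(3) by (simp add: right_diff_distrib)
      fix W h assume h: "h \<in> arr (sB y) W" "h * ?c = 0"
      have "h * sd y = h * ?c * i" "h * v = h * ?c * j"
        using R(5-8) arr_ide_right[OF dy] arr_ide_right[OF V(1)] by (simp_all add: distrib_left distrib_right mult.assoc)
      then show "h = 0" using bc h unfolding rpo_def by simp
    next
      fix W g assume g: "g \<in> arr B W" "g * ?a = 0"
      have "g * i * uu x y v = g * j * sd x" using g(2) by (simp add: right_diff_distrib mult.assoc)
      moreover have "g * i \<in> arr (sA y) W" "g * j \<in> arr (sB x) W" using arr_mult R g by blast+
      ultimately obtain h where h: "h \<in> arr (sB y) W" "h * sd y = g * i" "h * v = g * j"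
        using bc unfolding rpo_def by blast
      have "h * ?c = g * (i * p + j * q)" using h by (simp add: distrib_left mult.assoc[symmetric])
      then show "\<exists>h\<in>arr (sB y) W. h * ?c = g" using h(1) R(9) arr_ide_right[OF g(1)] by auto
    qed
    then have cov: "cover B (sB y) ?c" by (auto simp: cover_def)
    show "bq x y v"
    proof (rule bqI[OF x y v])
      fix W b a' assume b: "b \<in> arr W (sB x)" "a' \<in> arr W (sA y)" "v * b = sd y * a'"
      then obtain h where "h \<in> arr W (sA x)" "sd x * h = b" using bc unfolding rpb_def by metis
      then show "\<exists>W' e. \<exists>a\<in>arr W' (sA x). cover W' W e \<and> b * e = sd x * a"
        using cover_ide[OF arr_obj(1)[OF b(1)]] arr_ide_right[OF b(1)] by metis
    next
      fix W b' assume b': "b' \<in> arr W (sB y)"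
      obtain W' e g where g: "cover W' W e" "g \<in> arr W' B" "?c * g = b' * e" using cover_pullback[OF cov b'] by metis
      have "b' * e = v * (q * g) + sd y * (p * g)" using g(3) by (simp add: distrib_right mult.assoc add.commute)
      then show "\<exists>W' e. \<exists>b\<in>arr W' (sB x). \<exists>a'\<in>arr W' (sA y). cover W' W e \<and> b' * e = v * b + sd y * a'"
        using g(1) arr_mult[OF g(2) R(4)] arr_mult[OF g(2) R(3)] by blast
    qed }
  assume q: "bq x y v"
  \<comment> \<open>The cover over which \<open>b\<close> comes from the subobject is removed by
    orthogonality to the monomorphism \<open>sd x\<close>. This is the pullback property.\<close>
  have lift: "\<exists>h\<in>arr W (sA x). uu x y v * h = a' \<and> sd x * h = b"
    if b: "a' \<in> arr W (sA y)" "b \<in> arr W (sB x)" "sd y * a' = v * b" for W a' b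
  proof -
    obtain W' e a where a: "a \<in> arr W' (sA x)" "cover W' W e" "b * e = sd x * a"
      using bq_inj[OF q b(2,1)] b(3) by metis
    obtain h where h: "h \<in> arr W (sA x)" "sd x * h = b"
      using cover_lift[OF a(2) sd_mono[OF x] a(1) b(2)] a(3) by metis
    have "sd y * (uu x y v * h) = sd y * a'" using V(3) h(2) b(3) by (simp add: mult.assoc[symmetric]) (simp add: mult.assoc)
    then have "uu x y v * h = a'" using rmono_cancel[OF sd_mono[OF y] arr_mult[OF h(1) V(2)] b(1)] by blast
    then show ?thesis using h by blast
  qed
  have pb: "rpb (sA x) (sA y) (sB x) (sB y) (uu x y v) (sd x) (sd y) v"
    unfolding rpb_def using V dx dy lift sd_mono[OF x] unfolding rmono_def by blast
  \<comment> \<open>Surjectivity applied to the generic element, the identity of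
    \<open>sB y\<close>, shows that \<open>?c\<close> is a cover.\<close>
  obtain W e b0 a0 where s: "b0 \<in> arr W (sB x)" "a0 \<in> arr W (sA y)" "cover W (sB y) e"
    "ide (sB y) * e = v * b0 + sd y * a0"
    using bq_surj[OF q arr_ide[OF s_obj(2)[OF y]]] .
  have ij: "i * a0 + j * b0 \<in> arr W B" using arr_add[OF arr_mult[OF s(2) R(1)] arr_mult[OF s(1) R(2)]] .
  have "?c * (i * a0 + j * b0) = sd y * a0 + v * b0"
    unfolding distrib_left[of ?c] ci[OF s(2)] cj[OF s(1)] by (rule refl)
  then have "?c * (i * a0 + j * b0) = e"
    using s(4) arr_ide_left[OF cover_arr[OF s(3)]] by (simp only: add.commute)
  then have cov: "cover B (sB y) ?c" using cover_factor[of W "sB y" ?c "i * a0 + j * b0"] s(3) ij c by simp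
  obtain Kc kc where kc: "rcok Kc B (sB y) kc ?c" using cov by (auto simp: cover_def)
  have po: "rpo (sA x) (sA y) (sB x) (sB y) (uu x y v) (sd x) (sd y) v"
    unfolding rpo_def
  proof (intro conjI allI ballI impI V dx dy)
    fix W g1 g2 assume g: "g1 \<in> arr (sA y) W" "g2 \<in> arr (sB x) W" "g1 * uu x y v = g2 * sd x"
    \<comment> \<open>The components of \<open>kc\<close>, one with a sign, have the same image in
      \<open>sB y\<close>, so by the pullback property they come from a map into
      \<open>sA x\<close>. Compatible maps \<open>g1\<close>, \<open>g2\<close> therefore annihilate
      \<open>kc\<close>, and their sum descends along its cokernel \<open>?c\<close>.\<close>
    have kca: "kc \<in> arr Kc B" "?c * kc = 0" using kc by (auto simp: rcok_def)
    have pk: "- (p * kc) \<in> arr Kc (sA y)" "q * kc \<in> arr Kc (sB x)" using arr_neg arr_mult kca R by blast+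
    have "sd y * (- (p * kc)) = v * (q * kc)"
      using kca(2) by (simp add: distrib_right mult.assoc eq_neg_iff_add_eq_0 minus_equation_iff[of "sd y * (p * kc)"] neg_eq_iff_add_eq_0)
    then obtain h where h: "h \<in> arr Kc (sA x)" "uu x y v * h = - (p * kc)" "sd x * h = q * kc"
      using lift[OF pk] by blast
    have "(g1 * p + g2 * q) * kc = - (g1 * (uu x y v * h)) + g2 * (sd x * h)"
      by (simp add: h(2,3) distrib_right mult.assoc)
    also have "\<dots> = 0" using g(3) by (simp add: mult.assoc[symmetric])
    finally have "(g1 * p + g2 * q) * kc = 0" .
    moreover have "g1 * p + g2 * q \<in> arr B W" using arr_add[OF arr_mult[OF R(3) g(1)] arr_mult[OF R(4) g(2)]] .
    ultimately obtain t where t: "t \<in> arr (sB y) W" "t * ?c = g1 * p + g2 * q" using kc unfolding rcok_def by blast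
    have "t * ?c * i = (g1 * p + g2 * q) * i" "t * ?c * j = (g1 * p + g2 * q) * j" using t(2) by simp_all
    then have "t * sd y = g1" "t * v = g2"
      using R(5-8) arr_ide_right[OF dy] arr_ide_right[OF V(1)] arr_ide_right[OF g(1)] arr_ide_right[OF g(2)]
      by (simp_all add: distrib_left distrib_right mult.assoc)
    then show "\<exists>h\<in>arr (sB y) W. h * sd y = g1 \<and> h * v = g2" using t(1) by blast
  next
    fix W h assume h: "h \<in> arr (sB y) W" "h * sd y = 0" "h * v = 0"
    then have "h * ?c = 0" by (simp add: distrib_left mult.assoc[symmetric])
    then show "h = 0" using cover_epi[OF cov] h(1) unfolding repi_def by blast
  qed
  show "rpb (sA x) (sA y) (sB x) (sB y) (uu x y v) (sd x) (sd y) v \<and>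
    rpo (sA x) (sA y) (sB x) (sB y) (uu x y v) (sd x) (sd y) v" using pb po by blast
qed

abbreviation "S \<equiv> bicartesian C"

lemma S_iff: "F \<in> S x y \<longleftrightarrow> F \<in> Hom hM x y \<and> (\<exists>f\<in>F. is_pullback C (sA x) (sA y) (sB x) (sB y) (fst f) (snd (snd x)) (snd (snd y)) (snd f) \<and>
    is_pushout C (sA x) (sA y) (sB x) (sB y) (fst f) (snd (snd x)) (snd (snd y)) (snd f))"
  by (simp add: bicartesian_def split_beta)

text \<open>\<open>bq_homotopic\<close> trades the bicartesian representative of a class for the one
  by which the class is named.\<close>

lemma mor_S:
  assumes x: "x \<in> Obj M" and y: "y \<in> Obj M"
  shows "mor hM x y ` S x y = mu x y ` {v. bq x y v}"
proof -
  note O = s_obj[OF x] s_obj[OF y]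
  have d: "snd (snd x) \<in> Hom C (sA x) (sB x)" "snd (snd y) \<in> Hom C (sA y) (sB y)" using x y by (simp_all add: Obj_M)
  have bc: "is_pullback C (sA x) (sA y) (sB x) (sB y) (fst f) (snd (snd x)) (snd (snd y)) (snd f) \<and>
    is_pushout C (sA x) (sA y) (sB x) (sB y) (fst f) (snd (snd x)) (snd (snd y)) (snd f) \<longleftrightarrow>
    bq x y (mor C (sB x) (sB y) (snd f))" if f: "f \<in> Hom M x y" for f
    using bicartesian_bq[OF x y, of "mor C (sB x) (sB y) (snd f)"] f[unfolded Hom_M_iff[OF x y]] O d
    by (simp add: is_pullback_iff is_pushout_iff sd_def)
  have hom: "F \<in> Hom hM x y \<longleftrightarrow> (\<exists>v. sqr x y v \<and> F = MQ.qcl x y (mm x y v))" for F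
    using MQ.Hom_Q[of x y] x y unfolding hM_eq[symmetric] by (auto simp: M_hom)
  have mem: "f \<in> MQ.qcl x y (mm x y v) \<longleftrightarrow> f \<in> Hom M x y \<and> nullsq x y (mor C (sB x) (sB y) (snd f) - v)"
    if v: "sqr x y v" for f v
  proof -
    have "mor M x y f - mm x y v \<in> null_sq_mor x y \<longleftrightarrow> nullsq x y (mor C (sB x) (sB y) (snd f) - v)"
      if f: "f \<in> Hom M x y"
    proof -
      define w where "w = mor C (sB x) (sB y) (snd f)"
      have w: "sqr x y w" "f = un x y w" "w = mor C (sB x) (sB y) (snd f)"
        unfolding w_def by (fact Hom_M_un[OF f x y] refl)+
      have "mor M x y f - mm x y v = mm x y (w - v)"
        using mm_diff(2)[OF x y w(1) v] by (simp add: mm_def w(2)[symmetric])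
      then show ?thesis
        using mm_ops(5)[OF x y mm_diff(1)[OF x y w(1) v]] nullsq_sqr(1)[OF x y] w(3)
        unfolding null_sq_mor_eq[OF x y] nullsq_def by auto
    qed
    then show ?thesis by (auto simp: MQ.qcl_def)
  qed
  show ?thesis
  proof (intro equalityI subsetI)
    fix a assume "a \<in> mor hM x y ` S x y"
    then obtain F where "a = mor hM x y F" "F \<in> S x y" by blast
    then obtain f where F: "a = mor hM x y F" "F \<in> Hom hM x y" "f \<in> F"
      "is_pullback C (sA x) (sA y) (sB x) (sB y) (fst f) (snd (snd x)) (snd (snd y)) (snd f) \<and>
       is_pushout C (sA x) (sA y) (sB x) (sB y) (fst f) (snd (snd x)) (snd (snd y)) (snd f)"
      unfolding S_iff by blast
    obtain v where v: "sqr x y v" "F = MQ.qcl x y (mm x y v)" using F(2) hom by blast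
    then have f: "f \<in> Hom M x y" "nullsq x y (mor C (sB x) (sB y) (snd f) - v)" using F(3) mem by blast+
    then have "bq x y v" using bc[OF f(1)] F(4) bq_homotopic v(1) by blast
    then show "a \<in> mu x y ` {v. bq x y v}" using F(1) v(2) by (simp add: mu_def)
  next
    fix a assume "a \<in> mu x y ` {v. bq x y v}"
    then obtain v where v: "bq x y v" "a = mu x y v" by blast
    note s = bqD(3)[OF v(1)]
    have f: "un x y v \<in> Hom M x y" "mor C (sB x) (sB y) (snd (un x y v)) = v"
      using un_in[OF x y s] sqr_arr[OF s] by (simp_all add: un_def arr_iff)
    have "nullsq x y 0" using O by (auto simp: nullsq_def intro!: bexI[of _ 0] arr_0)
    then have "un x y v \<in> MQ.qcl x y (mm x y v)" using mem[OF s] f by simp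
    moreover have "MQ.qcl x y (mm x y v) \<in> Hom hM x y" using hom s by blast
    ultimately have "MQ.qcl x y (mm x y v) \<in> S x y" unfolding S_iff using bc[OF f(1)] f(2) v(1) by auto
    then show "a \<in> mor hM x y ` S x y" by (simp add: v(2) mu_def)
  qed
qed

section \<open>Comparison of monomorphisms and complexes\<close>

lemma arr_to_zero: "\<lbrakk>ide Z = 0; a \<in> arr W Z\<rbrakk> \<Longrightarrow> a = 0"
  using arr_ide_left[of a W Z] by simp

definition zob where "zob = (SOME Z. Z \<in> Obj C \<and> ide Z = 0)"

lemma zob: "zob \<in> Obj C" "ide zob = 0"
proof -
  have "\<exists>Z. Z \<in> Obj C \<and> ide Z = 0" using ex_zero by metis
  from someI_ex[OF this] show "zob \<in> Obj C" "ide zob = 0" by (simp_all add: zob_def)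
qed

lemmas zob_arr = arr_to_zero[OF zob(2)]

section \<open>The functor from monomorphisms to complexes\<close>

definition Jo :: "('a, 'b) Defs.arr \<Rightarrow> ('a, 'b) cpx" where
  "Jo x = mk_cpx (\<lambda>n. if n = - 1 then sA x else if n = 0 then sB x else zob) (\<lambda>n. if n = - 1 then sd x else 0)"

lemma ob_Jo: "ob (Jo x) n = (if n = - 1 then sA x else if n = 0 then sB x else zob)"
  by (simp add: Jo_def)

lemma dd_Jo: "x \<in> Obj M \<Longrightarrow> dd (Jo x) n = (if n = - 1 then sd x else 0)"
  using sd_arr[of x] s_obj[of x] zob(1) unfolding Jo_def
  by (subst dd_mk) (auto simp: arr_0)

lemma Jo_complex: "x \<in> Obj M \<Longrightarrow> is_complex C (Jo x)"
  using sd_arr[of x] s_obj[of x] zob(1) unfolding Jo_def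
  by (intro is_complex_mk) (auto simp: arr_0)

definition Jv where
  "Jv x y v (n::int) = (if n = 0 then v else if n = - 1 then uu x y v else 0)"

lemma Jv_cmap:
  assumes x: "x \<in> Obj M" and y: "y \<in> Obj M" and v: "sqr x y v"
  shows "cmap (Jo x) (Jo y) (Jv x y v)"
proof (rule cmapI)
  note V = sqrD[OF v]
  fix n
  show "Jv x y v n \<in> arr (ob (Jo x) n) (ob (Jo y) n)"
    using V zob by (simp add: Jv_def ob_Jo arr_0)
  show "Jv x y v (n + 1) * dd (Jo x) n = dd (Jo y) n * Jv x y v n"
    using V by (simp add: Jv_def dd_Jo x y)
qed

text \<open>Between these complexes a homotopy can be non-zero only in degree \<open>0\<close>,
  where it is a morphism from \<open>sB x\<close> to \<open>sA y\<close>. Homotopy of complexes thus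
  is homotopy of squares, so \<open>J\<close> is well defined on classes.\<close>

lemma htp_Jv:
  assumes x: "x \<in> Obj M" and y: "y \<in> Obj M" and v: "sqr x y v"
  shows "htp (Jo x) (Jo y) (Jv x y v) \<longleftrightarrow> nullsq x y v"
proof
  assume "htp (Jo x) (Jo y) (Jv x y v)"
  then obtain h where h: "\<And>n. h n \<in> arr (ob (Jo x) n) (ob (Jo y) (n - 1))"
    "\<And>n. Jv x y v n = dd (Jo y) (n - 1) * h n + h (n + 1) * dd (Jo x) n"
    unfolding htp_def by blast
  have "h 0 \<in> arr (sB x) (sA y)" using h(1)[of 0] by (simp add: ob_Jo)
  moreover have "v = sd y * h 0" using h(2)[of 0] by (simp add: Jv_def dd_Jo x y)
  ultimately show "nullsq x y v" by (auto simp: nullsq_def)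
next
  assume "nullsq x y v"
  then obtain t where t: "t \<in> arr (sB x) (sA y)" "v = sd y * t" by (auto simp: nullsq_def)
  note u = nullsq_sqr(2)[OF x y t]
  show "htp (Jo x) (Jo y) (Jv x y v)"
  proof (rule htpI[of "\<lambda>n. if n = 0 then t else 0"])
    fix n :: int
    show "(if n = 0 then t else 0) \<in> arr (ob (Jo x) n) (ob (Jo y) (n - 1))"
      using t s_obj[OF x] s_obj[OF y] zob by (simp add: ob_Jo arr_0)
    show "Jv x y v n = dd (Jo y) (n - 1) * (if n = 0 then t else 0) + (if n + 1 = 0 then t else 0) * dd (Jo x) n"
      using t(2) u by (auto simp: Jv_def dd_Jo x y)
  qed
qed

text \<open>Defined on a class through a chosen representative; \<open>Jr_mu\<close> removes the
  choice. \<open>Hr\<close> follows the same pattern.\<close>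

definition Jr where
  "Jr x y a = kap (Jo x) (Jo y) (Jv x y (SOME v. sqr x y v \<and> a = mu x y v))"

lemma Jv_ops:
  assumes x: "x \<in> Obj M" and y: "y \<in> Obj M"
  shows "sqr x y v \<Longrightarrow> sqr x y v' \<Longrightarrow> Jv x y (v + v') = (\<lambda>n. Jv x y v n + Jv x y v' n)"
    and "sqr x y v \<Longrightarrow> sqr x y v' \<Longrightarrow> Jv x y (v - v') = (\<lambda>n. Jv x y v n - Jv x y v' n)"
    and "z \<in> Obj M \<Longrightarrow> sqr x y v \<Longrightarrow> sqr y z w \<Longrightarrow> Jv x z (w * v) = (\<lambda>n. Jv y z w n * Jv x y v n)"
  using uu_ops(1)[OF x y, of v v'] uu_ops(1)[OF x y, of v "- v'"] uu_ops(2)[OF x y, of v'] uu_ops(3)[OF x y, of z v w]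
  by (simp_all add: Jv_def fun_eq_iff)

lemma Jr_mu:
  assumes x: "x \<in> Obj M" and y: "y \<in> Obj M" and v: "sqr x y v"
  shows "Jr x y (mu x y v) = kap (Jo x) (Jo y) (Jv x y v)"
proof -
  define w where "w = (SOME w. sqr x y w \<and> mu x y v = mu x y w)"
  have w: "sqr x y w" "mu x y v = mu x y w"
    using someI[of "\<lambda>w. sqr x y w \<and> mu x y v = mu x y w" v] v unfolding w_def by blast+
  then have "nullsq x y (w - v)" using mu_eq_iff[OF x y w(1) v] by simp
  then have "htp (Jo x) (Jo y) (\<lambda>n. Jv x y w n - Jv x y v n)"
    using htp_Jv[OF x y mm_diff(1)[OF x y w(1) v]] Jv_ops(2)[OF x y w(1) v] by simp
  then show ?thesis
    unfolding Jr_def w_def[symmetric]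
    using kap_eq_iff[OF Jo_complex[OF x] Jo_complex[OF y] Jv_cmap[OF x y w(1)] Jv_cmap[OF x y v]] by blast
qed

lemma rfunctor_J: "rfunctor hM K Jo Jr"
proof (unfold_locales; (simp only: Obj_hM)?)
  fix x assume x: "x \<in> Obj M"
  then show "Jo x \<in> Obj K" by (simp add: Jo_complex)
  have "Jv x x (ide (sB x)) n = ide (ob (Jo x) n)" for n
    using uu_ops(5)[OF x x] zob by (simp add: Jv_def ob_Jo)
  then have "kap (Jo x) (Jo x) (Jv x x (ide (sB x))) = K.ide (Jo x)"
    using kap_ide[OF Jo_complex[OF x] Jo_complex[OF x]] by presburger
  then show "Jr x x (hM.ide x) = K.ide (Jo x)"
    using Jr_mu[OF x x conjunct1[OF uu_ops(5)[OF x x]]] mu_ops(3)[OF x x] by simp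
next
  fix x y a assume x: "x \<in> Obj M" and y: "y \<in> Obj M" and "a \<in> hM.hom x y"
  then obtain v where v: "sqr x y v" "a = mu x y v" using hM_homE by blast
  then show "Jr x y a \<in> K.hom (Jo x) (Jo y)"
    using kap_in[OF Jo_complex[OF x] Jo_complex[OF y] Jv_cmap[OF x y v(1)]] by (simp add: Jr_mu x y)
next
  fix x y z a b assume x: "x \<in> Obj M" and y: "y \<in> Obj M" and z: "z \<in> Obj M" and "a \<in> hM.hom x y" "b \<in> hM.hom y z"
  then obtain v w where v: "sqr x y v" "a = mu x y v" "sqr y z w" "b = mu y z w" using hM_homE by metis
  have "b * a = mu x z (w * v)" using mu_ops(2)[OF x y z] v by simp
  then show "Jr x z (b * a) = Jr y z b * Jr x y a"
    using v Jr_mu[OF x z] Jr_mu[OF y z] Jr_mu[OF x y] uu_ops(3)[OF x y z v(1,3)] Jv_ops(3)[OF x y z v(1,3)]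
      kap_mult[OF Jo_complex[OF x] Jo_complex[OF y] Jo_complex[OF z] Jv_cmap[OF x y v(1)] Jv_cmap[OF y z v(3)]] by simp
next
  fix x y a b assume x: "x \<in> Obj M" and y: "y \<in> Obj M" and "a \<in> hM.hom x y" "b \<in> hM.hom x y"
  then obtain v w where v: "sqr x y v" "a = mu x y v" "sqr x y w" "b = mu x y w" using hM_homE by metis
  have "a + b = mu x y (v + w)" using mu_ops(1)[OF x y] v by simp
  then show "Jr x y (a + b) = Jr x y a + Jr x y b"
    using v Jr_mu[OF x y] uu_ops(1)[OF x y v(1,3)] Jv_ops(1)[OF x y v(1,3)]
      kap_add[OF Jo_complex[OF x] Jo_complex[OF y] Jv_cmap[OF x y v(1)] Jv_cmap[OF x y v(3)]] by simp
qed

lemma bnd_0: "\<lbrakk>is_complex C X; W \<in> Obj C\<rbrakk> \<Longrightarrow> bnd X n W 0"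
  using bnd_global[of 0 W "ob X n" 0 X n] by (simp add: arr_0 ob_in)

text \<open>All cohomology of the two complexes sits in degree \<open>0\<close>, and there the
  clauses of \<open>bq\<close> give those of \<open>qis\<close>.\<close>

lemma Jv_qis:
  assumes b: "bq x y v"
  shows "qis (Jo x) (Jo y) (Jv x y v)"
  unfolding qis_def
proof (intro conjI allI impI)
  note B = bqD[OF b]
  show "is_complex C (Jo x)" "is_complex C (Jo y)" "cmap (Jo x) (Jo y) (Jv x y v)"
    using B Jo_complex Jv_cmap by blast+
  have z: "w = 0" if "cyc (Jo t) n W w" "n \<noteq> 0" "t \<in> Obj M" for t n W w
  proof (cases "n = - 1")
    case True
    then show ?thesis using that sd_mono[OF that(3)] unfolding rmono_def by (auto simp: cyc_def ob_Jo dd_Jo)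
  qed (use that zob_arr in \<open>auto simp: cyc_def ob_Jo\<close>)
  fix n W
  { fix w assume w: "cyc (Jo x) n W w" "bnd (Jo y) n W (Jv x y v n * w)"
    have W: "W \<in> Obj C" using cyc_arr[OF w(1)] arr_obj by blast
    show "bnd (Jo x) n W w"
    proof (cases "n = 0")
      case False
      then show ?thesis using z[OF w(1) _ B(1)] bnd_0[OF Jo_complex[OF B(1)] W] by simp
    next
      case True
      have wa: "w \<in> arr W (sB x)" using cyc_arr[OF w(1)] True by (simp add: ob_Jo)
      obtain W' e a' where a': "cover W' W e" "a' \<in> arr W' (sA y)" "v * w * e = sd y * a'"
        using bndE[OF w(2)] True by (auto simp: ob_Jo dd_Jo B Jv_def)
      obtain W'' e' a where a: "a \<in> arr W'' (sA x)" "cover W'' W' e'" "w * e * e' = sd x * a"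
        using bq_inj[OF b arr_mult[OF cover_arr[OF a'(1)] wa] a'(2)] a'(3) by (metis mult.assoc)
      show ?thesis
        using bnd_local[OF a'(1) bndI[OF a(2)]] a(1,3) True by (simp add: ob_Jo dd_Jo B)
    qed }
  fix w assume w: "cyc (Jo y) n W w"
  have W: "W \<in> Obj C" using cyc_arr[OF w] arr_obj by blast
  show "\<exists>W' e x' y'. cover W' W e \<and> cyc (Jo x) n W' x' \<and> y' \<in> arr W' (ob (Jo y) (n - 1)) \<and>
      w * e = Jv x y v n * x' + dd (Jo y) (n - 1) * y'"
  proof (cases "n = 0")
    case False
    have "cyc (Jo x) n W 0" using arr_0[OF W ob_in[OF Jo_complex[OF B(1)]]] by (simp add: cyc_def)
    then show ?thesis
      using z[OF w False B(2)] cover_ide[OF W] arr_0[OF W ob_in[OF Jo_complex[OF B(2)]]]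
      by (intro exI[of _ W] exI[of _ "ide W"] exI[of _ "0 :: ('a, 'b) endo"]) simp
  next
    case True
    have wa: "w \<in> arr W (sB y)" using cyc_arr[OF w] True by (simp add: ob_Jo)
    obtain W' e c a' where c: "c \<in> arr W' (sB x)" "a' \<in> arr W' (sA y)" "cover W' W e" "w * e = v * c + sd y * a'"
      using bq_surj[OF b wa] .
    then show ?thesis using True
      by (intro exI[of _ W'] exI[of _ e] exI[of _ c] exI[of _ a']) (simp add: cyc_def ob_Jo dd_Jo B Jv_def)
  qed
qed

text \<open>The degree zero data \<open>X\<^sup>-\<^sup>1 \<rightarrow> im d\<^sup>-\<^sup>1 \<rightarrow> ker d\<^sup>0 \<rightarrow> X\<^sup>0\<close> of a complex.\<close>

definition is_hdata where
  "is_hdata X = (\<lambda>(A, k, I, p, m). rker A (ob X 0) (ob X 1) k (dd X 0) \<and> cover (ob X (- 1)) I p \<and> rmono I A m \<and>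
    dd X (- 1) = k * (m * p))"

definition hd where "hd X = (SOME t. is_hdata X t)"

definition hK where "hK X = fst (hd X)"
definition hk where "hk X = fst (snd (hd X))"
definition hI where "hI X = fst (snd (snd (hd X)))"
definition hp where "hp X = fst (snd (snd (snd (hd X))))"
definition hm where "hm X = snd (snd (snd (snd (hd X))))"

lemma hdata:
  assumes X: "is_complex C X"
  shows "rker (hK X) (ob X 0) (ob X 1) (hk X) (dd X 0)" and hp: "cover (ob X (- 1)) (hI X) (hp X)"
    and hm: "rmono (hI X) (hK X) (hm X)" and hd_eq: "dd X (- 1) = hk X * (hm X * hp X)"
proof -
  have d: "dd X 0 \<in> arr (ob X 0) (ob X 1)" "dd X (- 1) \<in> arr (ob X (- 1)) (ob X 0)" "dd X 0 * dd X (- 1) = 0"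
    using dd_arr[OF X, of 0] dd_arr[OF X, of "- 1"] dd_dd[OF X, of "- 1"] by simp_all
  obtain A k where k: "rker A (ob X 0) (ob X 1) k (dd X 0)" using kernel_exists[OF d(1)] .
  then obtain c where c: "c \<in> arr (ob X (- 1)) A" "k * c = dd X (- 1)" using d(2,3) unfolding rker_def by blast
  \<comment> \<open>The image is taken of the corestriction to the kernel, so that \<open>I\<close>
    becomes a subobject of \<open>A\<close> and not merely of the object in degree
    \<open>0\<close>.\<close>
  obtain I p m where "cover (ob X (- 1)) I p" "rmono I A m" "c = m * p" using image[OF c(1)] .
  then have "is_hdata X (A, k, I, p, m)" using k c by (simp add: is_hdata_def)
  then have "is_hdata X (hd X)" unfolding hd_def by (rule someI)
  then show "rker (hK X) (ob X 0) (ob X 1) (hk X) (dd X 0)" "cover (ob X (- 1)) (hI X) (hp X)"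
    "rmono (hI X) (hK X) (hm X)" "dd X (- 1) = hk X * (hm X * hp X)"
    by (auto simp: is_hdata_def hK_def hk_def hI_def hp_def hm_def split_beta)
qed

lemma hk:
  assumes X: "is_complex C X"
  shows hk_mono: "rmono (hK X) (ob X 0) (hk X)" and hk_arr: "hk X \<in> arr (hK X) (ob X 0)"
    and hk_0: "dd X 0 * hk X = 0" and hm_arr: "hm X \<in> arr (hI X) (hK X)" and hp_arr: "hp X \<in> arr (ob X (- 1)) (hI X)"
  using hdata(1)[OF X] hm[OF X] hp[OF X] cover_arr by (auto simp: rker_def rmono_def)

lemma hk_lift:
  assumes "is_complex C X" "a \<in> arr W (ob X 0)" "dd X 0 * a = 0"
  obtains b where "b \<in> arr W (hK X)" "hk X * b = a"
  using hdata(1)[OF assms(1)] assms(2,3) unfolding rker_def by blast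

section \<open>The functor from complexes to monomorphisms\<close>

definition Ho where "Ho X = (hI X, hK X, unmor (hI X) (hK X) (hm X))"

lemma Ho:
  assumes "is_complex C X"
  shows "Ho X \<in> Obj M" "sA (Ho X) = hI X" "sB (Ho X) = hK X" "sd (Ho X) = hm X"
  using mk_Obj_M[OF hm[OF assms]] by (simp_all add: Ho_def)

definition Hv where
  "Hv X Y \<phi> = (SOME v. v \<in> arr (hK X) (hK Y) \<and> hk Y * v = \<phi> 0 * hk X)"

text \<open>That the map induced on kernels respects the images is an instance of orthogonality:
  \<open>hp Y * \<phi> (- 1)\<close> descends along the cover \<open>hp X\<close> because
  \<open>hm Y\<close> is monic.\<close>

lemma Hv:
  assumes X: "is_complex C X" and Y: "is_complex C Y" and c: "cmap X Y \<phi>"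
  shows Hv_arr: "Hv X Y \<phi> \<in> arr (hK X) (hK Y)" and Hv_eq: "hk Y * Hv X Y \<phi> = \<phi> 0 * hk X"
    and Hv_sqr: "sqr (Ho X) (Ho Y) (Hv X Y \<phi>)"
    and Hv_uu: "uu (Ho X) (Ho Y) (Hv X Y \<phi>) * hp X = hp Y * \<phi> (- 1)"
proof -
  have "dd Y 0 * (\<phi> 0 * hk X) = 0"
    using cmap_comm[OF c, of 0] hk_0[OF X] by (simp add: mult.assoc[symmetric]) (metis mult.assoc mult_zero_right)
  then have "\<exists>v. v \<in> arr (hK X) (hK Y) \<and> hk Y * v = \<phi> 0 * hk X"
    using hk_lift[OF Y arr_mult[OF hk_arr[OF X] cmap_arr[OF c]]] by blast
  from someI_ex[OF this] have v: "Hv X Y \<phi> \<in> arr (hK X) (hK Y) \<and> hk Y * Hv X Y \<phi> = \<phi> 0 * hk X"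
    by (simp add: Hv_def)
  then show v1: "Hv X Y \<phi> \<in> arr (hK X) (hK Y)" and v2: "hk Y * Hv X Y \<phi> = \<phi> 0 * hk X" by blast+
  note k = hk_arr[OF X] hk_arr[OF Y] and m = hm_arr[OF X] hm_arr[OF Y] and p = hp_arr[OF X] hp_arr[OF Y]
  have pf: "hp Y * \<phi> (- 1) \<in> arr (ob X (- 1)) (hI Y)" using arr_mult[OF cmap_arr[OF c] p(2)] .
  have "hk Y * (Hv X Y \<phi> * hm X * hp X) = \<phi> 0 * (hk X * (hm X * hp X))" using v2 by (simp add: mult.assoc[symmetric])
  also have "\<dots> = dd Y (- 1) * \<phi> (- 1)" using cmap_comm[OF c, of "- 1"] by (simp add: hd_eq[OF X, symmetric])
  also have "\<dots> = hk Y * (hm Y * (hp Y * \<phi> (- 1)))" by (simp add: hd_eq[OF Y] mult.assoc)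
  finally have eq: "hm Y * (hp Y * \<phi> (- 1)) = Hv X Y \<phi> * hm X * hp X"
    using rmono_cancel[OF hk_mono[OF Y] arr_mult[OF p(1) arr_mult[OF m(1) v1]] arr_mult[OF pf m(2)]] by simp
  obtain u where u: "u \<in> arr (hI X) (hI Y)" "u * hp X = hp Y * \<phi> (- 1)" "hm Y * u = Hv X Y \<phi> * hm X"
    using cover_lift[OF hp[OF X] hm[OF Y] pf arr_mult[OF m(1) v1] eq] .
  show s: "sqr (Ho X) (Ho Y) (Hv X Y \<phi>)"
    using sqrI[of "Hv X Y \<phi>" "Ho X" "Ho Y" u] v1 u by (simp add: Ho X Y)
  have "uu (Ho X) (Ho Y) (Hv X Y \<phi>) = u"
    using uu_unique[OF Ho(1)[OF Y] s, of u] u by (simp add: Ho X Y)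
  then show "uu (Ho X) (Ho Y) (Hv X Y \<phi>) * hp X = hp Y * \<phi> (- 1)" using u by simp
qed

lemma Hv_unique:
  assumes "is_complex C X" "is_complex C Y" "cmap X Y \<phi>" "v \<in> arr (hK X) (hK Y)" "hk Y * v = \<phi> 0 * hk X"
  shows "Hv X Y \<phi> = v"
  using rmono_cancel[OF hk_mono Hv_arr] Hv_eq assms by metis

text \<open>On the kernel of the differential the homotopy formula leaves only
  \<open>d * h 0\<close>, which passes through the image in degree \<open>0\<close>; the resulting
  map into \<open>hI Y\<close> is the homotopy of squares.\<close>

lemma Hv_htp:
  assumes X: "is_complex C X" and Y: "is_complex C Y" and h: "htp X Y \<phi>"
  shows "nullsq (Ho X) (Ho Y) (Hv X Y \<phi>)"
proof -
  obtain h where h': "\<And>n. h n \<in> arr (ob X n) (ob Y (n - 1))" "\<And>n. \<phi> n = dd Y (n - 1) * h n + h (n + 1) * dd X n"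
    using h unfolding htp_def by blast
  have h0: "h 0 \<in> arr (ob X 0) (ob Y (- 1))" using h'(1)[of 0] by simp
  have t: "hp Y * (h 0 * hk X) \<in> arr (hK X) (hI Y)"
    using arr_mult[OF arr_mult[OF hk_arr[OF X] h0] hp_arr[OF Y]] .
  have "\<phi> 0 * hk X = dd Y (- 1) * h 0 * hk X" using h'(2)[of 0] hk_0[OF X] by (simp add: distrib_right mult.assoc)
  then have "Hv X Y \<phi> = hm Y * (hp Y * (h 0 * hk X))"
    using arr_mult[OF t hm_arr[OF Y]] by (intro Hv_unique X Y htp_cmap[OF X Y h]) (simp_all add: hd_eq[OF Y] mult.assoc)
  then show ?thesis unfolding nullsq_def using t by (auto simp: Ho X Y)
qed

lemma Hv_ops:
  assumes X: "is_complex C X" and Y: "is_complex C Y" and c: "cmap X Y \<phi>"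
  shows "cmap X Y \<psi> \<Longrightarrow> Hv X Y (\<lambda>n. \<phi> n + \<psi> n) = Hv X Y \<phi> + Hv X Y \<psi>"
    and "cmap X Y \<psi> \<Longrightarrow> Hv X Y (\<lambda>n. \<phi> n - \<psi> n) = Hv X Y \<phi> - Hv X Y \<psi>"
    and "is_complex C Z \<Longrightarrow> cmap Y Z \<chi> \<Longrightarrow> Hv X Z (\<lambda>n. \<chi> n * \<phi> n) = Hv Y Z \<chi> * Hv X Y \<phi>"
    and "Hv X X (\<lambda>n. ide (ob X n)) = ide (hK X)"
proof -
  note V = Hv[OF X Y c]
  { assume d: "cmap X Y \<psi>"
    note W = Hv[OF X Y d]
    show "Hv X Y (\<lambda>n. \<phi> n + \<psi> n) = Hv X Y \<phi> + Hv X Y \<psi>"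
      using V W by (intro Hv_unique X Y cmap_add c d arr_add) (simp_all add: distrib_left distrib_right)
    show "Hv X Y (\<lambda>n. \<phi> n - \<psi> n) = Hv X Y \<phi> - Hv X Y \<psi>"
      using V W by (intro Hv_unique X Y cmap_diff c d arr_diff) (simp_all add: right_diff_distrib left_diff_distrib) }
  { assume Z: "is_complex C Z" and d: "cmap Y Z \<chi>"
    note W = Hv[OF Y Z d]
    have "hk Z * (Hv Y Z \<chi> * Hv X Y \<phi>) = \<chi> 0 * (hk Y * Hv X Y \<phi>)" using W(2) by (simp add: mult.assoc[symmetric])
    then show "Hv X Z (\<lambda>n. \<chi> n * \<phi> n) = Hv Y Z \<chi> * Hv X Y \<phi>"
      using V by (intro Hv_unique X Z cmap_comp[OF c d] arr_mult[OF V(1) W(1)]) (simp add: mult.assoc) }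
  show "Hv X X (\<lambda>n. ide (ob X n)) = ide (hK X)"
    using arr_obj[OF hk_arr[OF X]] arr_ide_left[OF hk_arr[OF X]] arr_ide_right[OF hk_arr[OF X]]
    by (intro Hv_unique X cmap_ide[OF X]) (simp_all add: arr_ide)
qed

definition Hr where
  "Hr X Y a = mu (Ho X) (Ho Y) (Hv X Y (SOME \<phi>. cmap X Y \<phi> \<and> a = kap X Y \<phi>))"

lemma Hr_kap:
  assumes X: "is_complex C X" and Y: "is_complex C Y" and c: "cmap X Y \<phi>"
  shows "Hr X Y (kap X Y \<phi>) = mu (Ho X) (Ho Y) (Hv X Y \<phi>)"
proof -
  define \<psi> where "\<psi> = (SOME \<psi>. cmap X Y \<psi> \<and> kap X Y \<phi> = kap X Y \<psi>)"
  have w: "cmap X Y \<psi>" "kap X Y \<phi> = kap X Y \<psi>"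
    using someI[of "\<lambda>\<psi>. cmap X Y \<psi> \<and> kap X Y \<phi> = kap X Y \<psi>" \<phi>] c unfolding \<psi>_def by blast+
  then have "htp X Y (\<lambda>n. \<psi> n - \<phi> n)" using kap_eq_iff[OF X Y w(1) c] by simp
  then have "nullsq (Ho X) (Ho Y) (Hv X Y \<psi> - Hv X Y \<phi>)"
    using Hv_htp[OF X Y] Hv_ops(2)[OF X Y w(1) c] by metis
  then show ?thesis
    unfolding Hr_def \<psi>_def[symmetric]
    using mu_eq_iff[OF Ho(1)[OF X] Ho(1)[OF Y] Hv_sqr[OF X Y w(1)] Hv_sqr[OF X Y c]] by blast
qed

lemma rfunctor_H: "rfunctor K hM Ho Hr"
proof (unfold_locales; (simp only: Obj_K mem_Collect_eq)?)
  fix X assume X: "is_complex C X"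
  then show "Ho X \<in> Obj hM" by (simp add: Ho)
  show "Hr X X (K.ide X) = hM.ide (Ho X)"
    using Hr_kap[OF X X cmap_ide[OF X]] Hv_ops(4)[OF X X cmap_ide[OF X]] mu_ops(3)[OF Ho(1)[OF X] Ho(1)[OF X]]
    by (simp add: kap_ide[OF X X, symmetric] X Ho)
next
  fix X Y a assume X: "is_complex C X" and Y: "is_complex C Y" and "a \<in> K.hom X Y"
  then obtain \<phi> where p: "cmap X Y \<phi>" "a = kap X Y \<phi>" using K_homE by blast
  then show "Hr X Y a \<in> hM.hom (Ho X) (Ho Y)"
    using mu_in[OF Ho(1)[OF X] Ho(1)[OF Y] Hv_sqr[OF X Y p(1)]] by (simp add: Hr_kap X Y)
next
  fix X Y Z a b assume X: "is_complex C X" and Y: "is_complex C Y" and Z: "is_complex C Z" and "a \<in> K.hom X Y" "b \<in> K.hom Y Z"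
  then obtain \<phi> \<psi> where p: "cmap X Y \<phi>" "a = kap X Y \<phi>" "cmap Y Z \<psi>" "b = kap Y Z \<psi>" using K_homE by metis
  have "b * a = kap X Z (\<lambda>n. \<psi> n * \<phi> n)" using kap_mult[OF X Y Z] p by simp
  then show "Hr X Z (b * a) = Hr Y Z b * Hr X Y a"
    using p Hr_kap[OF X Z cmap_comp[OF p(1,3)]] Hr_kap[OF Y Z] Hr_kap[OF X Y] Hv_ops(3)[OF X Y p(1) Z p(3)]
      mu_ops(2)[OF Ho(1)[OF X] Ho(1)[OF Y] Ho(1)[OF Z] Hv_sqr[OF X Y p(1)] Hv_sqr[OF Y Z p(3)]] by simp
next
  fix X Y a b assume X: "is_complex C X" and Y: "is_complex C Y" and "a \<in> K.hom X Y" "b \<in> K.hom X Y"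
  then obtain \<phi> \<psi> where p: "cmap X Y \<phi>" "a = kap X Y \<phi>" "cmap X Y \<psi>" "b = kap X Y \<psi>" using K_homE by metis
  have "a + b = kap X Y (\<lambda>n. \<phi> n + \<psi> n)" using kap_add[OF X Y] p by simp
  then show "Hr X Y (a + b) = Hr X Y a + Hr X Y b"
    using p Hr_kap[OF X Y cmap_add[OF p(1,3)]] Hr_kap[OF X Y] Hv_ops(1)[OF X Y p(1,3)]
      mu_ops(1)[OF Ho(1)[OF X] Ho(1)[OF Y] Hv_sqr[OF X Y p(1)] Hv_sqr[OF X Y p(3)]] by simp
qed

text \<open>Elements of \<open>hK X\<close> are the cycles in degree \<open>0\<close>, and elements
  of \<open>hI X\<close> are, after a cover, the boundaries. The clauses of \<open>qis\<close> in
  degree \<open>0\<close> thereby turn into those of \<open>bq\<close>.\<close>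

lemma Hv_bq:
  assumes q: "qis X Y \<phi>"
  shows "bq (Ho X) (Ho Y) (Hv X Y \<phi>)"
proof (rule bqI)
  note X = qisD(1)[OF q] and Y = qisD(2)[OF q] and c = qisD(3)[OF q]
  note V = Hv[OF X Y c]
  show "Ho X \<in> Obj M" "Ho Y \<in> Obj M" "sqr (Ho X) (Ho Y) (Hv X Y \<phi>)" using Ho X Y V by blast+
  have bnd_m: "\<exists>W' e. \<exists>a\<in>arr W' (hI Z). cover W' W e \<and> b * e = hm Z * a"
    if Z: "is_complex C Z" and b: "b \<in> arr W (hK Z)" "bnd Z 0 W (hk Z * b)" for Z W b
  proof -
    obtain W' e y where y: "cover W' W e" "y \<in> arr W' (ob Z (- 1))" "hk Z * b * e = dd Z (- 1) * y"
      using bndE[OF b(2)] by auto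
    have py: "hp Z * y \<in> arr W' (hI Z)" using arr_mult[OF y(2) hp_arr[OF Z]] .
    have "hk Z * (b * e) = hk Z * (hm Z * (hp Z * y))" using y(3) by (simp add: hd_eq[OF Z] mult.assoc)
    then have "b * e = hm Z * (hp Z * y)"
      using rmono_cancel[OF hk_mono[OF Z] arr_mult[OF cover_arr[OF y(1)] b(1)] arr_mult[OF py hm_arr[OF Z]]] by blast
    then show ?thesis using y(1) py by blast
  qed
  have m_bnd: "\<exists>W' e. \<exists>y\<in>arr W' (ob Z (- 1)). cover W' W e \<and> hk Z * (hm Z * a) * e = dd Z (- 1) * y"
    if Z: "is_complex C Z" and a: "a \<in> arr W (hI Z)" for Z W a
  proof -
    obtain W' e y where y: "cover W' W e" "y \<in> arr W' (ob Z (- 1))" "hp Z * y = a * e"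
      using cover_pullback[OF hp[OF Z] a] by metis
    have "hk Z * (hm Z * a) * e = dd Z (- 1) * y" using y(3) by (simp add: hd_eq[OF Z] mult.assoc)
    then show ?thesis using y by blast
  qed
  fix W
  { fix b a' assume b: "b \<in> arr W (sB (Ho X))" "a' \<in> arr W (sA (Ho Y))" "Hv X Y \<phi> * b = sd (Ho Y) * a'"
    then have b': "b \<in> arr W (hK X)" "a' \<in> arr W (hI Y)" "Hv X Y \<phi> * b = hm Y * a'" by (simp_all add: Ho X Y)
    obtain W' e y where y: "y \<in> arr W' (ob Y (- 1))" "cover W' W e" "hk Y * (hm Y * a') * e = dd Y (- 1) * y"
      using m_bnd[OF Y b'(2)] by blast
    have "\<phi> 0 * (hk X * b) = hk Y * (Hv X Y \<phi> * b)" using V(2) by (simp add: mult.assoc[symmetric])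
    then have "\<phi> 0 * (hk X * b) = hk Y * (hm Y * a')" using b'(3) by simp
    then have "bnd Y 0 W (\<phi> 0 * (hk X * b))" using bndI[OF y(2), of y Y 0] y(1,3) by simp
    moreover have "cyc X 0 W (hk X * b)"
      using arr_mult[OF b'(1) hk_arr[OF X]] hk_0[OF X] by (simp add: cyc_def mult.assoc[symmetric])
    ultimately have "bnd X 0 W (hk X * b)" using qis_inj[OF q] by blast
    then show "\<exists>W' e. \<exists>a\<in>arr W' (sA (Ho X)). cover W' W e \<and> b * e = sd (Ho X) * a"
      using bnd_m[OF X b'(1)] by (simp add: Ho X) }
  fix b' assume "b' \<in> arr W (sB (Ho Y))"
  then have b': "b' \<in> arr W (hK Y)" by (simp add: Ho Y)
  have "cyc Y 0 W (hk Y * b')"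
    using arr_mult[OF b' hk_arr[OF Y]] hk_0[OF Y] by (simp add: cyc_def mult.assoc[symmetric])
  then obtain W' e x y where x: "cover W' W e" "cyc X 0 W' x" "y \<in> arr W' (ob Y (0 - 1))"
    "hk Y * b' * e = \<phi> 0 * x + dd Y (0 - 1) * y" by (rule qis_surj[OF q])
  obtain c' where c': "c' \<in> arr W' (hK X)" "hk X * c' = x" using hk_lift[OF X, of x W'] x(2) by (auto simp: cyc_def)
  have y: "hp Y * y \<in> arr W' (hI Y)" using arr_mult[OF _ hp_arr[OF Y]] x(3) by simp
  have "hk Y * (b' * e) = hk Y * (Hv X Y \<phi> * c' + hm Y * (hp Y * y))"
    using x(4) by (simp add: c'(2)[symmetric] hd_eq[OF Y] distrib_left mult.assoc[symmetric] V(2))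
  then have "b' * e = Hv X Y \<phi> * c' + hm Y * (hp Y * y)"
    using rmono_cancel[OF hk_mono[OF Y] arr_mult[OF cover_arr[OF x(1)] b']
        arr_add[OF arr_mult[OF c'(1) V(1)] arr_mult[OF y hm_arr[OF Y]]]] by blast
  then show "\<exists>W' e. \<exists>b\<in>arr W' (sB (Ho X)). \<exists>a'\<in>arr W' (sA (Ho Y)). cover W' W e \<and> b' * e = Hv X Y \<phi> * b + sd (Ho Y) * a'"
    using x(1) c'(1) y by (auto simp: Ho X Y)
qed

text \<open>
  The chosen kernel \<open>hk (Jo x)\<close> of the zero map in degree \<open>0\<close> is only an isomorphism, so \<open>Ho (Jo x)\<close> is not \<open>x\<close>.
\<close>

definition eta where "eta x = (SOME v. v \<in> arr (sB x) (hK (Jo x)) \<and> hk (Jo x) * v = ide (sB x))"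

lemma eta:
  assumes x: "x \<in> Obj M"
  shows eta_eq: "hk (Jo x) * eta x = ide (sB x)" and eta_eq': "eta x * hk (Jo x) = ide (hK (Jo x))"
    and eta_bq: "bq x (Ho (Jo x)) (eta x)" and eta_bq': "bq (Ho (Jo x)) x (hk (Jo x))"
proof -
  let ?X = "Jo x"
  note X = Jo_complex[OF x]
  have o: "ob ?X 0 = sB x" "ob ?X (- 1) = sA x" "dd ?X 0 = 0" "dd ?X (- 1) = sd x" by (simp_all add: ob_Jo dd_Jo x)
  note k = hk_arr[OF X, unfolded o] and km = hk_mono[OF X, unfolded o] and m = hm_arr[OF X]
    and p = hp_arr[OF X, unfolded o] and pc = hp[OF X, unfolded o] and d = hd_eq[OF X, unfolded o]
  have "\<exists>v. v \<in> arr (sB x) (hK ?X) \<and> hk ?X * v = ide (sB x)"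
    using hk_lift[OF X, unfolded o, OF arr_ide[OF s_obj(2)[OF x]]] by auto
  from someI_ex[OF this] have e: "eta x \<in> arr (sB x) (hK ?X) \<and> hk ?X * eta x = ide (sB x)"
    by (simp add: eta_def)
  then show eq: "hk ?X * eta x = ide (sB x)" by blast
  have "hk ?X * (eta x * hk ?X) = hk ?X * ide (hK ?X)"
    using e arr_ide_left[OF k] arr_ide_right[OF k] by (simp add: mult.assoc[symmetric])
  then show eq': "eta x * hk ?X = ide (hK ?X)"
    using rmono_cancel[OF km arr_mult[OF k conjunct1[OF e]] arr_ide[OF arr_obj(1)[OF k]]] by blast
  have "eta x * (hk ?X * (hm ?X * hp ?X)) = hm ?X * hp ?X"
    using eq' arr_ide_left[OF arr_mult[OF p m]] by (simp add: mult.assoc[symmetric])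
  then have s: "sqr x (Ho ?X) (eta x)"
    using sqrI[of "eta x" x "Ho ?X" "hp ?X"] e p by (simp add: Ho X d)
  \<comment> \<open>The inverse also respects the subobjects: \<open>hp\<close> is a cover and
    \<open>sd x\<close> is monic, so \<open>hk * hm\<close> factors through
    \<open>sd x\<close>.\<close>
  obtain u where u: "u \<in> arr (hI ?X) (sA x)" "sd x * u = hk ?X * hm ?X"
    using cover_lift[OF pc sd_mono[OF x] arr_ide[OF s_obj(1)[OF x]] arr_mult[OF m k]] arr_ide_right[OF sd_arr[OF x]] d
    by (metis mult.assoc)
  have s': "sqr (Ho ?X) x (hk ?X)" using sqrI[of "hk ?X" "Ho ?X" x u] k u by (simp add: Ho X)
  show "bq x (Ho ?X) (eta x)" "bq (Ho ?X) x (hk ?X)"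
    using bq_iso[OF x Ho(1)[OF X] s s'] bq_iso[OF Ho(1)[OF X] x s' s] eq eq' by (simp_all add: Ho X)
qed

text \<open>Both sides become \<open>v\<close> after composition with the monomorphism
  \<open>hk (Jo y)\<close>.\<close>

lemma eta_natural:
  assumes x: "x \<in> Obj M" and y: "y \<in> Obj M" and v: "sqr x y v"
  shows "eta y * v = Hv (Jo x) (Jo y) (Jv x y v) * eta x"
proof -
  note X = Jo_complex[OF x] and Y = Jo_complex[OF y]
  note c = Jv_cmap[OF x y v]
  have ex: "eta x \<in> arr (sB x) (hK (Jo x))" "eta y \<in> arr (sB y) (hK (Jo y))"
    using sqr_arr[OF bqD(3)[OF eta_bq[OF x]]] sqr_arr[OF bqD(3)[OF eta_bq[OF y]]] by (simp_all add: Ho X Y)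
  have "hk (Jo y) * (eta y * v) = v" using eta_eq[OF y] arr_ide_left[OF sqr_arr[OF v]] by (simp add: mult.assoc[symmetric])
  moreover have "hk (Jo y) * (Hv (Jo x) (Jo y) (Jv x y v) * eta x) = v * (hk (Jo x) * eta x)"
    using Hv_eq[OF X Y c] by (simp add: mult.assoc[symmetric] Jv_def)
  ultimately show ?thesis
    using rmono_cancel[OF hk_mono[OF Y] arr_mult[OF sqr_arr[OF v] ex(2)], of "Hv (Jo x) (Jo y) (Jv x y v) * eta x"]
      arr_mult[OF ex(1) Hv_arr[OF X Y c]] eta_eq[OF x] arr_ide_right[OF sqr_arr[OF v]] by simp
qed

section \<open>The unit, and the transfer of the calculus of fractions to monomorphisms\<close>

lemma mu_eta:
  assumes x: "x \<in> Obj M"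
  shows mu_eta_S: "mu x (Ho (Jo x)) (eta x) \<in> mor hM x (Ho (Jo x)) ` S x (Ho (Jo x))"
    "mu (Ho (Jo x)) x (hk (Jo x)) \<in> mor hM (Ho (Jo x)) x ` S (Ho (Jo x)) x"
    and mu_eta_in: "mu x (Ho (Jo x)) (eta x) \<in> hM.hom x (Ho (Jo x))" "mu (Ho (Jo x)) x (hk (Jo x)) \<in> hM.hom (Ho (Jo x)) x"
    and mu_eta_inv: "mu (Ho (Jo x)) x (hk (Jo x)) * mu x (Ho (Jo x)) (eta x) = hM.ide x"
    "mu x (Ho (Jo x)) (eta x) * mu (Ho (Jo x)) x (hk (Jo x)) = hM.ide (Ho (Jo x))"
proof -
  note b = eta_bq[OF x] eta_bq'[OF x] and H = Ho[OF Jo_complex[OF x]]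
  note eb = bqD(3)[OF b(1)] and eb' = bqD(3)[OF b(2)]
  show "mu x (Ho (Jo x)) (eta x) \<in> mor hM x (Ho (Jo x)) ` S x (Ho (Jo x))"
    "mu (Ho (Jo x)) x (hk (Jo x)) \<in> mor hM (Ho (Jo x)) x ` S (Ho (Jo x)) x"
    using mor_S[OF x H(1)] mor_S[OF H(1) x] b by blast+
  show "mu x (Ho (Jo x)) (eta x) \<in> hM.hom x (Ho (Jo x))" "mu (Ho (Jo x)) x (hk (Jo x)) \<in> hM.hom (Ho (Jo x)) x"
    using mu_in[OF x H(1) eb] mu_in[OF H(1) x eb'] .
  show "mu (Ho (Jo x)) x (hk (Jo x)) * mu x (Ho (Jo x)) (eta x) = hM.ide x"
    using mu_ops(2)[OF x H(1) x eb eb'] mu_ops(3)[OF x x] eta_eq[OF x] by simp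
  show "mu x (Ho (Jo x)) (eta x) * mu (Ho (Jo x)) x (hk (Jo x)) = hM.ide (Ho (Jo x))"
    using mu_ops(2)[OF H(1) x H(1) eb' eb] mu_ops(3)[OF H(1) H(1)] eta_eq'[OF x] by (simp add: H)
qed

lemma mu_eta_natural:
  assumes x: "x \<in> Obj M" and y: "y \<in> Obj M" and a: "a \<in> hM.hom x y"
  shows "mu y (Ho (Jo y)) (eta y) * a = Hr (Jo x) (Jo y) (Jr x y a) * mu x (Ho (Jo x)) (eta x)"
proof -
  obtain v where v: "sqr x y v" "a = mu x y v" using hM_homE a x y by blast
  note X = Jo_complex[OF x] and Y = Jo_complex[OF y] and c = Jv_cmap[OF x y v(1)]
  have "Hr (Jo x) (Jo y) (Jr x y a) = mu (Ho (Jo x)) (Ho (Jo y)) (Hv (Jo x) (Jo y) (Jv x y v))"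
    using Jr_mu[OF x y v(1)] Hr_kap[OF X Y c] v(2) by simp
  then show ?thesis
    using mu_ops(2)[OF x y Ho(1)[OF Y] v(1) bqD(3)[OF eta_bq[OF y]]] eta_natural[OF x y v(1)] v(2)
      mu_ops(2)[OF x Ho(1)[OF X] Ho(1)[OF Y] bqD(3)[OF eta_bq[OF x]] Hv_sqr[OF X Y c]] by simp
qed

end

sublocale additive_regular_category \<subseteq> KT: mult_system "homotopy_category C"
    "cone_in C (thick_closure C (acyclic_complex C))"
  by (intro mult_system.intro K.preadditive_category_axioms multiplicative_KS)

context additive_regular_category
begin

lemma multiplicative_S: "multiplicative_system hM S"
proof (rule multiplicative_system_transfer[OF KT.mult_system_axioms rfunctor_J rfunctor_H,
      of S "\<lambda>x. mu x (Ho (Jo x)) (eta x)" "\<lambda>x. mu (Ho (Jo x)) x (hk (Jo x))"])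
  have muS: "mu x y v \<in> mor hM x y ` S x y" if "bq x y v" for x y v
    using mor_S[OF bqD(1,2)[OF that]] that by blast
  have SE: "\<exists>v. bq x y v \<and> s = mu x y v" if "s \<in> mor hM x y ` S x y" "x \<in> Obj hM" "y \<in> Obj hM" for x y s
    using that mor_S[of x y] by auto
  fix x y assume xy: "x \<in> Obj hM" "y \<in> Obj hM"
  then have x: "x \<in> Obj M" and y: "y \<in> Obj M" by simp_all
  show "S x y \<subseteq> Hom hM x y" by (auto simp: S_iff)
  show "mu x (Ho (Jo x)) (eta x) \<in> mor hM x (Ho (Jo x)) ` S x (Ho (Jo x))"
    "mu (Ho (Jo x)) x (hk (Jo x)) \<in> mor hM (Ho (Jo x)) x ` S (Ho (Jo x)) x"
    "mu (Ho (Jo x)) x (hk (Jo x)) * mu x (Ho (Jo x)) (eta x) = hM.ide x"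
    "mu x (Ho (Jo x)) (eta x) * mu (Ho (Jo x)) x (hk (Jo x)) = hM.ide (Ho (Jo x))"
    "\<And>a. a \<in> hM.hom x y \<Longrightarrow> mu y (Ho (Jo y)) (eta y) * a = Hr (Jo x) (Jo y) (Jr x y a) * mu x (Ho (Jo x)) (eta x)"
    using mu_eta[OF x] mu_eta_natural[OF x y] by blast+
  { fix s assume "s \<in> mor hM x y ` S x y"
    then obtain v where v: "bq x y v" "s = mu x y v" using SE xy by blast
    then show "Jr x y s \<in> mor K (Jo x) (Jo y) ` KS (Jo x) (Jo y)"
      using kap_in_KS[OF Jv_qis[OF v(1)]] Jr_mu[OF x y bqD(3)[OF v(1)]] by simp
    fix z t assume z: "z \<in> Obj hM" "t \<in> mor hM y z ` S y z"
    then obtain w where w: "bq y z w" "t = mu y z w" using SE xy by blast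
    have "t * s = mu x z (w * v)" using mu_ops(2)[OF x y _ bqD(3)[OF v(1)] bqD(3)[OF w(1)]] z v w by simp
    then show "t * s \<in> mor hM x z ` S x z" using muS[OF bq_comp[OF v(1) w(1)]] by simp }
next
  fix X Y s assume XY: "X \<in> Obj K" "Y \<in> Obj K" "s \<in> mor K X Y ` KS X Y"
  then obtain \<phi> where p: "qis X Y \<phi>" "s = kap X Y \<phi>" using mor_KS[of X Y] by auto
  then show "Hr X Y s \<in> mor hM (Ho X) (Ho Y) ` S (Ho X) (Ho Y)"
    using Hr_kap[OF qisD(1-3)[OF p(1)]] mor_S[OF bqD(1,2)[OF Hv_bq[OF p(1)]]] Hv_bq[OF p(1)] by simp
qed

end

sublocale additive_regular_category \<subseteq> ST: mult_system "hMon C" "bicartesian C"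
  by (intro mult_system.intro hM.preadditive_category_axioms multiplicative_S)

section \<open>Truncations and the left heart\<close>

context additive_regular_category
begin

definition exact_at where
  "exact_at X n \<longleftrightarrow> (\<forall>W x. cyc X n W x \<longrightarrow> bnd X n W x)"

lemma exact_atD: "\<lbrakk>exact_at X n; cyc X n W x\<rbrakk> \<Longrightarrow> bnd X n W x"
  unfolding exact_at_def by blast

lemma exact_iff: "exact_cpx X \<longleftrightarrow> is_complex C X \<and> (\<forall>n. exact_at X n)"
  unfolding exact_cpx_def exact_at_def by blast

lemma exact_at_0:
  assumes "is_complex C X" "\<And>W x. cyc X n W x \<Longrightarrow> x = 0"
  shows "exact_at X n"
  unfolding exact_at_def using assms bnd_0 cyc_arr arr_obj by metis

lemma exact_at_cong:
  assumes "ob T n = ob X n" "ob T (n - 1) = ob X (n - 1)" "dd T (n - 1) = dd X (n - 1)"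
    "\<And>W x. x \<in> arr W (ob X n) \<Longrightarrow> dd T n * x = 0 \<longleftrightarrow> dd X n * x = 0"
  shows "exact_at T n \<longleftrightarrow> exact_at X n"
  unfolding exact_at_def cyc_def bnd_def assms(1-3) using assms(4) by blast

definition is_tle where
  "is_tle N X T k \<longleftrightarrow> is_complex C T \<and> rker (ob T N) (ob X N) (ob X (N + 1)) k (dd X N) \<and>
    dd X (N - 1) = k * dd T (N - 1) \<and> (\<forall>m<N. ob T m = ob X m) \<and> (\<forall>m<N - 1. dd T m = dd X m) \<and>
    (\<forall>m>N. ide (ob T m) = 0)"

lemma trunc_le_tle:
  assumes X: "is_complex C X" and t: "trunc_le C N X T"
  shows "\<exists>k. is_tle N X T k"
proof -
  have T: "is_complex C T" using t by (simp add: trunc_le_def)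
  obtain i where i: "is_kernel C (ob T N) (ob X N) (ob X (N + 1)) i (df X N)"
    "df X (N - 1) = Cmp C (ob X (N - 1)) (ob T N) (ob X N) i (df T (N - 1))" and
    o: "\<And>m. m < N \<Longrightarrow> ob T m = ob X m" and d: "\<And>m. m < N - 1 \<Longrightarrow> df T m = df X m"
    and z: "\<And>m. m > N \<Longrightarrow> zero_obj C (ob T m)"
    using t unfolding trunc_le_def by blast
  have iH: "i \<in> Hom C (ob T N) (ob X N)" using i(1) by (simp add: is_kernel_def)
  have "rker (ob T N) (ob X N) (ob X (N + 1)) (mor C (ob T N) (ob X N) i) (dd X N)"
    using i(1) is_kernel_iff[of "ob T N" "ob X N" "ob X (N + 1)" i "df X N"] iH ob_in[OF X] ob_in[OF T] df_in[OF X]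
    by (simp add: dd_def)
  moreover have "dd X (N - 1) = mor C (ob T N) (ob X N) i * dd T (N - 1)"
    using arg_cong[OF i(2), of "mor C (ob X (N - 1)) (ob X N)"] iH ob_in[OF X] ob_in[OF T] df_in[OF T, of "N - 1"] o[of "N - 1"]
    by (simp add: dd_def mor_Cmp)
  moreover have "dd T m = dd X m" if "m < N - 1" for m using that o d by (simp add: dd_def)
  ultimately have "is_tle N X T (mor C (ob T N) (ob X N) i)"
    unfolding is_tle_def using T o z by (simp add: zero_obj_iff)
  then show ?thesis by blast
qed

text \<open>Below degree \<open>N\<close> the two complexes differ only in the differential into
  degree \<open>N\<close>, which is corestricted along a monomorphism and so has the same cycles;
  above \<open>N\<close> there are only zero objects.\<close>

lemma tle_exact_at:
  assumes t: "is_tle N X T k"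
  shows "n < N \<Longrightarrow> exact_at T n \<longleftrightarrow> exact_at X n" and "n > N \<Longrightarrow> exact_at T n"
proof -
  have T: "is_complex C T" and km: "rmono (ob T N) (ob X N) k" and
    d: "dd X (N - 1) = k * dd T (N - 1)" and o: "\<And>m. m < N \<Longrightarrow> ob T m = ob X m" and
    d': "\<And>m. m < N - 1 \<Longrightarrow> dd T m = dd X m" and z: "\<And>m. m > N \<Longrightarrow> ide (ob T m) = 0"
    using t unfolding is_tle_def rker_def by blast+
  have d1: "dd T (N - 1) \<in> arr (ob X (N - 1)) (ob T N)" using dd_arr'[OF T, of N] o by simp
  show "exact_at T n" if "n > N"
    using exact_at_0[OF T] arr_to_zero[OF z[OF that]] cyc_arr by metis
  show "exact_at T n \<longleftrightarrow> exact_at X n" if n: "n < N"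
  proof (rule exact_at_cong)
    show "ob T n = ob X n" "ob T (n - 1) = ob X (n - 1)" "dd T (n - 1) = dd X (n - 1)" using n o d' by simp_all
    fix W x assume x: "x \<in> arr W (ob X n)"
    show "dd T n * x = 0 \<longleftrightarrow> dd X n * x = 0"
    proof (cases "n = N - 1")
      case True
      then have "dd T n * x \<in> arr W (ob T N)" using arr_mult[OF _ d1] x by simp
      then show ?thesis using km d True unfolding rmono_def by (auto simp: mult.assoc)
    qed (use n d' in simp)
  qed
qed

text \<open>In degree \<open>N\<close> the cycles of \<open>X\<close> are the elements of the kernel
  placed there, and boundaries correspond because \<open>k\<close> is monic. So truncation keeps
  cohomology in degrees up to \<open>N\<close> and removes the rest.\<close>

lemma tle_exact:
  assumes X: "is_complex C X" and t: "is_tle N X T k"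
  shows "exact_cpx T \<longleftrightarrow> (\<forall>n\<le>N. exact_at X n)"
proof -
  have T: "is_complex C T" and kr: "rker (ob T N) (ob X N) (ob X (N + 1)) k (dd X N)" and
    d: "dd X (N - 1) = k * dd T (N - 1)" and o: "\<And>m. m < N \<Longrightarrow> ob T m = ob X m" and
    d': "\<And>m. m < N - 1 \<Longrightarrow> dd T m = dd X m" and z: "\<And>m. m > N \<Longrightarrow> ide (ob T m) = 0"
    using t unfolding is_tle_def by blast+
  have km: "rmono (ob T N) (ob X N) k" "dd X N * k = 0" using kr by (simp_all add: rker_def)
  then have ka: "k \<in> arr (ob T N) (ob X N)" by (simp add: rmono_def)
  have dN: "dd T N = 0" using arr_to_zero[OF z[of "N + 1"] dd_arr[OF T]] by simp
  have d1: "dd T (N - 1) \<in> arr (ob X (N - 1)) (ob T N)" using dd_arr'[OF T, of N] o by simp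
  note lt = tle_exact_at(1)[OF t] and gt = tle_exact_at(2)[OF t]
  have eqN: "exact_at T N \<longleftrightarrow> exact_at X N"
  proof
    assume e: "exact_at T N"
    show "exact_at X N" unfolding exact_at_def
    proof (intro allI impI)
      fix W x assume x: "cyc X N W x"
      then obtain h where h: "h \<in> arr W (ob T N)" "k * h = x" using kr unfolding cyc_def rker_def by blast
      have "cyc T N W h" using h by (simp add: cyc_def dN)
      then obtain W' e y where y: "cover W' W e" "y \<in> arr W' (ob T (N - 1))" "h * e = dd T (N - 1) * y"
        using exact_atD[OF e] bndE by metis
      have "x * e = dd X (N - 1) * y" using y(3) by (simp add: h(2)[symmetric] d mult.assoc)
      then show "bnd X N W x" using bndI[OF y(1)] y(2) o by simp
    qed
  next
    assume e: "exact_at X N"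
    show "exact_at T N" unfolding exact_at_def
    proof (intro allI impI)
      fix W h assume "cyc T N W h"
      then have h: "h \<in> arr W (ob T N)" by (rule cyc_arr)
      have "cyc X N W (k * h)" using arr_mult[OF h ka] km(2) by (simp add: cyc_def mult.assoc[symmetric])
      then obtain W' e y where y: "cover W' W e" "y \<in> arr W' (ob X (N - 1))" "k * h * e = dd X (N - 1) * y"
        using exact_atD[OF e] bndE by metis
      have "k * (h * e) = k * (dd T (N - 1) * y)" using y(3) by (simp add: d mult.assoc)
      then have "h * e = dd T (N - 1) * y"
        using rmono_cancel[OF km(1) arr_mult[OF cover_arr[OF y(1)] h] arr_mult[OF y(2) d1]] by blast
      then show "bnd T N W h" using bndI[OF y(1)] y(2) o by simp
    qed
  qed
  show ?thesis
    unfolding exact_iff using T gt lt eqN by (metis linorder_less_linear order.order_iff_strict)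
qed

text \<open>Built around a kernel supplied from outside, so that one construction gives the
  truncations in general and, with the chosen kernel \<open>hK X\<close>, the complex
  \<open>tX X\<close>.\<close>

definition tau where
  "tau N A c X = mk_cpx (\<lambda>n. if n < N then ob X n else if n = N then A else zob)
    (\<lambda>n. if n < N - 1 then dd X n else if n = N - 1 then c else 0)"

lemma tau:
  assumes X: "is_complex C X" and kr: "rker A (ob X N) (ob X (N + 1)) k (dd X N)"
    and c: "c \<in> arr (ob X (N - 1)) A" "dd X (N - 1) = k * c"
  shows tau_complex: "is_complex C (tau N A c X)"
    and ob_tau: "ob (tau N A c X) n = (if n < N then ob X n else if n = N then A else zob)"
    and dd_tau: "dd (tau N A c X) n = (if n < N - 1 then dd X n else if n = N - 1 then c else 0)"
    and tau_tle: "is_tle N X (tau N A c X) k"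
    and tau_trunc: "trunc_le C N X (tau N A c X)"
proof -
  have km: "rmono A (ob X N) k" using kr by (simp add: rker_def)
  then have ka: "k \<in> arr A (ob X N)" by (simp add: rmono_def)
  have A: "A \<in> Obj C" using ka arr_obj by blast
  let ?o = "\<lambda>n. if n < N then ob X n else if n = N then A else zob"
  let ?d = "\<lambda>n. if n < N - 1 then dd X n else if n = N - 1 then c else 0"
  have d: "?d n \<in> arr (?o n) (?o (n + 1))" for n
    using dd_arr[OF X, of n] c(1) A zob ob_in[OF X] by (auto simp: arr_0)
  have cd: "c * dd X (N - 1 - 1) = 0"
  proof -
    have "k * (c * dd X (N - 1 - 1)) = 0" using dd_dd'[OF X, of "N - 1"] by (simp add: c(2) mult.assoc)
    then show ?thesis using km arr_mult[OF dd_arr'[OF X, of "N - 1"] c(1)] unfolding rmono_def by blast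
  qed
  have dd0: "?d (n + 1) * ?d n = 0" for n
  proof -
    consider "n + 1 < N - 1" | "n = N - 1 - 1" | "n \<ge> N - 1" by linarith
    then show ?thesis using dd_dd[OF X, of n] cd by cases auto
  qed
  show T: "is_complex C (tau N A c X)" unfolding tau_def by (rule is_complex_mk[of ?d ?o, OF d dd0])
  show on: "ob (tau N A c X) n = ?o n" for n by (simp add: tau_def)
  show dn: "dd (tau N A c X) n = ?d n" for n unfolding tau_def by (rule dd_mk[of ?d n ?o, OF d])
  show tle: "is_tle N X (tau N A c X) k"
    unfolding is_tle_def using T kr c(2) zob(2) by (simp add: on dn)
  have "df (tau N A c X) m = df X m" if "m < N - 1" for m
    using that df_in[OF X, of m] ob_in[OF X] dn[of m] unmor_mor[of "ob X m" "ob X (m + 1)" "df (tau N A c X) m"] df_in[OF T, of m]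
    by (simp add: on dd_def)
  moreover have "df X (N - 1) = Cmp C (ob X (N - 1)) A (ob X N) (unmor A (ob X N) k) (df (tau N A c X) (N - 1))"
    using df_in[OF T, of "N - 1"] df_in[OF X, of "N - 1"] ob_in[OF X] A dn[of "N - 1"] c(2) ka
    by (intro iffD1[OF mor_inject[of "ob X (N - 1)" "ob X N"]])
      (simp_all add: on dd_def mor_Cmp Cmp_in arr_iff unmor_in)
  moreover have "is_kernel C A (ob X N) (ob X (N + 1)) (unmor A (ob X N) k) (df X N)"
    using rker_is_kernel[OF kr] df_in[OF X] ob_in[OF X] by (simp add: dd_def)
  ultimately show "trunc_le C N X (tau N A c X)"
    unfolding trunc_le_def using T zob by (auto simp: on zero_obj_iff)
qed

lemma ex_trunc_le:
  assumes X: "is_complex C X"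
  obtains T where "trunc_le C N X T"
proof -
  obtain A k where k: "rker A (ob X N) (ob X (N + 1)) k (dd X N)" using kernel_exists[OF dd_arr[OF X]] .
  obtain c where "c \<in> arr (ob X (N - 1)) A" "k * c = dd X (N - 1)"
    using k dd_arr'[OF X, of N] dd_dd'[OF X, of N] unfolding rker_def by blast
  then show ?thesis using that tau_trunc[OF X k] by metis
qed

text \<open>The kernel in degree \<open>N - 1\<close> accounts for all cycles of degree
  \<open>N\<close> and, its inclusion being monic, has no non-zero cycles itself. The truncation is
  therefore exact in degrees up to \<open>N\<close>, and its vanishing is a condition above
  \<open>N\<close> only.\<close>

lemma trunc_ge_exact:
  assumes X: "is_complex C X" and t: "trunc_ge_Suc C N X T"
  shows "exact_cpx T \<longleftrightarrow> (\<forall>n>N. exact_at X n)"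
proof -
  have T: "is_complex C T" and k: "is_kernel C (ob T (N - 1)) (ob X N) (ob X (N + 1)) (df T (N - 1)) (df X N)" and
    o: "\<And>m. m \<ge> N \<Longrightarrow> ob T m = ob X m \<and> df T m = df X m" and z: "\<And>m. m < N - 1 \<Longrightarrow> zero_obj C (ob T m)"
    using t unfolding trunc_ge_Suc_def by blast+
  have d: "dd T m = dd X m" if "m \<ge> N" for m using that o by (simp add: dd_def)
  have kr: "rker (ob T (N - 1)) (ob X N) (ob X (N + 1)) (dd T (N - 1)) (dd X N)"
    using k is_kernel_iff[of "ob T (N - 1)" "ob X N" "ob X (N + 1)" "df T (N - 1)" "df X N"] df_in[OF T, of "N - 1"]
      df_in[OF X] ob_in[OF X] ob_in[OF T] o[of N] by (simp add: dd_def)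
  have lt: "exact_at T n" if "n < N - 1" for n
    using exact_at_0[OF T] z[OF that] arr_to_zero cyc_arr by (metis zero_obj_iff)
  have m1: "exact_at T (N - 1)"
    using exact_at_0[OF T, of "N - 1"] kr unfolding rker_def rmono_def cyc_def by blast
  have eN: "exact_at T N" unfolding exact_at_def
  proof (intro allI impI)
    fix W x assume "cyc T N W x"
    then have x: "x \<in> arr W (ob X N)" "dd X N * x = 0" using o d by (simp_all add: cyc_def)
    then obtain h where "h \<in> arr W (ob T (N - 1))" "dd T (N - 1) * h = x" using kr unfolding rker_def by blast
    then show "bnd T N W x" using bnd_global[OF x(1)] by blast
  qed
  have gt: "exact_at T n \<longleftrightarrow> exact_at X n" if "n > N" for n
    using that o d by (intro exact_at_cong) simp_all
  have all: "n < N - 1 \<or> n = N - 1 \<or> n = N \<or> n > N" for n by linarith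
  show ?thesis
    unfolding exact_iff using T lt m1 eN gt all by metis
qed

lemma ex_trunc_ge:
  assumes X: "is_complex C X"
  obtains T where "trunc_ge_Suc C N X T"
proof -
  obtain A k where k: "rker A (ob X N) (ob X (N + 1)) k (dd X N)" using kernel_exists[OF dd_arr[OF X]] .
  have ka: "k \<in> arr A (ob X N)" "dd X N * k = 0" using k by (simp_all add: rker_def rmono_def)
  have A: "A \<in> Obj C" using ka arr_obj by blast
  let ?o = "\<lambda>n. if n \<ge> N then ob X n else if n = N - 1 then A else zob"
  let ?d = "\<lambda>n. if n \<ge> N then dd X n else if n = N - 1 then k else 0"
  let ?T = "mk_cpx ?o ?d"
  have d: "?d n \<in> arr (?o n) (?o (n + 1))" for n
    using dd_arr[OF X, of n] ka A zob ob_in[OF X] by (auto simp: arr_0)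
  have dd0: "?d (n + 1) * ?d n = 0" for n
  proof -
    consider "n \<ge> N" | "n = N - 1" | "n < N - 1" by linarith
    then show ?thesis using dd_dd[OF X, of n] ka(2) by cases auto
  qed
  have T: "is_complex C ?T" by (rule is_complex_mk[of ?d ?o, OF d dd0])
  have df: "df ?T n = df X n" if "n \<ge> N" for n
    using that df_in[OF X, of n] ob_in[OF X] by (simp add: mk_cpx_def dd_def)
  have "df ?T (N - 1) = unmor A (ob X N) k" by (simp add: mk_cpx_def)
  then have "is_kernel C A (ob X N) (ob X (N + 1)) (df ?T (N - 1)) (df X N)"
    using rker_is_kernel[OF k] df_in[OF X] ob_in[OF X] by (simp add: dd_def)
  then have "trunc_ge_Suc C N X ?T"
    unfolding trunc_ge_Suc_def using T df zob by (auto simp: zero_obj_iff)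
  then show ?thesis using that by blast
qed

section \<open>Zero objects of the derived category and the heart\<close>

abbreviation "DC \<equiv> localization K KS"

lemma derived_eq: "derived_category C = DC"
  by (simp add: derived_category_def verdier_quotient_def)

lemma KT_SS: "\<lbrakk>is_complex C X; is_complex C Y\<rbrakk> \<Longrightarrow> KT.SS X Y = kap X Y ` {\<phi>. qis X Y \<phi>}"
  unfolding KT.SS_def by (rule mor_KS)

text \<open>If the identity of \<open>X\<close> becomes zero in the localization, some
  quasi-isomorphism into \<open>X\<close> is null-homotopic, and its surjectivity exhibits every
  cycle as a boundary. Conversely the zero endomorphism of an exact complex is a quasi-isomorphism,
  and it equalizes the identity and zero.\<close>

lemma exact_zero_derived:
  assumes X: "is_complex C X"
  shows "is_zero_in_derived C X \<longleftrightarrow> exact_cpx X"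
proof
  assume "is_zero_in_derived C X"
  then obtain Z f g where Z: "zero_obj DC Z" "X \<in> Obj DC" "Z \<in> Obj DC" "f \<in> Hom DC X Z" "g \<in> Hom DC Z X"
    "Cmp DC X Z X g f = Idn DC X"
    unfolding is_zero_in_derived_def derived_eq iso_obj_def is_iso_def by blast
  have z: "KT.L.ide Z = 0" using Z(1) KT.L.zero_obj_iff by blast
  have "mor DC X Z f = KT.L.ide Z * mor DC X Z f" using Z KT.L.mor_in[OF Z(4)] by simp
  then have "mor DC X Z f = 0" using z by simp
  then have "KT.L.ide X = 0"
    using KT.L.mor_Cmp[OF Z(2,3,2,4,5)] unfolding KT.L.ide_def Z(6) by simp
  then have "KT.loc X X (K.ide X) = KT.loc X X 0"
    using KT.loc.F_ide[of X] KT.loc.F_0[of X X] X by simp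
  then obtain W t where W: "W \<in> Obj K" "t \<in> KT.SS W X" "K.ide X * t = 0 * t"
    using KT.loc_eq_iff[of X X "K.ide X" 0] X by auto
  then obtain \<phi> where p: "qis W X \<phi>" "t = kap W X \<phi>" using KT_SS[of W X] X by auto
  note Q = qisD[OF p(1)]
  have "t = 0" using W(3) p(2) kap_in[OF Q(1-3)] Q(1) X by simp
  then have ht: "htp W X (\<lambda>n. \<phi> n - 0)" using kap_eq_0_iff[OF Q(1-3)] p(2) by simp
  obtain k where k: "\<And>n. k n \<in> arr (ob W n) (ob X (n - 1))"
    "\<And>n V x. cyc W n V x \<Longrightarrow> \<phi> n * x = 0 * x + dd X (n - 1) * (k n * x)" by (rule htp_cyc[OF ht]) blast
  show "exact_cpx X" unfolding exact_cpx_def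
  proof (intro conjI allI impI X)
    fix n V z assume "cyc X n V z"
    then obtain V' e x y where x: "cover V' V e" "cyc W n V' x" "y \<in> arr V' (ob X (n - 1))"
      "z * e = \<phi> n * x + dd X (n - 1) * y" by (rule qis_surj[OF p(1)])
    have "z * e = dd X (n - 1) * (k n * x + y)" using x(4) k(2)[OF x(2)] by (simp add: distrib_left)
    then show "bnd X n V z"
      using bndI[OF x(1) arr_add[OF arr_mult[OF cyc_arr[OF x(2)] k(1)] x(3)]] by blast
  qed
next
  assume e: "exact_cpx X"
  have "kap X X (\<lambda>n. 0) \<in> KT.SS X X" using KT_SS[OF X X] exact_qis_0[OF e e cmap_0[OF X X]] by blast
  then have "0 \<in> KT.SS X X" "K.ide X * 0 = 0 * 0" using kap_0[OF X X] by simp_all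
  then have "KT.loc X X (K.ide X) = KT.loc X X 0"
    using KT.loc_eq_iff[of X X "K.ide X" 0] X K.ide_in[of X] K.hom_0[of X X] by (metis Obj_K mem_Collect_eq)
  then have "KT.L.ide X = 0" using KT.loc.F_ide[of X] KT.loc.F_0[of X X] X by simp
  then have "zero_obj DC X" using KT.L.zero_obj_iff X by simp
  moreover have "is_iso DC X X (Idn DC X)"
    using KT.L.is_iso_unmor[OF _ _ KT.L.riso_ide[of X]] X KT.L.unmor_Idn[of X] by simp
  then have "iso_obj DC X X" unfolding iso_obj_def using X by auto
  ultimately show "is_zero_in_derived C X" unfolding is_zero_in_derived_def derived_eq by blast
qed

definition heart where
  "heart X \<longleftrightarrow> is_complex C X \<and> (\<forall>n. n \<noteq> 0 \<longrightarrow> exact_at X n)"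

lemma heartD: "heart X \<Longrightarrow> is_complex C X" "\<lbrakk>heart X; n \<noteq> 0\<rbrakk> \<Longrightarrow> exact_at X n"
  by (simp_all add: heart_def)

lemma D_le_0_iff: "D_le_0 C X \<longleftrightarrow> is_complex C X \<and> (\<forall>n>0. exact_at X n)"
proof -
  have "(\<exists>T. trunc_ge_Suc C 0 X T \<and> is_zero_in_derived C T) \<longleftrightarrow> (\<forall>n>0. exact_at X n)" if X: "is_complex C X"
    using trunc_ge_exact[OF X] ex_trunc_ge[OF X] exact_zero_derived trunc_ge_Suc_def by metis
  then show ?thesis by (auto simp: D_le_0_def)
qed

lemma D_ge_0_iff: "D_ge_0 C X \<longleftrightarrow> is_complex C X \<and> (\<forall>n<0. exact_at X n)"
proof -
  have "n \<le> - 1 \<longleftrightarrow> n < (0::int)" for n by linarith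
  then have "exact_cpx T \<longleftrightarrow> (\<forall>n<0. exact_at X n)" if "is_complex C X" "trunc_le C (- 1) X T" for T
    using trunc_le_tle[OF that] tle_exact[OF that(1)] by metis
  then have "(\<exists>T. trunc_le C (- 1) X T \<and> is_zero_in_derived C T) \<longleftrightarrow> (\<forall>n<0. exact_at X n)" if X: "is_complex C X"
    using X ex_trunc_le[OF X] exact_zero_derived trunc_le_def by metis
  then show ?thesis by (auto simp: D_ge_0_def)
qed

lemma left_heart_eq: "left_heart C = full_subcategory DC heart"
proof -
  have "(D_le_0 C X \<and> D_ge_0 C X) = heart X" for X
    unfolding D_le_0_iff D_ge_0_iff heart_def by (metis linorder_neqE less_irrefl)
  then show ?thesis by (simp add: left_heart_def derived_eq)
qed

lemma heart_Jo:
  assumes x: "x \<in> Obj M"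
  shows "heart (Jo x)"
  unfolding heart_def
proof (intro conjI allI impI Jo_complex[OF x] exact_at_0)
  fix n W w assume n: "n \<noteq> 0" and w: "cyc (Jo x) n W w"
  show "w = 0"
  proof (cases "n = - 1")
    case True
    then show ?thesis using w sd_mono[OF x] unfolding rmono_def by (auto simp: cyc_def ob_Jo dd_Jo x)
  qed (use n w zob_arr in \<open>auto simp: cyc_def ob_Jo\<close>)
qed

text \<open>Injectivity on cohomology reflects exactness in each degree. Consequently the vertex of
  a roof between objects of the heart lies in the heart.\<close>

lemma heart_qis:
  assumes q: "qis U X \<phi>" and h: "heart X"
  shows "heart U"
  unfolding heart_def exact_at_def
proof (intro conjI allI impI qisD(1)[OF q])
  fix n W x assume "n \<noteq> 0" and x: "cyc U n W x"
  then show "bnd U n W x"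
    using qis_inj[OF q x] exact_atD[OF heartD(2)[OF h] cyc_map[OF qisD(3)[OF q] x]] by blast
qed

text \<open>The covers over which \<open>x\<close> and \<open>y\<close> bound are refined to a
  common one by pulling one back along the other.\<close>

lemma bnd_plus:
  assumes "bnd X n W x" "bnd X n W y"
  shows "bnd X n W (x + y)"
proof -
  obtain V e u where u: "cover V W e" "u \<in> arr V (ob X (n - 1))" "x * e = dd X (n - 1) * u" using assms(1) by (rule bndE)
  obtain V' e' v where v: "cover V' W e'" "v \<in> arr V' (ob X (n - 1))" "y * e' = dd X (n - 1) * v" using assms(2) by (rule bndE)
  obtain P d d' where p: "cover P V d" "d' \<in> arr P V'" "e' * d' = e * d" using cover_pullback[OF v(1) cover_arr[OF u(1)]] by metis
  have "(x + y) * (e * d) = x * e * d + y * (e' * d')" by (simp add: p(3) distrib_right mult.assoc)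
  also have "\<dots> = dd X (n - 1) * (u * d + v * d')" using u(3) v(3) by (simp add: mult.assoc[symmetric] distrib_left)
  finally show ?thesis
    using bndI[OF cover_comp[OF u(1) p(1)] arr_add[OF arr_mult[OF cover_arr[OF p(1)] u(2)] arr_mult[OF p(2) v(2)]]] by blast
qed

text \<open>A twisted sum with \<open>\<phi> = 0\<close>. Exactness is recorded degree by degree so
  that biproducts of objects of the heart are seen to stay in it.\<close>

lemma K_biprod:
  assumes X: "is_complex C X" and Y: "is_complex C Y"
  obtains B i j p q where "K.rbiprod X Y B i j p q" "\<And>n. exact_at X n \<Longrightarrow> exact_at Y n \<Longrightarrow> exact_at B n"
proof -
  obtain B i j p q where e: "is_ext X Y (\<lambda>n. 0) B i j p q"
    by (rule ext_exists[OF X Y, of "\<lambda>n. 0"]) (simp_all add: arr_0 ob_in X Y)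
  note E = is_extD[OF e] and B = is_extD(3)[OF e]
  note R = rbiprodD[OF E(4)]
  have c: "cmap X B i" "cmap Y B j" "cmap B X p" "cmap B Y q"
    using R E(6-9) by (auto intro!: cmapI)
  have "K.rbiprod X Y B (kap X B i) (kap Y B j) (kap B X p) (kap B Y q)"
    unfolding K.rbiprod_def
  proof (intro conjI)
    show "kap B X p * kap X B i = K.ide X" "kap B Y q * kap Y B j = K.ide Y"
      "kap B X p * kap Y B j = 0" "kap B Y q * kap X B i = 0"
      using R(5-8) by (simp_all add: kap_mult[symmetric] X Y B c kap_ide[OF X X, symmetric] kap_ide[OF Y Y, symmetric] kap_0)
    have "kap B B (\<lambda>n. i n * p n + j n * q n) = K.ide B"
      using R(9) kap_ide[OF B B] by simp
    then show "kap X B i * kap B X p + kap Y B j * kap B Y q = K.ide B"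
      using kap_add[OF B B cmap_comp[OF c(3,1)] cmap_comp[OF c(4,2)]]
        kap_mult[OF B X B c(3,1)] kap_mult[OF B Y B c(4,2)] by simp
  qed (use X Y B c kap_in in auto)
  moreover have "exact_at B n" if x: "exact_at X n" "exact_at Y n" for n
    unfolding exact_at_def
  proof (intro allI impI)
    fix W w assume w: "cyc B n W w"
    have "bnd B n W (i n * (p n * w))" "bnd B n W (j n * (q n * w))"
      using bnd_map c exact_atD[OF x(1) cyc_map[OF c(3) w]] exact_atD[OF x(2) cyc_map[OF c(4) w]] by blast+
    then show "bnd B n W w" using bnd_plus rbiprod_elem(5)[OF E(4) cyc_arr[OF w]] by metis
  qed
  ultimately show ?thesis using that by blast
qed

definition zcpx where "zcpx = mk_cpx (\<lambda>n. zob) (\<lambda>n. 0)"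

lemma zcpx: "is_complex C zcpx" "ob zcpx n = zob" "K.ide zcpx = 0" "heart zcpx"
proof -
  show z: "is_complex C zcpx" unfolding zcpx_def by (rule is_complex_mk) (simp_all add: arr_0 zob)
  show o: "ob zcpx n = zob" for n by (simp add: zcpx_def)
  show "K.ide zcpx = 0" using kap_ide[OF z z] kap_0[OF z z] by (simp add: o zob)
  show "heart zcpx" unfolding heart_def
    using z exact_at_0[OF z] zob_arr cyc_arr o by metis
qed

text \<open>The zero object and the biproducts come from complexes: \<open>H\<close> preserves their
  equations, and the biproduct of \<open>Ho (Jo x)\<close> and \<open>Ho (Jo y)\<close> is
  transported along the unit.\<close>

lemma additive_hM: "additive_category hM"
proof -
  interpret H: rfunctor K hM Ho Hr by (rule rfunctor_H)
  show ?thesis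
  proof (rule hM.additive_categoryI[of "Ho zcpx"])
    show "Ho zcpx \<in> Obj hM" "hM.ide (Ho zcpx) = 0"
      using H.F_ide[of zcpx] H.F_0[of zcpx zcpx] zcpx Ho(1)[OF zcpx(1)] by simp_all
    fix x y assume "x \<in> Obj hM" "y \<in> Obj hM"
    then have x: "x \<in> Obj M" and y: "y \<in> Obj M" by simp_all
    note X = Jo_complex[OF x] and Y = Jo_complex[OF y]
    obtain B i j p q where "K.rbiprod (Jo x) (Jo y) B i j p q" by (rule K_biprod[OF X Y])
    then have b: "hM.rbiprod (Ho (Jo x)) (Ho (Jo y)) (Ho B) (Hr (Jo x) B i) (Hr (Jo y) B j) (Hr B (Jo x) p) (Hr B (Jo y) q)"
      by (rule H.F_biprod)
    show "\<exists>B i j p q. hM.rbiprod x y B i j p q"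
      using hM.rbiprod_iso[OF b _ _ mu_eta_in[OF x] mu_eta_inv[OF x] mu_eta_in[OF y] mu_eta_inv[OF y]] x y by (metis Obj_hM)
  qed
qed

section \<open>The equivalence\<close>

lemma rmono_ide: "A \<in> Obj C \<Longrightarrow> rmono A A (ide A)"
  unfolding rmono_def using arr_ide[of A] arr_ide_left[where Y = A] by metis

text \<open>A criterion to be applied degree by degree: either both cohomologies vanish, or cycles
  lift strictly, over \<open>W\<close> itself, and only boundaries remain to be compared.\<close>

lemma qisI:
  assumes X: "is_complex C X" and Y: "is_complex C Y" and c: "cmap X Y \<phi>"
    and E: "\<And>n. (exact_at X n \<and> exact_at Y n) \<or>
      (\<forall>W x. cyc X n W x \<longrightarrow> bnd Y n W (\<phi> n * x) \<longrightarrow> bnd X n W x) \<and>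
      (\<forall>W z. cyc Y n W z \<longrightarrow> (\<exists>x. cyc X n W x \<and> z = \<phi> n * x))"
  shows "qis X Y \<phi>"
  unfolding qis_def
proof (intro conjI allI impI X Y c)
  fix n W
  show "bnd X n W x" if "cyc X n W x" "bnd Y n W (\<phi> n * x)" for x
    using E[of n] that exact_atD by blast
  fix z assume z: "cyc Y n W z"
  have W: "W \<in> Obj C" using cyc_arr[OF z] arr_obj by blast
  show "\<exists>W' e x y. cover W' W e \<and> cyc X n W' x \<and> y \<in> arr W' (ob Y (n - 1)) \<and>
      z * e = \<phi> n * x + dd Y (n - 1) * y"
  proof (cases "exact_at X n \<and> exact_at Y n")
    case True
    then obtain W' e y where y: "cover W' W e" "y \<in> arr W' (ob Y (n - 1))" "z * e = dd Y (n - 1) * y"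
      using exact_atD[OF _ z] bndE by metis
    have "W' \<in> Obj C" using y(2) arr_obj by blast
    then have "cyc X n W' 0" by (simp add: cyc_def arr_0 ob_in X)
    then show ?thesis
      using y by (intro exI[of _ W'] exI[of _ e] exI[of _ 0] exI[of _ y]) simp
  next
    case False
    then obtain x where x: "cyc X n W x" "z = \<phi> n * x" using E[of n] z by blast
    then show ?thesis
      using cover_ide[OF W] arr_0[OF W ob_in[OF Y]] arr_ide_right[OF cyc_arr[OF z]]
      by (intro exI[of _ W] exI[of _ "ide W"] exI[of _ x] exI[of _ "0 :: ('a, 'b) endo"]) simp
  qed
qed

text \<open>
  The counit at \<open>X\<close> in the left heart is the roof \<open>X \<leftarrow> \<tau>\<^sup>\<le>\<^sup>0 X \<rightarrow> Jo (Ho X)\<close>, whose legs \<open>tinc\<close> and \<open>tproj\<close> are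
  quasi-isomorphisms because \<open>X\<close> is exact in positive and in negative degrees, respectively.
\<close>

definition tX where "tX X = tau 0 (hK X) (hm X * hp X) X"

lemma tX:
  assumes X: "is_complex C X"
  shows tX_complex: "is_complex C (tX X)"
    and ob_tX: "ob (tX X) n = (if n < 0 then ob X n else if n = 0 then hK X else zob)"
    and dd_tX: "dd (tX X) n = (if n < - 1 then dd X n else if n = - 1 then hm X * hp X else 0)"
    and tX_exact: "n < 0 \<Longrightarrow> exact_at (tX X) n \<longleftrightarrow> exact_at X n" "n > 0 \<Longrightarrow> exact_at (tX X) n"
proof -
  have h: "rker (hK X) (ob X 0) (ob X (0 + 1)) (hk X) (dd X 0)"
    "hm X * hp X \<in> arr (ob X (0 - 1)) (hK X)" "dd X (0 - 1) = hk X * (hm X * hp X)"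
    using hdata(1)[OF X] arr_mult[OF hp_arr[OF X] hm_arr[OF X]] hd_eq[OF X] by simp_all
  note t = tau[OF X h, folded tX_def]
  show "is_complex C (tX X)" by (rule t)
  show "ob (tX X) n = (if n < 0 then ob X n else if n = 0 then hK X else zob)" by (rule t)
  show "dd (tX X) n = (if n < - 1 then dd X n else if n = - 1 then hm X * hp X else 0)" using t(3)[of n] by simp
  show "n < 0 \<Longrightarrow> exact_at (tX X) n \<longleftrightarrow> exact_at X n" "n > 0 \<Longrightarrow> exact_at (tX X) n"
    by (rule tle_exact_at[OF t(4)]; assumption)+
qed

text \<open>This is what makes \<open>tproj\<close> a chain map at degree \<open>-2\<close>, where
  the target has a zero object.\<close>

lemma hp_dd:
  assumes X: "is_complex C X"
  shows "hp X * dd X (- 2) = 0"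
proof -
  have a: "dd X (- 2) \<in> arr (ob X (- 2)) (ob X (- 1))" using dd_arr[OF X, of "- 2"] by simp
  have "hk X * (hm X * (hp X * dd X (- 2))) = 0" using dd_dd[OF X, of "- 2"] by (simp add: hd_eq[OF X] mult.assoc)
  then have "hm X * (hp X * dd X (- 2)) = 0"
    using hk_mono[OF X] arr_mult[OF arr_mult[OF a hp_arr[OF X]] hm_arr[OF X]] unfolding rmono_def by blast
  then show ?thesis using hm[OF X] arr_mult[OF a hp_arr[OF X]] unfolding rmono_def by blast
qed

definition tinc where
  "tinc X (n::int) = (if n < 0 then ide (ob X n) else if n = 0 then hk X else 0)"

definition tproj where
  "tproj X (n::int) = (if n = 0 then ide (hK X) else if n = - 1 then hp X else 0)"

lemma int_trichotomy: "(n::int) < - 1 \<or> n = - 1 \<or> n = 0 \<or> n > 0"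
  by linarith

lemma tinc_cmap:
  assumes X: "is_complex C X"
  shows "cmap (tX X) X (tinc X)"
proof (rule cmapI)
  fix n
  show "tinc X n \<in> arr (ob (tX X) n) (ob X n)"
    using arr_ide[OF ob_in[OF X]] hk_arr[OF X] arr_0[OF zob(1) ob_in[OF X]] by (simp add: tinc_def ob_tX[OF X])
  show "tinc X (n + 1) * dd (tX X) n = dd X n * tinc X n"
    using int_trichotomy[of n] arr_ide_left[OF dd_arr[OF X, of n]] arr_ide_right[OF dd_arr[OF X, of n]] hd_eq[OF X] hk_0[OF X]
    by (auto simp: tinc_def dd_tX[OF X])
qed

lemma tproj_cmap:
  assumes X: "is_complex C X"
  shows "cmap (tX X) (Jo (Ho X)) (tproj X)"
proof (rule cmapI)
  note H = Ho[OF X]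
  fix n
  show "tproj X n \<in> arr (ob (tX X) n) (ob (Jo (Ho X)) n)"
    using arr_ide[OF arr_obj(1)[OF hk_arr[OF X]]] hp_arr[OF X] arr_0[OF zob(1) zob(1)] arr_0[OF ob_in[OF X] zob(1)]
    by (simp add: tproj_def ob_tX[OF X] ob_Jo H)
  have "n = - 2 \<or> n < - 2 \<or> n = - 1 \<or> n \<ge> 0" by linarith
  then show "tproj X (n + 1) * dd (tX X) n = dd (Jo (Ho X)) n * tproj X n"
    using arr_ide_left[OF arr_mult[OF hp_arr[OF X] hm_arr[OF X]]] hp_dd[OF X]
    by (auto simp: tproj_def dd_tX[OF X] dd_Jo H)
qed

lemma tinc_qis:
  assumes X: "is_complex C X" and e: "\<And>n. n > 0 \<Longrightarrow> exact_at X n"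
  shows "qis (tX X) X (tinc X)"
proof (rule qisI[OF tX_complex[OF X] X tinc_cmap[OF X]])
  \<comment> \<open>In degrees up to \<open>0\<close> the inclusion is monic, so a bounding equation
    in \<open>X\<close> can be cancelled to one in the truncation.\<close>
  have mono: "rmono (ob (tX X) m) (ob X m) (tinc X m)" if "m \<le> 0" for m
    using that hk_mono[OF X] rmono_ide[OF ob_in[OF X]] by (cases "m = 0") (simp_all add: tinc_def ob_tX[OF X])
  fix n
  show "(exact_at (tX X) n \<and> exact_at X n) \<or>
      (\<forall>W x. cyc (tX X) n W x \<longrightarrow> bnd X n W (tinc X n * x) \<longrightarrow> bnd (tX X) n W x) \<and>
      (\<forall>W z. cyc X n W z \<longrightarrow> (\<exists>x. cyc (tX X) n W x \<and> z = tinc X n * x))"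
  proof (cases "n > 0")
    case True
    then show ?thesis using e tX_exact(2)[OF X] by blast
  next
    case n: False
    have inj: "bnd (tX X) n W x" if x: "cyc (tX X) n W x" "bnd X n W (tinc X n * x)" for W x
    proof -
      obtain W' f y where y: "cover W' W f" "y \<in> arr W' (ob X (n - 1))" "tinc X n * x * f = dd X (n - 1) * y"
        using x(2) by (rule bndE)
      have m: "rmono (ob (tX X) n) (ob X n) (tinc X n)" using n by (intro mono) simp
      have y': "y \<in> arr W' (ob (tX X) (n - 1))" using y(2) n by (simp add: ob_tX[OF X])
      have "tinc X (n - 1) * y = y" using n arr_ide_left[OF y(2)] by (simp add: tinc_def)
      then have "tinc X n * (x * f) = tinc X n * (dd (tX X) (n - 1) * y)"
        using y(3) cmap_comm'[OF tinc_cmap[OF X], of n] by (metis mult.assoc)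
      then have "x * f = dd (tX X) (n - 1) * y"
        using rmono_cancel[OF m arr_mult[OF cover_arr[OF y(1)] cyc_arr[OF x(1)]] arr_mult[OF y' dd_arr'[OF tX_complex[OF X]]]]
        by blast
      then show ?thesis by (rule bndI[OF y(1) y'])
    qed
    have surj: "\<exists>x. cyc (tX X) n W x \<and> z = tinc X n * x" if z: "cyc X n W z" for W z
    proof (cases "n = 0")
      case True
      then obtain b where "b \<in> arr W (hK X)" "hk X * b = z" using hk_lift[OF X, of z W] z unfolding cyc_def by blast
      then show ?thesis using True by (intro exI[of _ b]) (simp add: cyc_def ob_tX[OF X] dd_tX[OF X] tinc_def)
    next
      case False
      have za: "z \<in> arr W (ob (tX X) n)" using cyc_arr[OF z] n False by (simp add: ob_tX[OF X])
      have iz: "z = tinc X n * z" using n False arr_ide_left[OF cyc_arr[OF z]] by (simp add: tinc_def)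
      have "tinc X (n + 1) * (dd (tX X) n * z) = dd X n * (tinc X n * z)"
        using cmap_comm[OF tinc_cmap[OF X], of n] by (simp add: mult.assoc[symmetric])
      then have 0: "tinc X (n + 1) * (dd (tX X) n * z) = 0" using iz z by (simp add: cyc_def)
      have "rmono (ob (tX X) (n + 1)) (ob X (n + 1)) (tinc X (n + 1))" using n False by (intro mono) simp
      then have "dd (tX X) n * z = 0"
        using arr_mult[OF za dd_arr[OF tX_complex[OF X]]] 0 unfolding rmono_def by blast
      then show ?thesis using iz za unfolding cyc_def by blast
    qed
    show ?thesis using inj surj by blast
  qed
qed

lemma tproj_qis:
  assumes X: "is_complex C X" and e: "\<And>n. n < 0 \<Longrightarrow> exact_at X n"
  shows "qis (tX X) (Jo (Ho X)) (tproj X)"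
proof (rule qisI[OF tX_complex[OF X] Jo_complex[OF Ho(1)[OF X]] tproj_cmap[OF X]])
  let ?Y = "Jo (Ho X)"
  note H = Ho[OF X]
  fix n
  show "(exact_at (tX X) n \<and> exact_at ?Y n) \<or>
      (\<forall>W x. cyc (tX X) n W x \<longrightarrow> bnd ?Y n W (tproj X n * x) \<longrightarrow> bnd (tX X) n W x) \<and>
      (\<forall>W z. cyc ?Y n W z \<longrightarrow> (\<exists>x. cyc (tX X) n W x \<and> z = tproj X n * x))"
  proof (cases "n = 0")
    case False
    then have "exact_at (tX X) n" using tX_exact[OF X] e by (metis linorder_neqE)
    then show ?thesis using heartD(2)[OF heart_Jo[OF H(1)] False] by blast
  next
    case True
    have inj: "bnd (tX X) 0 W x" if x: "cyc (tX X) 0 W x" "bnd ?Y 0 W (tproj X 0 * x)" for W x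
    proof -
      have xa: "x \<in> arr W (hK X)" using cyc_arr[OF x(1)] by (simp add: ob_tX[OF X])
      obtain W' f y where y: "cover W' W f" "y \<in> arr W' (hI X)" "x * f = hm X * y"
        using bndE[OF x(2)] arr_ide_left[OF xa] by (auto simp: tproj_def ob_Jo dd_Jo H)
      \<comment> \<open>So far \<open>x\<close> comes from the image \<open>hI X\<close>; lifting
        along the cover \<open>hp X\<close> makes it a boundary of the truncation.\<close>
      obtain W'' f' y' where y': "cover W'' W' f'" "y' \<in> arr W'' (ob X (- 1))" "hp X * y' = y * f'"
        using cover_pullback[OF hp[OF X] y(2)] by metis
      have "x * (f * f') = hm X * hp X * y'" using y(3) y'(3) by (simp add: mult.assoc) (simp add: mult.assoc[symmetric])
      then show ?thesis
        using bndI[OF cover_comp[OF y(1) y'(1)], of y' "tX X" 0] y'(2) by (simp add: ob_tX[OF X] dd_tX[OF X])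
    qed
    have surj: "\<exists>x. cyc (tX X) 0 W x \<and> z = tproj X 0 * x" if z: "cyc ?Y 0 W z" for W z
    proof -
      have "z \<in> arr W (hK X)" using cyc_arr[OF z] by (simp add: ob_Jo H)
      then show ?thesis
        using arr_ide_left by (intro exI[of _ z]) (simp add: cyc_def ob_tX[OF X] dd_tX[OF X] tproj_def)
    qed
    show ?thesis using inj surj True by blast
  qed
qed

text \<open>The induced map of truncations. In degree \<open>0\<close> it uses the same
  \<open>Hv\<close> as the functor \<open>H\<close>, which makes both legs of the roof natural as
  equations of chain maps, before passing to homotopy.\<close>

definition tmap where
  "tmap X Y \<phi> (n::int) = (if n < 0 then \<phi> n else if n = 0 then Hv X Y \<phi> else 0)"

lemma tmap:
  assumes X: "is_complex C X" and Y: "is_complex C Y" and c: "cmap X Y \<phi>"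
  shows tmap_cmap: "cmap (tX X) (tX Y) (tmap X Y \<phi>)"
    and tinc_tmap: "tinc Y n * tmap X Y \<phi> n = \<phi> n * tinc X n"
    and tproj_tmap: "tproj Y n * tmap X Y \<phi> n = Jv (Ho X) (Ho Y) (Hv X Y \<phi>) n * tproj X n"
proof -
  note V = Hv[OF X Y c] and a = cmap_arr[OF c]
  have e: "Hv X Y \<phi> * (hm X * hp X) = hm Y * hp Y * \<phi> (- 1)"
  proof -
    have "Hv X Y \<phi> * hm X * hp X = hm Y * (uu (Ho X) (Ho Y) (Hv X Y \<phi>) * hp X)"
      using uu_eq[OF V(3)] by (simp add: Ho X Y mult.assoc[symmetric])
    then show ?thesis by (simp add: V(4) mult.assoc)
  qed
  show "cmap (tX X) (tX Y) (tmap X Y \<phi>)"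
  proof (rule cmapI)
    fix n
    show "tmap X Y \<phi> n \<in> arr (ob (tX X) n) (ob (tX Y) n)"
      using a[of n] V(1) arr_0[OF zob(1) zob(1)] by (simp add: tmap_def ob_tX[OF X] ob_tX[OF Y])
    show "tmap X Y \<phi> (n + 1) * dd (tX X) n = dd (tX Y) n * tmap X Y \<phi> n"
      using int_trichotomy[of n] cmap_comm[OF c, of n] e by (auto simp: tmap_def dd_tX[OF X] dd_tX[OF Y])
  qed
  show "tinc Y n * tmap X Y \<phi> n = \<phi> n * tinc X n"
    using int_trichotomy[of n] V(2) arr_ide_left[OF a, of n] arr_ide_right[OF a, of n]
    by (auto simp: tinc_def tmap_def)
  show "tproj Y n * tmap X Y \<phi> n = Jv (Ho X) (Ho Y) (Hv X Y \<phi>) n * tproj X n"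
    using int_trichotomy[of n] V(4) arr_ide_left[OF V(1)] arr_ide_right[OF V(1)]
    by (auto simp: tproj_def tmap_def Jv_def)
qed

lemma qis_iso:
  assumes q: "qis X Y \<phi>"
  shows "KT.L.riso X Y (KT.loc X Y (kap X Y \<phi>))"
proof (rule KT.loc_iso)
  note X = qisD(1)[OF q] and Y = qisD(2)[OF q]
  show "X \<in> Obj K" "Y \<in> Obj K" using X Y by simp_all
  show "kap X Y \<phi> \<in> KT.SS X Y" using KT_SS[OF X Y] q by blast
qed

text \<open>The fraction of \<open>tinc\<close> by \<open>tproj\<close>, characterized by an
  equation together with invertibility, so that no inverse has to be named.\<close>

definition eps where
  "eps X = (SOME e. KT.L.riso (Jo (Ho X)) X e \<and>
    e * KT.loc (tX X) (Jo (Ho X)) (kap (tX X) (Jo (Ho X)) (tproj X)) = KT.loc (tX X) X (kap (tX X) X (tinc X)))"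

lemma eps:
  assumes h: "heart X"
  shows eps_iso: "KT.L.riso (Jo (Ho X)) X (eps X)"
    and eps_eq: "eps X * KT.loc (tX X) (Jo (Ho X)) (kap (tX X) (Jo (Ho X)) (tproj X)) = KT.loc (tX X) X (kap (tX X) X (tinc X))"
proof -
  note X = heartD(1)[OF h]
  note H = Jo_complex[OF Ho(1)[OF X]] and tc = tX_complex[OF X]
  let ?i = "KT.loc (tX X) X (kap (tX X) X (tinc X))"
  let ?p = "KT.loc (tX X) (Jo (Ho X)) (kap (tX X) (Jo (Ho X)) (tproj X))"
  have q: "qis (tX X) X (tinc X)" "qis (tX X) (Jo (Ho X)) (tproj X)"
    using tinc_qis[OF X] tproj_qis[OF X] heartD(2)[OF h] by simp_all
  have "KT.L.riso (tX X) X ?i"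
    using qis_iso[OF q(1)] .
  then obtain i' where i: "?i \<in> KT.L.hom (tX X) X" "i' \<in> KT.L.hom X (tX X)" "i' * ?i = KT.L.ide (tX X)" "?i * i' = KT.L.ide X"
    unfolding KT.L.riso_def by blast
  have "KT.L.riso (tX X) (Jo (Ho X)) ?p"
    using qis_iso[OF q(2)] .
  then obtain p' where p: "?p \<in> KT.L.hom (tX X) (Jo (Ho X))" "p' \<in> KT.L.hom (Jo (Ho X)) (tX X)"
    "p' * ?p = KT.L.ide (tX X)" "?p * p' = KT.L.ide (Jo (Ho X))"
    unfolding KT.L.riso_def by blast
  have O: "X \<in> Obj DC" "tX X \<in> Obj DC" "Jo (Ho X) \<in> Obj DC" using X tc H by simp_all
  have e: "?i * p' * ?p = ?i" using p(3) KT.L.ide_right[OF O(2,1) i(1)] by (simp add: mult.assoc)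
  have "?p * i' * (?i * p') = ?p * (i' * ?i) * p'" "?i * p' * (?p * i') = ?i * (p' * ?p) * i'"
    by (simp_all only: mult.assoc)
  then have "?p * i' * (?i * p') = KT.L.ide (Jo (Ho X))" "?i * p' * (?p * i') = KT.L.ide X"
    using i(3,4) p(3,4) KT.L.ide_right[OF O(2,3) p(1)] KT.L.ide_right[OF O(2,1) i(1)] by simp_all
  then have "KT.L.riso (Jo (Ho X)) X (?i * p')"
    unfolding KT.L.riso_def using KT.L.hom_mult[OF O(3,2,1) p(2) i(1)] KT.L.hom_mult[OF O(1,2,3) i(2) p(1)] by blast
  then have "KT.L.riso (Jo (Ho X)) X (?i * p') \<and> ?i * p' * ?p = ?i" using e by blast
  from someI[of "\<lambda>e. KT.L.riso (Jo (Ho X)) X e \<and> e * ?p = ?i", OF this]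
  show "KT.L.riso (Jo (Ho X)) X (eps X)" "eps X * ?p = ?i" unfolding eps_def by blast+
qed

text \<open>Both legs of the roof are natural through \<open>tmap\<close>. Composing the counit
  square with the invertible \<open>tproj X\<close> reduces it to these two.\<close>

lemma eps_natural:
  assumes hX: "heart X" and hY: "heart Y" and c: "cmap X Y \<phi>"
  shows "eps Y * KT.loc (Jo (Ho X)) (Jo (Ho Y)) (Jr (Ho X) (Ho Y) (Hr X Y (kap X Y \<phi>))) = KT.loc X Y (kap X Y \<phi>) * eps X"
proof -
  note X = heartD(1)[OF hX] and Y = heartD(1)[OF hY]
  note HX = Jo_complex[OF Ho(1)[OF X]] and HY = Jo_complex[OF Ho(1)[OF Y]] and tX = tX_complex[OF X] and tY = tX_complex[OF Y]
  let ?i = "\<lambda>X. KT.loc (tX X) X (kap (tX X) X (tinc X))"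
  let ?p = "\<lambda>X. KT.loc (tX X) (Jo (Ho X)) (kap (tX X) (Jo (Ho X)) (tproj X))"
  let ?t = "KT.loc (tX X) (tX Y) (kap (tX X) (tX Y) (tmap X Y \<phi>))"
  let ?J = "kap (Jo (Ho X)) (Jo (Ho Y)) (Jv (Ho X) (Ho Y) (Hv X Y \<phi>))"
  note cs = tmap_cmap[OF X Y c] Jv_cmap[OF Ho(1)[OF X] Ho(1)[OF Y] Hv_sqr[OF X Y c]]
    tinc_cmap[OF X] tinc_cmap[OF Y] tproj_cmap[OF X] tproj_cmap[OF Y]
  have J: "Jr (Ho X) (Ho Y) (Hr X Y (kap X Y \<phi>)) = ?J"
    using Hr_kap[OF X Y c] Jr_mu[OF Ho(1)[OF X] Ho(1)[OF Y] Hv_sqr[OF X Y c]] by simp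
  have "kap (tX Y) Y (tinc Y) * kap (tX X) (tX Y) (tmap X Y \<phi>) = kap X Y \<phi> * kap (tX X) X (tinc X)"
    using kap_mult[OF tX tY Y cs(1,4)] kap_mult[OF tX X Y cs(3) c] tinc_tmap[OF X Y c] by simp
  then have 1: "?i Y * ?t = KT.loc X Y (kap X Y \<phi>) * ?i X"
    using KT.loc.F_mult[OF _ _ _ kap_in[OF tX tY cs(1)] kap_in[OF tY Y cs(4)]]
      KT.loc.F_mult[OF _ _ _ kap_in[OF tX X cs(3)] kap_in[OF X Y c]] X Y tX tY by simp
  have "kap (tX Y) (Jo (Ho Y)) (tproj Y) * kap (tX X) (tX Y) (tmap X Y \<phi>) = ?J * kap (tX X) (Jo (Ho X)) (tproj X)"
    using kap_mult[OF tX tY HY cs(1,6)] kap_mult[OF tX HX HY cs(5,2)] tproj_tmap[OF X Y c] by simp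
  then have 2: "?p Y * ?t = KT.loc (Jo (Ho X)) (Jo (Ho Y)) ?J * ?p X"
    using KT.loc.F_mult[OF _ _ _ kap_in[OF tX tY cs(1)] kap_in[OF tY HY cs(6)]]
      KT.loc.F_mult[OF _ _ _ kap_in[OF tX HX cs(5)] kap_in[OF HX HY cs(2)]] HX HY tX tY by simp
  have "eps Y * KT.loc (Jo (Ho X)) (Jo (Ho Y)) ?J * ?p X = eps Y * (?p Y * ?t)" using 2 by (simp only: mult.assoc)
  also have "\<dots> = ?i Y * ?t" using eps_eq[OF hY] by (simp only: mult.assoc[symmetric])
  also have "\<dots> = KT.loc X Y (kap X Y \<phi>) * (eps X * ?p X)" using 1 eps_eq[OF hX] by simp
  finally have eq: "eps Y * KT.loc (Jo (Ho X)) (Jo (Ho Y)) ?J * ?p X = KT.loc X Y (kap X Y \<phi>) * eps X * ?p X"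
    by (simp only: mult.assoc)
  have iso: "KT.L.riso (tX X) (Jo (Ho X)) (?p X)"
    using qis_iso[OF tproj_qis[OF X heartD(2)[OF hX]]] by blast
  have O: "X \<in> Obj DC" "tX X \<in> Obj DC" "Jo (Ho X) \<in> Obj DC" "Y \<in> Obj DC" "Jo (Ho Y) \<in> Obj DC" using X tX HX Y HY by simp_all
  have "KT.loc (Jo (Ho X)) (Jo (Ho Y)) ?J \<in> KT.L.hom (Jo (Ho X)) (Jo (Ho Y))" "KT.loc X Y (kap X Y \<phi>) \<in> KT.L.hom X Y"
    using KT.loc.F_in[OF _ _ kap_in[OF HX HY cs(2)]] KT.loc.F_in[OF _ _ kap_in[OF X Y c]] X Y HX HY by simp_all
  then show ?thesis
    unfolding J
    using KT.L.riso_cancel_right[OF O(2,3,4) iso _ _ eq] KT.L.hom_mult[OF O(3,5,4) _ KT.L.risoD[OF eps_iso[OF hY]]]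
      KT.L.hom_mult[OF O(3,1,4) KT.L.risoD[OF eps_iso[OF hX]]] by blast
qed

section \<open>The two functors on the localizations and the additivity of the heart\<close>

lemma loc_functor_J: "loc_functor hM S DC Jo (\<lambda>x y a. KT.loc (Jo x) (Jo y) (Jr x y a))"
proof (intro loc_functor.intro loc_functor_axioms.intro)
  show "mult_system hM S" by (rule ST.mult_system_axioms)
  show "rfunctor hM DC Jo (\<lambda>x y a. KT.loc (Jo x) (Jo y) (Jr x y a))"
    by (rule rfunctor_comp[OF rfunctor_J KT.loc.rfunctor_axioms])
  fix x y s assume "x \<in> Obj hM" "y \<in> Obj hM" "s \<in> mult_system.SS hM S x y"
  then have x: "x \<in> Obj M" and y: "y \<in> Obj M" and "s \<in> mor hM x y ` S x y" by (simp_all add: ST.SS_def)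
  then obtain v where v: "bq x y v" "s = mu x y v" using mor_S[OF x y] by blast
  then show "KT.L.riso (Jo x) (Jo y) (KT.loc (Jo x) (Jo y) (Jr x y s))"
    using qis_iso[OF Jv_qis[OF v(1)]] Jr_mu[OF x y bqD(3)[OF v(1)]] by simp
qed

lemma loc_functor_H: "loc_functor K KS (localization hM S) Ho (\<lambda>X Y a. ST.loc (Ho X) (Ho Y) (Hr X Y a))"
proof (intro loc_functor.intro loc_functor_axioms.intro)
  show "mult_system K KS" by (rule KT.mult_system_axioms)
  show "rfunctor K (localization hM S) Ho (\<lambda>X Y a. ST.loc (Ho X) (Ho Y) (Hr X Y a))"
    by (rule rfunctor_comp[OF rfunctor_H ST.loc.rfunctor_axioms])
  fix X Y s assume "X \<in> Obj K" "Y \<in> Obj K" "s \<in> mult_system.SS K KS X Y"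
  then have X: "is_complex C X" and Y: "is_complex C Y" and s: "s \<in> KT.SS X Y" by simp_all
  then obtain \<phi> where p: "qis X Y \<phi>" "s = kap X Y \<phi>" using KT_SS[OF X Y] by blast
  have "Hr X Y s \<in> ST.SS (Ho X) (Ho Y)"
    unfolding ST.SS_def using Hr_kap[OF qisD(1-3)[OF p(1)]] mor_S[OF Ho(1)[OF X] Ho(1)[OF Y]] Hv_bq[OF p(1)] p(2) by blast
  then show "ST.L.riso (Ho X) (Ho Y) (ST.loc (Ho X) (Ho Y) (Hr X Y s))"
    using ST.loc_iso[of "Ho X" "Ho Y"] Ho(1)[OF X] Ho(1)[OF Y] by simp
qed

text \<open>Exactness outside degree \<open>0\<close> passes to biproducts of complexes, and
  \<open>loc\<close> preserves the equations of a biproduct.\<close>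

lemma additive_heart: "additive_category (full_subcategory DC heart)"
proof -
  interpret H: full_sub DC heart by (rule full_sub.intro[OF KT.L.preadditive_category_axioms])
  show ?thesis
  proof (rule H.additive_full)
    show "zcpx \<in> Obj DC" "heart zcpx" "KT.L.ide zcpx = 0"
      using zcpx KT.loc.F_ide[of zcpx] KT.loc.F_0[of zcpx zcpx] by simp_all
    fix X Y assume h: "heart X" "heart Y"
    note X = heartD(1)[OF h(1)] and Y = heartD(1)[OF h(2)]
    obtain B i j p q where B: "K.rbiprod X Y B i j p q" "\<And>n. exact_at X n \<Longrightarrow> exact_at Y n \<Longrightarrow> exact_at B n"
      by (rule K_biprod[OF X Y]) blast
    have "is_complex C B" using B(1) by (simp add: K.rbiprod_def)
    then have "heart B" unfolding heart_def using B(2) heartD(2)[OF h(1)] heartD(2)[OF h(2)] by blast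
    then show "\<exists>B i j p q. heart B \<and> KT.L.rbiprod X Y B i j p q" using KT.loc.F_biprod[OF B(1)] by blast
  qed
qed

lemma equivalent_left_heart: "equivalent_categories (localization hM S) (left_heart C)"
proof -
  interpret LJ: loc_functor hM S DC Jo "\<lambda>x y a. KT.loc (Jo x) (Jo y) (Jr x y a)" by (rule loc_functor_J)
  interpret LH: loc_functor K KS "localization hM S" Ho "\<lambda>X Y a. ST.loc (Ho X) (Ho Y) (Hr X Y a)" by (rule loc_functor_H)
  interpret H: full_sub DC heart by (rule full_sub.intro[OF KT.L.preadditive_category_axioms])
  interpret J: rfunctor hM K Jo Jr by (rule rfunctor_J)
  interpret Hf: rfunctor K hM Ho Hr by (rule rfunctor_H)
  note JH = rfunctor_comp[OF LJ.rfunctor_lift LH.rfunctor_lift] and HJ = rfunctor_comp[OF LH.rfunctor_lift LJ.rfunctor_lift]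
  let ?J = "\<lambda>x y a. H.res (Jo x) (Jo y) (LJ.lift x y a)"
  let ?H = "\<lambda>X Y a. LH.lift X Y (H.emb X Y a)"
  let ?eta = "\<lambda>x. ST.loc x (Ho (Jo x)) (mu x (Ho (Jo x)) (eta x))"
  let ?eps = "\<lambda>X. H.res (Jo (Ho X)) X (eps X)"
  have hJ: "heart (Jo x)" if "x \<in> Obj (localization hM S)" for x using that heart_Jo by simp
  have HD: "X \<in> Obj DC" "heart X" "is_complex C X" "Ho X \<in> Obj M" "Jo (Ho X) \<in> Obj H.D" if "X \<in> Obj H.D" for X
    using that heart_Jo[OF Ho(1)[of X]] Jo_complex[OF Ho(1)[of X]] Ho(1)[of X] by simp_all
  have HJo: "Ho (Jo x) \<in> Obj M" if "x \<in> Obj M" for x using Ho(1)[OF Jo_complex[OF that]] .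
  have eta_in: "?eta x \<in> ST.L.hom x (Ho (Jo x))" if x: "x \<in> Obj M" for x
    using ST.loc.F_in[OF _ _ mu_eta_in(1)[OF x]] x HJo[OF x] by simp
  show ?thesis
    unfolding left_heart_eq
  proof (rule equivalent_categoriesI[where \<eta> = ?eta and \<epsilon> = ?eps])
    show "additive_category (localization hM S)" by (rule ST.additive_L[OF additive_hM])
    show "additive_category H.D" by (rule additive_heart)
    show "rfunctor (localization hM S) H.D Jo ?J" by (rule H.rfunctor_res[OF LJ.rfunctor_lift hJ])
    show "rfunctor H.D (localization hM S) Ho ?H" by (rule rfunctor_comp[OF H.emb_rfunctor LH.rfunctor_lift])
    show "ST.L.riso x (Ho (Jo x)) (?eta x)" if "x \<in> Obj (localization hM S)" for x
    proof -
      have x: "x \<in> Obj M" using that by simp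
      show ?thesis
        using ST.loc_iso[of x "Ho (Jo x)"] mu_eta_S(1)[OF x] x HJo[OF x] by (simp add: ST.SS_def)
    qed
    show "?eta y * a = ?H (Jo x) (Jo y) (?J x y a) * ?eta x"
      if xy: "x \<in> Obj (localization hM S)" "y \<in> Obj (localization hM S)" and a: "a \<in> ST.L.hom x y" for x y a
    proof -
      have x: "x \<in> Obj M" and y: "y \<in> Obj M" using xy by simp_all
      have D: "Jo x \<in> Obj H.D" "Jo y \<in> Obj H.D" using hJ[OF xy(1)] hJ[OF xy(2)] x y Jo_complex by simp_all
      have "?eta y * a = LH.lift (Jo x) (Jo y) (LJ.lift x y a) * ?eta x"
      \<comment> \<open>The unit is natural on all of \<open>hMon(E)\<close>, so \<open>P\<close> is
        taken trivial.\<close>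
      proof (rule ST.natural_on_localization[OF ST.L.rfunctor_id JH, where P = "\<lambda>x. True"])
        fix z assume "z \<in> Obj hM"
        then show "?eta z \<in> ST.L.hom z (Ho (Jo z))" using eta_in by simp
      next
        fix z w f assume "z \<in> Obj hM" "w \<in> Obj hM" and f: "f \<in> hM.hom z w"
        then have z: "z \<in> Obj M" and w: "w \<in> Obj M" by simp_all
        have j: "Jr z w f \<in> K.hom (Jo z) (Jo w)" using J.F_in[OF _ _ f] z w by simp
        have h: "Hr (Jo z) (Jo w) (Jr z w f) \<in> hM.hom (Ho (Jo z)) (Ho (Jo w))"
          using Hf.F_in[OF _ _ j] Jo_complex z w by simp
        have "LH.lift (Jo z) (Jo w) (LJ.lift z w (ST.loc z w f)) = ST.loc (Ho (Jo z)) (Ho (Jo w)) (Hr (Jo z) (Jo w) (Jr z w f))"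
          using LJ.lift_loc[OF _ _ f] LH.lift_loc[OF _ _ j] z w Jo_complex by simp
        moreover have "?eta w * ST.loc z w f = ST.loc z (Ho (Jo w)) (mu w (Ho (Jo w)) (eta w) * f)"
          using ST.loc.F_mult[OF _ _ _ f mu_eta_in(1)[OF w]] z w HJo by simp
        moreover have "ST.loc (Ho (Jo z)) (Ho (Jo w)) (Hr (Jo z) (Jo w) (Jr z w f)) * ?eta z
            = ST.loc z (Ho (Jo w)) (Hr (Jo z) (Jo w) (Jr z w f) * mu z (Ho (Jo z)) (eta z))"
          using ST.loc.F_mult[OF _ _ _ mu_eta_in(1)[OF z] h] z w HJo by simp
        ultimately show "?eta w * ST.loc z w f = LH.lift (Jo z) (Jo w) (LJ.lift z w (ST.loc z w f)) * ?eta z"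
          using mu_eta_natural[OF z w f] by simp
      qed (use a x y in simp_all)
      then show ?thesis
        using H.emb_res[OF D LJ.lift_in[OF _ _ a]] x y by simp
    qed
    show "H.D.riso (Jo (Ho X)) X (?eps X)" if X: "X \<in> Obj H.D" for X
      by (rule H.res_iso[OF HD(5)[OF X] X eps_iso[OF HD(2)[OF X]]])
    show "?eps Y * ?J (Ho X) (Ho Y) (?H X Y a) = a * ?eps X"
      if X: "X \<in> Obj H.D" and Y: "Y \<in> Obj H.D" and a: "a \<in> H.D.hom X Y" for X Y a
    proof -
      let ?b = "H.emb X Y a"
      have b: "?b \<in> KT.L.hom X Y" using H.emb.F_in[OF X Y a] .
      note E = KT.L.risoD[OF eps_iso]
      have nat: "eps Y * LJ.lift (Ho X) (Ho Y) (LH.lift X Y ?b) = ?b * eps X"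
      \<comment> \<open>The counit is natural on the heart, so \<open>P\<close> is the heart;
        \<open>heart_qis\<close> supplies the closure condition on the vertices of roofs.\<close>
      proof (rule KT.natural_on_localization[OF HJ KT.L.rfunctor_id, where P = heart])
        show "eps Z \<in> KT.L.hom (Jo (Ho Z)) Z" if "heart Z" for Z using E[OF that] .
        show "heart U" if Z: "Z \<in> Obj K" "heart Z" "U \<in> Obj K" "s \<in> KT.SS U Z" for Z U s
        proof -
          obtain \<phi> where "qis U Z \<phi>" using KT_SS[of U Z] Z by auto
          then show ?thesis using heart_qis Z(2) by blast
        qed
        fix Z W f assume Z: "heart Z" and W: "heart W" and f: "f \<in> K.hom Z W"
        note Zc = heartD(1)[OF Z] and Wc = heartD(1)[OF W]
        obtain \<phi> where p: "cmap Z W \<phi>" "f = kap Z W \<phi>" using K_homE[OF f Zc Wc] .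
        have h: "Hr Z W f \<in> hM.hom (Ho Z) (Ho W)" using Hf.F_in[OF _ _ f] Zc Wc by simp
        have "LJ.lift (Ho Z) (Ho W) (LH.lift Z W (KT.loc Z W f)) = KT.loc (Jo (Ho Z)) (Jo (Ho W)) (Jr (Ho Z) (Ho W) (Hr Z W f))"
          using LH.lift_loc[OF _ _ f] LJ.lift_loc[OF _ _ h] Ho(1) Zc Wc by simp
        then show "eps W * LJ.lift (Ho Z) (Ho W) (LH.lift Z W (KT.loc Z W f)) = KT.loc Z W f * eps Z"
          using eps_natural[OF Z W p(1)] p(2) by simp
      qed (use HD[OF X] HD[OF Y] b in simp_all)
      have l: "LJ.lift (Ho X) (Ho Y) (LH.lift X Y ?b) \<in> KT.L.hom (Jo (Ho X)) (Jo (Ho Y))"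
        using LJ.lift_in[OF _ _ LH.lift_in[OF _ _ b]] HD[OF X] HD[OF Y] by simp
      \<comment> \<open>Naturality has been shown in \<open>D(E)\<close>; \<open>res\<close> carries
        the equation over to the full subcategory.\<close>
      have "?eps Y * ?J (Ho X) (Ho Y) (?H X Y a) = H.res (Jo (Ho X)) Y (eps Y * LJ.lift (Ho X) (Ho Y) (LH.lift X Y ?b))"
        using H.res_mult[OF HD(5)[OF X] HD(5)[OF Y] Y l E[OF HD(2)[OF Y]]] by simp
      also have "\<dots> = H.res X Y ?b * ?eps X"
        unfolding nat by (rule H.res_mult[OF HD(5)[OF X] X Y E[OF HD(2)[OF X]] b])
      also have "H.res X Y ?b = a" by (rule H.res_emb[OF X Y a])
      finally show ?thesis .
    qed
  qed
qed

end

theorem theorem1p4: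
  fixes E :: "('o, 'm) acat"
  assumes "additive_regular_category E"
  shows "multiplicative_system (hMon E) (bicartesian E) \<and>
    equivalent_categories (localization (hMon E) (bicartesian E)) (left_heart E)"
proof -
  interpret additive_regular_category E by fact
  show ?thesis using multiplicative_S equivalent_left_heart by blast
qed

end
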